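(* The map $\Theta\mapsto\operatorname{PreCPM}[\Theta]$ on SMC-universes can be extended to an endofunctor $\operatorname{PreCPM}[\cdot]$ of $\operatorname{SMCUnivs}$ by defining its action on morphisms $(\zeta,n^\zeta):\Theta\to\Theta'$ of $\operatorname{SMCUnivs}$ as follows: - the functor $\operatorname{PreCPM}[\Theta]\to\operatorname{PreCPM}[\Theta']$ is given by $(\mathcal{C},\Phi,\Xi)\mapsto(\zeta(\mathcal{C}),\zeta(\Phi),n^\zeta(\Xi))$ on objects and $F\mapsto\zeta(F)$ on morphisms, where $\zeta(\Phi)$ is the group homomorphism $\gamma\mapsto\zeta(\Phi(\gamma))$ and $n^\zeta(\Xi)$ is the multi-environment structure consisting, at the object $n^\zeta_{\mathcal{C}}(A)$, of the effects $\{n^\zeta_{\mathcal{C}}(\xi_A)\mid\xi_A\in\Xi_A\}$; - the natural transformation $\llbracket\mathcal{C}\rrbracket_\Theta\to\llbracket\zeta(\mathcal{C})\rrbracket_{\Theta'}$ is given by $n^\zeta_{\mathcal{C}}$. The endofunctor $\operatorname{PreCPM}[\cdot]$ is a monad with the following multiplication $\mu_\Theta:\operatorname{PreCPM}[\operatorname{PreCPM}[\Theta]]\to\operatorname{PreCPM}[\Theta]$ and unit $\eta_\Theta:\Theta\to\operatorname{PreCPM}[\Theta]$: - the functor $\operatorname{PreCPM}[\operatorname{PreCPM}[\Theta]]\to\operatorname{PreCPM}[\Theta]$ for the multiplication $\mu$ is given by $((\mathcal{C},\Phi,\Xi),\Phi',\Xi')\mapsto(\mathcal{C},\Phi\odot\Phi',\Xi\odot\Xi')$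 on objects and $F\mapsto F$ on morphisms; - the functor $\Theta\to\operatorname{PreCPM}[\Theta]$ for the unit $\eta$ is given by $\mathcal{C}\mapsto(\mathcal{C},1,1)$ on objects and $F\mapsto F$ on morphisms; - the natural transformations for both the multiplication $\mu$ and the unit $\eta$ are the identity functors $\mathrm{id}_{\llbracket\mathcal{C}\rrbracket_\Theta}:\llbracket\mathcal{C}\rrbracket_\Theta\to\llbracket\mathcal{C}\rrbracket_\Theta$. If $\Theta$ is a sub-category of $\operatorname{SMCs}$, then $\operatorname{CPM}:\operatorname{PreCPM}[\Theta]\to\Theta$ is an Eilenberg–Moore algebra for the monad $\operatorname{PreCPM}[\cdot]$.
   Context: "Monoidal" always means "strict monoidal". An effect on $X$ is a morphism $X\to I$, where $I$ is the tensor unit. $\operatorname{SMCs}$ is the category of (suitably small) symmetric monoidal categories and monoidal functors between them. An SMC-universe is a category $\Theta$ equipped with a faithful functor $\llbracket\cdot\rrbracket_\Theta:\Theta\to\operatorname{SMCs}$ (the underlying SMC functor) with image $\llbracket\Theta\rrbracket_\Theta$ forming a sub-category of $\operatorname{SMCs}$. A sub-category $\Theta$ of $\operatorname{SMCs}$ is seen as an SMC-universe by taking $\llbracket\cdot\rrbracket_\Theta$ to be the sub-category inclusion. A morphism of SMC-universes $(\zeta,n^\zeta):\Theta\to\Theta'$ is a functor $\zeta:\Theta\to\Theta'$ together with a natural transformation $n^\zeta:\llbracket\cdot\rrbracket_\Theta\Rightarrow\llbracket\zeta(\cdot)\rrbracket_{\Theta'}$. $\operatorname{SMCUnivs}$ is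 the category of SMC-universes and morphisms between them. Higher-order CPM construction: let $(\mathcal{D},\otimes,I)$ be a symmetric monoidal category, $G$ a finite abelian group and $\Psi$ a group homomorphism from $G$ to the group of monoidal automorphisms of $\mathcal{D}$ (monoidal endofunctors with monoidal two-sided inverse). The folding functor $\operatorname{fld}_\Psi$ is the endofunctor of $\mathcal{D}$ with $\operatorname{fld}_\Psi[A]=\bigotimes_{\gamma\in G}\Psi(\gamma)[A]$ and $\operatorname{fld}_\Psi[f]=\bigotimes_{\gamma\in G}\Psi(\gamma)[f]$; the choice of ordering for the tensor product is regarded as essentially irrelevant, since all choices lead to folding functors which are naturally isomorphic via conjugation by permutations on objects. It is required that $\operatorname{fld}_\Psi$ be injective on objects. Its image $\operatorname{FLD}_\Psi(\mathcal{D})$ is then a symmetric monoidal category with $\operatorname{fld}_\Psi[A]\boxtimes\operatorname{fld}_\Psi[B]:=\operatorname{fld}_\Psi[A\otimes B]$, $\operatorname{fld}_\Psi[f]\boxtimes\operatorname{fld}_\Psi[g]:=\operatorname{fld}_\Psi[f\otimes g]$ and unit $\operatorname{fld}_\Psi[I]$. Let $\tau_A(\gamma):\bigotimes_{\delta\in G}\Psi(\delta)[A]\to\bigotimes_{\delta\in G}\Psi(\gamma\delta)[A]$ and $\pi_{A,B}:\operatorname{fld}_\Psi[A]\otimes\operatorname{fld}_\Psi[B]\to\operatorname{fld}_\Psi[A\otimes B]$ be the unique permutations of tensor factors of these types. A multi-environment structure for $\Psi$ is a family $\Xi=(\Xi_A)_{A\in\operatorname{obj}\mathcal{D}}$ of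 sets $\Xi_A$ of effects on $\operatorname{fld}_\Psi[A]$ in $\mathcal{D}$ such that: (i) $(\xi_A\otimes\xi_B)\circ\pi_{A,B}^{-1}\in\Xi_{A\otimes B}$ for all $\xi_A\in\Xi_A$, $\xi_B\in\Xi_B$; (ii) $\Xi_I=\{1\}$; (iii) $\Psi(\gamma)[\xi_A]=\xi_A\circ\tau_A(\gamma)^{-1}$ for all $\xi_A\in\Xi_A$, $\gamma\in G$. The multi-environment structures for a fixed $\Psi$, partially ordered by object-wise inclusion, form a lattice with meet the object-wise intersection and join $\bigvee$ given by suitable closure of the object-wise union. The category $\operatorname{CPM}_{\Psi,\Xi}(\mathcal{D})$ is the smallest sub-category of $\mathcal{D}$ containing $\operatorname{FLD}_\Psi(\mathcal{D})$ and all maps $(\xi_A\otimes\mathrm{id}_{\operatorname{fld}_\Psi[B]})\circ\pi_{A,B}^{-1}$, for all objects $A,B$ and all $\xi_A\in\Xi_A$; it is a symmetric monoidal category with $F\boxtimes H:=\pi_{C,D}\circ(F\otimes H)\circ\pi_{A,B}^{-1}$ for $F:\operatorname{fld}_\Psi[A]\to\operatorname{fld}_\Psi[C]$ and $H:\operatorname{fld}_\Psi[B]\to\operatorname{fld}_\Psi[D]$. The category $\operatorname{PreCPM}[\Theta]$, for an SMC-universe $\Theta$: objects are triples $(\mathcal{C},\Phi,\Xi)$ where $\mathcal{C}$ is an object of $\Theta$; $\Phi$ is a group homomorphism from a finite abelian group $G$ to the automorphisms $\operatorname{Aut}_\Theta(\mathcal{C})$; $\Xi$ is a multi-environment structure for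 $\llbracket\Phi\rrbracket_\Theta:\gamma\mapsto\llbracket\Phi(\gamma)\rrbracket_\Theta$; the category $\operatorname{CPM}_{\llbracket\Phi\rrbracket_\Theta,\Xi}(\llbracket\mathcal{C}\rrbracket_\Theta)$ is an object of $\llbracket\Theta\rrbracket_\Theta$; the folding functor $\operatorname{fld}_{\llbracket\Phi\rrbracket_\Theta}:\llbracket\mathcal{C}\rrbracket_\Theta\to\operatorname{CPM}_{\llbracket\Phi\rrbracket_\Theta,\Xi}(\llbracket\mathcal{C}\rrbracket_\Theta)$ is a morphism of $\llbracket\Theta\rrbracket_\Theta$; and this folding functor is injective on objects. Morphisms $(\mathcal{C},\Phi,\Xi)\to(\mathcal{C}',\Phi',\Xi')$, where $\Phi,\Phi'$ are both actions of the same group $G$, are the morphisms $F:\mathcal{C}\to\mathcal{C}'$ of $\Theta$ which are $G$-equivariant ($F\circ\Phi(\gamma)=\Phi'(\gamma)\circ F$ for all $\gamma\in G$) and such that $\llbracket F\rrbracket_\Theta$ respects the multi-environment structure ($\{\llbracket F\rrbracket_\Theta(\xi_A)\mid\xi_A\in\Xi_A\}\subseteq\Xi'_{\llbracket F\rrbracket_\Theta(A)}$ for all $A\in\operatorname{obj}\llbracket\mathcal{C}\rrbracket_\Theta$); if $\Phi,\Phi'$ are not actions of the same finite abelian group, there are no morphisms. $\operatorname{PreCPM}[\Theta]$ is an SMC-universe with underlying SMC functor sending $(\mathcal{C},\Phi,\Xi)$ to $\llbracket\mathcal{C}\rrbracket_\Theta$ and $F$ to $\llbracket F\rrbracket_\Theta$.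 Products: if $\Phi:G\to\operatorname{Aut}_\Theta(\mathcal{C})$ and $\Phi':G'\to\operatorname{Aut}_\Theta(\mathcal{C})$ commute ($\Phi(\gamma)\Phi'(\gamma')=\Phi'(\gamma')\Phi(\gamma)$ for all $(\gamma,\gamma')\in G\times G'$), then $\Phi\odot\Phi':G\times G'\to\operatorname{Aut}_\Theta(\mathcal{C})$ is $(\Phi\odot\Phi')(\gamma,\gamma'):=\Phi(\gamma)\Phi'(\gamma')$; the unit is the trivial action $1$ of the one-element group, given by the identity automorphism. If $\Xi,\Xi'$ are multi-environment structures for $\llbracket\Phi\rrbracket_\Theta,\llbracket\Phi'\rrbracket_\Theta$ respectively, define multi-environment structures for $\llbracket\Phi\odot\Phi'\rrbracket_\Theta$ by $\operatorname{fld}_{\Phi'}[\Xi]_A:=\{\operatorname{fld}_{\Phi'}[\xi_A]\mid\xi_A\in\Xi_A\}$, $\operatorname{fld}_{\Phi}[\Xi']_A:=\{\operatorname{fld}_{\Phi}[\xi'_A]\mid\xi'_A\in\Xi'_A\}$ and $\Xi\odot\Xi':=\operatorname{fld}_{\Phi'}[\Xi]\bigvee\operatorname{fld}_\Phi[\Xi']$ (here $\operatorname{fld}_\Phi$, $\operatorname{fld}_{\Phi'}$ are the folding functors of the underlying actions). The trivial multi-environment structure $1$ for $\llbracket 1\rrbracket_\Theta$ is defined by $1_A:=\{1\}$ if $A\cong I$ and $1_A:=\emptyset$ otherwise. The morphism of SMC-universes $(\operatorname{CPM},n^{\operatorname{CPM}}):\operatorname{PreCPM}[\Theta]\to\Theta$,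 for $\Theta$ a sub-category of $\operatorname{SMCs}$: its functor sends an object $(\mathcal{C},\Phi,\Xi)$ to $\operatorname{CPM}_{\Phi,\Xi}(\mathcal{C})$ and acts as the identity on morphisms (a morphism $F:(\mathcal{C},\Phi,\Xi)\to(\mathcal{C}',\Phi',\Xi')$ yields $F:\operatorname{CPM}_{\Phi,\Xi}(\mathcal{C})\to\operatorname{CPM}_{\Phi',\Xi'}(\mathcal{C}')$ by restriction); its natural transformation $n^{\operatorname{CPM}}$ is given by the folding functors $\operatorname{fld}_\Phi:\mathcal{C}\to\operatorname{CPM}_{\Phi,\Xi}(\mathcal{C})$.
   Formalization: Restricted to morphisms and universes where PreCPM on morphisms, μ, and (for the algebra) CPM and PreCPM[CPM] land in the stated targets (joins exist, folding injective, CPM and folds in Θ); functors preserve symmetries; 1_A={1} only if A=I; products of groups taken strictly associative and unital. *)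

theory Defs
  imports "HOL-Algebra.Group" "HOL-Library.FuncSet" "HOL-Library.List_Lexorder"
begin

section \<open>Categories, functors, monads, algebras\<close>

text \<open>
  Hom-sets are indexed by objects and need not be disjoint, so the same element may be a morphism
  between several pairs of objects.  Composition is \<open>ccomp K A B C g f\<close> for
  \<open>f : A \<rightarrow> B\<close> and \<open>g : B \<rightarrow> C\<close>.  Nothing is required outside \<open>cob K\<close>.
\<close>

record ('u,'v) cat =
  cob :: "'u set"
  chom :: "'u \<Rightarrow> 'u \<Rightarrow> 'v set"
  cid :: "'u \<Rightarrow> 'v"
  ccomp :: "'u \<Rightarrow> 'u \<Rightarrow> 'u \<Rightarrow> 'v \<Rightarrow> 'v \<Rightarrow> 'v"

definition is_category :: "('u,'v) cat \<Rightarrow> bool" where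
  "is_category K \<longleftrightarrow>
     (\<forall>A\<in>cob K. cid K A \<in> chom K A A) \<and>
     (\<forall>A\<in>cob K. \<forall>B\<in>cob K. \<forall>C\<in>cob K. \<forall>f\<in>chom K A B. \<forall>g\<in>chom K B C.
        ccomp K A B C g f \<in> chom K A C) \<and>
     (\<forall>A\<in>cob K. \<forall>B\<in>cob K. \<forall>f\<in>chom K A B.
        ccomp K A A B f (cid K A) = f \<and> ccomp K A B B (cid K B) f = f) \<and>
     (\<forall>A\<in>cob K. \<forall>B\<in>cob K. \<forall>C\<in>cob K. \<forall>D\<in>cob K.
        \<forall>f\<in>chom K A B. \<forall>g\<in>chom K B C. \<forall>h\<in>chom K C D.
        ccomp K A C D h (ccomp K A B C g f) = ccomp K A B D (ccomp K B C D h g) f)"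

definition is_subcategory :: "('u,'v) cat \<Rightarrow> ('u,'v) cat \<Rightarrow> bool" where
  "is_subcategory L K \<longleftrightarrow>
     is_category L \<and> is_category K \<and> cob L \<subseteq> cob K \<and>
     (\<forall>A\<in>cob L. cid L A = cid K A) \<and>
     (\<forall>A\<in>cob L. \<forall>B\<in>cob L. chom L A B \<subseteq> chom K A B) \<and>
     (\<forall>A\<in>cob L. \<forall>B\<in>cob L. \<forall>C\<in>cob L. \<forall>f\<in>chom L A B. \<forall>g\<in>chom L B C.
        ccomp L A B C g f = ccomp K A B C g f)"

record ('u,'v,'p,'q) fctr =
  omap :: "'u \<Rightarrow> 'p"
  mmap :: "'u \<Rightarrow> 'u \<Rightarrow> 'v \<Rightarrow> 'q"

definition is_functor :: "('u,'v) cat \<Rightarrow> ('p,'q) cat \<Rightarrow> ('u,'v,'p,'q) fctr \<Rightarrow> bool" where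
  "is_functor K L F \<longleftrightarrow>
     is_category K \<and> is_category L \<and>
     (\<forall>A\<in>cob K. omap F A \<in> cob L) \<and>
     (\<forall>A\<in>cob K. \<forall>B\<in>cob K. \<forall>f\<in>chom K A B. mmap F A B f \<in> chom L (omap F A) (omap F B)) \<and>
     (\<forall>A\<in>cob K. mmap F A A (cid K A) = cid L (omap F A)) \<and>
     (\<forall>A\<in>cob K. \<forall>B\<in>cob K. \<forall>C\<in>cob K. \<forall>f\<in>chom K A B. \<forall>g\<in>chom K B C.
        mmap F A C (ccomp K A B C g f) =
        ccomp L (omap F A) (omap F B) (omap F C) (mmap F B C g) (mmap F A B f))"

definition is_faithful :: "('u,'v) cat \<Rightarrow> ('u,'v,'p,'q) fctr \<Rightarrow> bool" where
  "is_faithful K F \<longleftrightarrow> (\<forall>A\<in>cob K. \<forall>B\<in>cob K. inj_on (mmap F A B) (chom K A B))"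

definition fctr_id :: "('u,'v,'u,'v) fctr" where
  "fctr_id = \<lparr>omap = (\<lambda>A. A), mmap = (\<lambda>A B f. f)\<rparr>"

definition fctr_comp ::
    "('p,'q,'r,'s) fctr \<Rightarrow> ('u,'v,'p,'q) fctr \<Rightarrow> ('u,'v,'r,'s) fctr" where
  "fctr_comp G F =
     \<lparr>omap = (\<lambda>A. omap G (omap F A)),
      mmap = (\<lambda>A B f. mmap G (omap F A) (omap F B) (mmap F A B f))\<rparr>"

definition fctr_restrict :: "('u,'v) cat \<Rightarrow> ('u,'v,'p,'q) fctr \<Rightarrow> ('u,'v,'p,'q) fctr" where
  "fctr_restrict K F =
     \<lparr>omap = restrict (omap F) (cob K),
      mmap = (\<lambda>A B. if A \<in> cob K \<and> B \<in> cob K then restrict (mmap F A B) (chom K A B)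
                    else (\<lambda>_. undefined))\<rparr>"

definition is_nat_trans ::
    "('u,'v) cat \<Rightarrow> ('p,'q) cat \<Rightarrow> ('u,'v,'p,'q) fctr \<Rightarrow> ('u,'v,'p,'q) fctr \<Rightarrow> ('u \<Rightarrow> 'q) \<Rightarrow> bool"
  where
  "is_nat_trans K L F G n \<longleftrightarrow>
     is_functor K L F \<and> is_functor K L G \<and>
     (\<forall>A\<in>cob K. n A \<in> chom L (omap F A) (omap G A)) \<and>
     (\<forall>A\<in>cob K. \<forall>B\<in>cob K. \<forall>f\<in>chom K A B.
        ccomp L (omap F A) (omap F B) (omap G B) (n B) (mmap F A B f) =
        ccomp L (omap F A) (omap G A) (omap G B) (mmap G A B f) (n A))"

definition is_monad ::
    "('u,'v) cat \<Rightarrow> ('u,'v,'u,'v) fctr \<Rightarrow> ('u \<Rightarrow> 'v) \<Rightarrow> ('u \<Rightarrow> 'v) \<Rightarrow> bool" where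
  "is_monad K T mu eta \<longleftrightarrow>
     is_functor K K T \<and>
     is_nat_trans K K (fctr_comp T T) T mu \<and>
     is_nat_trans K K fctr_id T eta \<and>
     (\<forall>A\<in>cob K. let TA = omap T A; TTA = omap T TA; TTTA = omap T TTA in
        ccomp K TTTA TTA TA (mu A) (mmap T TTA TA (mu A)) =
          ccomp K TTTA TTA TA (mu A) (mu TA) \<and>
        ccomp K TA TTA TA (mu A) (mmap T A TA (eta A)) = cid K TA \<and>
        ccomp K TA TTA TA (mu A) (eta TA) = cid K TA)"

definition is_EM_algebra ::
    "('u,'v) cat \<Rightarrow> ('u,'v,'u,'v) fctr \<Rightarrow> ('u \<Rightarrow> 'v) \<Rightarrow> ('u \<Rightarrow> 'v) \<Rightarrow> 'u \<Rightarrow> 'v \<Rightarrow> bool" where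
  "is_EM_algebra K T mu eta A a \<longleftrightarrow>
     is_monad K T mu eta \<and> A \<in> cob K \<and> a \<in> chom K (omap T A) A \<and>
     ccomp K A (omap T A) A a (eta A) = cid K A \<and>
     ccomp K (omap T (omap T A)) (omap T A) A a (mmap T (omap T A) A a) =
       ccomp K (omap T (omap T A)) (omap T A) A a (mu A)"

definition image_cat ::
    "('u,'v) cat \<Rightarrow> ('p,'q) cat \<Rightarrow> ('u,'v,'p,'q) fctr \<Rightarrow> ('p,'q) cat" where
  "image_cat K L F =
     \<lparr>cob = omap F ` cob K,
      chom = (\<lambda>C D. {mmap F A B f | A B f.
                A \<in> cob K \<and> B \<in> cob K \<and> f \<in> chom K A B \<and> omap F A = C \<and> omap F B = D}),
      cid = cid L,
      ccomp = ccomp L\<rparr>"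

definition aut_group :: "('u,'v) cat \<Rightarrow> 'u \<Rightarrow> 'v monoid" where
  "aut_group K A =
     \<lparr>carrier = {f \<in> chom K A A. \<exists>g\<in>chom K A A.
                   ccomp K A A A g f = cid K A \<and> ccomp K A A A f g = cid K A},
      mult = ccomp K A A A,
      one = cid K A\<rparr>"


section \<open>Strict symmetric monoidal categories\<close>

record ('o,'a) smc =
  Obj :: "'o set"
  Arr :: "'a set"
  Dom :: "'a \<Rightarrow> 'o"
  Cod :: "'a \<Rightarrow> 'o"
  Idn :: "'o \<Rightarrow> 'a"
  Cmp :: "'a \<Rightarrow> 'a \<Rightarrow> 'a"
  TensO :: "'o \<Rightarrow> 'o \<Rightarrow> 'o"
  TensA :: "'a \<Rightarrow> 'a \<Rightarrow> 'a"
  TUnit :: "'o"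
  Sym :: "'o \<Rightarrow> 'o \<Rightarrow> 'a"

definition Homs :: "('o,'a) smc \<Rightarrow> 'o \<Rightarrow> 'o \<Rightarrow> 'a set" where
  "Homs D A B = {f \<in> Arr D. Dom D f = A \<and> Cod D f = B}"

text \<open>
  All operations are pinned to \<open>undefined\<close> outside their domains, so that equality of records is
  equality of symmetric monoidal categories.
\<close>

definition smc_pinned :: "('o,'a) smc \<Rightarrow> bool" where
  "smc_pinned D \<longleftrightarrow>
     Dom D \<in> extensional (Arr D) \<and> Cod D \<in> extensional (Arr D) \<and> Idn D \<in> extensional (Obj D) \<and>
     (\<forall>g f. \<not> (f \<in> Arr D \<and> g \<in> Arr D \<and> Cod D f = Dom D g) \<longrightarrow> Cmp D g f = undefined) \<and>
     (\<forall>A B. \<not> (A \<in> Obj D \<and> B \<in> Obj D) \<longrightarrow> TensO D A B = undefined \<and> Sym D A B = undefined) \<and>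
     (\<forall>f g. \<not> (f \<in> Arr D \<and> g \<in> Arr D) \<longrightarrow> TensA D f g = undefined)"

definition is_smc :: "('o,'a) smc \<Rightarrow> bool" where
  "is_smc D \<longleftrightarrow>
     smc_pinned D \<and>
     (\<forall>f\<in>Arr D. Dom D f \<in> Obj D \<and> Cod D f \<in> Obj D) \<and>
     (\<forall>A\<in>Obj D. Idn D A \<in> Homs D A A) \<and>
     (\<forall>f\<in>Arr D. \<forall>g\<in>Arr D. Cod D f = Dom D g \<longrightarrow> Cmp D g f \<in> Homs D (Dom D f) (Cod D g)) \<and>
     (\<forall>f\<in>Arr D. Cmp D f (Idn D (Dom D f)) = f \<and> Cmp D (Idn D (Cod D f)) f = f) \<and>
     (\<forall>f\<in>Arr D. \<forall>g\<in>Arr D. \<forall>h\<in>Arr D. Cod D f = Dom D g \<longrightarrow> Cod D g = Dom D h \<longrightarrow>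
        Cmp D h (Cmp D g f) = Cmp D (Cmp D h g) f) \<and>
     TUnit D \<in> Obj D \<and>
     (\<forall>A\<in>Obj D. \<forall>B\<in>Obj D. TensO D A B \<in> Obj D) \<and>
     (\<forall>A\<in>Obj D. TensO D (TUnit D) A = A \<and> TensO D A (TUnit D) = A) \<and>
     (\<forall>A\<in>Obj D. \<forall>B\<in>Obj D. \<forall>C\<in>Obj D. TensO D A (TensO D B C) = TensO D (TensO D A B) C) \<and>
     (\<forall>f\<in>Arr D. \<forall>g\<in>Arr D. TensA D f g
        \<in> Homs D (TensO D (Dom D f) (Dom D g)) (TensO D (Cod D f) (Cod D g))) \<and>
     (\<forall>A\<in>Obj D. \<forall>B\<in>Obj D. TensA D (Idn D A) (Idn D B) = Idn D (TensO D A B)) \<and>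
     (\<forall>f\<in>Arr D. \<forall>g\<in>Arr D. \<forall>h\<in>Arr D. \<forall>k\<in>Arr D. Cod D f = Dom D g \<longrightarrow> Cod D h = Dom D k \<longrightarrow>
        TensA D (Cmp D g f) (Cmp D k h) = Cmp D (TensA D g k) (TensA D f h)) \<and>
     (\<forall>f\<in>Arr D. TensA D (Idn D (TUnit D)) f = f \<and> TensA D f (Idn D (TUnit D)) = f) \<and>
     (\<forall>f\<in>Arr D. \<forall>g\<in>Arr D. \<forall>h\<in>Arr D. TensA D f (TensA D g h) = TensA D (TensA D f g) h) \<and>
     (\<forall>A\<in>Obj D. \<forall>B\<in>Obj D. Sym D A B \<in> Homs D (TensO D A B) (TensO D B A)) \<and>
     (\<forall>f\<in>Arr D. \<forall>g\<in>Arr D.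
        Cmp D (Sym D (Cod D f) (Cod D g)) (TensA D f g) =
        Cmp D (TensA D g f) (Sym D (Dom D f) (Dom D g))) \<and>
     (\<forall>A\<in>Obj D. \<forall>B\<in>Obj D. Cmp D (Sym D B A) (Sym D A B) = Idn D (TensO D A B)) \<and>
     (\<forall>A\<in>Obj D. \<forall>B\<in>Obj D. \<forall>C\<in>Obj D.
        Sym D A (TensO D B C) =
        Cmp D (TensA D (Idn D B) (Sym D A C)) (TensA D (Sym D A B) (Idn D C)))"

record ('o,'a) smcf =
  fobj :: "'o \<Rightarrow> 'o"
  farr :: "'a \<Rightarrow> 'a"

definition is_smc_functor :: "('o,'a) smc \<Rightarrow> ('o,'a) smc \<Rightarrow> ('o,'a) smcf \<Rightarrow> bool" where
  "is_smc_functor C D F \<longleftrightarrow>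
     fobj F \<in> Obj C \<rightarrow>\<^sub>E Obj D \<and> farr F \<in> Arr C \<rightarrow>\<^sub>E Arr D \<and>
     (\<forall>f\<in>Arr C. Dom D (farr F f) = fobj F (Dom C f) \<and> Cod D (farr F f) = fobj F (Cod C f)) \<and>
     (\<forall>A\<in>Obj C. farr F (Idn C A) = Idn D (fobj F A)) \<and>
     (\<forall>f\<in>Arr C. \<forall>g\<in>Arr C. Cod C f = Dom C g \<longrightarrow>
        farr F (Cmp C g f) = Cmp D (farr F g) (farr F f)) \<and>
     fobj F (TUnit C) = TUnit D \<and>
     (\<forall>A\<in>Obj C. \<forall>B\<in>Obj C. fobj F (TensO C A B) = TensO D (fobj F A) (fobj F B)) \<and>
     (\<forall>f\<in>Arr C. \<forall>g\<in>Arr C. farr F (TensA C f g) = TensA D (farr F f) (farr F g)) \<and>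
     (\<forall>A\<in>Obj C. \<forall>B\<in>Obj C. farr F (Sym C A B) = Sym D (fobj F A) (fobj F B))"

definition smcf_restrict :: "('o,'a) smc \<Rightarrow> ('o,'a) smcf \<Rightarrow> ('o,'a) smcf" where
  "smcf_restrict C F = \<lparr>fobj = restrict (fobj F) (Obj C), farr = restrict (farr F) (Arr C)\<rparr>"

definition smcf_id :: "('o,'a) smc \<Rightarrow> ('o,'a) smcf" where
  "smcf_id C = smcf_restrict C \<lparr>fobj = (\<lambda>A. A), farr = (\<lambda>f. f)\<rparr>"

definition smcf_comp :: "('o,'a) smc \<Rightarrow> ('o,'a) smcf \<Rightarrow> ('o,'a) smcf \<Rightarrow> ('o,'a) smcf" where
  "smcf_comp C G F = smcf_restrict C \<lparr>fobj = fobj G \<circ> fobj F, farr = farr G \<circ> farr F\<rparr>"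

text \<open>
  The size bound on the symmetric monoidal categories is given by the types of their objects and
  arrows, which are arbitrary.
\<close>

definition SMCs :: "(('o,'a) smc, ('o,'a) smcf) cat" where
  "SMCs = \<lparr>cob = {C. is_smc C},
           chom = (\<lambda>C D. {F. is_smc_functor C D F}),
           cid = smcf_id,
           ccomp = (\<lambda>C D E G F. smcf_comp C G F)\<rparr>"


section \<open>Permutations of tensor factors\<close>

definition arr_inv :: "('o,'a) smc \<Rightarrow> 'a \<Rightarrow> 'a" where
  "arr_inv D f = (THE g. g \<in> Homs D (Cod D f) (Dom D f) \<and>
                         Cmp D g f = Idn D (Dom D f) \<and> Cmp D f g = Idn D (Cod D f))"

definition tensO_list :: "('o,'a) smc \<Rightarrow> 'o list \<Rightarrow> 'o" where
  "tensO_list D As = foldr (TensO D) As (TUnit D)"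

definition tensA_list :: "('o,'a) smc \<Rightarrow> 'a list \<Rightarrow> 'a" where
  "tensA_list D fs = foldr (TensA D) fs (Idn D (TUnit D))"

text \<open>
  For distinct lists \<open>xs\<close>, \<open>ys\<close> with the same elements, \<open>tperm D X xs ys\<close> is the permutation of
  tensor factors from the product of the \<open>X x\<close> in the order \<open>xs\<close> to their product in the order
  \<open>ys\<close>: the factor labelled by the head of \<open>ys\<close> is moved to the front, and the rest is permuted
  recursively.  Labelling the factors makes the permutation unique even if some \<open>X x\<close> coincide.
\<close>

primrec tperm :: "('o,'a) smc \<Rightarrow> ('i \<Rightarrow> 'o) \<Rightarrow> 'i list \<Rightarrow> 'i list \<Rightarrow> 'a" where
  "tperm D X xs [] = Idn D (TUnit D)"
| "tperm D X xs (y # ys) =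
     Cmp D (TensA D (Idn D (X y)) (tperm D X (remove1 y xs) ys))
           (TensA D (Sym D (tensO_list D (map X (takeWhile (\<lambda>x. x \<noteq> y) xs))) (X y))
                    (Idn D (tensO_list D (map X (tl (dropWhile (\<lambda>x. x \<noteq> y) xs))))))"


section \<open>Finite abelian groups with a strict product\<close>

text \<open>
  The monad laws compare actions of \<open>(G \<times> G') \<times> G''\<close> with actions of \<open>G \<times> (G' \<times> G'')\<close>, and of
  \<open>1 \<times> G\<close> and \<open>G \<times> 1\<close> with actions of \<open>G\<close>, so the product of groups has to be strictly associative
  and unital.  Elements of groups are therefore words of a fixed length, pairs are concatenations
  of words, and the only element of the trivial group is the empty word.  Every finite abelian
  group is of this form, with words of length one.
\<close>

definition fab_group :: "'g list monoid \<Rightarrow> bool" where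
  "fab_group G \<longleftrightarrow>
     comm_group G \<and> finite (carrier G) \<and>
     (\<forall>x\<in>carrier G. length x = length \<one>\<^bsub>G\<^esub>) \<and>
     (\<forall>x y. \<not> (x \<in> carrier G \<and> y \<in> carrier G) \<longrightarrow> x \<otimes>\<^bsub>G\<^esub> y = undefined)"

definition gfst :: "'g list monoid \<Rightarrow> 'g list \<Rightarrow> 'g list" where
  "gfst G w = take (length \<one>\<^bsub>G\<^esub>) w"

definition gsnd :: "'g list monoid \<Rightarrow> 'g list \<Rightarrow> 'g list" where
  "gsnd G w = drop (length \<one>\<^bsub>G\<^esub>) w"

definition gprod :: "'g list monoid \<Rightarrow> 'g list monoid \<Rightarrow> 'g list monoid" where
  "gprod G H =
     (let S = {x @ y | x y. x \<in> carrier G \<and> y \<in> carrier H} in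
      \<lparr>carrier = S,
       mult = (\<lambda>v w. if v \<in> S \<and> w \<in> S
                      then (gfst G v \<otimes>\<^bsub>G\<^esub> gfst G w) @ (gsnd G v \<otimes>\<^bsub>H\<^esub> gsnd G w) else undefined),
       one = \<one>\<^bsub>G\<^esub> @ \<one>\<^bsub>H\<^esub>\<rparr>)"

definition gtriv :: "'g list monoid" where
  "gtriv = \<lparr>carrier = {[]}, mult = (\<lambda>v w. if v = [] \<and> w = [] then [] else undefined), one = []\<rparr>"

text \<open>
  Tensor products over a group are taken in lexicographic order, so that products over
  \<open>G \<times> H\<close> are iterated products, with \<open>G\<close> as outer index.
\<close>

definition elems :: "('g::linorder) list monoid \<Rightarrow> 'g list list" where
  "elems G = sorted_list_of_set (carrier G)"

definition is_action :: "('u,'v) cat \<Rightarrow> 'u \<Rightarrow> 'g list monoid \<Rightarrow> ('g list \<Rightarrow> 'v) \<Rightarrow> bool" where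
  "is_action K A G Phi \<longleftrightarrow> Phi \<in> hom G (aut_group K A) \<and> Phi \<in> extensional (carrier G)"

definition act_prod ::
    "('u,'v) cat \<Rightarrow> 'u \<Rightarrow> 'g list monoid \<Rightarrow> ('g list \<Rightarrow> 'v) \<Rightarrow> 'g list monoid \<Rightarrow> ('g list \<Rightarrow> 'v)
     \<Rightarrow> 'g list \<Rightarrow> 'v" where
  "act_prod K A G Phi H Phi' =
     (\<lambda>w\<in>carrier (gprod G H). ccomp K A A A (Phi (gfst G w)) (Phi' (gsnd G w)))"

definition act_triv :: "('u,'v) cat \<Rightarrow> 'u \<Rightarrow> 'g list \<Rightarrow> 'v" where
  "act_triv K A = (\<lambda>w\<in>carrier gtriv. cid K A)"


section \<open>The higher-order CPM construction\<close>

definition foldO ::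
    "('o,'a) smc \<Rightarrow> ('g::linorder) list monoid \<Rightarrow> ('g list \<Rightarrow> ('o,'a) smcf) \<Rightarrow> 'o \<Rightarrow> 'o" where
  "foldO D G Psi A = tensO_list D (map (\<lambda>\<gamma>. fobj (Psi \<gamma>) A) (elems G))"

definition foldA ::
    "('o,'a) smc \<Rightarrow> ('g::linorder) list monoid \<Rightarrow> ('g list \<Rightarrow> ('o,'a) smcf) \<Rightarrow> 'a \<Rightarrow> 'a" where
  "foldA D G Psi f = tensA_list D (map (\<lambda>\<gamma>. farr (Psi \<gamma>) f) (elems G))"

definition fld ::
    "('o,'a) smc \<Rightarrow> ('g::linorder) list monoid \<Rightarrow> ('g list \<Rightarrow> ('o,'a) smcf) \<Rightarrow> ('o,'a) smcf" where
  "fld D G Psi = smcf_restrict D \<lparr>fobj = foldO D G Psi, farr = foldA D G Psi\<rparr>"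

definition tau ::
    "('o,'a) smc \<Rightarrow> ('g::linorder) list monoid \<Rightarrow> ('g list \<Rightarrow> ('o,'a) smcf) \<Rightarrow> 'o \<Rightarrow> 'g list \<Rightarrow> 'a"
  where
  "tau D G Psi A \<gamma> =
     tperm D (\<lambda>\<delta>. fobj (Psi \<delta>) A) (elems G) (map (\<lambda>\<delta>. \<gamma> \<otimes>\<^bsub>G\<^esub> \<delta>) (elems G))"

text \<open>
  The factors of \<open>A\<close> are labelled by \<open>Inl\<close>, those of \<open>B\<close> by \<open>Inr\<close>; they are interleaved since
  \<open>\<Psi>(\<gamma>)[A \<otimes> B] = \<Psi>(\<gamma>)[A] \<otimes> \<Psi>(\<gamma>)[B]\<close>.
\<close>

definition pimap ::
    "('o,'a) smc \<Rightarrow> ('g::linorder) list monoid \<Rightarrow> ('g list \<Rightarrow> ('o,'a) smcf) \<Rightarrow> 'o \<Rightarrow> 'o \<Rightarrow> 'a" where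
  "pimap D G Psi A B =
     tperm D (case_sum (\<lambda>\<gamma>. fobj (Psi \<gamma>) A) (\<lambda>\<gamma>. fobj (Psi \<gamma>) B))
       (map Inl (elems G) @ map Inr (elems G))
       (concat (map (\<lambda>\<gamma>. [Inl \<gamma>, Inr \<gamma>]) (elems G)))"

definition env_tens ::
    "('o,'a) smc \<Rightarrow> ('g::linorder) list monoid \<Rightarrow> ('g list \<Rightarrow> ('o,'a) smcf)
     \<Rightarrow> 'o \<Rightarrow> 'o \<Rightarrow> 'a \<Rightarrow> 'a \<Rightarrow> 'a" where
  "env_tens D G Psi A B \<xi> \<xi>' = Cmp D (TensA D \<xi> \<xi>') (arr_inv D (pimap D G Psi A B))"

definition is_multi_env ::
    "('o,'a) smc \<Rightarrow> ('g::linorder) list monoid \<Rightarrow> ('g list \<Rightarrow> ('o,'a) smcf) \<Rightarrow> ('o \<Rightarrow> 'a set) \<Rightarrow> bool"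
  where
  "is_multi_env D G Psi Xi \<longleftrightarrow>
     (\<forall>A\<in>Obj D. Xi A \<subseteq> Homs D (foldO D G Psi A) (TUnit D)) \<and>
     (\<forall>A. A \<notin> Obj D \<longrightarrow> Xi A = {}) \<and>
     (\<forall>A\<in>Obj D. \<forall>B\<in>Obj D. \<forall>\<xi>\<in>Xi A. \<forall>\<xi>'\<in>Xi B. env_tens D G Psi A B \<xi> \<xi>' \<in> Xi (TensO D A B)) \<and>
     Xi (TUnit D) = {Idn D (TUnit D)} \<and>
     (\<forall>A\<in>Obj D. \<forall>\<xi>\<in>Xi A. \<forall>\<gamma>\<in>carrier G.
        farr (Psi \<gamma>) \<xi> = Cmp D \<xi> (arr_inv D (tau D G Psi A \<gamma>)))"

inductive_set cpm_arrs ::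
    "('o,'a) smc \<Rightarrow> ('g::linorder) list monoid \<Rightarrow> ('g list \<Rightarrow> ('o,'a) smcf) \<Rightarrow> ('o \<Rightarrow> 'a set) \<Rightarrow> 'a set"
  for D G Psi Xi where
  folded: "f \<in> Arr D \<Longrightarrow> foldA D G Psi f \<in> cpm_arrs D G Psi Xi"
| discard: "A \<in> Obj D \<Longrightarrow> B \<in> Obj D \<Longrightarrow> \<xi> \<in> Xi A \<Longrightarrow>
     Cmp D (TensA D \<xi> (Idn D (foldO D G Psi B))) (arr_inv D (pimap D G Psi A B))
       \<in> cpm_arrs D G Psi Xi"
| composite: "f \<in> cpm_arrs D G Psi Xi \<Longrightarrow> g \<in> cpm_arrs D G Psi Xi \<Longrightarrow> Cod D f = Dom D g \<Longrightarrow>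
     Cmp D g f \<in> cpm_arrs D G Psi Xi"

definition unfoldO ::
    "('o,'a) smc \<Rightarrow> ('g::linorder) list monoid \<Rightarrow> ('g list \<Rightarrow> ('o,'a) smcf) \<Rightarrow> 'o \<Rightarrow> 'o" where
  "unfoldO D G Psi = the_inv_into (Obj D) (foldO D G Psi)"

text \<open>
  The symmetry is the image under folding of the symmetry of \<open>D\<close>, as in the image of the folding
  functor.
\<close>

definition cpm ::
    "('o,'a) smc \<Rightarrow> ('g::linorder) list monoid \<Rightarrow> ('g list \<Rightarrow> ('o,'a) smcf) \<Rightarrow> ('o \<Rightarrow> 'a set)
     \<Rightarrow> ('o,'a) smc" where
  "cpm D G Psi Xi =
     (let Ob = foldO D G Psi ` Obj D; Ar = cpm_arrs D G Psi Xi; u = unfoldO D G Psi in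
      \<lparr>Obj = Ob,
       Arr = Ar,
       Dom = restrict (Dom D) Ar,
       Cod = restrict (Cod D) Ar,
       Idn = restrict (Idn D) Ob,
       Cmp = (\<lambda>g f. if f \<in> Ar \<and> g \<in> Ar \<and> Cod D f = Dom D g then Cmp D g f else undefined),
       TensO = (\<lambda>X Y. if X \<in> Ob \<and> Y \<in> Ob then foldO D G Psi (TensO D (u X) (u Y)) else undefined),
       TensA = (\<lambda>F H. if F \<in> Ar \<and> H \<in> Ar
                 then Cmp D (Cmp D (pimap D G Psi (u (Cod D F)) (u (Cod D H))) (TensA D F H))
                        (arr_inv D (pimap D G Psi (u (Dom D F)) (u (Dom D H))))
                 else undefined),
       TUnit = foldO D G Psi (TUnit D),
       Sym = (\<lambda>X Y. if X \<in> Ob \<and> Y \<in> Ob then foldA D G Psi (Sym D (u X) (u Y)) else undefined)\<rparr>)"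

text \<open>
  The effect \<open>1\<close> is only defined on the tensor unit itself: an object that is merely isomorphic to
  the unit carries no distinguished effect.
\<close>

definition env_triv :: "('o,'a) smc \<Rightarrow> 'o \<Rightarrow> 'a set" where
  "env_triv D A = (if A = TUnit D then {Idn D (TUnit D)} else {})"

definition env_image ::
    "('o,'a) smc \<Rightarrow> ('o,'a) smcf \<Rightarrow> ('o \<Rightarrow> 'a set) \<Rightarrow> 'o \<Rightarrow> 'a set" where
  "env_image D F Xi B = (\<Union>A\<in>{A \<in> Obj D. fobj F A = B}. farr F ` Xi A)"

text \<open>
  The effects \<open>fld\<^sub>\<Psi>\<^sub>'[\<xi>]\<close> have their domain factors ordered with \<open>H\<close> as outer index; they are turned
  into effects on the object folded over \<open>G \<times> H\<close> by the reordering permutation.  The effects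
  \<open>fld\<^sub>\<Psi>[\<xi>']\<close> need no reordering.  The join of the two structures is the closure of their
  object-wise union under tensor products.  Whenever this closure has no effect on the tensor unit
  besides the identity, it is a multi-environment structure, and hence the least one above both;
  otherwise there is none above both.
\<close>

inductive env_prod_rel ::
    "('o,'a) smc \<Rightarrow> ('g::linorder) list monoid \<Rightarrow> ('g list \<Rightarrow> ('o,'a) smcf) \<Rightarrow> ('o \<Rightarrow> 'a set)
     \<Rightarrow> 'g list monoid \<Rightarrow> ('g list \<Rightarrow> ('o,'a) smcf) \<Rightarrow> ('o \<Rightarrow> 'a set) \<Rightarrow> 'o \<Rightarrow> 'a \<Rightarrow> bool"
  for D G Psi Xi H Psi' Xi' where
  left: "A \<in> Obj D \<Longrightarrow> \<xi> \<in> Xi A \<Longrightarrow>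
     env_prod_rel D G Psi Xi H Psi' Xi' A
       (Cmp D (foldA D H Psi' \<xi>)
          (tperm D (\<lambda>w. fobj (act_prod SMCs D G Psi H Psi' w) A)
             (elems (gprod G H))
             (concat (map (\<lambda>\<gamma>'. map (\<lambda>\<gamma>. \<gamma> @ \<gamma>') (elems G)) (elems H)))))"
| right: "A \<in> Obj D \<Longrightarrow> \<xi>' \<in> Xi' A \<Longrightarrow>
     env_prod_rel D G Psi Xi H Psi' Xi' A (foldA D G Psi \<xi>')"
| tens: "A \<in> Obj D \<Longrightarrow> B \<in> Obj D \<Longrightarrow>
     env_prod_rel D G Psi Xi H Psi' Xi' A \<xi> \<Longrightarrow> env_prod_rel D G Psi Xi H Psi' Xi' B \<xi>' \<Longrightarrow>
     env_prod_rel D G Psi Xi H Psi' Xi' (TensO D A B)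
       (env_tens D (gprod G H) (act_prod SMCs D G Psi H Psi') A B \<xi> \<xi>')"

definition env_prod ::
    "('o,'a) smc \<Rightarrow> ('g::linorder) list monoid \<Rightarrow> ('g list \<Rightarrow> ('o,'a) smcf) \<Rightarrow> ('o \<Rightarrow> 'a set)
     \<Rightarrow> 'g list monoid \<Rightarrow> ('g list \<Rightarrow> ('o,'a) smcf) \<Rightarrow> ('o \<Rightarrow> 'a set) \<Rightarrow> 'o \<Rightarrow> 'a set" where
  "env_prod D G Psi Xi H Psi' Xi' A = {\<xi>. env_prod_rel D G Psi Xi H Psi' Xi' A \<xi>}"


section \<open>SMC-universes\<close>

record ('u,'v,'o,'a) smcu =
  ucat :: "('u,'v) cat"
  und :: "('u,'v,('o,'a) smc,('o,'a) smcf) fctr"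

definition uimage :: "('u,'v,'o,'a) smcu \<Rightarrow> (('o,'a) smc,('o,'a) smcf) cat" where
  "uimage \<Theta> = image_cat (ucat \<Theta>) SMCs (und \<Theta>)"

definition is_smc_universe :: "('u,'v,'o,'a) smcu \<Rightarrow> bool" where
  "is_smc_universe \<Theta> \<longleftrightarrow>
     is_functor (ucat \<Theta>) SMCs (und \<Theta>) \<and> is_faithful (ucat \<Theta>) (und \<Theta>) \<and>
     is_subcategory (uimage \<Theta>) SMCs"

record ('u,'v,'o,'a) umor =
  ufun :: "('u,'v,'u,'v) fctr"
  unat :: "'u \<Rightarrow> ('o,'a) smcf"

definition umor_restrict ::
    "('u,'v,'o,'a) smcu \<Rightarrow> ('u,'v,'o,'a) umor \<Rightarrow> ('u,'v,'o,'a) umor" where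
  "umor_restrict \<Theta> m =
     \<lparr>ufun = fctr_restrict (ucat \<Theta>) (ufun m), unat = restrict (unat m) (cob (ucat \<Theta>))\<rparr>"

text \<open>
  The first conjunct pins the data of a morphism outside its source, so that equality of records is
  equality of morphisms.
\<close>

definition is_smcu_mor ::
    "('u,'v,'o,'a) smcu \<Rightarrow> ('u,'v,'o,'a) smcu \<Rightarrow> ('u,'v,'o,'a) umor \<Rightarrow> bool" where
  "is_smcu_mor \<Theta> \<Theta>' m \<longleftrightarrow>
     umor_restrict \<Theta> m = m \<and>
     is_functor (ucat \<Theta>) (ucat \<Theta>') (ufun m) \<and>
     is_nat_trans (ucat \<Theta>) SMCs (und \<Theta>) (fctr_comp (und \<Theta>') (ufun m)) (unat m)"

definition umor_id :: "('u,'v,'o,'a) smcu \<Rightarrow> ('u,'v,'o,'a) umor" where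
  "umor_id \<Theta> =
     umor_restrict \<Theta> \<lparr>ufun = fctr_id, unat = (\<lambda>X. smcf_id (omap (und \<Theta>) X))\<rparr>"

definition umor_comp ::
    "('u,'v,'o,'a) smcu \<Rightarrow> ('u,'v,'o,'a) umor \<Rightarrow> ('u,'v,'o,'a) umor \<Rightarrow> ('u,'v,'o,'a) umor" where
  "umor_comp \<Theta> m' m =
     umor_restrict \<Theta>
       \<lparr>ufun = fctr_comp (ufun m') (ufun m),
        unat = (\<lambda>X. smcf_comp (omap (und \<Theta>) X) (unat m' (omap (ufun m) X)) (unat m X))\<rparr>"

definition SMCUnivs :: "(('u,'v,'o,'a) smcu, ('u,'v,'o,'a) umor) cat" where
  "SMCUnivs = \<lparr>cob = {\<Theta>. is_smc_universe \<Theta>},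
               chom = (\<lambda>\<Theta> \<Theta>'. {m. is_smcu_mor \<Theta> \<Theta>' m}),
               cid = umor_id,
               ccomp = (\<lambda>\<Theta> \<Theta>' \<Theta>'' m' m. umor_comp \<Theta> m' m)\<rparr>"


section \<open>PreCPM\<close>

text \<open>
  The objects of all SMC-universes are drawn from a type closed under the formation of triples
  \<open>(C, \<Phi>, \<Xi>)\<close>, where \<open>\<Phi>\<close> is recorded together with its group.  The type of basic objects is
  arbitrary, so this does not restrict the SMC-universes.  Morphisms of the PreCPM universe are
  literally morphisms of the given universe, so their type does not change.
\<close>

datatype ('b,'v,'o,'a,'g) uobj =
  Base (unBase: 'b)
| Pre (pobj: "('b,'v,'o,'a,'g) uobj") (pgrp: "'g list monoid") (pact: "'g list \<Rightarrow> 'v")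
      (penv: "'o \<Rightarrow> 'a set")

type_synonym ('b,'v,'o,'a,'g) univ = "(('b,'v,'o,'a,'g) uobj,'v,'o,'a) smcu"
type_synonym ('b,'v,'o,'a,'g) univ_mor = "(('b,'v,'o,'a,'g) uobj,'v,'o,'a) umor"

definition und_act ::
    "('u,'v,'o,'a) smcu \<Rightarrow> 'u \<Rightarrow> 'g list monoid \<Rightarrow> ('g list \<Rightarrow> 'v) \<Rightarrow> 'g list \<Rightarrow> ('o,'a) smcf" where
  "und_act \<Theta> C G Phi = (\<lambda>\<gamma>\<in>carrier G. mmap (und \<Theta>) C C (Phi \<gamma>))"

definition cpm_in ::
    "('u,'v,'o,'a) smcu \<Rightarrow> 'u \<Rightarrow> ('g::linorder) list monoid \<Rightarrow> ('g list \<Rightarrow> 'v) \<Rightarrow> ('o \<Rightarrow> 'a set) \<Rightarrow> bool"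
  where
  "cpm_in \<Theta> C G Phi Xi \<longleftrightarrow>
     (let D = omap (und \<Theta>) C; Psi = und_act \<Theta> C G Phi; E = cpm D G Psi Xi in
      E \<in> cob (uimage \<Theta>) \<and> fld D G Psi \<in> chom (uimage \<Theta>) D E)"

definition fold_inj ::
    "('u,'v,'o,'a) smcu \<Rightarrow> 'u \<Rightarrow> ('g::linorder) list monoid \<Rightarrow> ('g list \<Rightarrow> 'v) \<Rightarrow> bool" where
  "fold_inj \<Theta> C G Phi \<longleftrightarrow>
     inj_on (foldO (omap (und \<Theta>) C) G (und_act \<Theta> C G Phi)) (Obj (omap (und \<Theta>) C))"

definition precpm_obs ::
    "('b,'v,'o,'a,'g::linorder) univ \<Rightarrow> ('b,'v,'o,'a,'g) uobj set" where
  "precpm_obs \<Theta> =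
     {Pre C G Phi Xi | C G Phi Xi.
        C \<in> cob (ucat \<Theta>) \<and> fab_group G \<and> is_action (ucat \<Theta>) C G Phi \<and>
        is_multi_env (omap (und \<Theta>) C) G (und_act \<Theta> C G Phi) Xi \<and>
        cpm_in \<Theta> C G Phi Xi \<and> fold_inj \<Theta> C G Phi}"

definition precpm_homs ::
    "('b,'v,'o,'a,'g::linorder) univ \<Rightarrow> ('b,'v,'o,'a,'g) uobj \<Rightarrow> ('b,'v,'o,'a,'g) uobj \<Rightarrow> 'v set"
  where
  "precpm_homs \<Theta> X Y =
     {F. \<exists>C C' G Phi Phi' Xi Xi'.
        X = Pre C G Phi Xi \<and> Y = Pre C' G Phi' Xi' \<and>
        F \<in> chom (ucat \<Theta>) C C' \<and>
        (\<forall>\<gamma>\<in>carrier G. ccomp (ucat \<Theta>) C C C' F (Phi \<gamma>) = ccomp (ucat \<Theta>) C C' C' (Phi' \<gamma>) F) \<and>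
        (\<forall>A\<in>Obj (omap (und \<Theta>) C).
           farr (mmap (und \<Theta>) C C' F) ` Xi A \<subseteq> Xi' (fobj (mmap (und \<Theta>) C C' F) A))}"

definition precpm :: "('b,'v,'o,'a,'g::linorder) univ \<Rightarrow> ('b,'v,'o,'a,'g) univ" where
  "precpm \<Theta> =
     \<lparr>ucat = \<lparr>cob = precpm_obs \<Theta>,
              chom = precpm_homs \<Theta>,
              cid = (\<lambda>X. cid (ucat \<Theta>) (pobj X)),
              ccomp = (\<lambda>X Y Z. ccomp (ucat \<Theta>) (pobj X) (pobj Y) (pobj Z))\<rparr>,
      und = \<lparr>omap = (\<lambda>X. omap (und \<Theta>) (pobj X)),
             mmap = (\<lambda>X Y. mmap (und \<Theta>) (pobj X) (pobj Y))\<rparr>\<rparr>"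

definition act_image ::
    "('u,'v,'o,'a) umor \<Rightarrow> 'u \<Rightarrow> 'g list monoid \<Rightarrow> ('g list \<Rightarrow> 'v) \<Rightarrow> 'g list \<Rightarrow> 'v" where
  "act_image m C G Phi = (\<lambda>\<gamma>\<in>carrier G. mmap (ufun m) C C (Phi \<gamma>))"

definition precpm_mor ::
    "('b,'v,'o,'a,'g::linorder) univ \<Rightarrow> ('b,'v,'o,'a,'g) univ_mor \<Rightarrow> ('b,'v,'o,'a,'g) univ_mor"
  where
  "precpm_mor \<Theta> m =
     umor_restrict (precpm \<Theta>)
       \<lparr>ufun = \<lparr>omap = (\<lambda>X. Pre (omap (ufun m) (pobj X)) (pgrp X)
                              (act_image m (pobj X) (pgrp X) (pact X))
                              (env_image (omap (und \<Theta>) (pobj X)) (unat m (pobj X)) (penv X))),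
                mmap = (\<lambda>X Y. mmap (ufun m) (pobj X) (pobj Y))\<rparr>,
        unat = (\<lambda>X. unat m (pobj X))\<rparr>"

definition precpm_fctr ::
    "(('b,'v,'o,'a,'g::linorder) univ, ('b,'v,'o,'a,'g) univ_mor,
      ('b,'v,'o,'a,'g) univ, ('b,'v,'o,'a,'g) univ_mor) fctr" where
  "precpm_fctr = \<lparr>omap = precpm, mmap = (\<lambda>\<Theta> \<Theta>'. precpm_mor \<Theta>)\<rparr>"

definition precpm_mult :: "('b,'v,'o,'a,'g::linorder) univ \<Rightarrow> ('b,'v,'o,'a,'g) univ_mor" where
  "precpm_mult \<Theta> =
     umor_restrict (precpm (precpm \<Theta>))
       \<lparr>ufun = \<lparr>omap = (\<lambda>X. let Y = pobj X; C = pobj Y; D = omap (und \<Theta>) C; G = pgrp Y; H = pgrp X in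
                   Pre C (gprod G H)
                     (act_prod (ucat \<Theta>) C G (pact Y) H (pact X))
                     (env_prod D G (und_act \<Theta> C G (pact Y)) (penv Y)
                               H (und_act \<Theta> C H (pact X)) (penv X))),
                mmap = (\<lambda>X Y F. F)\<rparr>,
        unat = (\<lambda>X. smcf_id (omap (und \<Theta>) (pobj (pobj X))))\<rparr>"

definition precpm_unit :: "('b,'v,'o,'a,'g::linorder) univ \<Rightarrow> ('b,'v,'o,'a,'g) univ_mor" where
  "precpm_unit \<Theta> =
     umor_restrict \<Theta>
       \<lparr>ufun = \<lparr>omap = (\<lambda>C. Pre C gtriv (act_triv (ucat \<Theta>) C) (env_triv (omap (und \<Theta>) C))),
                mmap = (\<lambda>C C' F. F)\<rparr>,
        unat = (\<lambda>C. smcf_id (omap (und \<Theta>) C))\<rparr>"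


section \<open>Well-definedness of the assignments on objects\<close>

text \<open>
  For an arbitrary morphism \<open>(\<zeta>, n) : \<Theta> \<rightarrow> \<Theta>'\<close> of SMC-universes and an arbitrary object
  \<open>(C, \<Phi>, \<Xi>)\<close> of the PreCPM universe of \<open>\<Theta>\<close>, the triple \<open>(\<zeta>(C), \<zeta>(\<Phi>), n(\<Xi>))\<close> need not be an
  object of the PreCPM universe of \<open>\<Theta>'\<close>: folding over \<open>\<zeta>(\<Phi>)\<close> may fail to be injective on objects,
  the CPM category of the triple or its folding functor may not belong to \<open>\<Theta>'\<close>, and if \<open>n\<close> maps a
  nontrivial object to the tensor unit then \<open>n(\<Xi>)\<close> may contain a nontrivial scalar.  The
  following predicate excludes exactly these failures; the other defining properties of an object
  always hold.  It is closed under composition and stable under PreCPM.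
\<close>

definition preserves_cpm ::
    "('b,'v,'o,'a,'g::linorder) univ \<Rightarrow> ('b,'v,'o,'a,'g) univ \<Rightarrow> ('b,'v,'o,'a,'g) univ_mor \<Rightarrow> bool"
  where
  "preserves_cpm \<Theta> \<Theta>' m \<longleftrightarrow>
     (\<forall>C G Phi Xi. Pre C G Phi Xi \<in> cob (ucat (precpm \<Theta>)) \<longrightarrow>
        (let C' = omap (ufun m) C; D' = omap (und \<Theta>') C'; Phi' = act_image m C G Phi;
             Xi' = env_image (omap (und \<Theta>) C) (unat m C) Xi in
         Xi' (TUnit D') = {Idn D' (TUnit D')} \<and> fold_inj \<Theta>' C' G Phi' \<and> cpm_in \<Theta>' C' G Phi' Xi'))"

text \<open>
  Similarly, the triple \<open>(C, \<Phi> \<odot> \<Phi>', \<Xi> \<odot> \<Xi>')\<close> need not be an object of the PreCPM universe: the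
  CPM category of the product or its folding functor may not belong to \<open>\<Theta>\<close>, and if \<open>A \<otimes> B\<close> is the
  tensor unit for nontrivial \<open>A\<close> and \<open>B\<close> then the join defining \<open>\<Xi> \<odot> \<Xi>'\<close> may not exist.  This is
  all that can fail.
\<close>

definition closed_under_products :: "('b,'v,'o,'a,'g::linorder) univ \<Rightarrow> bool" where
  "closed_under_products \<Theta> \<longleftrightarrow>
     (\<forall>C G Phi Xi H Phi' Xi'.
        Pre (Pre C G Phi Xi) H Phi' Xi' \<in> cob (ucat (precpm (precpm \<Theta>))) \<longrightarrow>
        (let D = omap (und \<Theta>) C;
             Xi'' = env_prod D G (und_act \<Theta> C G Phi) Xi H (und_act \<Theta> C H Phi') Xi' in
         Xi'' (TUnit D) = {Idn D (TUnit D)} \<and>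
         cpm_in \<Theta> C (gprod G H) (act_prod (ucat \<Theta>) C G Phi H Phi') Xi''))"

definition SMCUnivs_cpm ::
    "(('b,'v,'o,'a,'g::linorder) univ, ('b,'v,'o,'a,'g) univ_mor) cat" where
  "SMCUnivs_cpm =
     SMCUnivs\<lparr>chom := (\<lambda>\<Theta> \<Theta>'. {m \<in> chom SMCUnivs \<Theta> \<Theta>'. preserves_cpm \<Theta> \<Theta>' m})\<rparr>"

definition SMCUnivs_prod ::
    "(('b,'v,'o,'a,'g::linorder) univ, ('b,'v,'o,'a,'g) univ_mor) cat" where
  "SMCUnivs_prod =
     SMCUnivs_cpm\<lparr>cob := {\<Theta> \<in> cob SMCUnivs. closed_under_products \<Theta>}\<rparr>"


section \<open>CPM as a morphism of SMC-universes\<close>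

definition incl_univ ::
    "(('o,'a) smc, ('o,'a) smcf) cat \<Rightarrow> (('o,'a) smc, ('o,'a) smcf, 'o, 'a, 'g) univ" where
  "incl_univ K =
     \<lparr>ucat = \<lparr>cob = Base ` cob K,
              chom = (\<lambda>X Y. chom K (unBase X) (unBase Y)),
              cid = (\<lambda>X. cid K (unBase X)),
              ccomp = (\<lambda>X Y Z. ccomp K (unBase X) (unBase Y) (unBase Z))\<rparr>,
      und = \<lparr>omap = unBase, mmap = (\<lambda>X Y F. F)\<rparr>\<rparr>"

definition cpm_of ::
    "('b,'v,'o,'a,'g::linorder) univ \<Rightarrow> ('b,'v,'o,'a,'g) uobj \<Rightarrow> ('o,'a) smc" where
  "cpm_of \<Theta> X =
     cpm (omap (und \<Theta>) (pobj X)) (pgrp X) (und_act \<Theta> (pobj X) (pgrp X) (pact X)) (penv X)"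

definition CPM_mor ::
    "(('o,'a) smc, ('o,'a) smcf) cat \<Rightarrow> (('o,'a) smc, ('o,'a) smcf, 'o, 'a, 'g::linorder) univ_mor"
  where
  "CPM_mor K =
     (let \<Theta> = incl_univ K in
      umor_restrict (precpm \<Theta>)
        \<lparr>ufun = \<lparr>omap = (\<lambda>X. Base (cpm_of \<Theta> X)), mmap = (\<lambda>X Y F. smcf_restrict (cpm_of \<Theta> X) F)\<rparr>,
         unat = (\<lambda>X. fld (omap (und \<Theta>) (pobj X)) (pgrp X) (und_act \<Theta> (pobj X) (pgrp X) (pact X)))\<rparr>)"

text \<open>
  A sub-category \<open>K\<close> need not contain the restriction of each equivariant functor to the CPM
  categories, which is required for CPM to be a functor to \<open>K\<close>.
\<close>

definition closed_under_restriction ::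
    "(('o,'a) smc, ('o,'a) smcf) cat \<Rightarrow> 'g::linorder itself \<Rightarrow> bool" where
  "closed_under_restriction K _ \<longleftrightarrow>
     (let \<Theta> = incl_univ K :: (('o,'a) smc, ('o,'a) smcf, 'o, 'a, 'g) univ; P = ucat (precpm \<Theta>) in
      \<forall>X\<in>cob P. \<forall>Y\<in>cob P. \<forall>F\<in>chom P X Y.
        smcf_restrict (cpm_of \<Theta> X) F \<in> chom K (cpm_of \<Theta> X) (cpm_of \<Theta> Y))"

end

theory Submission
  imports Defs "HOL-Library.Multiset"
begin

text \<open>
  All structural maps of the CPM construction, that is \<open>\<tau>\<close>, \<open>\<pi>\<close>
  and the reordering in the product of multi-environment structures, are permutations of tensor
  factors. By coherence a permutation of factors depends only on the orders of the factors that it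
  connects. For the recursively defined \<open>tperm\<close> this is the composition law
  \<open>tperm_Cmp\<close>; its inductive step is the Yang-Baxter equation, in the form
  \<open>front_swap\<close>. With naturality (\<open>tperm_natural\<close>), compatibility with
  tensor products (\<open>tperm_append\<close>) and refinement of factors into products of factors
  (\<open>tperm_blocks\<close>), an equation between structural maps becomes an equality of lists of
  labels: if the factors of an object are labelled by a list, those of the folded object are
  labelled by pairs of a group element and an element of the list (\<open>foldO_tens\<close>), and
  \<open>\<pi>\<close> and \<open>\<tau>\<close> permute these pairs (\<open>pimap_tens\<close>,
  \<open>tau_tens\<close>).

  Folding over \<open>G \<times> H\<close> is folding over \<open>H\<close> and then over
  \<open>G\<close> (\<open>foldO_GH\<close>, \<open>foldA_GH\<close>), because the product is
  enumerated lexicographically. Equivariant functors preserve folding and all structural maps, hence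
  they carry multi-environment structures to multi-environment structures
  (\<open>is_multi_env_image\<close>) as long as the unit keeps a single effect; this gives the
  action of PreCPM on morphisms. Comparing labels, one finds that effects of either action, folded
  over the other one, are equivariant for the product action (\<open>equiv_effect_left\<close>, \<open>equiv_effect_right\<close>), and that
  the product of multi-environment structures is preserved by equivariant functors
  (\<open>env_image_envp\<close>), associative (\<open>envp_assoc\<close>) and unital
  (\<open>env_prod_triv_left\<close>, \<open>env_prod_triv_right\<close>). These facts are the
  naturality and the laws of the monad on objects. On morphisms and on underlying categories there
  is nothing to compare, since multiplication and unit are identities there.

  The algebra law is an equality of categories (\<open>cpm_cpm\<close>): the CPM construction for a
  second action, carried out inside the CPM category of a first one, gives the CPM category of the
  product action. The tensor product of the CPM category is that of the given category conjugated by
  \<open>\<pi>\<close>, so that folding inside the CPM category is conjugate to folding in the given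
  category by a reordering (\<open>tensA_list_E\<close>, \<open>foldA_E\<close>). Therefore the
  folded arrows agree, and so do the generators that discard an effect (\<open>disc_left\<close>,
  \<open>disc_right_E\<close>); discarding a tensor product of effects is discarding one after the
  other (\<open>disc_env_tens\<close>), so that closing the effects under tensor products adds no
  morphisms.
\<close>

section \<open>Rearrangements of lists\<close>

definition reord :: "'i list \<Rightarrow> 'i list \<Rightarrow> bool" where
  "reord xs ys \<longleftrightarrow> distinct xs \<and> distinct ys \<and> set xs = set ys"

lemma reord_Nil [simp]: "reord xs [] \<longleftrightarrow> xs = []"
  by (auto simp: reord_def)

lemma reord_ConsD:
  assumes "reord xs (y # ys)" shows "y \<in> set xs" "reord (remove1 y xs) ys" "reord xs xs"
  using assms by (auto simp: reord_def)

lemma reord_concat: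
  assumes "reord xs ys" "distinct (concat (map b xs))"
  shows "reord (concat (map b xs)) (concat (map b ys))"
proof -
  have "mset xs = mset ys"
    using assms(1) unfolding reord_def by (metis set_eq_iff_mset_eq_distinct)
  then have "mset (map b xs) = mset (map b ys)" by simp
  then have "mset (concat (map b xs)) = mset (concat (map b ys))"
    by (simp only: mset_concat sum_mset_sum_list[symmetric] mset_map)
  then show ?thesis
    using assms(2) mset_eq_imp_distinct_iff mset_eq_setD unfolding reord_def by metis
qed

lemma map_remove1_inj_on:
  "inj_on f (set xs) \<Longrightarrow> y \<in> set xs \<Longrightarrow> map f (remove1 y xs) = remove1 (f y) (map f xs)"
  by (induction xs) (auto simp: inj_on_def)

lemma reord_map: "reord xs ys \<Longrightarrow> inj_on f (set xs) \<Longrightarrow> reord (map f xs) (map f ys)"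
  by (simp add: reord_def distinct_map)

section \<open>Strict symmetric monoidal categories\<close>

locale sym_mon_cat =
  fixes D :: "('o,'a) smc"
  assumes smc_D: "is_smc D"
begin

abbreviation cmp (infixr "\<bullet>" 70) where "g \<bullet> f \<equiv> Cmp D g f"
abbreviation ten (infixr "\<star>" 75) where "f \<star> g \<equiv> TensA D f g"
abbreviation teno (infixr "\<diamondop>" 75) where "A \<diamondop> B \<equiv> TensO D A B"
abbreviation idn ("\<i>") where "\<i> A \<equiv> Idn D A"
abbreviation unit_obj ("\<I>") where "\<I> \<equiv> TUnit D"
abbreviation tens where "tens X xs \<equiv> tensO_list D (map X xs)"

lemmas ax_rest1 = smc_D[unfolded is_smc_def Homs_def mem_Collect_eq, THEN conjunct2]
lemmas ax_rest2 = ax_rest1[THEN conjunct2]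
lemmas ax_rest3 = ax_rest2[THEN conjunct2]
lemmas ax_rest4 = ax_rest3[THEN conjunct2]
lemmas ax_rest5 = ax_rest4[THEN conjunct2]
lemmas ax_rest6 = ax_rest5[THEN conjunct2]
lemmas ax_rest7 = ax_rest6[THEN conjunct2]
lemmas ax_rest8 = ax_rest7[THEN conjunct2]
lemmas ax_rest9 = ax_rest8[THEN conjunct2]
lemmas ax_rest10 = ax_rest9[THEN conjunct2]
lemmas ax_rest11 = ax_rest10[THEN conjunct2]
lemmas ax_rest12 = ax_rest11[THEN conjunct2]
lemmas ax_rest13 = ax_rest12[THEN conjunct2]
lemmas ax_rest14 = ax_rest13[THEN conjunct2]
lemmas ax_rest15 = ax_rest14[THEN conjunct2]
lemmas ax_rest16 = ax_rest15[THEN conjunct2]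
lemmas ax_rest17 = ax_rest16[THEN conjunct2]

lemma Dom_Obj [simp]: "f \<in> Arr D \<Longrightarrow> Dom D f \<in> Obj D"
  and Cod_Obj [simp]: "f \<in> Arr D \<Longrightarrow> Cod D f \<in> Obj D"
  using ax_rest1[THEN conjunct1] by simp_all

lemma Idn_simps [simp]:
  assumes "A \<in> Obj D" shows "\<i> A \<in> Arr D" "Dom D (\<i> A) = A" "Cod D (\<i> A) = A"
  using ax_rest2[THEN conjunct1] assms by simp_all

lemma Cmp_simps [simp]:
  assumes "f \<in> Arr D" "g \<in> Arr D" "Cod D f = Dom D g"
  shows "g \<bullet> f \<in> Arr D" "Dom D (g \<bullet> f) = Dom D f" "Cod D (g \<bullet> f) = Cod D g"
  using ax_rest3[THEN conjunct1] assms by simp_all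

lemma Cmp_Idn [simp]:
  assumes "f \<in> Arr D"
  shows "Dom D f = A \<Longrightarrow> f \<bullet> \<i> A = f" "Cod D f = A \<Longrightarrow> \<i> A \<bullet> f = f"
  using ax_rest4[THEN conjunct1] assms by auto

lemma Cmp_assoc [simp]:
  assumes "f \<in> Arr D" "g \<in> Arr D" "h \<in> Arr D" "Cod D f = Dom D g" "Cod D g = Dom D h"
  shows "(h \<bullet> g) \<bullet> f = h \<bullet> g \<bullet> f"
  using ax_rest5[THEN conjunct1] assms by simp_all

lemma TUnit_Obj [simp]: "\<I> \<in> Obj D"
  using ax_rest6[THEN conjunct1] by simp_all

lemma TensO_Obj [simp]: "A \<in> Obj D \<Longrightarrow> B \<in> Obj D \<Longrightarrow> A \<diamondop> B \<in> Obj D"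
  using ax_rest7[THEN conjunct1] by simp_all

lemma TensO_unit [simp]: "A \<in> Obj D \<Longrightarrow> \<I> \<diamondop> A = A" "A \<in> Obj D \<Longrightarrow> A \<diamondop> \<I> = A"
  using ax_rest8[THEN conjunct1] by simp_all

lemma TensO_assoc [simp]:
  "A \<in> Obj D \<Longrightarrow> B \<in> Obj D \<Longrightarrow> C \<in> Obj D \<Longrightarrow> (A \<diamondop> B) \<diamondop> C = A \<diamondop> B \<diamondop> C"
  using ax_rest9[THEN conjunct1] by simp_all

lemma TensA_simps [simp]:
  assumes "f \<in> Arr D" "g \<in> Arr D"
  shows "f \<star> g \<in> Arr D" "Dom D (f \<star> g) = Dom D f \<diamondop> Dom D g" "Cod D (f \<star> g) = Cod D f \<diamondop> Cod D g"
  using ax_rest10[THEN conjunct1] assms by simp_all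

lemma TensA_Idn [simp]: "A \<in> Obj D \<Longrightarrow> B \<in> Obj D \<Longrightarrow> \<i> A \<star> \<i> B = \<i> (A \<diamondop> B)"
  using ax_rest11[THEN conjunct1] by simp_all

lemma interchange:
  assumes "f \<in> Arr D" "g \<in> Arr D" "h \<in> Arr D" "k \<in> Arr D" "Cod D f = Dom D g" "Cod D h = Dom D k"
  shows "(g \<star> k) \<bullet> (f \<star> h) = (g \<bullet> f) \<star> (k \<bullet> h)"
  using ax_rest12[THEN conjunct1] assms by simp

lemma TensA_unit [simp]: "f \<in> Arr D \<Longrightarrow> \<i> \<I> \<star> f = f" "f \<in> Arr D \<Longrightarrow> f \<star> \<i> \<I> = f"
  using ax_rest13[THEN conjunct1] by simp_all

lemma TensA_assoc [simp]:
  "f \<in> Arr D \<Longrightarrow> g \<in> Arr D \<Longrightarrow> h \<in> Arr D \<Longrightarrow> (f \<star> g) \<star> h = f \<star> g \<star> h"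
  using ax_rest14[THEN conjunct1] by simp_all

lemma Sym_simps [simp]:
  assumes "A \<in> Obj D" "B \<in> Obj D"
  shows "Sym D A B \<in> Arr D" "Dom D (Sym D A B) = A \<diamondop> B" "Cod D (Sym D A B) = B \<diamondop> A"
  using ax_rest15[THEN conjunct1] assms by simp_all

lemma Sym_natural:
  assumes "f \<in> Arr D" "g \<in> Arr D"
  shows "Sym D (Cod D f) (Cod D g) \<bullet> (f \<star> g) = (g \<star> f) \<bullet> Sym D (Dom D f) (Dom D g)"
  using ax_rest16[THEN conjunct1] assms by simp_all

lemma Sym_inverse [simp]:
  "A \<in> Obj D \<Longrightarrow> B \<in> Obj D \<Longrightarrow> Sym D B A \<bullet> Sym D A B = \<i> (A \<diamondop> B)"
  using ax_rest17[THEN conjunct1] by simp_all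

lemma Sym_TensO_right:
  "A \<in> Obj D \<Longrightarrow> B \<in> Obj D \<Longrightarrow> C \<in> Obj D \<Longrightarrow>
    Sym D A (B \<diamondop> C) = (\<i> B \<star> Sym D A C) \<bullet> (Sym D A B \<star> \<i> C)"
  using ax_rest17[THEN conjunct2] by simp_all

text \<open>
  A two-sided inverse is unique, which evaluates the description operator in \<open>arr_inv\<close>.
\<close>

lemma arr_inv_eqI:
  assumes f: "f \<in> Arr D" and g: "g \<in> Arr D" "Dom D g = Cod D f" "Cod D g = Dom D f"
    and 1: "g \<bullet> f = \<i> (Dom D f)" and 2: "f \<bullet> g = \<i> (Cod D f)"
  shows "arr_inv D f = g"
  unfolding arr_inv_def
proof (rule the_equality)
  fix h assume h: "h \<in> Homs D (Cod D f) (Dom D f) \<and> h \<bullet> f = \<i> (Dom D f) \<and> f \<bullet> h = \<i> (Cod D f)"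
  then have a: "h \<in> Arr D" "Dom D h = Cod D f" "Cod D h = Dom D f" by (auto simp: Homs_def)
  have "h = h \<bullet> (f \<bullet> g)" using a 2 by simp
  also have "\<dots> = (h \<bullet> f) \<bullet> g" using a f g by (simp del: Cmp_assoc add: Cmp_assoc[symmetric])
  also have "\<dots> = g" using h g by simp
  finally show "h = g" .
qed (use assms in \<open>auto simp: Homs_def\<close>)

lemma whisker_left:
  "A \<in> Obj D \<Longrightarrow> f \<in> Arr D \<Longrightarrow> g \<in> Arr D \<Longrightarrow> Cod D f = Dom D g \<Longrightarrow>
    \<i> A \<star> (g \<bullet> f) = (\<i> A \<star> g) \<bullet> (\<i> A \<star> f)"
  by (simp add: interchange)

lemma whisker_right:
  "A \<in> Obj D \<Longrightarrow> f \<in> Arr D \<Longrightarrow> g \<in> Arr D \<Longrightarrow> Cod D f = Dom D g \<Longrightarrow>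
    (g \<bullet> f) \<star> \<i> A = (g \<star> \<i> A) \<bullet> (f \<star> \<i> A)"
  by (simp add: interchange)

lemma TensA_Idn_left [simp]:
  "A \<in> Obj D \<Longrightarrow> B \<in> Obj D \<Longrightarrow> f \<in> Arr D \<Longrightarrow> \<i> A \<star> \<i> B \<star> f = \<i> (A \<diamondop> B) \<star> f"
  by (simp flip: TensA_assoc)

lemma slide:
  assumes "f \<in> Arr D" "Dom D f = A" "Cod D f = B" "g \<in> Arr D" "Dom D g = A'" "Cod D g = B'"
  shows "(\<i> B \<star> g) \<bullet> (f \<star> \<i> A') = (f \<star> \<i> B') \<bullet> (\<i> A \<star> g)"
  using assms Dom_Obj[of f] Cod_Obj[of f] Dom_Obj[of g] Cod_Obj[of g] by (simp add: interchange)

text \<open>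
  By the hexagon identity this symmetry is idempotent, and it is invertible.
\<close>

lemma Sym_unit_right [simp]: assumes A: "A \<in> Obj D" shows "Sym D A \<I> = \<i> A"
proof -
  let ?s = "Sym D A \<I>"
  have "?s = ?s \<bullet> ?s" using Sym_TensO_right[OF A TUnit_Obj TUnit_Obj] A by simp
  then have "Sym D \<I> A \<bullet> ?s = Sym D \<I> A \<bullet> ?s \<bullet> ?s" by simp
  also have "\<dots> = (Sym D \<I> A \<bullet> ?s) \<bullet> ?s"
    using A by (subst Cmp_assoc) simp_all
  also have "\<dots> = ?s" using A by simp
  finally show ?thesis using A by simp
qed

lemma Sym_unit_left [simp]: assumes A: "A \<in> Obj D" shows "Sym D \<I> A = \<i> A"
proof -
  have "Sym D \<I> A = Sym D A \<I> \<bullet> Sym D \<I> A" using A by (simp del: Sym_inverse)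
  also have "\<dots> = \<i> A" using A by (simp del: Sym_unit_right)
  finally show ?thesis .
qed

text \<open>
  The second hexagon identity is the inverse of the first.
\<close>

lemma Sym_TensO_left:
  assumes [simp]: "A \<in> Obj D" "B \<in> Obj D" "C \<in> Obj D"
  shows "Sym D (A \<diamondop> B) C = (Sym D A C \<star> \<i> B) \<bullet> (\<i> A \<star> Sym D B C)"
proof -
  let ?g = "(Sym D A C \<star> \<i> B) \<bullet> (\<i> A \<star> Sym D B C)"
  have r: "Sym D C (A \<diamondop> B) = (\<i> A \<star> Sym D C B) \<bullet> (Sym D C A \<star> \<i> B)"
    by (rule Sym_TensO_right) simp_all
  have 0: "(Sym D C A \<star> \<i> B) \<bullet> (Sym D A C \<star> \<i> B) \<bullet> (\<i> A \<star> Sym D B C) = \<i> A \<star> Sym D B C"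
    by (subst Cmp_assoc[symmetric]) (simp_all add: interchange del: Cmp_assoc)
  have 1: "Sym D C (A \<diamondop> B) \<bullet> ?g = \<i> (A \<diamondop> B \<diamondop> C)"
    unfolding r by (simp add: 0) (simp add: interchange)
  have 0: "(\<i> A \<star> Sym D B C) \<bullet> (\<i> A \<star> Sym D C B) \<bullet> (Sym D C A \<star> \<i> B) = Sym D C A \<star> \<i> B"
    by (subst Cmp_assoc[symmetric]) (simp_all add: interchange del: Cmp_assoc)
  \<comment> \<open>the candidate is a two-sided inverse of the symmetry in the other direction\<close>
  have 2: "?g \<bullet> Sym D C (A \<diamondop> B) = \<i> (C \<diamondop> A \<diamondop> B)"
    unfolding r by (simp add: 0) (simp add: interchange)
  have "Sym D (A \<diamondop> B) C = arr_inv D (Sym D C (A \<diamondop> B))"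
    by (rule arr_inv_eqI[symmetric])
      (use Sym_inverse[of "A \<diamondop> B" C] Sym_inverse[of C "A \<diamondop> B"] in simp_all)
  also have "\<dots> = ?g" by (rule arr_inv_eqI) (simp_all add: 1 2)
  finally show ?thesis .
qed

section \<open>Permutations of tensor factors\<close>

lemma tensO_list_simps [simp]:
  "tensO_list D [] = \<I>" "tensO_list D (A # As) = A \<diamondop> tensO_list D As"
  by (simp_all add: tensO_list_def)

lemma tensO_list_Obj [simp]: "\<forall>A\<in>set As. A \<in> Obj D \<Longrightarrow> tensO_list D As \<in> Obj D"
  by (induction As) auto

lemma tensO_list_append [simp]:
  "\<forall>A\<in>set As. A \<in> Obj D \<Longrightarrow> \<forall>B\<in>set Bs. B \<in> Obj D \<Longrightarrow>
    tensO_list D (As @ Bs) = tensO_list D As \<diamondop> tensO_list D Bs"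
  by (induction As) auto

lemma tens_concat:
  "\<forall>x\<in>set xs. \<forall>y\<in>set (b x). X y \<in> Obj D \<Longrightarrow> tens X (concat (map b xs)) = tens (\<lambda>x. tens X (b x)) xs"
  by (induction xs) auto

lemma tensA_list_simps [simp]:
  "tensA_list D [] = \<i> \<I>" "tensA_list D (f # fs) = f \<star> tensA_list D fs"
  by (simp_all add: tensA_list_def)

lemma tensA_list_typing [simp]:
  assumes "\<forall>f\<in>set fs. f \<in> Arr D"
  shows "tensA_list D fs \<in> Arr D"
    "Dom D (tensA_list D fs) = tensO_list D (map (Dom D) fs)"
    "Cod D (tensA_list D fs) = tensO_list D (map (Cod D) fs)"
  using assms by (induction fs) auto

lemma tensA_list_append [simp]:
  "\<forall>f\<in>set fs. f \<in> Arr D \<Longrightarrow> \<forall>g\<in>set gs. g \<in> Arr D \<Longrightarrow>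
    tensA_list D (fs @ gs) = tensA_list D fs \<star> tensA_list D gs"
  by (induction fs) auto

lemma tensA_list_Cmp:
  assumes "\<forall>x\<in>set xs. f x \<in> Arr D \<and> g x \<in> Arr D \<and> Cod D (f x) = Dom D (g x)"
  shows "tensA_list D (map (\<lambda>x. g x \<bullet> f x) xs) = tensA_list D (map g xs) \<bullet> tensA_list D (map f xs)"
  using assms
proof (induction xs)
  case (Cons a xs)
  then have "tensO_list D (map (Cod D \<circ> f) xs) = tensO_list D (map (Dom D \<circ> g) xs)"
    by (simp cong: map_cong)
  with Cons show ?case by (simp add: interchange)
qed simp

lemma tensA_list_Idn:
  "\<forall>x\<in>set xs. X x \<in> Obj D \<Longrightarrow> tensA_list D (map (\<lambda>x. \<i> (X x)) xs) = \<i> (tens X xs)"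
  by (induction xs) auto

lemma tensA_list_concat:
  "\<forall>x\<in>set xs. \<forall>f\<in>set (b x). f \<in> Arr D \<Longrightarrow>
    tensA_list D (concat (map b xs)) = tensA_list D (map (\<lambda>x. tensA_list D (b x)) xs)"
  by (induction xs) auto

text \<open>
  One step of the recursion that defines \<open>tperm\<close>.
\<close>

definition front where
  "front X y xs = Sym D (tens X (takeWhile (\<lambda>x. x \<noteq> y) xs)) (X y)
     \<star> \<i> (tens X (tl (dropWhile (\<lambda>x. x \<noteq> y) xs)))"

lemma tperm_Cons: "tperm D X xs (y # ys) = (\<i> (X y) \<star> tperm D X (remove1 y xs) ys) \<bullet> front X y xs"
  by (simp add: front_def)

declare tperm.simps(2) [simp del] tperm_Cons [simp]

lemma remove1_split:
  "y \<in> set xs \<Longrightarrow> remove1 y xs = takeWhile (\<lambda>x. x \<noteq> y) xs @ tl (dropWhile (\<lambda>x. x \<noteq> y) xs)"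
  by (induction xs) auto

lemma front_Cons_same [simp]:
  "X y \<in> Obj D \<Longrightarrow> \<forall>x\<in>set xs. X x \<in> Obj D \<Longrightarrow> front X y (y # xs) = \<i> (X y \<diamondop> tens X xs)"
  by (simp add: front_def)

lemma front_Cons_other [simp]:
  assumes "x \<noteq> y" "y \<in> set xs" "X x \<in> Obj D" "\<forall>x\<in>set xs. X x \<in> Obj D"
  shows "front X y (x # xs) = (Sym D (X x) (X y) \<star> \<i> (tens X (remove1 y xs))) \<bullet> (\<i> (X x) \<star> front X y xs)"
proof -
  let ?P = "takeWhile (\<lambda>x. x \<noteq> y) xs" and ?Q = "tl (dropWhile (\<lambda>x. x \<noteq> y) xs)"
  have PQ: "\<forall>x\<in>set ?P. X x \<in> Obj D" "\<forall>x\<in>set ?Q. X x \<in> Obj D"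
    using assms(4) set_takeWhileD set_dropWhileD[where xs = xs] list.set_sel(2)
    by (metis, metis list.sel(2) tl_Nil)
  have y: "X y \<in> Obj D" using assms by blast
  show ?thesis using assms PQ y
    by (simp add: front_def remove1_split Sym_TensO_left whisker_right)
qed

lemma front_typing [simp]:
  assumes "y \<in> set xs" "\<forall>x\<in>set xs. X x \<in> Obj D"
  shows "front X y xs \<in> Arr D" "Dom D (front X y xs) = tens X xs"
    "Cod D (front X y xs) = X y \<diamondop> tens X (remove1 y xs)"
proof -
  have "front X y xs \<in> Arr D \<and> Dom D (front X y xs) = tens X xs
    \<and> Cod D (front X y xs) = X y \<diamondop> tens X (remove1 y xs)"
    using assms
  proof (induction xs)
    case (Cons x xs)
    have r: "\<forall>z\<in>set (remove1 y xs). X z \<in> Obj D"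
      using Cons.prems set_remove1_subset[of y xs] by auto
    show ?case
    proof (cases "x = y")
      case True with Cons.prems show ?thesis by simp
    next
      case False
      then have "X y \<in> Obj D" "y \<in> set xs" using Cons.prems by auto
      with False Cons r show ?thesis by simp
    qed
  qed simp
  then show "front X y xs \<in> Arr D" "Dom D (front X y xs) = tens X xs"
    "Cod D (front X y xs) = X y \<diamondop> tens X (remove1 y xs)" by auto
qed

text \<open>
  The Yang-Baxter equation: both sides are the two ways of decomposing the symmetry
  \<open>A \<otimes> B \<otimes> C \<rightarrow> C \<otimes> B \<otimes> A\<close>.
\<close>

lemma yang_baxter:
  assumes [simp]: "A \<in> Obj D" "B \<in> Obj D" "C \<in> Obj D"
  shows "(Sym D B C \<star> \<i> A) \<bullet> (\<i> B \<star> Sym D A C) \<bullet> (Sym D A B \<star> \<i> C) =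
    (\<i> C \<star> Sym D A B) \<bullet> (Sym D A C \<star> \<i> B) \<bullet> (\<i> A \<star> Sym D B C)"
  using Sym_natural[of "Sym D A B" "\<i> C"] by (simp add: Sym_TensO_left)

text \<open>
  The inductive step of \<open>front_swap\<close>: the further factor \<open>A\<close> has to be
  passed both by \<open>B\<close> and by \<open>C\<close>, where \<open>F\<close>, \<open>f\<close>,
  \<open>G\<close> and \<open>g\<close> stand for the moves inside the shorter list.
\<close>

lemma yang_baxter_whiskered:
  assumes [simp]: "A \<in> Obj D" "B \<in> Obj D" "C \<in> Obj D" "R \<in> Obj D" "P \<in> Obj D" "P' \<in> Obj D"
    and [simp]: "F \<in> Arr D" "Dom D F = P" "Cod D F = C \<diamondop> R"
      "f \<in> Arr D" "Dom D f = Q" "Cod D f = B \<diamondop> P"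
      "G \<in> Arr D" "Dom D G = P'" "Cod D G = B \<diamondop> R"
      "g \<in> Arr D" "Dom D g = Q" "Cod D g = C \<diamondop> P'"
    and eq: "(Sym D B C \<star> \<i> R) \<bullet> (\<i> B \<star> F) \<bullet> f = (\<i> C \<star> G) \<bullet> g"
  shows "(Sym D B C \<star> \<i> (A \<diamondop> R)) \<bullet> (\<i> B \<star> ((Sym D A C \<star> \<i> R) \<bullet> (\<i> A \<star> F)))
      \<bullet> (Sym D A B \<star> \<i> P) \<bullet> (\<i> A \<star> f) =
    (\<i> C \<star> ((Sym D A B \<star> \<i> R) \<bullet> (\<i> A \<star> G))) \<bullet> (Sym D A C \<star> \<i> P') \<bullet> (\<i> A \<star> g)"
    (is "?lhs = ?rhs")
proof -
  let ?AB = "Sym D A B" and ?AC = "Sym D A C" and ?BC = "Sym D B C"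
  have [simp]: "Q \<in> Obj D" using Dom_Obj[of f] by simp
  have F: "(\<i> (B \<diamondop> A) \<star> F) \<bullet> (?AB \<star> \<i> P) = (?AB \<star> \<i> (C \<diamondop> R)) \<bullet> (\<i> (A \<diamondop> B) \<star> F)"
    by (rule slide) simp_all
  have G: "(\<i> (C \<diamondop> A) \<star> G) \<bullet> (?AC \<star> \<i> P') = (?AC \<star> \<i> (B \<diamondop> R)) \<bullet> (\<i> (A \<diamondop> C) \<star> G)"
    by (rule slide) simp_all
  have "?lhs = (?BC \<star> \<i> A \<star> \<i> R) \<bullet> (\<i> B \<star> ?AC \<star> \<i> R) \<bullet> ((\<i> (B \<diamondop> A) \<star> F) \<bullet> (?AB \<star> \<i> P)) \<bullet> (\<i> A \<star> f)"
    by (simp add: whisker_left)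
  also have "\<dots> = (((?BC \<star> \<i> A) \<bullet> (\<i> B \<star> ?AC) \<bullet> (?AB \<star> \<i> C)) \<star> \<i> R) \<bullet> (\<i> (A \<diamondop> B) \<star> F) \<bullet> (\<i> A \<star> f)"
    unfolding F by (simp add: whisker_right)
  also have "\<dots> = (((\<i> C \<star> ?AB) \<bullet> (?AC \<star> \<i> B) \<bullet> (\<i> A \<star> ?BC)) \<star> \<i> R) \<bullet> (\<i> (A \<diamondop> B) \<star> F) \<bullet> (\<i> A \<star> f)"
    by (subst yang_baxter) simp_all
  also have "\<dots> = (((\<i> C \<star> ?AB) \<bullet> (?AC \<star> \<i> B)) \<star> \<i> R) \<bullet> (\<i> A \<star> ((?BC \<star> \<i> R) \<bullet> (\<i> B \<star> F) \<bullet> f))"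
    by (simp add: whisker_right whisker_left)
  also have "\<dots> = (\<i> C \<star> ?AB \<star> \<i> R) \<bullet> ((?AC \<star> \<i> (B \<diamondop> R)) \<bullet> (\<i> (A \<diamondop> C) \<star> G)) \<bullet> (\<i> A \<star> g)"
    unfolding eq by (simp add: whisker_right whisker_left)
  also have "\<dots> = ?rhs"
    unfolding G[symmetric] by (simp add: whisker_left)
  finally show ?thesis .
qed

text \<open>
  Moving \<open>y\<close> and then \<open>z\<close> to the front, or \<open>z\<close> and then
  \<open>y\<close>, passes the same factors; the results differ by the symmetry of the two.
\<close>

lemma front_swap:
  assumes "y \<in> set xs" "z \<in> set xs" "y \<noteq> z" "distinct xs" "\<forall>x\<in>set xs. X x \<in> Obj D"
  shows "(Sym D (X y) (X z) \<star> \<i> (tens X (remove1 y (remove1 z xs))))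
      \<bullet> (\<i> (X y) \<star> front X z (remove1 y xs)) \<bullet> front X y xs =
    (\<i> (X z) \<star> front X y (remove1 z xs)) \<bullet> front X z xs"
  using assms
proof (induction xs)
  case (Cons x xs)
  have sub: "\<forall>x\<in>set xs. X x \<in> Obj D" "X x \<in> Obj D" using Cons.prems by auto
  have yz: "X y \<in> Obj D" "X z \<in> Obj D" using Cons.prems by auto
  have rem: "\<forall>u\<in>set (remove1 v ys). X u \<in> Obj D" if "\<forall>u\<in>set ys. X u \<in> Obj D" for v ys
    using that set_remove1_subset[of v ys] by auto
  consider "x = y" | "x = z" | "x \<noteq> y" "x \<noteq> z" by blast
  then show ?case
  proof cases
    case 1
    with Cons.prems have z: "z \<in> set xs" "y \<notin> set xs" by auto
    have y: "remove1 y (remove1 z xs) = remove1 z xs"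
      using z set_remove1_subset[of z xs] by (metis remove1_idem subsetD)
    show ?thesis using 1 Cons.prems(3) z sub rem y yz by simp
  next
    case 2
    with Cons.prems have y: "y \<in> set xs" "z \<notin> set xs" by auto
    have z: "remove1 z (remove1 y xs) = remove1 y xs"
      using y set_remove1_subset[of y xs] by (metis remove1_idem subsetD)
    let ?YZ = "Sym D (X y) (X z)" and ?ZY = "Sym D (X z) (X y)" and ?R = "\<i> (tens X (remove1 y xs))"
    have "(?YZ \<star> ?R) \<bullet> (?ZY \<star> ?R) \<bullet> (\<i> (X z) \<star> front X y xs) = \<i> (X z) \<star> front X y xs"
      using y sub rem yz
      by (subst Cmp_assoc[symmetric]) (simp_all add: interchange del: Cmp_assoc)
    then show ?thesis using 2 Cons.prems(3) y z sub rem yz by simp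
  next
    case 3
    with Cons.prems have in_set: "y \<in> set xs" "z \<in> set xs" and d: "distinct xs" by auto
    have in_rem: "y \<in> set (remove1 z xs)" "z \<in> set (remove1 y xs)"
      using in_set Cons.prems(3) by auto
    have IH: "(Sym D (X y) (X z) \<star> \<i> (tens X (remove1 y (remove1 z xs))))
      \<bullet> (\<i> (X y) \<star> front X z (remove1 y xs)) \<bullet> front X y xs =
    (\<i> (X z) \<star> front X y (remove1 z xs)) \<bullet> front X z xs"
      by (rule Cons.IH) (use in_set d sub Cons.prems(3) in auto)
    have "(Sym D (X y) (X z) \<star> \<i> (X x \<diamondop> tens X (remove1 y (remove1 z xs))))
        \<bullet> (\<i> (X y) \<star> ((Sym D (X x) (X z) \<star> \<i> (tens X (remove1 y (remove1 z xs))))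
            \<bullet> (\<i> (X x) \<star> front X z (remove1 y xs))))
        \<bullet> (Sym D (X x) (X y) \<star> \<i> (tens X (remove1 y xs))) \<bullet> (\<i> (X x) \<star> front X y xs) =
      (\<i> (X z) \<star> ((Sym D (X x) (X y) \<star> \<i> (tens X (remove1 y (remove1 z xs))))
            \<bullet> (\<i> (X x) \<star> front X y (remove1 z xs))))
        \<bullet> (Sym D (X x) (X z) \<star> \<i> (tens X (remove1 z xs))) \<bullet> (\<i> (X x) \<star> front X z xs)"
      by (rule yang_baxter_whiskered[OF _ _ _ _ _ _ _ _ _ _ _ _ _ _ _ _ _ _ IH, where Q = "tens X xs"])
        (use in_set in_rem sub rem rem[OF rem[OF sub(1)]] yz in \<open>simp_all add: remove1_commute[of z y]\<close>)
    then show ?thesis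
      using 3 in_set in_rem sub rem rem[OF rem[OF sub(1)]] yz by (simp add: remove1_commute[of z y])
  qed
qed simp

lemma tperm_typing [simp]:
  assumes "reord xs ys" "\<forall>x\<in>set xs. X x \<in> Obj D"
  shows "tperm D X xs ys \<in> Arr D" "Dom D (tperm D X xs ys) = tens X xs"
    "Cod D (tperm D X xs ys) = tens X ys"
proof -
  have "tperm D X xs ys \<in> Arr D \<and> Dom D (tperm D X xs ys) = tens X xs
    \<and> Cod D (tperm D X xs ys) = tens X ys"
    using assms
  proof (induction ys arbitrary: xs)
    case (Cons y ys)
    note r = reord_ConsD[OF Cons.prems(1)]
    have "\<forall>x\<in>set (remove1 y xs). X x \<in> Obj D"
      using Cons.prems(2) set_remove1_subset[of y xs] by auto
    from Cons.IH[OF r(2) this] r Cons.prems(2) show ?case by auto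
  qed simp
  then show "tperm D X xs ys \<in> Arr D" "Dom D (tperm D X xs ys) = tens X xs"
    "Cod D (tperm D X xs ys) = tens X ys" by auto
qed

lemma tperm_refl [simp]:
  "\<forall>x\<in>set xs. X x \<in> Obj D \<Longrightarrow> tperm D X xs xs = \<i> (tens X xs)"
  by (induction xs) auto

text \<open>
  A factor that is moved to the front after a permutation can be moved there at once, since it
  passes the factors moved by the permutation in either order. This is what \<open>tperm_Cmp\<close>
  needs at the head of its target list.
\<close>

lemma front_tperm:
  assumes "reord xs ys" "z \<in> set xs" "\<forall>x\<in>set xs. X x \<in> Obj D"
  shows "front X z ys \<bullet> tperm D X xs ys =
    (\<i> (X z) \<star> tperm D X (remove1 z xs) (remove1 z ys)) \<bullet> front X z xs"
  using assms
proof (induction ys arbitrary: xs)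
  case (Cons y ys)
  note r = reord_ConsD[OF Cons.prems(1)]
  have rem: "\<forall>u\<in>set (remove1 v ys). X u \<in> Obj D" if "\<forall>u\<in>set ys. X u \<in> Obj D" for v ys
    using that set_remove1_subset[of v ys] by auto
  have set_ys: "\<forall>x\<in>set ys. X x \<in> Obj D" "X y \<in> Obj D" "X z \<in> Obj D"
    using Cons.prems by (auto simp: reord_def)
  show ?case
  proof (cases "y = z")
    case True
    then show ?thesis using r Cons.prems set_ys rem by simp
  next
    case False
    have z: "z \<in> set ys" "z \<in> set (remove1 y xs)" "y \<in> set (remove1 z xs)"
      using False Cons.prems r by (auto simp: reord_def)
    have zr: "reord (remove1 z (remove1 y xs)) (remove1 z ys)"
      using r Cons.prems by (auto simp: reord_def)
    have IH: "front X z ys \<bullet> tperm D X (remove1 y xs) ys =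
      (\<i> (X z) \<star> tperm D X (remove1 z (remove1 y xs)) (remove1 z ys)) \<bullet> front X z (remove1 y xs)"
      using Cons.IH[OF r(2) z(2)] rem Cons.prems(3) by blast
    note r2 = rem[OF rem[OF Cons.prems(3)]]
    let ?t = "tperm D X (remove1 z (remove1 y xs)) (remove1 z ys)"
    let ?S = "Sym D (X y) (X z)" and ?R = "tens X (remove1 z ys)" and ?Q = "tens X (remove1 z (remove1 y xs))"
    have nat: "(?S \<star> \<i> ?R) \<bullet> (\<i> (X y \<diamondop> X z) \<star> ?t) = (\<i> (X z \<diamondop> X y) \<star> ?t) \<bullet> (?S \<star> \<i> ?Q)"
      using slide[OF _ refl refl _ refl refl, of ?S ?t] set_ys rem zr
      by (simp add: r2)
    have "front X z (y # ys) \<bullet> tperm D X xs (y # ys) =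
      (?S \<star> \<i> ?R) \<bullet> (\<i> (X y) \<star> (front X z ys \<bullet> tperm D X (remove1 y xs) ys)) \<bullet> front X y xs"
      using False z set_ys rem r Cons.prems by (simp add: whisker_left)
    also have "\<dots> = ((?S \<star> \<i> ?R) \<bullet> (\<i> (X y \<diamondop> X z) \<star> ?t))
        \<bullet> (\<i> (X y) \<star> front X z (remove1 y xs)) \<bullet> front X y xs"
      unfolding IH using z set_ys rem r zr r2 Cons.prems by (simp add: whisker_left)
    also have "\<dots> = (\<i> (X z \<diamondop> X y) \<star> ?t) \<bullet> (?S \<star> \<i> ?Q)
        \<bullet> (\<i> (X y) \<star> front X z (remove1 y xs)) \<bullet> front X y xs"
      unfolding nat using z set_ys rem r zr r2 Cons.prems by (simp)
    also have "(?S \<star> \<i> ?Q) \<bullet> (\<i> (X y) \<star> front X z (remove1 y xs)) \<bullet> front X y xs =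
        (\<i> (X z) \<star> front X y (remove1 z xs)) \<bullet> front X z xs"
      using front_swap[of y xs z X] False r(1) Cons.prems by (simp add: reord_def remove1_commute[of z y])
    finally show ?thesis
      using False z set_ys rem r zr r2 Cons.prems
      by (simp add: whisker_left remove1_commute[of y z])
  qed
qed simp

text \<open>
  Coherence: there is only one permutation of tensor factors between two given orders of labels.
\<close>

theorem tperm_Cmp:
  assumes "reord xs ys" "reord ys zs" "\<forall>x\<in>set xs. X x \<in> Obj D"
  shows "tperm D X ys zs \<bullet> tperm D X xs ys = tperm D X xs zs"
  using assms
proof (induction zs arbitrary: xs ys)
  case (Cons z zs)
  note r = reord_ConsD[OF Cons.prems(2)]
  have rem: "\<forall>u\<in>set (remove1 v ys). X u \<in> Obj D" if "\<forall>u\<in>set ys. X u \<in> Obj D" for v ys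
    using that set_remove1_subset[of v ys] by auto
  have z: "z \<in> set xs" "\<forall>x\<in>set ys. X x \<in> Obj D" "X z \<in> Obj D"
    using r Cons.prems by (auto simp: reord_def)
  have xy: "reord (remove1 z xs) (remove1 z ys)" using Cons.prems by (auto simp: reord_def)
  have "tperm D X ys (z # zs) \<bullet> tperm D X xs ys =
    (\<i> (X z) \<star> tperm D X (remove1 z ys) zs) \<bullet> front X z ys \<bullet> tperm D X xs ys"
    using r Cons.prems z rem by simp
  also have "\<dots> = (\<i> (X z) \<star> tperm D X (remove1 z ys) zs)
      \<bullet> (\<i> (X z) \<star> tperm D X (remove1 z xs) (remove1 z ys)) \<bullet> front X z xs"
    using front_tperm[OF Cons.prems(1) z(1) Cons.prems(3)] by simp
  also have "\<dots> = (\<i> (X z) \<star> (tperm D X (remove1 z ys) zs \<bullet> tperm D X (remove1 z xs) (remove1 z ys)))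
      \<bullet> front X z xs"
    using r Cons.prems z rem xy by (simp add: whisker_left)
  also have "\<dots> = tperm D X xs (z # zs)"
    using Cons.IH[OF xy r(2)] rem Cons.prems by simp
  finally show ?case .
qed simp

lemma tperm_cong:
  "\<forall>x\<in>set xs \<union> set ys. X x = Y x \<Longrightarrow> tperm D X xs ys = tperm D Y xs ys"
proof (induction ys arbitrary: xs)
  case (Cons y ys)
  have "map X (takeWhile (\<lambda>x. x \<noteq> y) xs) = map Y (takeWhile (\<lambda>x. x \<noteq> y) xs)"
    using Cons.prems set_takeWhileD by (metis UnI1 list.map_cong0)
  moreover have "set (tl (dropWhile (\<lambda>x. x \<noteq> y) xs)) \<subseteq> set xs"
    by (metis list.set_sel(2) set_dropWhileD subsetI tl_Nil)
  then have "map X (tl (dropWhile (\<lambda>x. x \<noteq> y) xs)) = map Y (tl (dropWhile (\<lambda>x. x \<noteq> y) xs))"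
    using Cons.prems by auto
  moreover have "tperm D X (remove1 y xs) ys = tperm D Y (remove1 y xs) ys"
    using Cons.prems set_remove1_subset[of y xs] by (intro Cons.IH) auto
  ultimately show ?case using Cons.prems by (simp add: front_def cong: map_cong)
qed simp

lemma front_append:
  "y \<in> set xs \<Longrightarrow> \<forall>x\<in>set xs \<union> set zs. X x \<in> Obj D \<Longrightarrow>
    front X y (xs @ zs) = front X y xs \<star> \<i> (tens X zs)"
proof -
  assume y: "y \<in> set xs" and X: "\<forall>x\<in>set xs \<union> set zs. X x \<in> Obj D"
  have "dropWhile (\<lambda>x. x \<noteq> y) xs \<noteq> []" using y by (auto simp: dropWhile_eq_Nil_conv)
  moreover have "\<forall>x\<in>set (takeWhile (\<lambda>x. x \<noteq> y) xs). X x \<in> Obj D"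
    using X set_takeWhileD by fastforce
  moreover have "\<forall>x\<in>set (tl (dropWhile (\<lambda>x. x \<noteq> y) xs)). X x \<in> Obj D"
    using X by (metis Un_iff list.set_sel(2) set_dropWhileD tl_Nil)
  ultimately show ?thesis
    using y X takeWhile_append1[of y xs "\<lambda>x. x \<noteq> y" zs] dropWhile_append1[of y xs "\<lambda>x. x \<noteq> y" zs]
    by (auto simp: front_def)
qed

lemma tperm_append:
  assumes "reord xs ys" "reord xs' ys'" "set xs \<inter> set xs' = {}" "\<forall>x\<in>set xs. X x \<in> Obj D" "\<forall>x\<in>set xs'. X x \<in> Obj D"
  shows "tperm D X (xs @ xs') (ys @ ys') = tperm D X xs ys \<star> tperm D X xs' ys'"
  using assms
proof (induction ys arbitrary: xs)
  case (Cons y ys)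
  note r = reord_ConsD[OF Cons.prems(1)]
  have X: "\<forall>x\<in>set (remove1 y xs). X x \<in> Obj D" "X y \<in> Obj D"
    using Cons.prems(4) r(1) set_remove1_subset[of y xs] by auto
  have "tperm D X (remove1 y xs @ xs') (ys @ ys') = tperm D X (remove1 y xs) ys \<star> tperm D X xs' ys'"
    using r Cons.prems X set_remove1_subset[of y xs] by (intro Cons.IH) auto
  then show ?case
    using r Cons.prems X
    by (simp add: remove1_append front_append ball_Un interchange flip: TensA_assoc)
qed simp

lemma tperm_map:
  assumes "inj_on f (set xs)" "reord xs ys"
  shows "tperm D X (map f xs) (map f ys) = tperm D (\<lambda>x. X (f x)) xs ys"
  using assms
proof (induction ys arbitrary: xs)
  case (Cons y ys)
  note r = reord_ConsD[OF Cons.prems(2)]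
  have "takeWhile (\<lambda>x. x \<noteq> f y) (map f xs) = map f (takeWhile (\<lambda>x. x \<noteq> y) xs)"
    "dropWhile (\<lambda>x. x \<noteq> f y) (map f xs) = map f (dropWhile (\<lambda>x. x \<noteq> y) xs)"
    unfolding takeWhile_map dropWhile_map comp_def
    using inj_on_eq_iff[OF Cons.prems(1)] r(1)
    by (auto intro!: arg_cong[where f = "map f"] takeWhile_cong dropWhile_cong)
  moreover have "tperm D X (map f (remove1 y xs)) (map f ys) = tperm D (\<lambda>x. X (f x)) (remove1 y xs) ys"
    using r Cons.prems inj_on_subset set_remove1_subset by (metis Cons.IH)
  ultimately show ?case
    using r Cons.prems(1)
    by (simp add: front_def map_remove1_inj_on[symmetric] comp_def map_tl[symmetric])
qed simp

lemma front_split: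
  "y \<notin> set P \<Longrightarrow> front X y (P @ y # Q) = Sym D (tens X P) (X y) \<star> \<i> (tens X Q)"
  by (auto simp: front_def takeWhile_append)

text \<open>
  Repeated use of the hexagon identity.
\<close>

lemma tperm_swap:
  assumes "distinct (P @ Q)" "\<forall>x\<in>set P \<union> set Q. X x \<in> Obj D"
  shows "tperm D X (P @ Q) (Q @ P) = Sym D (tens X P) (tens X Q)"
  using assms
proof (induction Q)
  case (Cons q Q)
  then have "remove1 q (P @ q # Q) = P @ Q" by (simp add: remove1_append)
  with Cons show ?case by (simp add: front_split Sym_TensO_right)
qed simp

text \<open>
  Moving a block of factors to the front moves the factors of the block there one after the other.
\<close>

lemma tperm_blocks:
  assumes "reord xs ys" "distinct (concat (map b xs))" "\<forall>x\<in>set xs. X x = tens Y (b x)"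
    "\<forall>x\<in>set xs. \<forall>y\<in>set (b x). Y y \<in> Obj D"
  shows "tperm D X xs ys = tperm D Y (concat (map b xs)) (concat (map b ys))"
  using assms
proof (induction ys arbitrary: xs)
  case (Cons y ys)
  note r = reord_ConsD[OF Cons.prems(1)]
  obtain P Q where xs: "xs = P @ y # Q" and y: "y \<notin> set P" using r(1) split_list_first by metis
  let ?c = "\<lambda>xs. concat (map b xs)"
  have rem: "remove1 y xs = P @ Q" using xs y by (simp add: remove1_append)
  have X: "\<forall>x\<in>set xs. X x \<in> Obj D" using Cons.prems by auto
  have 1: "tperm D X (P @ Q) ys = tperm D Y (?c (P @ Q)) (?c ys)"
    using Cons.prems r xs rem by (intro Cons.IH) auto
  have r': "reord (?c (P @ Q)) (?c ys)"
    using Cons.prems r xs rem by (intro reord_concat) auto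
  have 2: "\<i> (X y) = tperm D Y (b y) (b y)" using Cons.prems xs by simp
  have P: "tens X P = tens Y (?c P)" and Q: "tens X Q = tens Y (?c Q)"
    using Cons.prems xs by (simp_all add: tens_concat ball_Un cong: map_cong)
  have r2: "reord (?c P @ b y) (b y @ ?c P)" "reord (?c Q) (?c Q)" "reord (b y) (b y)"
    "reord (?c xs) (b y @ ?c (P @ Q))"
    using Cons.prems xs by (auto simp: reord_def)
  \<comment> \<open>moving the block of \<open>y\<close> to the front passes the blocks of \<open>P\<close> as a whole\<close>
  have "front X y xs = tperm D Y (?c P @ b y) (b y @ ?c P) \<star> tperm D Y (?c Q) (?c Q)"
    unfolding xs front_split[OF y] using Cons.prems xs P Q
    by (subst tperm_swap) (auto simp: ball_Un)
  also have "\<dots> = tperm D Y ((?c P @ b y) @ ?c Q) ((b y @ ?c P) @ ?c Q)"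
    using Cons.prems xs r2 by (subst tperm_append) auto
  finally have 3: "front X y xs = tperm D Y (?c xs) (b y @ ?c (P @ Q))" using xs by simp
  have "tperm D X xs (y # ys) = (tperm D Y (b y) (b y) \<star> tperm D Y (?c (P @ Q)) (?c ys))
      \<bullet> tperm D Y (?c xs) (b y @ ?c (P @ Q))"
    unfolding tperm_Cons rem 1 2 3 ..
  also have "\<dots> = tperm D Y (b y @ ?c (P @ Q)) (b y @ ?c ys) \<bullet> tperm D Y (?c xs) (b y @ ?c (P @ Q))"
    using Cons.prems xs r2 r' by (subst tperm_append) auto
  also have "\<dots> = tperm D Y (?c xs) (?c (y # ys))"
    using Cons.prems xs r2 r' by (subst tperm_Cmp) (auto simp: reord_def)
  finally show ?case .
qed simp

lemma front_natural:
  assumes "y \<in> set xs" "\<forall>x\<in>set xs. f x \<in> Arr D \<and> Dom D (f x) = X x \<and> Cod D (f x) = Y x"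
  shows "(f y \<star> tensA_list D (map f (remove1 y xs))) \<bullet> front X y xs
    = front Y y xs \<bullet> tensA_list D (map f xs)"
proof -
  obtain P Q where xs: "xs = P @ y # Q" and y: "y \<notin> set P" using assms(1) split_list_first by metis
  let ?t = "\<lambda>xs. tensA_list D (map f xs)"
  have rem: "remove1 y xs = P @ Q" using xs y by (simp add: remove1_append)
  have f: "\<forall>x\<in>set xs. f x \<in> Arr D" "f y \<in> Arr D" using assms by auto
  have dom: "Dom D (?t P) = tens X P" "Cod D (?t P) = tens Y P" "Dom D (?t Q) = tens X Q"
    "Cod D (?t Q) = tens Y Q" "Dom D (f y) = X y" "Cod D (f y) = Y y"
    using assms xs by (simp_all add: comp_def cong: map_cong)
  have XY: "X y \<in> Obj D" "tens X P \<in> Obj D" "tens X Q \<in> Obj D" "Y y \<in> Obj D" "tens Y P \<in> Obj D" "tens Y Q \<in> Obj D"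
    unfolding dom[symmetric] using f xs by (auto intro!: Dom_Obj Cod_Obj)
  show ?thesis
    using Sym_natural[of "?t P" "f y"] f XY dom y unfolding rem unfolding xs
    by (simp add: front_split interchange flip: TensA_assoc)
qed

text \<open>
  By naturality of the symmetry an arrow can be applied to a factor before or after the factor is
  moved.
\<close>

lemma tperm_natural:
  assumes "reord xs ys" "\<forall>x\<in>set xs. f x \<in> Arr D \<and> Dom D (f x) = X x \<and> Cod D (f x) = Y x"
  shows "tensA_list D (map f ys) \<bullet> tperm D X xs ys = tperm D Y xs ys \<bullet> tensA_list D (map f xs)"
  using assms
proof (induction ys arbitrary: xs)
  case (Cons y ys)
  note r = reord_ConsD[OF Cons.prems(1)]
  let ?t = "\<lambda>xs. tensA_list D (map f xs)" and ?xs = "remove1 y xs"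
  have IH: "?t ys \<bullet> tperm D X ?xs ys = tperm D Y ?xs ys \<bullet> ?t ?xs"
    using Cons.prems set_remove1_subset[of y xs] by (intro Cons.IH r) auto
  have f: "\<forall>x\<in>set xs. f x \<in> Arr D" "f y \<in> Arr D" "\<forall>x\<in>set ?xs. f x \<in> Arr D" "\<forall>x\<in>set ys. f x \<in> Arr D"
    using Cons.prems r set_remove1_subset[of y xs] by (auto simp: reord_def)
  have dom: "Dom D (?t ys) = tens X ys" "Cod D (?t ys) = tens Y ys" "Dom D (?t ?xs) = tens X ?xs"
      "Cod D (?t ?xs) = tens Y ?xs" "Dom D (f y) = X y" "Cod D (f y) = Y y"
      "Dom D (?t xs) = tens X xs" "Cod D (?t xs) = tens Y xs"
    using Cons.prems r set_remove1_subset[of y xs] f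
    by (auto simp: comp_def reord_def intro!: arg_cong[where f = "tensO_list D"] map_cong)
  have XY: "X y \<in> Obj D" "\<forall>x\<in>set xs. X x \<in> Obj D" "Y y \<in> Obj D" "\<forall>x\<in>set xs. Y x \<in> Obj D"
    using Cons.prems r(1) by (metis Dom_Obj Cod_Obj)+
  have XY': "\<forall>x\<in>set ?xs. X x \<in> Obj D" "\<forall>x\<in>set ?xs. Y x \<in> Obj D"
    using XY set_remove1_subset[of y xs] by auto
  have "?t (y # ys) \<bullet> tperm D X xs (y # ys) = (f y \<star> (?t ys \<bullet> tperm D X ?xs ys)) \<bullet> front X y xs"
    using f dom XY XY' r by (simp flip: Cmp_assoc add: interchange)
  also have "\<dots> = (\<i> (Y y) \<star> tperm D Y ?xs ys) \<bullet> (f y \<star> ?t ?xs) \<bullet> front X y xs"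
    unfolding IH using f dom XY XY' r by (simp flip: Cmp_assoc add: interchange)
  also have "\<dots> = tperm D Y xs (y # ys) \<bullet> ?t xs"
    using front_natural[OF r(1) Cons.prems(2)] f dom XY XY' r by simp
  finally show ?case .
qed simp

text \<open>
  The unit is the tensor product of no factors, so there is nothing to permute.
\<close>

lemma tperm_unit:
  assumes "reord xs ys" "\<forall>x\<in>set xs. X x = \<I>"
  shows "tperm D X xs ys = \<i> \<I>"
proof -
  have "tperm D X xs ys = tperm D X (concat (map (\<lambda>x. []) xs)) (concat (map (\<lambda>x. []) ys))"
    by (rule tperm_blocks) (use assms in \<open>auto simp: concat_eq_Nil_conv[THEN iffD2]\<close>)
  also have "\<dots> = \<i> \<I>" by (subst (1 2) concat_eq_Nil_conv[THEN iffD2]) auto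
  finally show ?thesis .
qed

text \<open>
  Effects can be tensored in any order, because permuting their codomains does nothing.
\<close>

lemma tensA_list_effects:
  assumes "reord xs ys" "distinct (concat (map b xs))"
    "\<forall>x\<in>set xs. f x \<in> Homs D (tens Y (b x)) \<I>" "\<forall>x\<in>set xs. \<forall>y\<in>set (b x). Y y \<in> Obj D"
  shows "tensA_list D (map f ys) \<bullet> tperm D Y (concat (map b xs)) (concat (map b ys))
    = tensA_list D (map f xs)"
proof -
  have f: "\<forall>x\<in>set xs. f x \<in> Arr D \<and> Dom D (f x) = tens Y (b x) \<and> Cod D (f x) = \<I>"
    using assms(3) by (simp add: Homs_def)
  have "tensA_list D (map f ys) \<bullet> tperm D (\<lambda>x. tens Y (b x)) xs ys
    = tperm D (\<lambda>x. \<I>) xs ys \<bullet> tensA_list D (map f xs)"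
    by (rule tperm_natural[OF assms(1) f])
  moreover have "tperm D (\<lambda>x. tens Y (b x)) xs ys = tperm D Y (concat (map b xs)) (concat (map b ys))"
    by (rule tperm_blocks) (use assms in auto)
  moreover have "tperm D (\<lambda>x. \<I>) xs ys = \<i> \<I>" by (rule tperm_unit) (use assms in auto)
  moreover have "Cod D (tensA_list D (map f xs)) = \<I>" using f by (induction xs) auto
  ultimately show ?thesis using f by simp
qed

lemma tensA_list_tperm:
  assumes "\<forall>x\<in>set xs. reord (b x) (c x)" "distinct (concat (map b xs))"
    "\<forall>x\<in>set xs. \<forall>y\<in>set (b x). Y y \<in> Obj D"
  shows "tensA_list D (map (\<lambda>x. tperm D Y (b x) (c x)) xs)
    = tperm D Y (concat (map b xs)) (concat (map c xs))"
  using assms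
proof (induction xs)
  case (Cons x xs)
  have "reord (concat (map b xs)) (concat (map c xs))"
    using Cons.prems(1,2)
  proof (induction xs)
    case (Cons a xs)
    then show ?case by (auto simp: reord_def)
  qed (simp)
  then show ?case using Cons by (subst list.map, simp) (subst tperm_append, auto)
qed simp

lemma arr_inv_tperm:
  assumes "reord xs ys" "\<forall>x\<in>set xs. X x \<in> Obj D"
  shows "arr_inv D (tperm D X xs ys) = tperm D X ys xs"
proof -
  have "reord ys xs" "\<forall>x\<in>set ys. X x \<in> Obj D" using assms by (auto simp: reord_def)
  then show ?thesis using assms by (intro arr_inv_eqI) (simp_all add: tperm_Cmp)
qed

end

section \<open>Monoidal functors\<close>

locale smc_functor = C: sym_mon_cat C + D: sym_mon_cat D
  for C D :: "('o,'a) smc" +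
  fixes F :: "('o,'a) smcf"
  assumes is_smc_functor: "is_smc_functor C D F"
begin

lemma fobj_Obj [simp]: "A \<in> Obj C \<Longrightarrow> fobj F A \<in> Obj D"
  using is_smc_functor unfolding is_smc_functor_def by (auto simp: PiE_iff)

lemma farr_typing [simp]:
  assumes "f \<in> Arr C"
  shows "farr F f \<in> Arr D" "Dom D (farr F f) = fobj F (Dom C f)" "Cod D (farr F f) = fobj F (Cod C f)"
  using is_smc_functor assms unfolding is_smc_functor_def by (auto simp: PiE_iff)

lemma farr_Idn [simp]: "A \<in> Obj C \<Longrightarrow> farr F (Idn C A) = Idn D (fobj F A)"
  using is_smc_functor unfolding is_smc_functor_def by auto

lemma farr_Cmp [simp]:
  "f \<in> Arr C \<Longrightarrow> g \<in> Arr C \<Longrightarrow> Cod C f = Dom C g \<Longrightarrow>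
    farr F (Cmp C g f) = Cmp D (farr F g) (farr F f)"
  using is_smc_functor unfolding is_smc_functor_def by auto

lemma fobj_TUnit [simp]: "fobj F (TUnit C) = TUnit D"
  using is_smc_functor unfolding is_smc_functor_def by auto

lemma fobj_TensO [simp]:
  "A \<in> Obj C \<Longrightarrow> B \<in> Obj C \<Longrightarrow> fobj F (TensO C A B) = TensO D (fobj F A) (fobj F B)"
  using is_smc_functor unfolding is_smc_functor_def by auto

lemma farr_TensA [simp]:
  "f \<in> Arr C \<Longrightarrow> g \<in> Arr C \<Longrightarrow> farr F (TensA C f g) = TensA D (farr F f) (farr F g)"
  using is_smc_functor unfolding is_smc_functor_def by auto

lemma farr_Sym [simp]:
  "A \<in> Obj C \<Longrightarrow> B \<in> Obj C \<Longrightarrow> farr F (Sym C A B) = Sym D (fobj F A) (fobj F B)"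
  using is_smc_functor unfolding is_smc_functor_def by auto

lemma fobj_tens:
  "\<forall>x\<in>set xs. X x \<in> Obj C \<Longrightarrow>
    fobj F (tensO_list C (map X xs)) = tensO_list D (map (\<lambda>x. fobj F (X x)) xs)"
  by (induction xs) auto

lemma farr_tensA_list:
  "\<forall>x\<in>set xs. f x \<in> Arr C \<Longrightarrow>
    farr F (tensA_list C (map f xs)) = tensA_list D (map (\<lambda>x. farr F (f x)) xs)"
  by (induction xs) auto

lemma farr_front:
  assumes "\<forall>x\<in>set xs. X x \<in> Obj C" "y \<in> set xs"
  shows "farr F (C.front X y xs) = D.front (\<lambda>x. fobj F (X x)) y xs"
proof -
  obtain P Q where xs: "xs = P @ y # Q" and y: "y \<notin> set P" using assms(2) split_list_first by metis
  with assms(1) show ?thesis by (simp add: C.front_split D.front_split ball_Un fobj_tens)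
qed

lemma farr_tperm:
  assumes "reord xs ys" "\<forall>x\<in>set xs. X x \<in> Obj C"
  shows "farr F (tperm C X xs ys) = tperm D (\<lambda>x. fobj F (X x)) xs ys"
  using assms
proof (induction ys arbitrary: xs)
  case (Cons y ys)
  note r = reord_ConsD[OF Cons.prems(1)]
  have X: "\<forall>x\<in>set (remove1 y xs). X x \<in> Obj C" "X y \<in> Obj C"
    using Cons.prems(2) r(1) set_remove1_subset[of y xs] by auto
  show ?case using Cons.IH[OF r(2) X(1)] X r Cons.prems(2) by (simp add: farr_front)
qed simp

end

section \<open>Folding over a group action\<close>

lemma product_Nil [simp]: "List.product xs [] = []"
  by (induction xs) auto

lemma elems_simps [simp]:
  assumes "fab_group G" shows "set (elems G) = carrier G" "distinct (elems G)"
  using assms by (simp_all add: elems_def fab_group_def)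

locale smc_action = sym_mon_cat D for D :: "('o,'a) smc" +
  fixes G :: "'g::linorder list monoid" (structure) and Psi :: "'g list \<Rightarrow> ('o,'a) smcf"
  assumes fab [simp]: "fab_group G"
    and act_functor: "\<gamma> \<in> carrier G \<Longrightarrow> is_smc_functor D D (Psi \<gamma>)"
    and act_fobj: "\<gamma> \<in> carrier G \<Longrightarrow> \<delta> \<in> carrier G \<Longrightarrow> A \<in> Obj D \<Longrightarrow>
      fobj (Psi \<gamma>) (fobj (Psi \<delta>) A) = fobj (Psi (\<gamma> \<otimes> \<delta>)) A"
    and act_farr: "\<gamma> \<in> carrier G \<Longrightarrow> \<delta> \<in> carrier G \<Longrightarrow> f \<in> Arr D \<Longrightarrow>
      farr (Psi \<gamma>) (farr (Psi \<delta>) f) = farr (Psi (\<gamma> \<otimes> \<delta>)) f"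
begin

lemma act: "\<gamma> \<in> carrier G \<Longrightarrow> smc_functor D D (Psi \<gamma>)"
  by (intro smc_functor.intro smc_functor_axioms.intro sym_mon_cat_axioms act_functor)

lemmas act_simps [simp] =
  smc_functor.fobj_Obj[OF act] smc_functor.farr_typing[OF act] smc_functor.farr_Idn[OF act]
  smc_functor.farr_Cmp[OF act] smc_functor.fobj_TUnit[OF act] smc_functor.fobj_TensO[OF act]
  smc_functor.farr_TensA[OF act] smc_functor.farr_Sym[OF act]

sublocale group G
  using fab unfolding fab_group_def comm_group_def by blast

lemma translate_carrier:
  assumes "\<gamma> \<in> carrier G"
  shows "(\<lambda>\<delta>. \<gamma> \<otimes> \<delta>) ` carrier G = carrier G" "inj_on (\<lambda>\<delta>. \<gamma> \<otimes> \<delta>) (carrier G)"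
  using assms surj_const_mult[of \<gamma>] inj_on_cmult[of \<gamma>] by auto

text \<open>
  If \<open>X\<close> gives the factors of an object, labelled by \<open>xs\<close>, then \<open>lab
  X\<close> gives those of the folded object, in the order \<open>prd xs\<close>; acting by
  \<open>\<gamma>\<close> turns this order into \<open>shift \<gamma> xs\<close>.
\<close>

abbreviation fO where "fO \<equiv> foldO D G Psi"
abbreviation fA where "fA \<equiv> foldA D G Psi"
abbreviation lab where "lab X \<equiv> \<lambda>(\<gamma>, x). fobj (Psi \<gamma>) (X x)"
abbreviation prd where "prd xs \<equiv> List.product (elems G) xs"
abbreviation shift where "shift \<gamma> xs \<equiv> List.product (map (\<lambda>\<delta>. \<gamma> \<otimes> \<delta>) (elems G)) xs"

lemma foldO_Obj [simp]: "A \<in> Obj D \<Longrightarrow> fO A \<in> Obj D"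
  by (auto simp: foldO_def)

lemma foldA_typing [simp]:
  assumes "f \<in> Arr D" shows "fA f \<in> Arr D" "Dom D (fA f) = fO (Dom D f)" "Cod D (fA f) = fO (Cod D f)"
  using assms
  by (auto simp: foldA_def foldO_def comp_def intro!: arg_cong[where f = "tensO_list D"] map_cong)

lemma foldA_Idn [simp]: "A \<in> Obj D \<Longrightarrow> fA (\<i> A) = \<i> (fO A)"
  unfolding foldA_def foldO_def
  by (subst tensA_list_Idn[symmetric]) (auto intro!: arg_cong[where f = "tensA_list D"] map_cong)

lemma foldA_Cmp [simp]:
  "f \<in> Arr D \<Longrightarrow> g \<in> Arr D \<Longrightarrow> Cod D f = Dom D g \<Longrightarrow> fA (g \<bullet> f) = fA g \<bullet> fA f"
  unfolding foldA_def
  by (subst tensA_list_Cmp[symmetric]) (auto intro!: arg_cong[where f = "tensA_list D"] map_cong)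

lemma foldO_unit [simp]: "fO \<I> = \<I>"
proof -
  have "tens (\<lambda>\<gamma>. fobj (Psi \<gamma>) \<I>) gs = \<I>" if "set gs \<subseteq> carrier G" for gs
    using that by (induction gs) auto
  then show ?thesis by (simp add: foldO_def)
qed

text \<open>
  Monoidal functors preserve tensor products of lists of factors. All structural maps of folding are
  permutations of the factors labelled in this way, hence equations between them amount to
  equalities of lists of labels.
\<close>

lemma foldO_tens:
  assumes "\<forall>x\<in>set xs. X x \<in> Obj D" shows "fO (tens X xs) = tens (lab X) (prd xs)"
proof -
  have "fO (tens X xs) = tens (\<lambda>\<gamma>. tens (lab X) (map (Pair \<gamma>) xs)) (elems G)"
    unfolding foldO_def using assms
    by (intro arg_cong[where f = "tensO_list D"] map_cong)
      (simp_all add: smc_functor.fobj_tens[OF act] comp_def)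
  also have "\<dots> = tens (lab X) (prd xs)"
    using assms by (subst tens_concat[symmetric]) (auto simp: product_concat_map)
  finally show ?thesis .
qed

lemma foldA_tperm:
  assumes "reord xs ys" "\<forall>x\<in>set xs. X x \<in> Obj D"
  shows "fA (tperm D X xs ys) = tperm D (lab X) (prd xs) (prd ys)"
proof -
  have "fA (tperm D X xs ys) =
    tensA_list D (map (\<lambda>\<gamma>. tperm D (lab X) (map (Pair \<gamma>) xs) (map (Pair \<gamma>) ys)) (elems G))"
    unfolding foldA_def using assms
    by (intro arg_cong[where f = "tensA_list D"] map_cong)
      (simp_all add: smc_functor.farr_tperm[OF act] tperm_map inj_on_def)
  also have "\<dots> = tperm D (lab X) (prd xs) (prd ys)"
    unfolding product_concat_map
    by (rule tensA_list_tperm)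
      (use assms in \<open>auto simp: reord_def distinct_map inj_on_def product_concat_map[symmetric] distinct_product\<close>)
  finally show ?thesis .
qed

lemma foldA_tensA_list:
  assumes "\<forall>x\<in>set xs. f x \<in> Arr D"
  shows "fA (tensA_list D (map f xs)) = tensA_list D (map (\<lambda>(\<gamma>, x). farr (Psi \<gamma>) (f x)) (prd xs))"
proof -
  have "fA (tensA_list D (map f xs)) = tensA_list D (map (\<lambda>\<gamma>. tensA_list D
      (map (\<lambda>(\<gamma>, x). farr (Psi \<gamma>) (f x)) (map (Pair \<gamma>) xs))) (elems G))"
    unfolding foldA_def using assms
    by (intro arg_cong[where f = "tensA_list D"] map_cong)
      (simp_all add: smc_functor.farr_tensA_list[OF act] comp_def)
  also have "\<dots> = tensA_list D (map (\<lambda>(\<gamma>, x). farr (Psi \<gamma>) (f x)) (prd xs))"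
    unfolding product_concat_map map_concat map_map using assms
    by (subst tensA_list_concat) (auto simp: comp_def)
  finally show ?thesis .
qed

lemma pimap_tens:
  assumes "distinct (as @ bs)" "\<forall>x\<in>set (as @ bs). X x \<in> Obj D"
  shows "pimap D G Psi (tens X as) (tens X bs) = tperm D (lab X) (prd as @ prd bs) (prd (as @ bs))"
proof -
  let ?b = "case_sum (\<lambda>\<gamma>. map (Pair \<gamma>) as) (\<lambda>\<gamma>. map (Pair \<gamma>) bs)"
  have "pimap D G Psi (tens X as) (tens X bs) = tperm D (lab X)
     (concat (map ?b (map Inl (elems G) @ map Inr (elems G))))
     (concat (map ?b (concat (map (\<lambda>\<gamma>. [Inl \<gamma>, Inr \<gamma>]) (elems G)))))"
    unfolding pimap_def
  proof (rule tperm_blocks)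
    show "reord (map Inl (elems G) @ map Inr (elems G)) (concat (map (\<lambda>\<gamma>. [Inl \<gamma>, Inr \<gamma>]) (elems G)))"
    proof -
      have "distinct (concat (map (\<lambda>\<gamma>. [Inl \<gamma>, Inr \<gamma>]) gs))" if "distinct gs" for gs :: "'g list list"
        using that by (induction gs) auto
      then show ?thesis by (auto simp: reord_def distinct_map)
    qed
    show "distinct (concat (map ?b (map Inl (elems G) @ map Inr (elems G))))"
      using assms(1) distinct_product[of "elems G" as] distinct_product[of "elems G" bs]
      by (auto simp: product_concat_map comp_def)
    show "\<forall>x\<in>set (map Inl (elems G) @ map Inr (elems G)).
       (case x of Inl \<gamma> \<Rightarrow> fobj (Psi \<gamma>) (tens X as) | Inr \<gamma> \<Rightarrow> fobj (Psi \<gamma>) (tens X bs))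
        = tens (lab X) (?b x)"
      using assms by (auto simp: smc_functor.fobj_tens[OF act] comp_def)
  qed (use assms in auto)
  also have "concat (map ?b (map Inl (elems G) @ map Inr (elems G))) = prd as @ prd bs"
    by (simp add: product_concat_map comp_def)
  also have "concat (map ?b (concat (map (\<lambda>\<gamma>. [Inl \<gamma>, Inr \<gamma>]) gs))) = List.product gs (as @ bs)" for gs
    by (induction gs) auto
  finally show ?thesis .
qed

lemma reord_pimap:
  assumes "distinct (as @ bs)"
  shows "reord (prd as @ prd bs) (prd (as @ bs))" "reord (prd (as @ bs)) (prd as @ prd bs)"
  using assms by (auto simp: reord_def distinct_product)

lemma arr_inv_pimap_tens:
  assumes "distinct (as @ bs)" "\<forall>x\<in>set (as @ bs). X x \<in> Obj D"
  shows "arr_inv D (pimap D G Psi (tens X as) (tens X bs))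
    = tperm D (lab X) (prd (as @ bs)) (prd as @ prd bs)"
  unfolding pimap_tens[OF assms] using reord_pimap[OF assms(1)] assms(2)
  by (intro arr_inv_tperm) auto

lemma env_tens_tens:
  assumes "distinct (as @ bs)" "\<forall>x\<in>set (as @ bs). X x \<in> Obj D"
  shows "env_tens D G Psi (tens X as) (tens X bs) \<xi> \<zeta>
    = (\<xi> \<star> \<zeta>) \<bullet> tperm D (lab X) (prd (as @ bs)) (prd as @ prd bs)"
  unfolding env_tens_def arr_inv_pimap_tens[OF assms] ..

lemma reord_shift:
  "\<gamma> \<in> carrier G \<Longrightarrow> distinct xs \<Longrightarrow> reord (prd xs) (shift \<gamma> xs)"
  "\<gamma> \<in> carrier G \<Longrightarrow> distinct xs \<Longrightarrow> reord (shift \<gamma> xs) (prd xs)"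
  using translate_carrier by (auto simp: reord_def distinct_product distinct_map)

lemma tau_tens:
  assumes \<gamma>: "\<gamma> \<in> carrier G" and xs: "distinct xs" "\<forall>x\<in>set xs. X x \<in> Obj D"
  shows "tau D G Psi (tens X xs) \<gamma> = tperm D (lab X) (prd xs) (shift \<gamma> xs)"
  unfolding tau_def product_concat_map
  by (rule tperm_blocks)
    (use assms translate_carrier[OF \<gamma>] in
      \<open>auto simp: reord_def distinct_map product_concat_map[symmetric] distinct_product
        smc_functor.fobj_tens[OF act] comp_def\<close>)

lemma arr_inv_tau_tens:
  assumes "\<gamma> \<in> carrier G" "distinct xs" "\<forall>x\<in>set xs. X x \<in> Obj D"
  shows "arr_inv D (tau D G Psi (tens X xs) \<gamma>) = tperm D (lab X) (shift \<gamma> xs) (prd xs)"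
  unfolding tau_tens[OF assms]
  by (rule arr_inv_tperm) (use assms reord_shift in auto)

text \<open>
  The factor labelled \<open>(\<delta>, x)\<close> is sent to the one labelled
  \<open>(\<gamma> \<delta>, x)\<close>.
\<close>

lemma farr_tperm_lab:
  assumes "\<gamma> \<in> carrier G" "reord ps qs" "set ps \<subseteq> carrier G \<times> {x. X x \<in> Obj D}"
  shows "farr (Psi \<gamma>) (tperm D (lab X) ps qs)
    = tperm D (lab X) (map (\<lambda>(\<delta>, x). (\<gamma> \<otimes> \<delta>, x)) ps) (map (\<lambda>(\<delta>, x). (\<gamma> \<otimes> \<delta>, x)) qs)"
proof -
  have "farr (Psi \<gamma>) (tperm D (lab X) ps qs) = tperm D (\<lambda>p. fobj (Psi \<gamma>) (lab X p)) ps qs"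
    by (rule smc_functor.farr_tperm[OF act]) (use assms in auto)
  also have "\<dots> = tperm D (\<lambda>p. lab X ((\<lambda>(\<delta>, x). (\<gamma> \<otimes> \<delta>, x)) p)) ps qs"
    by (rule tperm_cong) (use assms in \<open>auto simp: act_fobj reord_def\<close>)
  also have "\<dots> = tperm D (lab X) (map (\<lambda>(\<delta>, x). (\<gamma> \<otimes> \<delta>, x)) ps) (map (\<lambda>(\<delta>, x). (\<gamma> \<otimes> \<delta>, x)) qs)"
  proof (rule tperm_map[symmetric])
    show "inj_on (\<lambda>(\<delta>, x). (\<gamma> \<otimes> \<delta>, x)) (set ps)"
    proof (rule inj_onI)
      fix p q assume pq: "p \<in> set ps" "q \<in> set ps"
        "(\<lambda>(\<delta>, x). (\<gamma> \<otimes> \<delta>, x)) p = (\<lambda>(\<delta>, x). (\<gamma> \<otimes> \<delta>, x)) q"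
      moreover from pq have "fst p \<in> carrier G" "fst q \<in> carrier G" using assms(3) by auto
      ultimately show "p = q" using assms(1) by (auto simp: case_prod_beta intro: prod_eqI)
    qed
  qed (rule assms)
  finally show ?thesis .
qed

lemma map_shift:
  "map (\<lambda>(\<delta>, x). (\<gamma> \<otimes> \<delta>, x)) (prd xs) = shift \<gamma> xs"
  by (simp add: product_concat_map map_concat comp_def)

lemma pimap_unit_left [simp]: "A \<in> Obj D \<Longrightarrow> pimap D G Psi \<I> A = \<i> (fO A)"
proof -
  assume A: "A \<in> Obj D"
  show ?thesis
    using pimap_tens[of "[]" "[()]" "\<lambda>_. A"] foldO_tens[of "[()]" "\<lambda>_. A"] A
    by (simp del: tensO_list_append)
qed

text \<open>
  Both sides are tensor products of the translates of \<open>f\<close> and \<open>g\<close>, in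
  different orders, so naturality of permutations applies.
\<close>

lemma foldA_TensA:
  assumes f: "f \<in> Arr D" and g: "g \<in> Arr D"
  shows "fA (f \<star> g) = pimap D G Psi (Cod D f) (Cod D g) \<bullet> (fA f \<star> fA g)
    \<bullet> arr_inv D (pimap D G Psi (Dom D f) (Dom D g))"
proof -
  \<comment> \<open>\<open>f\<close> and \<open>g\<close> form a family indexed by truth values\<close>
  define k where "k = (\<lambda>b. if b then f else g)"
  have k [simp]: "k b \<in> Arr D" for b using assms by (simp add: k_def)
  let ?X = "\<lambda>b. Dom D (k b)" and ?Y = "\<lambda>b. Cod D (k b)"
  let ?k = "\<lambda>(\<gamma>, b). farr (Psi \<gamma>) (k b)"
  let ?s = "prd [True] @ prd [False]" and ?m = "prd ([True] @ [False])"
  have r: "reord ?s ?m" "reord ?m ?s" by (rule reord_pimap; simp)+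
  have one: "fA (k b) = tensA_list D (map ?k (prd [b]))" for b
    using foldA_tensA_list[of "[b]" k] by simp
  define M where "M = tensA_list D (map ?k ?m)"
  define N where "N = tensA_list D (map ?k ?s)"
  let ?X' = "tens (lab ?X)" and ?Y' = "tens (lab ?Y)"
  have M: "fA (f \<star> g) = M"
    using foldA_tensA_list[of "[True, False]" k] assms by (simp add: k_def M_def)
  have N: "fA f \<star> fA g = N"
    using one[of True] one[of False]
    unfolding N_def map_append by (subst tensA_list_append) (auto simp: k_def f g)
  have nat: "M \<bullet> tperm D (lab ?X) ?s ?m = tperm D (lab ?Y) ?s ?m \<bullet> N"
    unfolding M_def N_def by (rule tperm_natural[OF r(1)]) auto
  have inv: "arr_inv D (pimap D G Psi (Dom D f) (Dom D g)) = tperm D (lab ?X) ?m ?s"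
    using arr_inv_pimap_tens[of "[True]" "[False]" ?X] assms by (simp add: k_def)
  have pi: "pimap D G Psi (Cod D f) (Cod D g) = tperm D (lab ?Y) ?s ?m"
    using pimap_tens[of "[True]" "[False]" ?Y] assms by (simp add: k_def)
  have obj: "\<forall>p\<in>set ?s. lab ?X p \<in> Obj D" "\<forall>p\<in>set ?m. lab ?X p \<in> Obj D"
    "\<forall>p\<in>set ?s. lab ?Y p \<in> Obj D" "\<forall>p\<in>set ?m. lab ?Y p \<in> Obj D" by auto
  note X = tperm_typing[OF r(1) obj(1)] tperm_typing[OF r(2) obj(2)] tperm_typing[OF r(1) obj(3)]
  have MN: "M \<in> Arr D" "Dom D M = ?X' ?m" "N \<in> Arr D" "Cod D N = ?Y' ?s" "Dom D N = ?X' ?s"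
    unfolding M_def N_def
    by (auto simp: comp_def ball_Un simp del: map_append intro!: arg_cong[where f = "tensO_list D"] map_cong)
  have "M = M \<bullet> tperm D (lab ?X) ?s ?m \<bullet> tperm D (lab ?X) ?m ?s"
    using MN obj tperm_Cmp[OF r(2) r(1) obj(2)] by (simp only: tperm_refl Cmp_Idn)
  also have "\<dots> = (M \<bullet> tperm D (lab ?X) ?s ?m) \<bullet> tperm D (lab ?X) ?m ?s"
    by (rule Cmp_assoc[symmetric]) (simp_all only: MN X)
  also have "\<dots> = (tperm D (lab ?Y) ?s ?m \<bullet> N) \<bullet> tperm D (lab ?X) ?m ?s"
    unfolding nat ..
  also have "\<dots> = tperm D (lab ?Y) ?s ?m \<bullet> N \<bullet> tperm D (lab ?X) ?m ?s"
    by (rule Cmp_assoc) (simp_all only: MN X)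
  finally show ?thesis unfolding M N inv pi .
qed

text \<open>
  The conditions that a multi-environment structure imposes on each of its effects separately. They
  are preserved by folding, by tensor products of effects and by equivariant functors.
\<close>

definition equiv_effect :: "'o \<Rightarrow> 'a \<Rightarrow> bool" where
  "equiv_effect A \<xi> \<longleftrightarrow> A \<in> Obj D \<and> \<xi> \<in> Homs D (fO A) \<I> \<and>
    (\<forall>\<gamma>\<in>carrier G. farr (Psi \<gamma>) \<xi> = \<xi> \<bullet> arr_inv D (tau D G Psi A \<gamma>))"

lemma equiv_effect_tens:
  assumes xs: "distinct xs" "\<forall>x\<in>set xs. X x \<in> Obj D"
  shows "equiv_effect (tens X xs) \<xi> \<longleftrightarrow> \<xi> \<in> Homs D (tens (lab X) (prd xs)) \<I> \<and>
    (\<forall>\<gamma>\<in>carrier G. farr (Psi \<gamma>) \<xi> = \<xi> \<bullet> tperm D (lab X) (shift \<gamma> xs) (prd xs))"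
  using assms by (simp add: equiv_effect_def foldO_tens arr_inv_tau_tens cong: ball_cong)

text \<open>
  Translation by \<open>\<gamma>\<close> acts on the factors of \<open>A\<close> and of
  \<open>B\<close> separately, hence commutes with the interleaving of the two.
\<close>

lemma equiv_effect_env_tens:
  assumes ab: "equiv_effect A \<xi>" "equiv_effect B \<zeta>"
  shows "equiv_effect (A \<diamondop> B) (env_tens D G Psi A B \<xi> \<zeta>)"
proof -
  \<comment> \<open>\<open>A\<close> and \<open>B\<close> are regarded as single tensor factors, labelled by truth values\<close>
  define X where "X = (\<lambda>b. if b then A else B)"
  have AB [simp]: "A \<in> Obj D" "B \<in> Obj D" using ab by (auto simp: equiv_effect_def)
  have X [simp]: "X b \<in> Obj D" for b by (simp add: X_def)
  have eq: "A = tens X [True]" "B = tens X [False]" "A \<diamondop> B = tens X ([True] @ [False])"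
    by (simp_all add: X_def)
  let ?t = "tperm D (lab X)"
  have e: "env_tens D G Psi A B \<xi> \<zeta>
    = (\<xi> \<star> \<zeta>) \<bullet> ?t (prd ([True] @ [False])) (prd [True] @ prd [False])"
    unfolding eq(1,2) by (rule env_tens_tens) auto
  have T: "distinct [b]" "\<forall>x\<in>set [b]. X x \<in> Obj D" for b by auto
  note iff = iffD1[OF equiv_effect_tens[OF T]]
  have \<xi>: "\<xi> \<in> Arr D" "Dom D \<xi> = tens (lab X) (prd [True])" "Cod D \<xi> = \<I>"
    and \<zeta>: "\<zeta> \<in> Arr D" "Dom D \<zeta> = tens (lab X) (prd [False])" "Cod D \<zeta> = \<I>"
    and eqv: "\<And>\<gamma>. \<gamma> \<in> carrier G \<Longrightarrow> farr (Psi \<gamma>) \<xi> = \<xi> \<bullet> ?t (shift \<gamma> [True]) (prd [True])"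
      "\<And>\<gamma>. \<gamma> \<in> carrier G \<Longrightarrow> farr (Psi \<gamma>) \<zeta> = \<zeta> \<bullet> ?t (shift \<gamma> [False]) (prd [False])"
    using iff[OF ab(1)[unfolded eq(1)]] iff[OF ab(2)[unfolded eq(2)]] unfolding Homs_def by blast+
  have r: "reord (prd ([True] @ [False])) (prd [True] @ prd [False])"
    by (rule reord_pimap) auto
  have obj: "\<forall>p\<in>set (prd xs). lab X p \<in> Obj D" for xs by auto
  note obj [simp]
  show ?thesis
    unfolding eq(3) e
  proof (subst equiv_effect_tens, simp, simp, intro conjI ballI)
    show "(\<xi> \<star> \<zeta>) \<bullet> ?t (prd ([True] @ [False])) (prd [True] @ prd [False])
      \<in> Homs D (tens (lab X) (prd ([True] @ [False]))) \<I>"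
      using r \<xi> \<zeta> by (simp add: Homs_def ball_Un del: append_Cons append_Nil)
    fix \<gamma> assume \<gamma> [simp]: "\<gamma> \<in> carrier G"
    have tr: "\<forall>p\<in>set (shift \<gamma> xs). lab X p \<in> Obj D" for xs by auto
    have r2: "reord (shift \<gamma> ([True] @ [False])) (shift \<gamma> [True] @ shift \<gamma> [False])"
      "reord (shift \<gamma> [True] @ shift \<gamma> [False]) (prd [True] @ prd [False])"
      "reord (shift \<gamma> ([True] @ [False])) (prd ([True] @ [False]))"
      "reord (shift \<gamma> [True]) (prd [True])" "reord (shift \<gamma> [False]) (prd [False])"
      using translate_carrier[OF \<gamma>] by (auto simp: reord_def distinct_product distinct_map)
    have "farr (Psi \<gamma>) ((\<xi> \<star> \<zeta>) \<bullet> ?t (prd ([True] @ [False])) (prd [True] @ prd [False]))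
      = (farr (Psi \<gamma>) \<xi> \<star> farr (Psi \<gamma>) \<zeta>)
        \<bullet> ?t (shift \<gamma> ([True] @ [False])) (shift \<gamma> [True] @ shift \<gamma> [False])"
      using r \<xi> \<zeta> farr_tperm_lab[OF \<gamma> r, of X]
      by (simp add: map_shift ball_Un subset_iff del: append_Cons append_Nil)
    also have "\<dots> = (\<xi> \<star> \<zeta>) \<bullet> (?t (shift \<gamma> [True]) (prd [True]) \<star> ?t (shift \<gamma> [False]) (prd [False]))
        \<bullet> ?t (shift \<gamma> ([True] @ [False])) (shift \<gamma> [True] @ shift \<gamma> [False])"
      using r2 \<xi> \<zeta> tr by (simp add: eqv interchange[symmetric] ball_Un del: append_Cons append_Nil)
    also have "?t (shift \<gamma> [True]) (prd [True]) \<star> ?t (shift \<gamma> [False]) (prd [False])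
      = ?t (shift \<gamma> [True] @ shift \<gamma> [False]) (prd [True] @ prd [False])"
      by (rule tperm_append[symmetric]) (use r2 tr in auto)
    also have "\<dots> \<bullet> ?t (shift \<gamma> ([True] @ [False])) (shift \<gamma> [True] @ shift \<gamma> [False])
      = ?t (prd ([True] @ [False])) (prd [True] @ prd [False])
        \<bullet> ?t (shift \<gamma> ([True] @ [False])) (prd ([True] @ [False]))"
      using r r2 tr by (simp add: tperm_Cmp del: append_Cons append_Nil)
    finally show "farr (Psi \<gamma>) ((\<xi> \<star> \<zeta>) \<bullet> ?t (prd ([True] @ [False])) (prd [True] @ prd [False]))
      = ((\<xi> \<star> \<zeta>) \<bullet> ?t (prd ([True] @ [False])) (prd [True] @ prd [False]))
        \<bullet> ?t (shift \<gamma> ([True] @ [False])) (prd ([True] @ [False]))"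
      using r r2 \<xi> \<zeta> tr by (simp add: ball_Un del: append_Cons append_Nil)
  qed
qed

end

lemma (in smc_action) arr_inv_pimap_typing [simp]:
  assumes AB: "A \<in> Obj D" "B \<in> Obj D"
  shows "arr_inv D (pimap D G Psi A B) \<in> Arr D" "Dom D (arr_inv D (pimap D G Psi A B)) = fO (A \<diamondop> B)"
    "Cod D (arr_inv D (pimap D G Psi A B)) = fO A \<diamondop> fO B"
    and pimap_typing [simp]:
    "pimap D G Psi A B \<in> Arr D" "Cod D (pimap D G Psi A B) = fO (A \<diamondop> B)"
    "Dom D (pimap D G Psi A B) = fO A \<diamondop> fO B"
    and pimap_inverse [simp]:
    "pimap D G Psi A B \<bullet> arr_inv D (pimap D G Psi A B) = \<i> (fO (A \<diamondop> B))"
    "arr_inv D (pimap D G Psi A B) \<bullet> pimap D G Psi A B = \<i> (fO A \<diamondop> fO B)"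
proof -
  define X where "X = (\<lambda>b. if b then A else B)"
  let ?as = "[True]" and ?bs = "[False]"
  have X: "distinct (?as @ ?bs)" "\<forall>x\<in>set (?as @ ?bs). X x \<in> Obj D"
    "\<forall>x\<in>set ?as. X x \<in> Obj D" "\<forall>x\<in>set ?bs. X x \<in> Obj D"
    using AB by (auto simp: X_def)
  have eq: "A = tens X ?as" "B = tens X ?bs" "A \<diamondop> B = tens X (?as @ ?bs)"
    using AB by (simp_all add: X_def)
  note r = reord_pimap[OF X(1)]
  have o: "\<forall>p\<in>set (prd ?as @ prd ?bs). lab X p \<in> Obj D" "\<forall>p\<in>set (prd (?as @ ?bs)). lab X p \<in> Obj D"
    "\<forall>p\<in>set (prd ?as). lab X p \<in> Obj D" "\<forall>p\<in>set (prd ?bs). lab X p \<in> Obj D"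
    using X by auto
  have f: "fO (A \<diamondop> B) = tens (lab X) (prd (?as @ ?bs))" "fO A \<diamondop> fO B = tens (lab X) (prd ?as @ prd ?bs)"
    unfolding eq(3) foldO_tens[OF X(2)] unfolding eq(1,2) foldO_tens[OF X(3)] foldO_tens[OF X(4)] map_append
    by (rule refl, rule tensO_list_append[symmetric]) (use o in auto)
  have p: "pimap D G Psi A B = tperm D (lab X) (prd ?as @ prd ?bs) (prd (?as @ ?bs))"
    "arr_inv D (pimap D G Psi A B) = tperm D (lab X) (prd (?as @ ?bs)) (prd ?as @ prd ?bs)"
    using pimap_tens[OF X(1,2)] arr_inv_pimap_tens[OF X(1,2)] unfolding eq[symmetric] .
  show "arr_inv D (pimap D G Psi A B) \<in> Arr D" "Dom D (arr_inv D (pimap D G Psi A B)) = fO (A \<diamondop> B)"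
    "Cod D (arr_inv D (pimap D G Psi A B)) = fO A \<diamondop> fO B"
    "pimap D G Psi A B \<in> Arr D" "Cod D (pimap D G Psi A B) = fO (A \<diamondop> B)"
    "Dom D (pimap D G Psi A B) = fO A \<diamondop> fO B"
    unfolding p(2) f unfolding p(1) by (rule tperm_typing[OF r(1) o(1)] tperm_typing[OF r(2) o(2)])+
  show "pimap D G Psi A B \<bullet> arr_inv D (pimap D G Psi A B) = \<i> (fO (A \<diamondop> B))"
    "arr_inv D (pimap D G Psi A B) \<bullet> pimap D G Psi A B = \<i> (fO A \<diamondop> fO B)"
    unfolding p(2) f unfolding p(1) tperm_Cmp[OF r o(1)] tperm_Cmp[OF r(2,1) o(2)]
    by (rule tperm_refl[OF o(2)], rule tperm_refl[OF o(1)])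
qed

lemma (in smc_action) env_tens_Homs:
  assumes "\<xi> \<in> Homs D (fO A) \<I>" "\<zeta> \<in> Homs D (fO B) \<I>" "A \<in> Obj D" "B \<in> Obj D"
  shows "env_tens D G Psi A B \<xi> \<zeta> \<in> Homs D (fO (A \<diamondop> B)) \<I>"
  using assms by (auto simp: env_tens_def Homs_def)

section \<open>Products of groups and of commuting actions\<close>

lemma length_carrier: "fab_group G \<Longrightarrow> x \<in> carrier G \<Longrightarrow> length x = length \<one>\<^bsub>G\<^esub>"
  by (simp add: fab_group_def)

lemma gfst_append [simp]: "fab_group G \<Longrightarrow> x \<in> carrier G \<Longrightarrow> gfst G (x @ y) = x"
  and gsnd_append [simp]: "fab_group G \<Longrightarrow> x \<in> carrier G \<Longrightarrow> gsnd G (x @ y) = y"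
  by (simp_all add: gfst_def gsnd_def flip: length_carrier)

lemma carrier_gprod: "carrier (gprod G H) = (\<lambda>(x, y). x @ y) ` (carrier G \<times> carrier H)"
  by (auto simp: gprod_def Let_def)

lemma gprod_memI [simp]: "x \<in> carrier G \<Longrightarrow> y \<in> carrier H \<Longrightarrow> x @ y \<in> carrier (gprod G H)"
  by (auto simp: carrier_gprod)

lemma gprod_memE:
  assumes "w \<in> carrier (gprod G H)"
  obtains x y where "w = x @ y" "x \<in> carrier G" "y \<in> carrier H"
  using assms by (auto simp: carrier_gprod)

lemma one_gprod [simp]: "\<one>\<^bsub>gprod G H\<^esub> = \<one>\<^bsub>G\<^esub> @ \<one>\<^bsub>H\<^esub>"
  by (simp add: gprod_def Let_def)

lemma mult_gprod [simp]:
  assumes "fab_group G" "x \<in> carrier G" "x' \<in> carrier G" "y \<in> carrier H" "y' \<in> carrier H"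
  shows "(x @ y) \<otimes>\<^bsub>gprod G H\<^esub> (x' @ y') = (x \<otimes>\<^bsub>G\<^esub> x') @ (y \<otimes>\<^bsub>H\<^esub> y')"
  using assms by (auto simp: gprod_def Let_def)

lemma mult_gprod_undefined:
  "\<not> (v \<in> carrier (gprod G H) \<and> w \<in> carrier (gprod G H)) \<Longrightarrow> v \<otimes>\<^bsub>gprod G H\<^esub> w = undefined"
  by (auto simp: gprod_def Let_def)

lemma fab_gprod [simp]:
  assumes G: "fab_group G" and H: "fab_group H" shows "fab_group (gprod G H)"
proof -
  interpret G: comm_group G using G by (simp add: fab_group_def)
  interpret H: comm_group H using H by (simp add: fab_group_def)
  have "comm_group (gprod G H)"
  proof (rule comm_groupI)
    fix v assume "v \<in> carrier (gprod G H)"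
    then obtain x y where v: "v = x @ y" "x \<in> carrier G" "y \<in> carrier H" by (rule gprod_memE)
    show "\<exists>w\<in>carrier (gprod G H). w \<otimes>\<^bsub>gprod G H\<^esub> v = \<one>\<^bsub>gprod G H\<^esub>"
      by (rule bexI[where x = "inv\<^bsub>G\<^esub> x @ inv\<^bsub>H\<^esub> y"]) (use v G in simp_all)
  next
    fix v w assume "v \<in> carrier (gprod G H)" "w \<in> carrier (gprod G H)"
    then obtain x y x' y' where "v = x @ y" "x \<in> carrier G" "y \<in> carrier H"
      and "w = x' @ y'" "x' \<in> carrier G" "y' \<in> carrier H"
      by (metis gprod_memE)
    then show "v \<otimes>\<^bsub>gprod G H\<^esub> w = w \<otimes>\<^bsub>gprod G H\<^esub> v"
      by (simp add: G G.m_comm[of x x'] H.m_comm[of y y'])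
  qed (auto elim!: gprod_memE simp: G G.m_assoc H.m_assoc)
  moreover have "finite (carrier (gprod G H))"
    using assms by (simp add: carrier_gprod fab_group_def)
  moreover have "length w = length \<one>\<^bsub>gprod G H\<^esub>" if "w \<in> carrier (gprod G H)" for w
    using that length_carrier[OF G] length_carrier[OF H] by (metis gprod_memE length_append one_gprod)
  ultimately show ?thesis by (simp add: fab_group_def mult_gprod_undefined)
qed

lemma gprod_assoc:
  assumes G: "fab_group G" and H: "fab_group H" and J: "fab_group J"
  shows "gprod (gprod G H) J = gprod G (gprod H J)"
proof -
  have c: "carrier (gprod (gprod G H) J) = carrier (gprod G (gprod H J))"
  proof (intro equalityI subsetI)
    fix w assume "w \<in> carrier (gprod (gprod G H) J)"
    then obtain x y z where "w = x @ y @ z" "x \<in> carrier G" "y \<in> carrier H" "z \<in> carrier J"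
      by (auto elim!: gprod_memE)
    then show "w \<in> carrier (gprod G (gprod H J))" by simp
  next
    fix w assume "w \<in> carrier (gprod G (gprod H J))"
    then obtain x y z where "w = (x @ y) @ z" "x \<in> carrier G" "y \<in> carrier H" "z \<in> carrier J"
      by (auto elim!: gprod_memE)
    then show "w \<in> carrier (gprod (gprod G H) J)" by (simp only: gprod_memI)
  qed
  have "v \<otimes>\<^bsub>gprod (gprod G H) J\<^esub> w = v \<otimes>\<^bsub>gprod G (gprod H J)\<^esub> w" for v w
  proof (cases "v \<in> carrier (gprod G (gprod H J)) \<and> w \<in> carrier (gprod G (gprod H J))")
    case True
    then obtain x y z x' y' z' where "v = x @ y @ z" "w = x' @ y' @ z'"
      and "x \<in> carrier G" "y \<in> carrier H" "z \<in> carrier J" "x' \<in> carrier G" "y' \<in> carrier H" "z' \<in> carrier J"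
      by (auto elim!: gprod_memE)
    then show ?thesis
      using mult_gprod[of "gprod G H" "x @ y" "x' @ y'" z J z'] assms by simp
  qed (simp add: mult_gprod_undefined c)
  then show ?thesis using c by (intro monoid.equality) auto
qed

lemma fab_gtriv [simp]: "fab_group gtriv"
proof -
  have "comm_group gtriv"
    by (rule comm_groupI) (auto simp: gtriv_def)
  then show ?thesis by (simp add: fab_group_def) (simp add: gtriv_def)
qed

lemma gtriv_simps [simp]: "carrier gtriv = {[]}" "\<one>\<^bsub>gtriv\<^esub> = []" "elems gtriv = [[]]"
  by (simp_all add: gtriv_def elems_def)

lemma mult_gtriv [simp]: "[] \<otimes>\<^bsub>gtriv\<^esub> [] = []"
  by (simp add: gtriv_def)

lemma gprod_gtriv:
  assumes G: "fab_group G" shows "gprod G gtriv = G" "gprod gtriv G = G"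
proof -
  have c: "carrier (gprod G gtriv) = carrier G" "carrier (gprod gtriv G) = carrier G"
    by (auto simp: carrier_gprod image_iff)
  have u: "\<not> (v \<in> carrier G \<and> w \<in> carrier G) \<Longrightarrow> v \<otimes>\<^bsub>G\<^esub> w = undefined" for v w
    using G by (simp add: fab_group_def)
  have "v \<otimes>\<^bsub>gprod G gtriv\<^esub> w = v \<otimes>\<^bsub>G\<^esub> w" for v w
  proof (cases "v \<in> carrier G \<and> w \<in> carrier G")
    case True
    then show ?thesis using mult_gprod[of G v w "[]" gtriv "[]"] G by simp
  qed (simp add: u mult_gprod_undefined c)
  then show "gprod G gtriv = G" using c by (intro monoid.equality) auto
  have "v \<otimes>\<^bsub>gprod gtriv G\<^esub> w = v \<otimes>\<^bsub>G\<^esub> w" for v w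
  proof (cases "v \<in> carrier G \<and> w \<in> carrier G")
    case True
    then show ?thesis using mult_gprod[of gtriv "[]" "[]" v G w] by simp
  qed (simp add: u mult_gprod_undefined c)
  then show "gprod gtriv G = G" using c by (intro monoid.equality) auto
qed

lemma product_map: "List.product (map f xs) (map g ys) = map (\<lambda>(x, y). (f x, g y)) (List.product xs ys)"
  by (induction xs) auto

lemma product_map_left: "List.product (map f xs) ys = map (\<lambda>(x, y). (f x, y)) (List.product xs ys)"
  using product_map[of f xs id ys] by simp

lemma product_map_right: "List.product xs (map g ys) = map (\<lambda>(x, y). (x, g y)) (List.product xs ys)"
  using product_map[of id xs g ys] by simp

lemma product_append: "List.product (xs @ ys) zs = List.product xs zs @ List.product ys zs"
  by (induction xs) auto

lemma product_assoc:
  "List.product (List.product xs ys) zs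
    = map (\<lambda>(x, y, z). ((x, y), z)) (List.product xs (List.product ys zs))"
proof (induction xs)
  case (Cons x xs)
  have "List.product (map (Pair x) ys) zs = map ((\<lambda>(x, y, z). ((x, y), z)) \<circ> Pair x) (List.product ys zs)"
    by (simp add: product_map_left comp_def case_prod_unfold)
  with Cons show ?case by (simp add: product_append)
qed simp

text \<open>
  Words of a fixed length are ordered lexicographically, so the product enumerates the first
  factor in the outer loop.
\<close>

lemma elems_gprod:
  assumes G: "fab_group G" and H: "fab_group (H :: 'g::linorder list monoid)"
  shows "elems (gprod G H) = map (\<lambda>(g, h). g @ h) (List.product (elems G) (elems H))"
proof -
  have left: "x @ y < x' @ y'" if "x < x'" "length x = length x'" for x x' y y' :: "'g list"
    using that unfolding list_less_def by (intro lexord_sufI) auto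
  have right: "x @ y < x @ y'" if "y < y'" for x y y' :: "'g list"
    using that unfolding list_less_def by (intro lexord_append_leftI)
  have sorted: "sorted_wrt (<) (map (\<lambda>(g, h). g @ h) (List.product xs ys))"
    if "sorted_wrt (<) xs" "sorted_wrt (<) ys" "\<forall>x\<in>set xs. length x = n" for xs ys :: "'g list list" and n
    using that
  proof (induction xs)
    case (Cons x xs)
    have "sorted_wrt (<) (map ((@) x) ys)"
      using Cons.prems(2) unfolding sorted_wrt_map
      by (rule sorted_wrt_mono_rel[rotated]) (rule right)
    moreover have "map (\<lambda>(g, h). g @ h) (map (Pair x) ys) = map ((@) x) ys" by simp
    ultimately show ?case
      using Cons by (auto simp: sorted_wrt_append comp_def intro!: left)
  qed simp
  have "sorted_wrt (<) (elems G)" "sorted_wrt (<) (elems H)" by (simp_all add: elems_def)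
  then have "sorted_wrt (<) (map (\<lambda>(g, h). g @ h) (List.product (elems G) (elems H)))"
    by (rule sorted[where n = "length \<one>\<^bsub>G\<^esub>"]) (use G length_carrier in auto)
  moreover have "sorted_wrt (<) (elems (gprod G H))" by (simp add: elems_def)
  moreover have "set (map (\<lambda>(g, h). g @ h) (List.product (elems G) (elems H))) = set (elems (gprod G H))"
    using G H by (simp add: carrier_gprod)
  ultimately show ?thesis by (metis strict_sorted_equal)
qed

lemma (in sym_mon_cat) is_smc_functor_comp:
  assumes "is_smc_functor D E F" "is_smc_functor E E' F'"
  shows "is_smc_functor D E' (smcf_comp D F' F)"
  using assms unfolding is_smc_functor_def smcf_comp_def smcf_restrict_def
  by (simp add: PiE_iff)

text \<open>
  The factors of an object that is folded over two groups are labelled by triples \<open>(g, h,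
  x)\<close> or \<open>(h, g, x)\<close>, depending on the order of folding. Folding over the
  product of the groups gives labels \<open>(g @ h, x)\<close>.
\<close>

definition lab_swap :: "'x \<times> 'y \<times> 'z \<Rightarrow> 'y \<times> 'x \<times> 'z" where
  "lab_swap = (\<lambda>(h, g, x). (g, h, x))"

definition lab_join :: "'x list \<times> 'x list \<times> 'z \<Rightarrow> 'x list \<times> 'z" where
  "lab_join = (\<lambda>(g, h, x). (g @ h, x))"

lemma lab_swap_simp [simp]: "lab_swap (h, g, x) = (g, h, x)"
  by (simp add: lab_swap_def)

lemma lab_join_simp [simp]: "lab_join (g, h, x) = (g @ h, x)"
  by (simp add: lab_join_def)

lemma inj_lab_swap [simp]: "inj_on lab_swap S"
  by (auto simp: inj_on_def)

locale two_actions = G: smc_action D G Psi + H: smc_action D H Psi'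
  for D :: "('o,'a) smc" and G H :: "'g::linorder list monoid" and Psi Psi' +
  assumes comm_fobj: "\<lbrakk>\<gamma> \<in> carrier G; \<eta> \<in> carrier H; A \<in> Obj D\<rbrakk> \<Longrightarrow>
      fobj (Psi' \<eta>) (fobj (Psi \<gamma>) A) = fobj (Psi \<gamma>) (fobj (Psi' \<eta>) A)"
    and comm_farr: "\<lbrakk>\<gamma> \<in> carrier G; \<eta> \<in> carrier H; f \<in> Arr D\<rbrakk> \<Longrightarrow>
      farr (Psi' \<eta>) (farr (Psi \<gamma>) f) = farr (Psi \<gamma>) (farr (Psi' \<eta>) f)"
begin

abbreviation Pact where "Pact \<equiv> act_prod SMCs D G Psi H Psi'"

lemma act_prod_append:
  "\<gamma> \<in> carrier G \<Longrightarrow> \<eta> \<in> carrier H \<Longrightarrow> Pact (\<gamma> @ \<eta>) = smcf_comp D (Psi \<gamma>) (Psi' \<eta>)"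
  by (simp add: act_prod_def SMCs_def)

lemma act_prod_eqs [simp]:
  assumes "\<gamma> \<in> carrier G" "\<eta> \<in> carrier H"
  shows "A \<in> Obj D \<Longrightarrow> fobj (Pact (\<gamma> @ \<eta>)) A = fobj (Psi \<gamma>) (fobj (Psi' \<eta>) A)"
    "f \<in> Arr D \<Longrightarrow> farr (Pact (\<gamma> @ \<eta>)) f = farr (Psi \<gamma>) (farr (Psi' \<eta>) f)"
  using assms by (simp_all add: act_prod_append smcf_comp_def smcf_restrict_def)

sublocale GH: smc_action D "gprod G H" Pact
proof
  fix w assume "w \<in> carrier (gprod G H)"
  then obtain \<gamma> \<eta> where w: "w = \<gamma> @ \<eta>" "\<gamma> \<in> carrier G" "\<eta> \<in> carrier H" by (rule gprod_memE)
  then show "is_smc_functor D D (Pact w)"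
    by (simp add: act_prod_append G.is_smc_functor_comp[OF H.act_functor G.act_functor])
  fix w' assume "w' \<in> carrier (gprod G H)"
  then obtain \<gamma>' \<eta>' where w': "w' = \<gamma>' @ \<eta>'" "\<gamma>' \<in> carrier G" "\<eta>' \<in> carrier H" by (rule gprod_memE)
  note eqs = comm_fobj comm_farr G.act_fobj[symmetric] G.act_farr[symmetric]
    H.act_fobj[symmetric] H.act_farr[symmetric]
  show "fobj (Pact w) (fobj (Pact w') A) = fobj (Pact (w \<otimes>\<^bsub>gprod G H\<^esub> w')) A" if "A \<in> Obj D" for A
    using w w' that by (simp add: eqs)
  show "farr (Pact w) (farr (Pact w') f) = farr (Pact (w \<otimes>\<^bsub>gprod G H\<^esub> w')) f" if "f \<in> Arr D" for f
    using w w' that by (simp add: eqs)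
qed simp

lemma swap: "two_actions D H G Psi' Psi"
  by unfold_locales (simp_all add: comm_fobj comm_farr)

abbreviation lab2 where "lab2 X \<equiv> G.lab (H.lab X)"

lemma GH_prd: "GH.prd xs = map lab_join (G.prd (H.prd xs))"
  by (simp add: elems_gprod product_map_left product_assoc comp_def case_prod_unfold lab_join_def)

lemma GH_lab: "\<gamma> \<in> carrier G \<Longrightarrow> \<eta> \<in> carrier H \<Longrightarrow> X x \<in> Obj D \<Longrightarrow>
    GH.lab X (lab_join (\<gamma>, \<eta>, x)) = lab2 X (\<gamma>, \<eta>, x)"
  by simp

text \<open>
  Words of \<open>G\<close> have a fixed length, so that \<open>g @ h\<close> determines
  \<open>g\<close> and \<open>h\<close>.
\<close>

lemma tperm_join:
  assumes "reord ps qs" "set ps \<subseteq> carrier G \<times> carrier H \<times> {x. X x \<in> Obj D}"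
  shows "tperm D (GH.lab X) (map lab_join ps) (map lab_join qs) = tperm D (lab2 X) ps qs"
proof -
  have "inj_on lab_join (set ps)"
  proof (rule inj_onI)
    fix p q :: "'g list \<times> 'g list \<times> 'b" assume pq: "p \<in> set ps" "q \<in> set ps" "lab_join p = lab_join q"
    then have "fst p \<in> carrier G" "fst q \<in> carrier G" using assms(2) by auto
    then have "length (fst p) = length (fst q)" using length_carrier[OF G.fab] by metis
    with pq show "p = q" by (auto simp: lab_join_def case_prod_unfold intro: prod_eqI)
  qed
  then have "tperm D (GH.lab X) (map lab_join ps) (map lab_join qs)
    = tperm D (\<lambda>p. GH.lab X (lab_join p)) ps qs" using assms(1) by (rule G.tperm_map)
  also have "\<dots> = tperm D (lab2 X) ps qs"
    by (rule G.tperm_cong) (use assms GH_lab in \<open>auto simp: reord_def\<close>)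
  finally show ?thesis .
qed

lemma tperm_lab_swap:
  assumes "reord ps qs" "set ps \<subseteq> carrier H \<times> carrier G \<times> {x. X x \<in> Obj D}"
  shows "tperm D (lab2 X) (map lab_swap ps) (map lab_swap qs) = tperm D (H.lab (G.lab X)) ps qs"
proof -
  have "tperm D (lab2 X) (map lab_swap ps) (map lab_swap qs) = tperm D (\<lambda>p. lab2 X (lab_swap p)) ps qs"
    by (rule G.tperm_map) (use assms in simp_all)
  also have "\<dots> = tperm D (H.lab (G.lab X)) ps qs"
    by (rule G.tperm_cong) (use assms in \<open>auto simp: reord_def comm_fobj\<close>)
  finally show ?thesis .
qed

lemma foldO_GH: "A \<in> Obj D \<Longrightarrow> GH.fO A = G.fO (H.fO A)"
proof -
  assume A: "A \<in> Obj D"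
  have "GH.fO A = tensO_list D (map (\<lambda>(g, h). fobj (Psi g) (fobj (Psi' h) A)) (List.product (elems G) (elems H)))"
    unfolding foldO_def using A
    by (auto simp: elems_gprod intro!: arg_cong[where f = "tensO_list D"] map_cong)
  also have "\<dots> = G.fO (H.fO A)"
    using G.foldO_tens[of "elems H" "\<lambda>h. fobj (Psi' h) A"] A by (simp add: foldO_def[of D H])
  finally show ?thesis .
qed

lemma foldA_GH: "f \<in> Arr D \<Longrightarrow> GH.fA f = G.fA (H.fA f)"
proof -
  assume f: "f \<in> Arr D"
  have "GH.fA f = tensA_list D (map (\<lambda>(g, h). farr (Psi g) (farr (Psi' h) f)) (List.product (elems G) (elems H)))"
    unfolding foldA_def using f
    by (auto simp: elems_gprod intro!: arg_cong[where f = "tensA_list D"] map_cong)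
  also have "\<dots> = G.fA (H.fA f)"
    using G.foldA_tensA_list[of "elems H" "\<lambda>h. farr (Psi' h) f"] f by (simp add: foldA_def[of D H])
  finally show ?thesis .
qed

lemma inj_foldO_GH:
  assumes "inj_on G.fO (Obj D)" "inj_on H.fO (Obj D)" shows "inj_on GH.fO (Obj D)"
proof (rule inj_onI)
  fix A B assume AB: "A \<in> Obj D" "B \<in> Obj D" "GH.fO A = GH.fO B"
  then have "H.fO A = H.fO B" using inj_onD[OF assms(1), of "H.fO A" "H.fO B"] by (simp add: foldO_GH)
  then show "A = B" using inj_onD[OF assms(2)] AB by blast
qed

end

section \<open>Effects folded over a product of groups\<close>

lemma lab_swap_image [simp]: "lab_swap ` (A \<times> B \<times> C) = B \<times> A \<times> C"
  by (force simp: lab_swap_def image_iff)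

lemma inj_append:
  assumes "fab_group G" shows "inj_on (\<lambda>(g, h). g @ h) (carrier G \<times> B)"
proof (rule inj_onI)
  fix p q assume pq: "p \<in> carrier G \<times> B" "q \<in> carrier G \<times> B"
    "(\<lambda>(g, h). g @ h) p = (\<lambda>(g, h). g @ h) q"
  then have "length (fst p) = length (fst q)" using length_carrier[OF assms] by (metis mem_Times_iff)
  with pq(3) show "p = q" by (auto simp: case_prod_unfold intro: prod_eqI)
qed

lemma inj_lab_join:
  assumes "fab_group G" "set ps \<subseteq> carrier G \<times> B" shows "inj_on lab_join (set ps)"
proof (rule inj_onI)
  fix p q assume pq: "p \<in> set ps" "q \<in> set ps" "lab_join p = lab_join q"
  then have "fst p \<in> carrier G" "fst q \<in> carrier G" using assms(2) by auto
  then have "length (fst p) = length (fst q)" using length_carrier[OF assms(1)] by metis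
  with pq show "p = q" by (auto simp: lab_join_def case_prod_unfold intro: prod_eqI)
qed

context two_actions begin

lemma foldO_GH_tens:
  assumes "\<forall>x\<in>set xs. X x \<in> Obj D"
  shows "GH.fO (G.tens X xs) = G.tens (lab2 X) (G.prd (H.prd xs))"
proof -
  have "GH.fO (G.tens X xs) = G.fO (H.fO (G.tens X xs))"
    using assms by (intro foldO_GH) simp
  also have "\<dots> = G.tens (lab2 X) (G.prd (H.prd xs))"
    unfolding H.foldO_tens[OF assms] by (rule G.foldO_tens) (use assms in auto)
  finally show ?thesis .
qed

lemma shift_join:
  assumes "\<gamma> \<in> carrier G" "\<eta> \<in> carrier H" "set ps \<subseteq> carrier G \<times> carrier H \<times> UNIV"
  shows "map (\<lambda>(w, x). ((\<gamma> @ \<eta>) \<otimes>\<^bsub>gprod G H\<^esub> w, x)) (map lab_join ps)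
    = map lab_join (map (\<lambda>(g, h, x). (\<gamma> \<otimes>\<^bsub>G\<^esub> g, \<eta> \<otimes>\<^bsub>H\<^esub> h, x)) ps)"
  unfolding map_map by (rule map_cong) (use assms in auto)

lemma shift_prd:
  "map (\<lambda>(g, h, x). (\<gamma> \<otimes>\<^bsub>G\<^esub> g, \<eta> \<otimes>\<^bsub>H\<^esub> h, x)) (G.prd (H.prd xs))
    = List.product (map (\<lambda>g. \<gamma> \<otimes>\<^bsub>G\<^esub> g) (elems G)) (H.shift \<eta> xs)"
  by (simp add: product_map_left product_map_right case_prod_unfold comp_def)

lemma shift_prd_swap:
  "map (\<lambda>(g, h, x). (\<gamma> \<otimes>\<^bsub>G\<^esub> g, \<eta> \<otimes>\<^bsub>H\<^esub> h, x)) (map lab_swap (H.prd (G.prd xs)))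
    = map lab_swap (List.product (map (\<lambda>h. \<eta> \<otimes>\<^bsub>H\<^esub> h) (elems H)) (G.shift \<gamma> xs))"
  by (simp add: product_map_left product_map_right case_prod_unfold lab_swap_def comp_def)

lemma GH_shift:
  assumes "\<gamma> \<in> carrier G" "\<eta> \<in> carrier H"
  shows "GH.shift (\<gamma> @ \<eta>) xs
    = map lab_join (List.product (map (\<lambda>g. \<gamma> \<otimes>\<^bsub>G\<^esub> g) (elems G)) (H.shift \<eta> xs))"
  unfolding GH.map_shift[symmetric] GH_prd shift_prd[symmetric]
  by (rule shift_join) (use assms in auto)

text \<open>
  Effects folded over \<open>H\<close> come with the factors of their domain ordered with \<open>H\<close> as outer index.
\<close>

definition reorder_GH :: "'o \<Rightarrow> 'a" where
  "reorder_GH A = tperm D (\<lambda>w. fobj (Pact w) A) (elems (gprod G H))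
     (concat (map (\<lambda>\<gamma>'. map (\<lambda>\<gamma>. \<gamma> @ \<gamma>') (elems G)) (elems H)))"

text \<open>
  The effect of the product action that comes from an effect \<open>\<xi>\<close> of the action of
  \<open>G\<close>.
\<close>

definition lft :: "'o \<Rightarrow> 'a \<Rightarrow> 'a" where
  "lft A \<xi> = Cmp D (H.fA \<xi>) (reorder_GH A)"

lemma reord_swap:
  assumes "distinct xs"
  shows "reord (G.prd (H.prd xs)) (map lab_swap (H.prd (G.prd xs)))"
    "reord (map lab_swap (H.prd (G.prd xs))) (G.prd (H.prd xs))"
  using assms by (simp_all add: reord_def distinct_map distinct_product)

lemma reorder_GH_tens:
  assumes "distinct xs" "\<forall>x\<in>set xs. X x \<in> Obj D"
  shows "reorder_GH (G.tens X xs)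
    = tperm D (lab2 X) (G.prd (H.prd xs)) (map lab_swap (H.prd (G.prd xs)))"
proof -
  let ?b = "\<lambda>w. map (Pair w) xs"
  let ?hg = "concat (map (\<lambda>\<gamma>'. map (\<lambda>\<gamma>. \<gamma> @ \<gamma>') (elems G)) (elems H))"
  have join: "inj_on (\<lambda>(g, h). g @ h) (carrier G \<times> carrier H)"
    by (rule inj_append) simp
  have "?hg = map (\<lambda>(h, g). g @ h) (List.product (elems H) (elems G))"
    by (simp add: product_concat_map map_concat comp_def)
  moreover have "inj_on (\<lambda>(h, g). g @ h) (carrier H \<times> carrier G)"
    using join by (auto simp: inj_on_def)
  ultimately have hg: "distinct ?hg" "set ?hg = carrier (gprod G H)"
    by (auto simp: distinct_map distinct_product carrier_gprod)
  have "reorder_GH (G.tens X xs) = tperm D (GH.lab X) (concat (map ?b (elems (gprod G H)))) (concat (map ?b ?hg))"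
    unfolding reorder_GH_def
  proof (rule G.tperm_blocks)
    show "reord (elems (gprod G H)) ?hg" using hg by (simp add: reord_def)
    show "distinct (concat (map ?b (elems (gprod G H))))"
      using assms(1) distinct_product[of "elems (gprod G H)" xs] by (simp add: product_concat_map)
  qed (use assms in \<open>auto simp: smc_functor.fobj_tens[OF GH.act] comp_def\<close>)
  also have "concat (map ?b (elems (gprod G H))) = map lab_join (G.prd (H.prd xs))"
    using GH_prd by (simp add: product_concat_map)
  also have "concat (map ?b ?hg) = map lab_join (map lab_swap (H.prd (G.prd xs)))"
  proof -
    have 1: "concat (map ?b (map (\<lambda>\<gamma>. \<gamma> @ \<eta>) gs))
      = map lab_join (map lab_swap (map (Pair \<eta>) (List.product gs xs)))"
      for gs :: "'g list list" and \<eta>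
      by (induction gs) auto
    have "concat (map ?b (concat (map (\<lambda>\<gamma>'. map (\<lambda>\<gamma>. \<gamma> @ \<gamma>') gs) hs)))
      = map lab_join (map lab_swap (List.product hs (List.product gs xs)))"
      for gs hs :: "'g list list"
      by (induction hs) (simp_all only: list.map concat.simps map_append concat_append List.product.simps 1)
    then show ?thesis .
  qed
  also have "tperm D (GH.lab X) (map lab_join (G.prd (H.prd xs))) (map lab_join (map lab_swap (H.prd (G.prd xs))))
    = tperm D (lab2 X) (G.prd (H.prd xs)) (map lab_swap (H.prd (G.prd xs)))"
    by (rule tperm_join[OF reord_swap(1)[OF assms(1)]]) (use assms(2) in auto)
  finally show ?thesis .
qed

lemma farr_reorder_GH:
  assumes "distinct xs" "\<forall>x\<in>set xs. X x \<in> Obj D" "\<gamma> \<in> carrier G" "\<eta> \<in> carrier H"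
  shows "farr (Pact (\<gamma> @ \<eta>)) (reorder_GH (G.tens X xs)) = tperm D (lab2 X)
      (List.product (map (\<lambda>g. \<gamma> \<otimes>\<^bsub>G\<^esub> g) (elems G)) (H.shift \<eta> xs))
      (map lab_swap (List.product (map (\<lambda>h. \<eta> \<otimes>\<^bsub>H\<^esub> h) (elems H)) (G.shift \<gamma> xs)))"
proof -
  let ?ps = "G.prd (H.prd xs)" and ?qs = "map lab_swap (H.prd (G.prd xs))"
  let ?s = "\<lambda>(g, h, x). (\<gamma> \<otimes>\<^bsub>G\<^esub> g, \<eta> \<otimes>\<^bsub>H\<^esub> h, x)"
  have r: "reord ?ps ?qs" using reord_swap assms by blast
  have sub: "set ?ps \<subseteq> carrier G \<times> carrier H \<times> {x. X x \<in> Obj D}" using assms by auto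
  have j: "inj_on lab_join (set ?ps)" using inj_lab_join[OF G.fab sub] .
  have jr: "reord (map lab_join ?ps) (map lab_join ?qs)"
    using r j by (rule reord_map)
  have "farr (Pact (\<gamma> @ \<eta>)) (reorder_GH (G.tens X xs))
    = farr (Pact (\<gamma> @ \<eta>)) (tperm D (GH.lab X) (map lab_join ?ps) (map lab_join ?qs))"
    unfolding reorder_GH_tens[OF assms(1,2)] tperm_join[OF r sub] ..
  also have "\<dots> = tperm D (GH.lab X) (map lab_join (map ?s ?ps)) (map lab_join (map ?s ?qs))"
  proof -
    have "set (map lab_join ?ps) \<subseteq> carrier (gprod G H) \<times> {x. X x \<in> Obj D}" using assms by auto
    note GH.farr_tperm_lab[OF gprod_memI[OF assms(3,4)] jr this]
    moreover have "set ?ps \<subseteq> carrier G \<times> carrier H \<times> UNIV" "set ?qs \<subseteq> carrier G \<times> carrier H \<times> UNIV"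
      by auto
    ultimately show ?thesis using shift_join[OF assms(3,4)] by metis
  qed
  also have "\<dots> = tperm D (lab2 X) (map ?s ?ps) (map ?s ?qs)"
  proof (rule tperm_join)
    have "inj_on ?s (set ?ps)"
      using G.translate_carrier(2)[OF assms(3)] H.translate_carrier(2)[OF assms(4)]
      by (auto simp: inj_on_def)
    with r show "reord (map ?s ?ps) (map ?s ?qs)" by (rule reord_map)
  qed (use sub assms in auto)
  finally show ?thesis unfolding shift_prd shift_prd_swap .
qed

text \<open>
  The folded effect is the tensor product of the effects \<open>\<Psi>'(h)[\<xi>]\<close>. Acting by
  \<open>\<gamma>\<close> permutes the domain of each of them, since \<open>\<xi>\<close> is
  equivariant, and acting by \<open>\<eta>\<close> permutes the effects, which makes no difference
  up to the order of the factors of the domain.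
\<close>

lemma fold_effect_equiv:
  assumes \<xi>: "\<xi> \<in> Homs D (G.tens (G.lab X) (G.prd xs)) (TUnit D)"
    and eqv: "\<And>\<gamma>. \<gamma> \<in> carrier G \<Longrightarrow>
      farr (Psi \<gamma>) \<xi> = Cmp D \<xi> (tperm D (G.lab X) (G.shift \<gamma> xs) (G.prd xs))"
    and xs: "distinct xs" "\<forall>x\<in>set xs. X x \<in> Obj D"
    and \<gamma>: "\<gamma> \<in> carrier G" and \<eta>: "\<eta> \<in> carrier H"
  shows "farr (Psi \<gamma>) (farr (Psi' \<eta>) (H.fA \<xi>)) = Cmp D (H.fA \<xi>)
    (tperm D (H.lab (G.lab X)) (List.product (map (\<lambda>h. \<eta> \<otimes>\<^bsub>H\<^esub> h) (elems H)) (G.shift \<gamma> xs)) (H.prd (G.prd xs)))"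
proof -
  let ?e = "\<lambda>k. farr (Psi' k) \<xi>" and ?L = "H.lab (G.lab X)" and ?ks = "map (\<lambda>h. \<eta> \<otimes>\<^bsub>H\<^esub> h) (elems H)"
  let ?T = "\<lambda>k. tperm D ?L (map (Pair k) (G.shift \<gamma> xs)) (map (Pair k) (G.prd xs))"
  have ks: "set ?ks = carrier H" "distinct ?ks"
    using H.translate_carrier[OF \<eta>] by (simp_all add: distinct_map)
  have obj: "\<forall>p\<in>set (G.prd xs). G.lab X p \<in> Obj D" "\<forall>p\<in>set (G.shift \<gamma> xs). G.lab X p \<in> Obj D"
    using xs \<gamma> by auto
  have rs: "reord (G.shift \<gamma> xs) (G.prd xs)" using xs \<gamma> G.reord_shift by blast
  have arr: "\<xi> \<in> Arr D" "Dom D \<xi> = G.tens (G.lab X) (G.prd xs)" "Cod D \<xi> = TUnit D"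
    using \<xi> by (auto simp: Homs_def)
  have e: "?e k \<in> Homs D (G.tens ?L (map (Pair k) (G.prd xs))) (TUnit D)" if "k \<in> carrier H" for k
    using that arr obj by (simp add: Homs_def smc_functor.fobj_tens[OF H.act] comp_def case_prod_unfold)
  have T: "farr (Psi' k) (tperm D (G.lab X) (G.shift \<gamma> xs) (G.prd xs)) = ?T k" if "k \<in> carrier H" for k
    using that rs obj by (simp add: smc_functor.farr_tperm[OF H.act] G.tperm_map inj_on_def)
  have rT: "reord (map (Pair k) (G.shift \<gamma> xs)) (map (Pair k) (G.prd xs))" for k :: "'g list"
    using rs by (auto simp: reord_def distinct_map inj_on_def)
  \<comment> \<open>\<open>\<eta>\<close> turns the translate by \<open>h\<close> into that by \<open>\<eta> h\<close>\<close>
  have step: "farr (Psi \<gamma>) (farr (Psi' \<eta>) (?e h)) = Cmp D (?e (\<eta> \<otimes>\<^bsub>H\<^esub> h)) (?T (\<eta> \<otimes>\<^bsub>H\<^esub> h))"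
    if h: "h \<in> carrier H" for h
  proof -
    have "farr (Psi \<gamma>) (farr (Psi' \<eta>) (?e h)) = farr (Psi' (\<eta> \<otimes>\<^bsub>H\<^esub> h)) (farr (Psi \<gamma>) \<xi>)"
      using h \<eta> \<gamma> arr by (simp add: H.act_farr comm_farr)
    also have "\<dots> = Cmp D (?e (\<eta> \<otimes>\<^bsub>H\<^esub> h)) (?T (\<eta> \<otimes>\<^bsub>H\<^esub> h))"
      using h \<eta> arr rs obj by (simp add: eqv[OF \<gamma>] T)
    finally show ?thesis .
  qed
  have T_typing: "?T k \<in> Arr D" "Cod D (?T k) = G.tens ?L (map (Pair k) (G.prd xs))"
    if "k \<in> carrier H" for k
    using G.tperm_typing[OF rT, of k ?L] that obj by auto
  have "farr (Psi \<gamma>) (farr (Psi' \<eta>) (H.fA \<xi>))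
    = tensA_list D (map (\<lambda>h. farr (Psi \<gamma>) (farr (Psi' \<eta>) (?e h))) (elems H))"
    using \<gamma> \<eta> arr
    by (simp add: foldA_def smc_functor.farr_tensA_list[OF H.act] smc_functor.farr_tensA_list[OF G.act])
  also have "\<dots> = tensA_list D (map (\<lambda>k. Cmp D (?e k) (?T k)) ?ks)"
    unfolding map_map comp_def by (intro arg_cong[where f = "tensA_list D"] map_cong) (simp_all add: step)
  also have "\<dots> = Cmp D (tensA_list D (map ?e ?ks)) (tensA_list D (map ?T ?ks))"
    using e T_typing ks(1) by (intro G.tensA_list_Cmp) (auto simp: Homs_def)
  also have "tensA_list D (map ?T ?ks) = tperm D ?L (List.product ?ks (G.shift \<gamma> xs)) (List.product ?ks (G.prd xs))"
    unfolding product_concat_map[of ?ks]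
  proof (rule G.tensA_list_tperm)
    show "distinct (concat (map (\<lambda>k. map (Pair k) (G.shift \<gamma> xs)) ?ks))"
      unfolding product_concat_map[symmetric] using ks rs by (simp add: distinct_product reord_def)
  qed (use rT ks obj in auto)
  also have "tensA_list D (map ?e ?ks) = Cmp D (H.fA \<xi>) (tperm D ?L (List.product ?ks (G.prd xs)) (H.prd (G.prd xs)))"
    unfolding foldA_def product_concat_map[of ?ks] product_concat_map[of "elems H"]
  proof (rule G.tensA_list_effects[symmetric])
    show "reord ?ks (elems H)" using ks by (simp add: reord_def)
    show "distinct (concat (map (\<lambda>x. map (Pair x) (G.prd xs)) ?ks))"
      using ks xs distinct_product[of ?ks "G.prd xs"] by (simp add: product_concat_map[of ?ks] distinct_product)
  qed (use e ks obj in auto)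
  also have "Cmp D \<dots> (tperm D ?L (List.product ?ks (G.shift \<gamma> xs)) (List.product ?ks (G.prd xs)))
    = Cmp D (H.fA \<xi>) (tperm D ?L (List.product ?ks (G.shift \<gamma> xs)) (H.prd (G.prd xs)))"
  proof -
    have r: "reord (List.product ?ks (G.shift \<gamma> xs)) (List.product ?ks (G.prd xs))"
      "reord (List.product ?ks (G.prd xs)) (H.prd (G.prd xs))"
      using rs ks by (auto simp: reord_def distinct_product)
    have o: "\<forall>p\<in>set (List.product ?ks (G.shift \<gamma> xs)). ?L p \<in> Obj D"
      "\<forall>p\<in>set (List.product ?ks (G.prd xs)). ?L p \<in> Obj D"
      using obj ks by auto
    have "Dom D (H.fA \<xi>) = G.tens ?L (H.prd (G.prd xs))"
      using arr obj by (simp add: H.foldO_tens)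
    then show ?thesis using arr r o by (simp add: G.tperm_Cmp)
  qed
  finally show ?thesis .
qed

lemma equiv_effect_right:
  assumes "H.equiv_effect A \<xi>" shows "GH.equiv_effect A (G.fA \<xi>)"
proof -
  interpret S: two_actions D H G Psi' Psi by (rule swap)
  have A: "A \<in> Obj D" using assms by (simp add: H.equiv_effect_def)
  \<comment> \<open>\<open>A\<close> is regarded as a single tensor factor\<close>
  define X where "X = (\<lambda>_::unit. A)"
  have xs: "distinct [()]" "\<forall>x\<in>set [()]. X x \<in> Obj D" using A by (auto simp: X_def)
  have eq: "A = G.tens X [()]" using A by (simp add: X_def)
  have \<xi>: "\<xi> \<in> Homs D (G.tens (H.lab X) (H.prd [()])) (TUnit D)"
    "\<And>\<eta>. \<eta> \<in> carrier H \<Longrightarrow> farr (Psi' \<eta>) \<xi> = Cmp D \<xi> (tperm D (H.lab X) (H.shift \<eta> [()]) (H.prd [()]))"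
    using iffD1[OF H.equiv_effect_tens[OF xs] assms[unfolded eq]] by blast+
  have arr: "\<xi> \<in> Arr D" "Cod D \<xi> = TUnit D" "Dom D \<xi> = H.fO A"
    using assms by (auto simp: H.equiv_effect_def Homs_def)
  have "GH.equiv_effect (G.tens X [()]) (G.fA \<xi>)"
  proof (rule iffD2[OF GH.equiv_effect_tens[OF xs]], intro conjI ballI)
    have "Dom D (G.fA \<xi>) = GH.fO (G.tens X [()])" using arr A eq by (simp add: foldO_GH)
    then show "G.fA \<xi> \<in> Homs D (G.tens (GH.lab X) (GH.prd [()])) (TUnit D)"
      using arr GH.foldO_tens[OF xs(2)] by (simp add: Homs_def)
    fix w assume "w \<in> carrier (gprod G H)"
    then obtain \<gamma> \<eta> where w: "w = \<gamma> @ \<eta>" "\<gamma> \<in> carrier G" "\<eta> \<in> carrier H" by (rule gprod_memE)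
    have "tperm D (GH.lab X) (GH.shift w [()]) (GH.prd [()]) = tperm D (lab2 X)
      (List.product (map (\<lambda>g. \<gamma> \<otimes>\<^bsub>G\<^esub> g) (elems G)) (H.shift \<eta> [()])) (G.prd (H.prd [()]))"
      unfolding w(1) GH_shift[OF w(2,3)] GH_prd
      by (rule tperm_join)
        (use w xs G.translate_carrier[OF w(2)] H.translate_carrier[OF w(3)] in
          \<open>auto simp: reord_def distinct_product distinct_map\<close>)
    with S.fold_effect_equiv[OF \<xi> xs w(3,2)]
    show "farr (Pact w) (G.fA \<xi>) = Cmp D (G.fA \<xi>) (tperm D (GH.lab X) (GH.shift w [()]) (GH.prd [()]))"
      using w arr by (simp add: comm_farr)
  qed
  then show ?thesis unfolding eq[symmetric] .
qed

lemma equiv_effect_left: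
  assumes "G.equiv_effect A \<xi>" shows "GH.equiv_effect A (lft A \<xi>)"
proof -
  have A: "A \<in> Obj D" using assms by (simp add: G.equiv_effect_def)
  define X where "X = (\<lambda>_::unit. A)"
  have xs: "distinct [()]" "\<forall>x\<in>set [()]. X x \<in> Obj D" using A by (auto simp: X_def)
  have eq: "A = G.tens X [()]" using A by (simp add: X_def)
  have \<xi>: "\<xi> \<in> Homs D (G.tens (G.lab X) (G.prd [()])) (TUnit D)"
    "\<And>\<gamma>. \<gamma> \<in> carrier G \<Longrightarrow> farr (Psi \<gamma>) \<xi> = Cmp D \<xi> (tperm D (G.lab X) (G.shift \<gamma> [()]) (G.prd [()]))"
    using iffD1[OF G.equiv_effect_tens[OF xs] assms[unfolded eq]] by blast+
  have arr: "\<xi> \<in> Arr D" "Cod D \<xi> = TUnit D" "Dom D \<xi> = G.tens (G.lab X) (G.prd [()])"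
    using \<xi>(1) by (auto simp: Homs_def)
  let ?l = "G.prd (H.prd [()])" and ?r = "map lab_swap (H.prd (G.prd [()]))"
  let ?t = "tperm D (lab2 X)"
  have r: "reord ?l ?r" using reord_swap xs by blast
  have obj: "\<forall>p\<in>set ?l. lab2 X p \<in> Obj D" "\<forall>p\<in>set ?r. lab2 X p \<in> Obj D"
    using A by (auto simp: X_def)
  have dom: "Dom D (H.fA \<xi>) = G.tens (lab2 X) ?r"
  proof -
    have "Dom D (H.fA \<xi>) = G.tens (H.lab (G.lab X)) (H.prd (G.prd [()]))"
      using arr A by (simp add: H.foldO_tens X_def)
    also have "\<dots> = G.tens (lab2 X) ?r"
      using A by (auto simp: comm_fobj X_def intro!: arg_cong[where f = "tensO_list D"])
    finally show ?thesis .
  qed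
  have lft: "lft (G.tens X [()]) \<xi> = Cmp D (H.fA \<xi>) (?t ?l ?r)"
    unfolding lft_def reorder_GH_tens[OF xs] ..
  have "GH.equiv_effect (G.tens X [()]) (lft (G.tens X [()]) \<xi>)"
    unfolding lft
  proof (rule iffD2[OF GH.equiv_effect_tens[OF xs]], intro conjI ballI)
    have "G.tens (lab2 X) ?l = G.tens (GH.lab X) (GH.prd [()])"
      using foldO_GH_tens[OF xs(2)] GH.foldO_tens[OF xs(2)] by (rule trans[OF sym])
    then show "Cmp D (H.fA \<xi>) (?t ?l ?r) \<in> Homs D (G.tens (GH.lab X) (GH.prd [()])) (TUnit D)"
      using arr dom G.tperm_typing[OF r obj(1)] by (simp add: Homs_def)
    fix w assume "w \<in> carrier (gprod G H)"
    then obtain \<gamma> \<eta> where w: "w = \<gamma> @ \<eta>" "\<gamma> \<in> carrier G" "\<eta> \<in> carrier H" by (rule gprod_memE)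
    let ?sl = "List.product (map (\<lambda>g. \<gamma> \<otimes>\<^bsub>G\<^esub> g) (elems G)) (H.shift \<eta> [()])"
    let ?sr = "List.product (map (\<lambda>h. \<eta> \<otimes>\<^bsub>H\<^esub> h) (elems H)) (G.shift \<gamma> [()])"
    note tr = G.translate_carrier[OF w(2)] H.translate_carrier[OF w(3)]
    have rs: "reord ?sl ?l" "reord ?sl (map lab_swap ?sr)" "reord (map lab_swap ?sr) ?r"
      using xs tr by (auto simp: reord_def distinct_product distinct_map)
    have sobj: "\<forall>p\<in>set ?sl. lab2 X p \<in> Obj D" "\<forall>p\<in>set (map lab_swap ?sr). lab2 X p \<in> Obj D"
      using A w by (auto simp: X_def)
    have t: "tperm D (GH.lab X) (GH.shift w [()]) (GH.prd [()]) = ?t ?sl ?l"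
      unfolding w(1) GH_shift[OF w(2,3)] GH_prd
      by (rule tperm_join[OF rs(1)]) (use w A in \<open>auto simp: X_def\<close>)
    have "?t (map lab_swap ?sr) ?r = tperm D (H.lab (G.lab X)) ?sr (H.prd (G.prd [()]))"
      by (rule tperm_lab_swap) (use w xs tr in \<open>auto simp: reord_def distinct_product distinct_map\<close>)
    with fold_effect_equiv[OF \<xi> xs w(2,3)]
    have f: "farr (Pact w) (H.fA \<xi>) = Cmp D (H.fA \<xi>) (?t (map lab_swap ?sr) ?r)"
      using w arr by simp
    have "farr (Pact w) (Cmp D (H.fA \<xi>) (?t ?l ?r)) = Cmp D (farr (Pact w) (H.fA \<xi>)) (farr (Pact w) (?t ?l ?r))"
      using \<open>w \<in> carrier (gprod G H)\<close> dom arr G.tperm_typing[OF r obj(1)] by simp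
    also have "farr (Pact w) (?t ?l ?r) = ?t ?sl (map lab_swap ?sr)"
      using farr_reorder_GH[OF xs w(2,3)] unfolding w(1) reorder_GH_tens[OF xs] .
    also have "Cmp D (farr (Pact w) (H.fA \<xi>)) \<dots> = Cmp D (H.fA \<xi>) (?t ?sl ?r)"
      unfolding f using arr dom G.tperm_typing[OF rs(3) sobj(2)] G.tperm_typing[OF rs(2) sobj(1)]
        G.tperm_Cmp[OF rs(2,3) sobj(1)] by simp
    also have "\<dots> = Cmp D (Cmp D (H.fA \<xi>) (?t ?l ?r)) (?t ?sl ?l)"
      using arr dom G.tperm_typing[OF r obj(1)] G.tperm_typing[OF rs(1) sobj(1)]
        G.tperm_Cmp[OF rs(1) r sobj(1)] by simp
    finally show "farr (Pact w) (Cmp D (H.fA \<xi>) (?t ?l ?r))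
      = Cmp D (Cmp D (H.fA \<xi>) (?t ?l ?r)) (tperm D (GH.lab X) (GH.shift w [()]) (GH.prd [()]))"
      unfolding t .
  qed
  then show ?thesis unfolding eq[symmetric] .
qed

end

context two_actions begin

lemma foldA_swap_typing:
  assumes "\<xi> \<in> Homs D (G.fO (G.tens X xs)) (TUnit D)" "\<forall>x\<in>set xs. X x \<in> Obj D"
  shows "H.fA \<xi> \<in> Arr D" "Dom D (H.fA \<xi>) = G.tens (lab2 X) (map lab_swap (H.prd (G.prd xs)))"
    "Cod D (H.fA \<xi>) = TUnit D"
proof -
  have "\<forall>p\<in>set (G.prd xs). G.lab X p \<in> Obj D" using assms(2) by auto
  then have "H.fO (G.fO (G.tens X xs)) = G.tens (H.lab (G.lab X)) (H.prd (G.prd xs))"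
    by (simp only: G.foldO_tens[OF assms(2)] H.foldO_tens)
  also have "\<dots> = G.tens (lab2 X) (map lab_swap (H.prd (G.prd xs)))"
    using assms(2) by (auto simp: comm_fobj intro!: arg_cong[where f = "tensO_list D"])
  finally show "H.fA \<xi> \<in> Arr D" "Dom D (H.fA \<xi>) = G.tens (lab2 X) (map lab_swap (H.prd (G.prd xs)))"
    "Cod D (H.fA \<xi>) = TUnit D"
    using assms(1) by (auto simp: Homs_def)
qed

lemma lft_tens:
  assumes "distinct xs" "\<forall>x\<in>set xs. X x \<in> Obj D"
  shows "lft (G.tens X xs) \<xi> = Cmp D (H.fA \<xi>)
    (tperm D (lab2 X) (G.prd (H.prd xs)) (map lab_swap (H.prd (G.prd xs))))"
  by (simp add: lft_def reorder_GH_tens[OF assms])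

text \<open>
  The factors of \<open>A\<close> and \<open>B\<close> can be separated inside each
  \<open>G\<close>-translate first, and then across the translates.
\<close>

lemma arr_inv_pimap_factor_tens:
  assumes X: "distinct (as @ bs)" "\<forall>x\<in>set (as @ bs). X x \<in> Obj D"
  shows "Cmp D (arr_inv D (pimap D G Psi (H.fO (G.tens X as)) (H.fO (G.tens X bs))))
      (G.fA (arr_inv D (pimap D H Psi' (G.tens X as) (G.tens X bs))))
    = tperm D (lab2 X) (G.prd (H.prd (as @ bs))) (G.prd (H.prd as) @ G.prd (H.prd bs))"
proof -
  let ?m = "H.prd (as @ bs)" and ?s = "H.prd as @ H.prd bs"
  have Xs: "\<forall>x\<in>set as. X x \<in> Obj D" "\<forall>x\<in>set bs. X x \<in> Obj D" using X by auto
  have d: "distinct ?s" "\<forall>p\<in>set ?s. H.lab X p \<in> Obj D" "\<forall>p\<in>set ?m. H.lab X p \<in> Obj D"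
    using X by (auto simp: distinct_product)
  have r: "reord ?m ?s" by (rule H.reord_pimap[OF X(1)])
  have r2: "reord (G.prd ?m) (G.prd ?s)" "reord (G.prd ?s) (G.prd (H.prd as) @ G.prd (H.prd bs))"
    using r d(1) by (auto simp: reord_def distinct_product)
  have "\<forall>p\<in>set (G.prd ?m). lab2 X p \<in> Obj D" using X by auto
  then show ?thesis
    unfolding H.foldO_tens[OF Xs(1)] H.foldO_tens[OF Xs(2)] G.arr_inv_pimap_tens[OF d(1,2)]
      H.arr_inv_pimap_tens[OF X] G.foldA_tperm[OF r d(3)]
    by (intro G.tperm_Cmp r2)
qed

lemma arr_inv_pimap_GH:
  assumes AB: "A \<in> Obj D" "B \<in> Obj D"
  shows "arr_inv D (pimap D (gprod G H) Pact A B)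
    = Cmp D (arr_inv D (pimap D G Psi (H.fO A) (H.fO B))) (G.fA (arr_inv D (pimap D H Psi' A B)))"
proof -
  define X where "X = (\<lambda>b. if b then A else B)"
  have X: "distinct ([True] @ [False])" "\<forall>x\<in>set ([True] @ [False]). X x \<in> Obj D"
    using AB by (auto simp: X_def)
  have eq: "A = G.tens X [True]" "B = G.tens X [False]" using AB by (simp_all add: X_def)
  have "arr_inv D (pimap D (gprod G H) Pact A B)
    = tperm D (GH.lab X) (map lab_join (G.prd (H.prd ([True] @ [False]))))
      (map lab_join (G.prd (H.prd [True]) @ G.prd (H.prd [False])))"
    unfolding eq GH.arr_inv_pimap_tens[OF X] GH_prd map_append ..
  also have "\<dots> = tperm D (lab2 X) (G.prd (H.prd ([True] @ [False]))) (G.prd (H.prd [True]) @ G.prd (H.prd [False]))"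
    by (rule tperm_join) (use AB in \<open>auto simp: X_def reord_def distinct_product\<close>)
  finally show ?thesis
    unfolding arr_inv_pimap_factor_tens[OF X, symmetric] eq[symmetric] .
qed

text \<open>
  Both sides separate the factors of \<open>A\<close> from those of \<open>B\<close> and order them
  with \<open>H\<close> as outer index.
\<close>

lemma arr_inv_pimap_reorder:
  assumes AB: "A \<in> Obj D" "B \<in> Obj D"
  shows "Cmp D (Cmp D (arr_inv D (pimap D H Psi' (G.fO A) (G.fO B))) (H.fA (arr_inv D (pimap D G Psi A B))))
      (reorder_GH (TensO D A B))
    = Cmp D (TensA D (reorder_GH A) (reorder_GH B)) (arr_inv D (pimap D (gprod G H) Pact A B))"
proof -
  interpret S: two_actions D H G Psi' Psi by (rule swap)
  define X where "X = (\<lambda>b. if b then A else B)"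
  let ?as = "[True]" and ?bs = "[False]"
  have X: "distinct (?as @ ?bs)" "\<forall>x\<in>set (?as @ ?bs). X x \<in> Obj D"
    using AB by (auto simp: X_def)
  have Xa: "distinct ?as" "\<forall>x\<in>set ?as. X x \<in> Obj D" and Xb: "distinct ?bs" "\<forall>x\<in>set ?bs. X x \<in> Obj D"
    using X by auto
  have eq: "A = G.tens X ?as" "B = G.tens X ?bs" "TensO D A B = G.tens X (?as @ ?bs)"
    using AB by (simp_all add: X_def)
  let ?t = "tperm D (lab2 X)"
  let ?gh = "\<lambda>xs. G.prd (H.prd xs)" and ?hg = "\<lambda>xs. map lab_swap (H.prd (G.prd xs))"
  have obj: "\<forall>p\<in>set (?gh (?as @ ?bs)). lab2 X p \<in> Obj D" "\<forall>p\<in>set (?gh ?as). lab2 X p \<in> Obj D"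
    "\<forall>p\<in>set (?gh ?bs). lab2 X p \<in> Obj D"
    using AB by (auto simp: X_def)
  have r: "reord (?gh (?as @ ?bs)) (?hg (?as @ ?bs))" "reord (?gh ?as) (?hg ?as)" "reord (?gh ?bs) (?hg ?bs)"
    using reord_swap X(1) Xa(1) Xb(1) by blast+
  have r2: "reord (?hg (?as @ ?bs)) (?hg ?as @ ?hg ?bs)" "reord (?gh (?as @ ?bs)) (?gh ?as @ ?gh ?bs)"
    "reord (?gh ?as @ ?gh ?bs) (?hg ?as @ ?hg ?bs)"
    by (auto simp: reord_def distinct_map distinct_product)
  have "Cmp D (arr_inv D (pimap D H Psi' (G.fO A) (G.fO B))) (H.fA (arr_inv D (pimap D G Psi A B)))
    = tperm D (H.lab (G.lab X)) (H.prd (G.prd (?as @ ?bs))) (H.prd (G.prd ?as) @ H.prd (G.prd ?bs))"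
    unfolding eq by (rule S.arr_inv_pimap_factor_tens[OF X])
  also have "\<dots> = ?t (?hg (?as @ ?bs)) (?hg ?as @ ?hg ?bs)"
    unfolding map_append[symmetric]
    by (rule tperm_lab_swap[symmetric]) (use AB in \<open>auto simp: X_def reord_def distinct_product\<close>)
  also have "Cmp D \<dots> (reorder_GH (TensO D A B)) = ?t (?gh (?as @ ?bs)) (?hg ?as @ ?hg ?bs)"
    unfolding eq(3) reorder_GH_tens[OF X] by (rule G.tperm_Cmp[OF r(1) r2(1) obj(1)])
  also have "\<dots> = Cmp D (?t (?gh ?as @ ?gh ?bs) (?hg ?as @ ?hg ?bs)) (?t (?gh (?as @ ?bs)) (?gh ?as @ ?gh ?bs))"
    by (rule G.tperm_Cmp[OF r2(2,3) obj(1), symmetric])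
  also have "?t (?gh ?as @ ?gh ?bs) (?hg ?as @ ?hg ?bs) = TensA D (reorder_GH A) (reorder_GH B)"
    unfolding eq(1,2) reorder_GH_tens[OF Xa] reorder_GH_tens[OF Xb]
    by (rule G.tperm_append[OF r(2,3) _ obj(2,3)]) auto
  also have "?t (?gh (?as @ ?bs)) (?gh ?as @ ?gh ?bs) = arr_inv D (pimap D (gprod G H) Pact A B)"
    unfolding arr_inv_pimap_GH[OF AB] unfolding eq(1,2) by (rule arr_inv_pimap_factor_tens[OF X, symmetric])
  finally show ?thesis .
qed

lemma reorder_GH_typing [simp]:
  assumes A: "A \<in> Obj D"
  shows "reorder_GH A \<in> Arr D" "Dom D (reorder_GH A) = GH.fO A" "Cod D (reorder_GH A) = H.fO (G.fO A)"
proof -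
  define X where "X = (\<lambda>_::unit. A)"
  have xs: "distinct [()]" "\<forall>x\<in>set [()]. X x \<in> Obj D" using A by (auto simp: X_def)
  have eq: "A = G.tens X [()]" using A by (simp add: X_def)
  have o: "\<forall>p\<in>set (G.prd (H.prd [()])). lab2 X p \<in> Obj D" using xs by auto
  have "Idn D A \<in> Homs D (G.tens X [()]) A" using A eq by (simp add: Homs_def)
  have og: "\<forall>p\<in>set (G.prd [()]). G.lab X p \<in> Obj D" using xs by auto
  have "H.fO (G.fO A) = G.tens (H.lab (G.lab X)) (H.prd (G.prd [()]))"
    unfolding eq G.foldO_tens[OF xs(2)] by (rule H.foldO_tens[OF og])
  also have "\<dots> = G.tens (lab2 X) (map lab_swap (H.prd (G.prd [()])))"
    using A by (auto simp: comm_fobj X_def intro!: arg_cong[where f = "tensO_list D"])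
  finally have c: "H.fO (G.fO A) = G.tens (lab2 X) (map lab_swap (H.prd (G.prd [()])))" .
  show "reorder_GH A \<in> Arr D" "Dom D (reorder_GH A) = GH.fO A" "Cod D (reorder_GH A) = H.fO (G.fO A)"
    unfolding c unfolding eq reorder_GH_tens[OF xs] foldO_GH_tens[OF xs(2)]
    by (rule G.tperm_typing[OF reord_swap(1)[OF xs(1)] o])+
qed

lemma env_tens_right:
  assumes a: "a \<in> Homs D (H.fO A) (TUnit D)" and b: "b \<in> Homs D (H.fO B) (TUnit D)"
    and AB: "A \<in> Obj D" "B \<in> Obj D"
  shows "G.fA (env_tens D H Psi' A B a b) = env_tens D (gprod G H) Pact A B (G.fA a) (G.fA b)"
  using a b AB unfolding env_tens_def arr_inv_pimap_GH[OF AB]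
  by (simp add: Homs_def G.foldA_TensA)

lemma env_tens_left:
  assumes a: "a \<in> Homs D (G.fO A) (TUnit D)" and b: "b \<in> Homs D (G.fO B) (TUnit D)"
    and AB: "A \<in> Obj D" "B \<in> Obj D"
  shows "lft (TensO D A B) (env_tens D G Psi A B a b) = env_tens D (gprod G H) Pact A B (lft A a) (lft B b)"
proof -
  let ?p = "arr_inv D (pimap D G Psi A B)" and ?q = "arr_inv D (pimap D H Psi' (G.fO A) (G.fO B))"
  have ab: "a \<in> Arr D" "Dom D a = G.fO A" "Cod D a = TUnit D" "b \<in> Arr D" "Dom D b = G.fO B" "Cod D b = TUnit D"
    using a b by (auto simp: Homs_def)
  have "lft (TensO D A B) (env_tens D G Psi A B a b) =
    Cmp D (TensA D (H.fA a) (H.fA b)) (Cmp D (Cmp D ?q (H.fA ?p)) (reorder_GH (TensO D A B)))"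
    unfolding lft_def env_tens_def using AB ab by (simp add: H.foldA_TensA foldO_GH)
  also have "\<dots> = Cmp D (TensA D (lft A a) (lft B b)) (arr_inv D (pimap D (gprod G H) Pact A B))"
    unfolding arr_inv_pimap_reorder[OF AB] lft_def using AB ab
    by (simp add: G.interchange[symmetric])
  finally show ?thesis by (simp add: env_tens_def)
qed

end

section \<open>Three commuting actions\<close>

lemma (in sym_mon_cat) tperm_relabel:
  assumes "reord us vs" "inj_on f (set us)" "\<forall>p\<in>set us. Y (f p) = X p"
  shows "tperm D Y (map f us) (map f vs) = tperm D X us vs"
proof -
  have "tperm D Y (map f us) (map f vs) = tperm D (\<lambda>p. Y (f p)) us vs"
    using assms(1,2) by (intro tperm_map)
  also have "\<dots> = tperm D X us vs"
    using assms by (intro tperm_cong) (auto simp: reord_def)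
  finally show ?thesis .
qed

lemma concat_product:
  fixes gs :: "'x list"
  shows "concat (map (\<lambda>(g, h). map (\<lambda>l. (g, h, l)) ls) (List.product gs hs)) = List.product gs (List.product hs ls)"
proof -
  have "concat (map (\<lambda>(g, h). map (\<lambda>l. (g, h, l)) ls) (map (Pair g) hs)) = map (Pair g) (List.product hs ls)" for g :: 'x
    by (induction hs) auto
  then show ?thesis by (induction gs) (auto simp del: map_map)
qed

lemma concat_product_swap:
  fixes hs :: "'x list"
  shows "concat (map (\<lambda>(g, h). map (\<lambda>l. (g, h, l)) ls) (map prod.swap (List.product hs gs)))
    = map lab_swap (List.product hs (List.product gs ls))"
proof -
  have "concat (map (\<lambda>(g, h). map (\<lambda>l. (g, h, l)) ls) (map prod.swap (map (Pair h) gs)))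
    = map lab_swap (map (Pair h) (List.product gs ls))" for h :: 'x
    by (induction gs) auto
  then show ?thesis by (induction hs) (auto simp del: map_map)
qed

text \<open>
  Both foldings tensor the effects \<open>\<Psi>(g)[\<Psi>'(h)[\<xi>]]\<close>, in different orders.
\<close>

lemma (in two_actions) fold_fold_effect:
  assumes \<xi>: "\<xi> \<in> Homs D (G.tens Y ls) (TUnit D)" and ls: "distinct ls" "\<forall>l\<in>set ls. Y l \<in> Obj D"
  shows "Cmp D (G.fA (H.fA \<xi>)) (tperm D (lab2 Y) (map lab_swap (H.prd (G.prd ls))) (G.prd (H.prd ls)))
    = H.fA (G.fA \<xi>)"
proof -
  let ?f = "\<lambda>(g, h). farr (Psi g) (farr (Psi' h) \<xi>)" and ?b = "\<lambda>(g, h). map (\<lambda>l. (g, h, l)) ls"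
  have arr: "\<xi> \<in> Arr D" "Dom D \<xi> = G.tens Y ls" "Cod D \<xi> = TUnit D" using \<xi> by (auto simp: Homs_def)
  have 1: "G.fA (H.fA \<xi>) = tensA_list D (map ?f (List.product (elems G) (elems H)))"
    using G.foldA_tensA_list[of "elems H" "\<lambda>h. farr (Psi' h) \<xi>"] arr by (simp add: foldA_def[of D H])
  have "H.fA (G.fA \<xi>) = tensA_list D (map (\<lambda>(h, g). farr (Psi' h) (farr (Psi g) \<xi>)) (List.product (elems H) (elems G)))"
    using H.foldA_tensA_list[of "elems G" "\<lambda>g. farr (Psi g) \<xi>"] arr by (simp add: foldA_def[of D G])
  also have "\<dots> = tensA_list D (map ?f (map prod.swap (List.product (elems H) (elems G))))"
    unfolding map_map using arr
    by (intro arg_cong[where f = "tensA_list D"] map_cong) (auto simp: comm_farr)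
  finally have 2: "H.fA (G.fA \<xi>) = tensA_list D (map ?f (map prod.swap (List.product (elems H) (elems G))))" .
  have d: "distinct (map lab_swap (H.prd (G.prd ls)))"
    using ls by (simp add: distinct_map distinct_product)
  have "reord (map prod.swap (List.product (elems H) (elems G))) (List.product (elems G) (elems H))"
    by (auto simp: reord_def distinct_map distinct_product)
  then show ?thesis
    unfolding 1 2 concat_product_swap[of ls "elems H" "elems G", symmetric]
      concat_product[of ls "elems G" "elems H", symmetric]
  proof (rule G.tensA_list_effects)
    show "\<forall>p\<in>set (map prod.swap (List.product (elems H) (elems G))). ?f p \<in> Homs D (G.tens (lab2 Y) (?b p)) (TUnit D)"
      using arr ls
      by (auto simp: Homs_def comp_def smc_functor.fobj_tens[OF G.act] smc_functor.fobj_tens[OF H.act])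
    show "distinct (concat (map ?b (map prod.swap (List.product (elems H) (elems G)))))"
      unfolding concat_product_swap by (rule d)
  qed (use ls in auto)
qed

locale three_actions = GH: two_actions D G H P Q + HJ: two_actions D H J Q R + GJ: two_actions D G J P R
  for D :: "('o,'a) smc" and G H J :: "'g::linorder list monoid" and P Q R
begin

sublocale GH_J: two_actions D "gprod G H" J GH.Pact R
  by unfold_locales
    (auto elim!: gprod_memE simp: HJ.comm_fobj GJ.comm_fobj HJ.comm_farr GJ.comm_farr)

sublocale G_HJ: two_actions D G "gprod H J" P HJ.Pact
  by unfold_locales
    (auto elim!: gprod_memE simp: GH.comm_fobj GJ.comm_fobj GH.comm_farr GJ.comm_farr)

abbreviation gp where "gp \<equiv> GH.G.prd"
abbreviation hp where "hp \<equiv> GH.H.prd"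
abbreviation jp where "jp \<equiv> HJ.H.prd"
abbreviation lab3 where "lab3 X \<equiv> GH.G.lab (GH.H.lab (HJ.H.lab X))"

lemma act_prod_assoc:
  "act_prod SMCs D (gprod G H) GH.Pact J R = act_prod SMCs D G P (gprod H J) HJ.Pact"
proof
  fix w
  show "act_prod SMCs D (gprod G H) GH.Pact J R w = act_prod SMCs D G P (gprod H J) HJ.Pact w"
  proof (cases "w \<in> carrier (gprod G (gprod H J))")
    case True
    then obtain x y z where w: "w = x @ y @ z" "x \<in> carrier G" "y \<in> carrier H" "z \<in> carrier J"
      by (auto elim!: gprod_memE)
    have "act_prod SMCs D (gprod G H) GH.Pact J R ((x @ y) @ z) = smcf_comp D (GH.Pact (x @ y)) (R z)"
      using w by (intro GH_J.act_prod_append gprod_memI)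
    moreover have "act_prod SMCs D G P (gprod H J) HJ.Pact (x @ y @ z) = smcf_comp D (P x) (HJ.Pact (y @ z))"
      using w by (intro G_HJ.act_prod_append gprod_memI)
    ultimately show ?thesis
      using w by (auto simp: GH.act_prod_append HJ.act_prod_append smcf_comp_def smcf_restrict_def)
  next
    case False
    then show ?thesis by (simp add: act_prod_def gprod_assoc)
  qed
qed

lemma reorder_GH_J:
  assumes "xs = [()]" "X = (\<lambda>_. A)" "A \<in> Obj D"
  shows "GH_J.reorder_GH A = tperm D (lab3 X) (gp (hp (jp xs)))
    (map (\<lambda>(j, g, h, x). (g, h, j, x)) (jp (gp (hp xs))))"
proof -
  have A: "A = GH.G.tens X xs" using assms by simp
  have X: "distinct xs" "\<forall>x\<in>set xs. X x \<in> Obj D" using assms by auto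
  have "GH_J.reorder_GH A = tperm D (GH_J.lab2 X) (GH.GH.prd (jp xs)) (map lab_swap (jp (GH.GH.prd xs)))"
    unfolding A by (rule GH_J.reorder_GH_tens[OF X])
  also have "GH.GH.prd (jp xs) = map lab_join (gp (hp (jp xs)))" by (rule GH.GH_prd)
  also have "map lab_swap (jp (GH.GH.prd xs))
    = map lab_join (map (\<lambda>(j, g, h, x). (g, h, j, x)) (jp (gp (hp xs))))"
    unfolding GH.GH_prd by (simp add: product_map_right case_prod_unfold lab_swap_def lab_join_def comp_def)
  also have "tperm D (GH_J.lab2 X) (map lab_join (gp (hp (jp xs))))
      (map lab_join (map (\<lambda>(j, g, h, x). (g, h, j, x)) (jp (gp (hp xs)))))
    = tperm D (lab3 X) (gp (hp (jp xs))) (map (\<lambda>(j, g, h, x). (g, h, j, x)) (jp (gp (hp xs))))"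
    by (rule GH.tperm_join)
      (use X in \<open>auto simp: reord_def distinct_map distinct_product inj_on_def image_iff\<close>)
  finally show ?thesis .
qed

text \<open>
  Both sides tensor the translates of \<open>\<xi>\<close> by elements of \<open>H\<close> and
  \<open>J\<close>. The order of these translates is compensated by the reordering of the domain.
  The lists of labels in the proof are named after the nesting of their indices, outermost first.
\<close>

lemma lft_lft:
  assumes A: "A \<in> Obj D" and \<xi>: "\<xi> \<in> Homs D (GH.G.fO A) (TUnit D)"
  shows "GH_J.lft A (GH.lft A \<xi>) = G_HJ.lft A \<xi>"
proof -
  define X where "X = (\<lambda>_::unit. A)"
  define xs where "xs = [()]"
  have X: "distinct xs" "\<forall>x\<in>set xs. X x \<in> Obj D" using A by (auto simp: X_def xs_def)
  have eq: "A = GH.G.tens X xs" using A by (simp add: X_def xs_def)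
  let ?c = "\<lambda>(j, g, h, x). (g, h, j, x)" and ?d = "\<lambda>(h, j, g, x). (g, h, j, x)"
  let ?ghj = "gp (hp (jp xs))" and ?jhg = "map ?c (jp (map lab_swap (hp (gp xs))))"
  let ?jgh = "map ?c (jp (gp (hp xs)))" and ?hjg = "map ?d (hp (jp (gp xs)))"
  let ?t = "tperm D (lab3 X)"
  have obj: "\<forall>p\<in>set ?ghj. lab3 X p \<in> Obj D" using X by auto
  have set: "set ?jhg = set ?ghj" "set ?jgh = set ?ghj" "set ?hjg = set ?ghj"
    by (auto simp: image_iff)
  have d: "distinct ?ghj" "distinct ?jhg" "distinct ?jgh" "distinct ?hjg"
    using X by (auto simp: distinct_map distinct_product inj_on_def)
  have r: "reord ?ghj ?jhg" "reord ?ghj ?jgh" "reord ?ghj ?hjg" "reord ?jgh ?jhg" "reord ?jhg ?hjg"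
    using set d unfolding reord_def by metis+
  have \<xi>': "\<xi> \<in> Homs D (GH.G.tens (GH.G.lab X) (gp xs)) (TUnit D)"
    using \<xi> GH.G.foldO_tens[OF X(2)] eq by simp
  have dg: "distinct (gp xs)" "\<forall>p\<in>set (gp xs). GH.G.lab X p \<in> Obj D" using X by (auto simp: distinct_product)
  note h\<xi> = GH.foldA_swap_typing[OF \<xi>[unfolded eq] X(2)]
  note rs = GH.reord_swap(1)[OF X(1)]
  have o2: "\<forall>p\<in>set (gp (hp xs)). GH.lab2 X p \<in> Obj D" using X by auto
  have J: "HJ.H.fA (tperm D (GH.lab2 X) (gp (hp xs)) (map lab_swap (hp (gp xs)))) = ?t ?jgh ?jhg"
    unfolding HJ.H.foldA_tperm[OF rs o2]
    by (rule GH.G.tperm_relabel[symmetric])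
      (use X rs in \<open>auto simp: reord_def distinct_product inj_on_def GJ.comm_fobj HJ.comm_fobj\<close>)
  have "HJ.H.fA (GH.H.fA \<xi>) = Cmp D (GH.H.fA (HJ.H.fA \<xi>)) (tperm D (GH.H.lab (HJ.H.lab (GH.G.lab X)))
      (map lab_swap (jp (hp (gp xs)))) (hp (jp (gp xs))))"
    by (rule HJ.fold_fold_effect[OF \<xi>' dg, symmetric])
  also have "tperm D (GH.H.lab (HJ.H.lab (GH.G.lab X))) (map lab_swap (jp (hp (gp xs)))) (hp (jp (gp xs)))
    = ?t (map ?d (map lab_swap (jp (hp (gp xs))))) ?hjg"
    by (rule GH.G.tperm_relabel[symmetric])
      (use X in \<open>auto simp: reord_def distinct_product distinct_map inj_on_def GJ.comm_fobj GH.comm_fobj\<close>)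
  also have "map ?d (map lab_swap (jp (hp (gp xs)))) = ?jhg"
    by (simp add: product_map_right case_prod_unfold lab_swap_def comp_def)
  finally have ff: "HJ.H.fA (GH.H.fA \<xi>) = Cmp D (GH.H.fA (HJ.H.fA \<xi>)) (?t ?jhg ?hjg)" .
  have oo: "\<forall>p\<in>set ?jgh. lab3 X p \<in> Obj D" "\<forall>p\<in>set ?jhg. lab3 X p \<in> Obj D"
    unfolding set by (rule obj)+
  have hj: "GH.H.fA (HJ.H.fA \<xi>) \<in> Arr D" "Dom D (GH.H.fA (HJ.H.fA \<xi>)) = GH.G.tens (lab3 X) ?hjg"
  proof -
    have arr: "\<xi> \<in> Arr D" "Dom D \<xi> = GH.G.tens (GH.G.lab X) (gp xs)" using \<xi>' by (auto simp: Homs_def)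
    then show "GH.H.fA (HJ.H.fA \<xi>) \<in> Arr D" by simp
    have "\<forall>p\<in>set (jp (gp xs)). HJ.H.lab (GH.G.lab X) p \<in> Obj D" using dg(2) by auto
    then have "Dom D (GH.H.fA (HJ.H.fA \<xi>)) = GH.G.tens (GH.H.lab (HJ.H.lab (GH.G.lab X))) (hp (jp (gp xs)))"
      using arr by (simp only: HJ.H.foldO_tens[OF dg(2)] GH.H.foldO_tens GH.H.foldA_typing HJ.H.foldA_typing)
    also have "\<dots> = GH.G.tens (lab3 X) ?hjg"
      using X by (auto simp: GH.comm_fobj GJ.comm_fobj intro!: arg_cong[where f = "tensO_list D"])
    finally show "Dom D (GH.H.fA (HJ.H.fA \<xi>)) = GH.G.tens (lab3 X) ?hjg" .
  qed
  have "GH_J.lft A (GH.lft A \<xi>) = Cmp D (HJ.H.fA (GH.lft A \<xi>)) (?t ?ghj ?jgh)"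
    unfolding GH_J.lft_def using reorder_GH_J[of xs X A] A by (simp add: X_def xs_def)
  also have "HJ.H.fA (GH.lft A \<xi>) = Cmp D (HJ.H.fA (GH.H.fA \<xi>)) (?t ?jgh ?jhg)"
    unfolding eq GH.lft_tens[OF X] J[symmetric]
    using h\<xi> GH.G.tperm_typing[OF rs o2] by (intro HJ.H.foldA_Cmp) simp_all
  also have "\<dots> = Cmp D (GH.H.fA (HJ.H.fA \<xi>)) (?t ?jgh ?hjg)"
    unfolding ff using hj GH.G.tperm_typing[OF r(5) oo(2)] GH.G.tperm_typing[OF r(4) oo(1)]
      GH.G.tperm_Cmp[OF r(4,5) oo(1)] by simp
  also have "Cmp D \<dots> (?t ?ghj ?jgh) = Cmp D (GH.H.fA (HJ.H.fA \<xi>)) (?t ?ghj ?hjg)"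
  proof -
    have r6: "reord ?jgh ?hjg" using r unfolding reord_def by metis
    show ?thesis
      using hj GH.G.tperm_typing[OF r6 oo(1)] GH.G.tperm_typing[OF r(2) obj]
        GH.G.tperm_Cmp[OF r(2) r6 obj] by simp
  qed
  also have "\<dots> = G_HJ.lft A \<xi>"
  proof -
    have 1: "gp (HJ.GH.prd xs) = map (\<lambda>(g, p). (g, lab_join p)) ?ghj"
      unfolding HJ.GH_prd by (simp add: product_map_right)
    have 2: "map lab_swap (HJ.GH.prd (gp xs)) = map (\<lambda>(g, p). (g, lab_join p)) ?hjg"
      unfolding HJ.GH_prd by (simp add: case_prod_unfold lab_swap_def lab_join_def)
    have inj: "inj_on (\<lambda>(g, p). (g, lab_join p)) (set ?ghj)"
      using inj_lab_join[OF GH.H.fab, of "hp (jp xs)" UNIV] by (auto simp: inj_on_def)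
    have t: "tperm D (GH.G.lab (HJ.GH.lab X)) (map (\<lambda>(g, p). (g, lab_join p)) ?ghj) (map (\<lambda>(g, p). (g, lab_join p)) ?hjg)
      = ?t ?ghj ?hjg"
      by (rule GH.G.tperm_relabel[OF r(3) inj]) (use X in auto)
    have "\<xi> \<in> Arr D" using \<xi> by (simp add: Homs_def)
    then show ?thesis
      unfolding eq G_HJ.lft_tens[OF X] 1 2 t by (simp add: HJ.foldA_GH)
  qed
  finally show ?thesis .
qed

text \<open>
  Foldings over \<open>G\<close> and over \<open>J\<close> can be exchanged by
  \<open>fold_fold_effect\<close>.
\<close>

lemma lft_right:
  assumes A: "A \<in> Obj D" and \<xi>: "\<xi> \<in> Homs D (GH.H.fO A) (TUnit D)"
  shows "GH_J.lft A (GH.G.fA \<xi>) = GH.G.fA (HJ.lft A \<xi>)"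
proof -
  define X where "X = (\<lambda>_::unit. A)"
  define xs where "xs = [()]"
  have X: "distinct xs" "\<forall>x\<in>set xs. X x \<in> Obj D" using A by (auto simp: X_def xs_def)
  have eq: "A = GH.G.tens X xs" using A by (simp add: X_def xs_def)
  let ?c = "\<lambda>(j, g, h, x). (g, h, j, x)" and ?e = "\<lambda>(g, j, h, x). (g, h, j, x)"
  let ?ghj = "gp (hp (jp xs))" and ?jgh = "map ?c (jp (gp (hp xs)))" and ?gjh = "gp (map lab_swap (jp (hp xs)))"
  let ?t = "tperm D (lab3 X)"
  have obj: "\<forall>p\<in>set ?ghj. lab3 X p \<in> Obj D" using X by auto
  have set: "set ?jgh = set ?ghj" "set ?gjh = set ?ghj" by (auto simp: image_iff)
  have d: "distinct ?ghj" "distinct ?jgh" "distinct ?gjh"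
    using X by (auto simp: distinct_map distinct_product inj_on_def)
  have r: "reord ?ghj ?jgh" "reord ?jgh ?gjh" "reord ?ghj ?gjh"
    using set d unfolding reord_def by metis+
  have oo: "\<forall>p\<in>set ?jgh. lab3 X p \<in> Obj D" using obj unfolding set .
  have \<xi>': "\<xi> \<in> Homs D (GH.G.tens (GH.H.lab X) (hp xs)) (TUnit D)"
    using \<xi> GH.H.foldO_tens[OF X(2)] eq by simp
  have dh: "distinct (hp xs)" "\<forall>p\<in>set (hp xs). GH.H.lab X p \<in> Obj D" using X by (auto simp: distinct_product)
  note j\<xi> = HJ.foldA_swap_typing[OF \<xi>[unfolded eq] X(2)]
  note rs = HJ.reord_swap(1)[OF X(1)]
  have o2: "\<forall>p\<in>set (hp (jp xs)). HJ.lab2 X p \<in> Obj D" using X by auto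
  have "HJ.H.fA (GH.G.fA \<xi>) = Cmp D (GH.G.fA (HJ.H.fA \<xi>)) (tperm D (GH.G.lab (HJ.H.lab (GH.H.lab X)))
      (map lab_swap (jp (gp (hp xs)))) (gp (jp (hp xs))))"
    by (rule GJ.fold_fold_effect[OF \<xi>' dh, symmetric])
  also have "tperm D (GH.G.lab (HJ.H.lab (GH.H.lab X))) (map lab_swap (jp (gp (hp xs)))) (gp (jp (hp xs)))
    = ?t (map ?e (map lab_swap (jp (gp (hp xs))))) (map ?e (gp (jp (hp xs))))"
    by (rule GH.G.tperm_relabel[symmetric])
      (use X in \<open>auto simp: reord_def distinct_product distinct_map inj_on_def HJ.comm_fobj\<close>)
  also have "map ?e (map lab_swap (jp (gp (hp xs)))) = ?jgh"
    by (simp add: case_prod_unfold lab_swap_def)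
  also have "map ?e (gp (jp (hp xs))) = ?gjh"
    by (simp add: product_map_right case_prod_unfold lab_swap_def)
  finally have ff: "HJ.H.fA (GH.G.fA \<xi>) = Cmp D (GH.G.fA (HJ.H.fA \<xi>)) (?t ?jgh ?gjh)" .
  have gj: "GH.G.fA (HJ.H.fA \<xi>) \<in> Arr D" "Dom D (GH.G.fA (HJ.H.fA \<xi>)) = GH.G.tens (lab3 X) ?gjh"
  proof -
    show "GH.G.fA (HJ.H.fA \<xi>) \<in> Arr D" using j\<xi> by simp
    have "\<forall>p\<in>set (map lab_swap (jp (hp xs))). HJ.lab2 X p \<in> Obj D" using X by auto
    then show "Dom D (GH.G.fA (HJ.H.fA \<xi>)) = GH.G.tens (lab3 X) ?gjh"
      using j\<xi> by (simp only: GH.G.foldA_typing GH.G.foldO_tens)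
  qed
  have "GH_J.lft A (GH.G.fA \<xi>) = Cmp D (HJ.H.fA (GH.G.fA \<xi>)) (?t ?ghj ?jgh)"
    unfolding GH_J.lft_def using reorder_GH_J[of xs X A] A by (simp add: X_def xs_def)
  also have "\<dots> = Cmp D (GH.G.fA (HJ.H.fA \<xi>)) (?t ?ghj ?gjh)"
    unfolding ff using gj GH.G.tperm_typing[OF r(1) obj] GH.G.tperm_typing[OF r(2) oo]
      GH.G.tperm_Cmp[OF r(1,2) obj] by simp
  also have "?t ?ghj ?gjh = GH.G.fA (tperm D (HJ.lab2 X) (hp (jp xs)) (map lab_swap (jp (hp xs))))"
    by (rule GH.G.foldA_tperm[OF rs o2, symmetric])
  also have "Cmp D (GH.G.fA (HJ.H.fA \<xi>)) \<dots> = GH.G.fA (HJ.lft A \<xi>)"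
    unfolding eq HJ.lft_tens[OF X]
    using j\<xi> GH.G.tperm_typing[OF rs o2] by (intro GH.G.foldA_Cmp[symmetric]) simp_all
  finally show ?thesis .
qed

end

section \<open>Equivariant functors\<close>

lemma env_imageI: "A \<in> Obj C \<Longrightarrow> \<xi> \<in> Xi A \<Longrightarrow> farr F \<xi> \<in> env_image C F Xi (fobj F A)"
  by (auto simp: env_image_def)

lemma env_imageE:
  assumes "\<xi> \<in> env_image C F Xi B"
  obtains A \<xi>0 where "A \<in> Obj C" "fobj F A = B" "\<xi>0 \<in> Xi A" "farr F \<xi>0 = \<xi>"
  using assms by (auto simp: env_image_def)

lemma (in smc_functor) farr_arr_inv_tperm:
  assumes "reord xs ys" "\<forall>x\<in>set xs. X x \<in> Obj C"
  shows "farr F (arr_inv C (tperm C X xs ys)) = arr_inv D (tperm D (\<lambda>x. fobj F (X x)) xs ys)"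
proof -
  have r: "reord ys xs" "\<forall>x\<in>set ys. X x \<in> Obj C" using assms by (auto simp: reord_def)
  show ?thesis
    using assms by (simp add: C.arr_inv_tperm D.arr_inv_tperm farr_tperm[OF r])
qed

locale equivariant_functor = smc_functor C D F + AC: smc_action C G Psi + AD: smc_action D G Psi'
  for C D :: "('o,'a) smc" and F and G :: "'g::linorder list monoid" and Psi Psi' +
  assumes equiv_fobj: "\<gamma> \<in> carrier G \<Longrightarrow> A \<in> Obj C \<Longrightarrow> fobj F (fobj (Psi \<gamma>) A) = fobj (Psi' \<gamma>) (fobj F A)"
    and equiv_farr: "\<gamma> \<in> carrier G \<Longrightarrow> f \<in> Arr C \<Longrightarrow> farr F (farr (Psi \<gamma>) f) = farr (Psi' \<gamma>) (farr F f)"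
begin

lemma fobj_foldO: "A \<in> Obj C \<Longrightarrow> fobj F (AC.fO A) = AD.fO (fobj F A)"
  unfolding foldO_def
  by (subst fobj_tens) (auto simp: equiv_fobj intro!: arg_cong[where f = "tensO_list D"])

lemma farr_foldA: "f \<in> Arr C \<Longrightarrow> farr F (AC.fA f) = AD.fA (farr F f)"
  unfolding foldA_def
  by (subst farr_tensA_list) (auto simp: equiv_farr intro!: arg_cong[where f = "tensA_list D"])

lemma farr_pimap:
  assumes AB: "A \<in> Obj C" "B \<in> Obj C"
  shows "farr F (pimap C G Psi A B) = pimap D G Psi' (fobj F A) (fobj F B)"
    "farr F (arr_inv C (pimap C G Psi A B)) = arr_inv D (pimap D G Psi' (fobj F A) (fobj F B))"
proof -
  define X where "X = (\<lambda>b. if b then A else B)"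
  let ?as = "[True]" and ?bs = "[False]"
  have X: "distinct (?as @ ?bs)" "\<forall>x\<in>set (?as @ ?bs). X x \<in> Obj C"
    "\<forall>x\<in>set (?as @ ?bs). fobj F (X x) \<in> Obj D"
    using AB by (auto simp: X_def)
  have eq: "A = C.tens X ?as" "B = C.tens X ?bs" "fobj F A = D.tens (\<lambda>b. fobj F (X b)) ?as"
    "fobj F B = D.tens (\<lambda>b. fobj F (X b)) ?bs"
    using AB by (simp_all add: X_def)
  note r = AC.reord_pimap[OF X(1)]
  have o: "\<forall>p\<in>set (AC.prd ?as @ AC.prd ?bs). AC.lab X p \<in> Obj C" using X by auto
  have cong: "tperm D (\<lambda>p. fobj F (AC.lab X p)) us vs = tperm D (AD.lab (\<lambda>b. fobj F (X b))) us vs"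
    if "set us \<subseteq> carrier G \<times> UNIV" "set vs \<subseteq> carrier G \<times> UNIV" for us vs
    by (rule D.tperm_cong) (use that AB in \<open>auto simp: equiv_fobj X_def\<close>)
  have s: "set (AC.prd ?as @ AC.prd ?bs) \<subseteq> carrier G \<times> UNIV" "set (AC.prd (?as @ ?bs)) \<subseteq> carrier G \<times> UNIV"
    by auto
  show "farr F (pimap C G Psi A B) = pimap D G Psi' (fobj F A) (fobj F B)"
    unfolding eq(3,4) AD.pimap_tens[OF X(1,3)] unfolding eq(1,2) AC.pimap_tens[OF X(1,2)] farr_tperm[OF r(1) o]
    by (rule cong[OF s])
  show "farr F (arr_inv C (pimap C G Psi A B)) = arr_inv D (pimap D G Psi' (fobj F A) (fobj F B))"
    unfolding eq(3,4) AD.pimap_tens[OF X(1,3)] unfolding eq(1,2) AC.pimap_tens[OF X(1,2)]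
      farr_arr_inv_tperm[OF r(1) o] cong[OF s] ..
qed

lemma farr_arr_inv_tau:
  assumes A: "A \<in> Obj C" and \<gamma>: "\<gamma> \<in> carrier G"
  shows "farr F (arr_inv C (tau C G Psi A \<gamma>)) = arr_inv D (tau D G Psi' (fobj F A) \<gamma>)"
proof -
  have r: "reord (elems G) (map (\<lambda>\<delta>. \<gamma> \<otimes>\<^bsub>G\<^esub> \<delta>) (elems G))"
    using AC.translate_carrier[OF \<gamma>] by (simp add: reord_def distinct_map)
  have "tperm D (\<lambda>\<delta>. fobj F (fobj (Psi \<delta>) A)) (elems G) (map (\<lambda>\<delta>. \<gamma> \<otimes>\<^bsub>G\<^esub> \<delta>) (elems G))
    = tau D G Psi' (fobj F A) \<gamma>"
    unfolding tau_def using A \<gamma> by (intro D.tperm_cong) (auto simp: equiv_fobj)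
  moreover have "farr F (arr_inv C (tau C G Psi A \<gamma>))
    = arr_inv D (tperm D (\<lambda>\<delta>. fobj F (fobj (Psi \<delta>) A)) (elems G) (map (\<lambda>\<delta>. \<gamma> \<otimes>\<^bsub>G\<^esub> \<delta>) (elems G)))"
    unfolding tau_def using A by (intro farr_arr_inv_tperm[OF r]) auto
  ultimately show ?thesis by simp
qed

lemma farr_Homs: "\<xi> \<in> Homs C (AC.fO A) (TUnit C) \<Longrightarrow> A \<in> Obj C \<Longrightarrow>
    farr F \<xi> \<in> Homs D (AD.fO (fobj F A)) (TUnit D)"
  by (auto simp: Homs_def fobj_foldO)

lemma farr_env_tens:
  assumes "\<xi> \<in> Homs C (AC.fO A) (TUnit C)" "\<zeta> \<in> Homs C (AC.fO B) (TUnit C)" "A \<in> Obj C" "B \<in> Obj C"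
  shows "farr F (env_tens C G Psi A B \<xi> \<zeta>)
    = env_tens D G Psi' (fobj F A) (fobj F B) (farr F \<xi>) (farr F \<zeta>)"
  using assms by (auto simp: env_tens_def Homs_def farr_pimap)

lemma farr_equiv_effect:
  assumes "AC.equiv_effect A \<xi>" shows "AD.equiv_effect (fobj F A) (farr F \<xi>)"
proof -
  have A: "A \<in> Obj C" and \<xi>: "\<xi> \<in> Homs C (AC.fO A) (TUnit C)"
    and eqv: "\<And>\<gamma>. \<gamma> \<in> carrier G \<Longrightarrow> farr (Psi \<gamma>) \<xi> = Cmp C \<xi> (arr_inv C (tau C G Psi A \<gamma>))"
    using assms by (auto simp: AC.equiv_effect_def)
  have arr: "\<xi> \<in> Arr C" "Dom C \<xi> = AC.fO A" using \<xi> by (auto simp: Homs_def)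
  have "farr (Psi' \<gamma>) (farr F \<xi>) = Cmp D (farr F \<xi>) (arr_inv D (tau D G Psi' (fobj F A) \<gamma>))"
    if \<gamma>: "\<gamma> \<in> carrier G" for \<gamma>
  proof -
    have xs: "distinct [()]" "\<forall>x\<in>set [()]. A \<in> Obj C" using A by auto
    have "arr_inv C (tau C G Psi A \<gamma>) = tperm C (AC.lab (\<lambda>_. A)) (AC.shift \<gamma> [()]) (AC.prd [()])"
      using AC.arr_inv_tau_tens[OF \<gamma> xs] A by simp
    moreover have "AC.fO A = C.tens (AC.lab (\<lambda>_. A)) (AC.prd [()])"
      using AC.foldO_tens[OF xs(2)] A by simp
    ultimately have t: "arr_inv C (tau C G Psi A \<gamma>) \<in> Arr C" "Cod C (arr_inv C (tau C G Psi A \<gamma>)) = AC.fO A"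
      using C.tperm_typing[OF AC.reord_shift(2)[OF \<gamma> xs(1)], of "AC.lab (\<lambda>_. A)"] A \<gamma> by auto
    have "farr (Psi' \<gamma>) (farr F \<xi>) = farr F (Cmp C \<xi> (arr_inv C (tau C G Psi A \<gamma>)))"
      using \<gamma> arr by (simp add: eqv flip: equiv_farr)
    then show ?thesis using arr t A \<gamma> by (simp add: farr_arr_inv_tau)
  qed
  then show ?thesis using farr_Homs[OF \<xi> A] A by (simp add: AD.equiv_effect_def)
qed

text \<open>
  Equivariant functors preserve \<open>\<pi>\<close> and \<open>\<tau>\<close>. The remaining
  condition can fail, because the image on the unit collects the effects of all objects that are
  mapped to the unit.
\<close>

lemma is_multi_env_image:
  assumes env: "is_multi_env C G Psi Xi"
    and unit: "env_image C F Xi (TUnit D) = {Idn D (TUnit D)}"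
  shows "is_multi_env D G Psi' (env_image C F Xi)"
proof -
  have eff: "AC.equiv_effect A \<xi>" if "\<xi> \<in> Xi A" "A \<in> Obj C" for A \<xi>
    using env that by (auto simp: is_multi_env_def AC.equiv_effect_def)
  have eff': "AD.equiv_effect B \<xi>" if "\<xi> \<in> env_image C F Xi B" for B \<xi>
    using that farr_equiv_effect[OF eff] by (auto simp: env_image_def)
  have "env_tens D G Psi' A B \<xi> \<zeta> \<in> env_image C F Xi (TensO D A B)"
    if \<xi>: "\<xi> \<in> env_image C F Xi A" and \<zeta>: "\<zeta> \<in> env_image C F Xi B" for A B \<xi> \<zeta>
  proof -
    from \<xi> obtain A0 \<xi>0 where 1: "A0 \<in> Obj C" "fobj F A0 = A" "\<xi>0 \<in> Xi A0" "\<xi> = farr F \<xi>0"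
      by (auto simp: env_image_def)
    from \<zeta> obtain B0 \<zeta>0 where 2: "B0 \<in> Obj C" "fobj F B0 = B" "\<zeta>0 \<in> Xi B0" "\<zeta> = farr F \<zeta>0"
      by (auto simp: env_image_def)
    have "env_tens C G Psi A0 B0 \<xi>0 \<zeta>0 \<in> Xi (TensO C A0 B0)"
      using env 1 2 by (auto simp: is_multi_env_def)
    moreover have "env_tens D G Psi' A B \<xi> \<zeta> = farr F (env_tens C G Psi A0 B0 \<xi>0 \<zeta>0)"
      using eff[OF 1(3,1)] eff[OF 2(3,1)] 1 2 by (simp add: farr_env_tens AC.equiv_effect_def)
    ultimately show ?thesis using 1 2 by (auto simp: env_image_def intro!: exI[of _ "TensO C A0 B0"])
  qed
  moreover have "env_image C F Xi A = {}" if "A \<notin> Obj D" for A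
    using that by (auto simp: env_image_def)
  ultimately show ?thesis
    using eff' unit unfolding is_multi_env_def AD.equiv_effect_def by blast
qed

end

section \<open>Products of multi-environment structures\<close>

context two_actions begin

abbreviation envp where "envp Xi Xi' \<equiv> env_prod D G Psi Xi H Psi' Xi'"

lemma envp_left: "A \<in> Obj D \<Longrightarrow> \<xi> \<in> Xi A \<Longrightarrow> lft A \<xi> \<in> envp Xi Xi' A"
  unfolding lft_def reorder_GH_def env_prod_def by (auto intro: env_prod_rel.left)

lemma envp_right: "A \<in> Obj D \<Longrightarrow> \<xi> \<in> Xi' A \<Longrightarrow> G.fA \<xi> \<in> envp Xi Xi' A"
  unfolding env_prod_def by (auto intro: env_prod_rel.right)

lemma envp_tens: "A \<in> Obj D \<Longrightarrow> B \<in> Obj D \<Longrightarrow> \<xi> \<in> envp Xi Xi' A \<Longrightarrow> \<zeta> \<in> envp Xi Xi' B \<Longrightarrow>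
    env_tens D (gprod G H) Pact A B \<xi> \<zeta> \<in> envp Xi Xi' (TensO D A B)"
  unfolding env_prod_def by (auto intro: env_prod_rel.tens)

lemma envp_induct [consumes 1, case_names left right tens]:
  assumes "\<xi> \<in> envp Xi Xi' A"
    and "\<And>A \<xi>. A \<in> Obj D \<Longrightarrow> \<xi> \<in> Xi A \<Longrightarrow> S A (lft A \<xi>)"
    and "\<And>A \<xi>. A \<in> Obj D \<Longrightarrow> \<xi> \<in> Xi' A \<Longrightarrow> S A (G.fA \<xi>)"
    and "\<And>A B \<xi> \<zeta>. A \<in> Obj D \<Longrightarrow> B \<in> Obj D \<Longrightarrow> \<xi> \<in> envp Xi Xi' A \<Longrightarrow> S A \<xi> \<Longrightarrow>
      \<zeta> \<in> envp Xi Xi' B \<Longrightarrow> S B \<zeta> \<Longrightarrow> S (TensO D A B) (env_tens D (gprod G H) Pact A B \<xi> \<zeta>)"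
  shows "S A \<xi>"
  using assms(1) unfolding env_prod_def mem_Collect_eq
proof (induction rule: env_prod_rel.induct)
  case (left A \<xi>)
  then show ?case using assms(2) unfolding lft_def reorder_GH_def by blast
qed (use assms(3,4) in \<open>auto simp: env_prod_def\<close>)

lemma lft_Homs:
  assumes "\<xi> \<in> Homs D (G.fO A) (TUnit D)" and A: "A \<in> Obj D"
  shows "lft A \<xi> \<in> Homs D (GH.fO A) (TUnit D)"
proof -
  define X where "X = (\<lambda>_::unit. A)"
  have xs: "distinct [()]" "\<forall>x\<in>set [()]. X x \<in> Obj D" using A by (auto simp: X_def)
  have eq: "A = G.tens X [()]" using A by (simp add: X_def)
  have "\<forall>p\<in>set (G.prd (H.prd [()])). lab2 X p \<in> Obj D" using xs by auto
  then show ?thesis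
    using foldA_swap_typing[OF assms(1)[unfolded eq] xs(2)] G.tperm_typing[OF reord_swap(1)[OF xs(1)], of "lab2 X"]
    unfolding eq lft_tens[OF xs] foldO_GH_tens[OF xs(2)] by (simp add: Homs_def)
qed

lemma right_Homs:
  "\<xi> \<in> Homs D (H.fO A) (TUnit D) \<Longrightarrow> A \<in> Obj D \<Longrightarrow> G.fA \<xi> \<in> Homs D (GH.fO A) (TUnit D)"
  by (auto simp: Homs_def foldO_GH)

lemma envp_Homs:
  assumes "\<xi> \<in> envp Xi Xi' A"
    and "\<And>A. A \<in> Obj D \<Longrightarrow> Xi A \<subseteq> Homs D (G.fO A) (TUnit D)"
    and "\<And>A. A \<in> Obj D \<Longrightarrow> Xi' A \<subseteq> Homs D (H.fO A) (TUnit D)"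
  shows "A \<in> Obj D" "\<xi> \<in> Homs D (GH.fO A) (TUnit D)"
proof -
  from assms have "A \<in> Obj D \<and> \<xi> \<in> Homs D (GH.fO A) (TUnit D)"
  proof (induction rule: envp_induct)
    case (left A \<xi>)
    then show ?case using lft_Homs by blast
  next
    case (right A \<xi>)
    then show ?case using right_Homs by blast
  next
    case (tens A B \<xi> \<zeta>)
    then show ?case by (auto intro!: GH.env_tens_Homs)
  qed
  then show "A \<in> Obj D" "\<xi> \<in> Homs D (GH.fO A) (TUnit D)" by auto
qed

text \<open>
  Equivariance of effects is inherited by folding and by tensor products. The effects on the unit
  are a hypothesis, because the unit may be a tensor product of nontrivial objects, whose effects
  then contribute to it.
\<close>

lemma is_multi_env_envp:
  assumes Xi: "is_multi_env D G Psi Xi" and Xi': "is_multi_env D H Psi' Xi'"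
    and unit: "envp Xi Xi' (TUnit D) = {Idn D (TUnit D)}"
  shows "is_multi_env D (gprod G H) Pact (envp Xi Xi')"
proof -
  have eff: "GH.equiv_effect A \<xi>" if "\<xi> \<in> envp Xi Xi' A" for A \<xi>
    using that
  proof (induction rule: envp_induct)
    case (left A \<xi>)
    with Xi show ?case by (intro equiv_effect_left) (auto simp: G.equiv_effect_def is_multi_env_def)
  next
    case (right A \<xi>)
    with Xi' show ?case by (intro equiv_effect_right) (auto simp: H.equiv_effect_def is_multi_env_def)
  next
    case (tens A B \<xi> \<zeta>)
    then show ?case by (intro GH.equiv_effect_env_tens)
  qed
  then show ?thesis
    unfolding is_multi_env_def using unit envp_tens[of _ _ _ Xi Xi']
    by (auto simp: GH.equiv_effect_def)
qed

end

locale equivariant_functor2 = two_actions C G H Psi Phi + D: two_actions D G H Psi' Phi'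
  + FG: equivariant_functor C D F G Psi Psi' + FH: equivariant_functor C D F H Phi Phi'
  for C D :: "('o,'a) smc" and F and G H :: "'g::linorder list monoid" and Psi Phi Psi' Phi'
begin

sublocale FGH: equivariant_functor C D F "gprod G H" Pact D.Pact
  by unfold_locales
    (auto elim!: gprod_memE simp: FG.equiv_fobj FH.equiv_fobj FG.equiv_farr FH.equiv_farr)

text \<open>
  An equivariant functor commutes with folding and with the reordering of factors.
\<close>

lemma farr_lft:
  assumes A: "A \<in> Obj C" and \<xi>: "\<xi> \<in> Homs C (G.fO A) (TUnit C)"
  shows "farr F (lft A \<xi>) = D.lft (fobj F A) (farr F \<xi>)"
proof -
  define X where "X = (\<lambda>_::nat. A)"
  have xs: "distinct [0]" "\<forall>x\<in>set [0]. X x \<in> Obj C" "\<forall>x\<in>set [0]. fobj F (X x) \<in> Obj D"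
    using A by (auto simp: X_def)
  have eq: "A = G.tens X [0]" "fobj F A = D.G.tens (\<lambda>x. fobj F (X x)) [0]" using A by (simp_all add: X_def)
  have o: "\<forall>p\<in>set (G.prd (H.prd [0])). lab2 X p \<in> Obj C" using xs by auto
  note f = foldA_swap_typing[OF \<xi>[unfolded eq] xs(2)]
  note r = reord_swap(1)[OF xs(1)]
  have "farr F (lft A \<xi>) = Cmp D (farr F (H.fA \<xi>)) (tperm D (\<lambda>p. fobj F (lab2 X p))
    (G.prd (H.prd [0])) (map lab_swap (H.prd (G.prd [0]))))"
    unfolding eq(1) lft_tens[OF xs(1,2)] using f G.tperm_typing[OF r o]
    by (simp add: FG.farr_tperm[OF r o] del: List.product.simps)
  also have "tperm D (\<lambda>p. fobj F (lab2 X p)) (G.prd (H.prd [0])) (map lab_swap (H.prd (G.prd [0])))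
    = tperm D (D.lab2 (\<lambda>x. fobj F (X x))) (G.prd (H.prd [0])) (map lab_swap (H.prd (G.prd [0])))"
    by (rule D.G.tperm_cong) (use A in \<open>auto simp: X_def FG.equiv_fobj FH.equiv_fobj\<close>)
  also have "farr F (H.fA \<xi>) = D.H.fA (farr F \<xi>)" using \<xi> by (auto simp: Homs_def FH.farr_foldA)
  finally show ?thesis unfolding eq(2) D.lft_tens[OF xs(1,3)] .
qed

lemma env_image_envp:
  assumes Xi: "\<And>A. A \<in> Obj C \<Longrightarrow> Xi A \<subseteq> Homs C (G.fO A) (TUnit C)"
    and Xi': "\<And>A. A \<in> Obj C \<Longrightarrow> Xi' A \<subseteq> Homs C (H.fO A) (TUnit C)"
  shows "env_image C F (envp Xi Xi') = D.envp (env_image C F Xi) (env_image C F Xi')"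
proof (intro ext equalityI subsetI)
  have Xi_Homs: "\<xi> \<in> Homs C (G.fO A) (TUnit C)" if "A \<in> Obj C" "\<xi> \<in> Xi A" for A \<xi>
    using Xi that by blast
  have Xi'_Homs: "\<xi> \<in> Homs C (H.fO A) (TUnit C)" if "A \<in> Obj C" "\<xi> \<in> Xi' A" for A \<xi>
    using Xi' that by blast
  have Homs: "\<xi> \<in> Homs C (GH.fO A) (TUnit C)" if "\<xi> \<in> envp Xi Xi' A" for A \<xi>
    using envp_Homs(2)[OF that] Xi Xi' by blast
  have fwd: "farr F \<xi> \<in> D.envp (env_image C F Xi) (env_image C F Xi') (fobj F A)"
    if "\<xi> \<in> envp Xi Xi' A" for A \<xi>
    using that
  proof (induction rule: envp_induct)
    case (left A \<xi>)
    show ?case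
      unfolding farr_lft[OF left(1) Xi_Homs[OF left]]
      using left by (intro D.envp_left env_imageI) simp_all
  next
    case (right A \<xi>)
    then have "farr F (G.fA \<xi>) = D.G.fA (farr F \<xi>)"
      using Xi'_Homs[OF right] by (intro FG.farr_foldA) (simp add: Homs_def)
    then show ?case using right by (auto intro!: D.envp_right env_imageI)
  next
    case (tens A B \<xi> \<zeta>)
    show ?case
      unfolding FGH.farr_env_tens[OF Homs[OF tens.hyps(3)] Homs[OF tens.hyps(4)] tens.hyps(1,2)]
        FG.fobj_TensO[OF tens.hyps(1,2)]
      by (rule D.envp_tens) (use tens in simp_all)
  qed
  show "\<xi> \<in> D.envp (env_image C F Xi) (env_image C F Xi') B" if "\<xi> \<in> env_image C F (envp Xi Xi') B" for B \<xi>
    using that fwd by (auto elim!: env_imageE)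
  show "\<xi> \<in> env_image C F (envp Xi Xi') B" if "\<xi> \<in> D.envp (env_image C F Xi) (env_image C F Xi') B" for B \<xi>
    using that
  proof (induction rule: D.envp_induct)
    case (left B \<xi>)
    from left(2) obtain A \<xi>0 where A: "A \<in> Obj C" "fobj F A = B" "\<xi>0 \<in> Xi A" "farr F \<xi>0 = \<xi>"
      by (rule env_imageE)
    show ?case
      unfolding A(2,4)[symmetric] farr_lft[OF A(1) Xi_Homs[OF A(1,3)], symmetric]
      by (intro env_imageI A(1) envp_left[where Xi = Xi] A(3))
  next
    case (right B \<xi>)
    from right(2) obtain A \<xi>0 where A: "A \<in> Obj C" "fobj F A = B" "\<xi>0 \<in> Xi' A" "farr F \<xi>0 = \<xi>"
      by (rule env_imageE)
    have "\<xi>0 \<in> Arr C" using Xi'_Homs[OF A(1,3)] by (simp add: Homs_def)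
    then show ?case
      unfolding A(2,4)[symmetric] using env_imageI[where F = F and Xi = "envp Xi Xi'", OF A(1) envp_right[where Xi' = Xi' and Xi = Xi, OF A(1,3)]]
      by (simp only: FG.farr_foldA)
  next
    case (tens B B' \<xi> \<zeta>)
    from tens.IH(1) obtain A \<xi>0 where A: "A \<in> Obj C" "fobj F A = B" "\<xi>0 \<in> envp Xi Xi' A" "farr F \<xi>0 = \<xi>"
      by (rule env_imageE)
    from tens.IH(2) obtain A' \<zeta>0 where A': "A' \<in> Obj C" "fobj F A' = B'" "\<zeta>0 \<in> envp Xi Xi' A'" "farr F \<zeta>0 = \<zeta>"
      by (rule env_imageE)
    show ?case
      unfolding A(2,4)[symmetric] A'(2,4)[symmetric]
        FGH.farr_env_tens[OF Homs[OF A(3)] Homs[OF A'(3)] A(1) A'(1), symmetric]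
        FG.fobj_TensO[OF A(1) A'(1), symmetric]
      by (rule env_imageI) (use A A' in \<open>auto intro!: envp_tens\<close>)
  qed
qed

end

context three_actions begin

text \<open>
  Both sides are closures under tensor products of effects of one action folded over the other two.
  The three kinds of generators are identified by \<open>lft_lft\<close>, \<open>lft_right\<close>
  and \<open>foldA_GH\<close>; effects that are already tensor products in the inner structure are
  handled by \<open>env_tens_left\<close> and \<open>env_tens_right\<close>.
\<close>

lemma envp_assoc:
  assumes Xi: "\<And>A. A \<in> Obj D \<Longrightarrow> Xi A \<subseteq> Homs D (GH.G.fO A) (TUnit D)"
    and Xi': "\<And>A. A \<in> Obj D \<Longrightarrow> Xi' A \<subseteq> Homs D (GH.H.fO A) (TUnit D)"
    and Xi'': "\<And>A. A \<in> Obj D \<Longrightarrow> Xi'' A \<subseteq> Homs D (HJ.H.fO A) (TUnit D)"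
  shows "GH_J.envp (GH.envp Xi Xi') Xi'' = G_HJ.envp Xi (HJ.envp Xi' Xi'')"
proof (intro ext equalityI subsetI)
  \<comment> \<open>strict associativity of \<open>gprod\<close>: effects are tensored in the same way on both sides\<close>
  have tens_eq: "env_tens D (gprod (gprod G H) J) GH_J.Pact = env_tens D (gprod G (gprod H J)) G_HJ.Pact"
    by (simp add: gprod_assoc act_prod_assoc)
  have fO_eq: "foldO D (gprod (gprod G H) J) GH_J.Pact = foldO D (gprod G (gprod H J)) G_HJ.Pact"
    by (simp add: gprod_assoc act_prod_assoc)
  have left_left: "GH_J.lft A \<zeta> \<in> G_HJ.envp Xi (HJ.envp Xi' Xi'') A" if "\<zeta> \<in> GH.envp Xi Xi' A" for A \<zeta>
    using that
  proof (induction rule: GH.envp_induct)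
    case (left A \<xi>)
    with Xi show ?case by (subst lft_lft) (auto intro!: G_HJ.envp_left)
  next
    case (right A \<xi>)
    with Xi' show ?case by (subst lft_right) (auto intro!: G_HJ.envp_right HJ.envp_left)
  next
    case (tens A B \<xi> \<zeta>)
    then have "GH_J.lft (TensO D A B) (env_tens D (gprod G H) GH.Pact A B \<xi> \<zeta>)
      = env_tens D (gprod (gprod G H) J) GH_J.Pact A B (GH_J.lft A \<xi>) (GH_J.lft B \<zeta>)"
      using GH.envp_Homs[of _ Xi Xi'] Xi Xi' by (intro GH_J.env_tens_left) blast+
    then show ?case using tens unfolding tens_eq by (auto intro!: G_HJ.envp_tens)
  qed
  show "\<xi> \<in> G_HJ.envp Xi (HJ.envp Xi' Xi'') A" if "\<xi> \<in> GH_J.envp (GH.envp Xi Xi') Xi'' A" for A \<xi>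
    using that
  proof (induction rule: GH_J.envp_induct)
    case (left A \<xi>)
    then show ?case by (intro left_left)
  next
    case (right A \<xi>)
    with Xi'' have "GH.GH.fA \<xi> = GH.G.fA (GH.H.fA \<xi>)" by (intro GH.foldA_GH) (auto simp: Homs_def)
    with right show ?case by (auto intro!: G_HJ.envp_right HJ.envp_right)
  next
    case (tens A B \<xi> \<zeta>)
    then show ?case unfolding tens_eq by (auto intro!: G_HJ.envp_tens)
  qed
  have right_right: "GH.G.fA \<zeta> \<in> GH_J.envp (GH.envp Xi Xi') Xi'' A" if "\<zeta> \<in> HJ.envp Xi' Xi'' A" for A \<zeta>
    using that
  proof (induction rule: HJ.envp_induct)
    case (left A \<xi>)
    with Xi' show ?case by (subst lft_right[symmetric]) (auto intro!: GH_J.envp_left GH.envp_right)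
  next
    case (right A \<xi>)
    with Xi'' have "GH.GH.fA \<xi> = GH.G.fA (GH.H.fA \<xi>)" by (intro GH.foldA_GH) (auto simp: Homs_def)
    with right show ?case using GH_J.envp_right[of A \<xi> Xi''] by auto
  next
    case (tens A B \<xi> \<zeta>)
    then have "GH.G.fA (env_tens D (gprod H J) HJ.Pact A B \<xi> \<zeta>)
      = env_tens D (gprod G (gprod H J)) G_HJ.Pact A B (GH.G.fA \<xi>) (GH.G.fA \<zeta>)"
      using HJ.envp_Homs[of _ Xi' Xi''] Xi' Xi'' by (intro G_HJ.env_tens_right) blast+
    then show ?case using tens unfolding tens_eq[symmetric] by (auto intro!: GH_J.envp_tens)
  qed
  show "\<xi> \<in> GH_J.envp (GH.envp Xi Xi') Xi'' A" if "\<xi> \<in> G_HJ.envp Xi (HJ.envp Xi' Xi'') A" for A \<xi>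
    using that
  proof (induction rule: G_HJ.envp_induct)
    case (left A \<xi>)
    with Xi show ?case by (subst lft_lft[symmetric]) (auto intro!: GH_J.envp_left GH.envp_left)
  next
    case (right A \<xi>)
    then show ?case by (intro right_right)
  next
    case (tens A B \<xi> \<zeta>)
    then show ?case unfolding tens_eq[symmetric] by (auto intro!: GH_J.envp_tens)
  qed
qed

end

section \<open>The trivial action\<close>

abbreviation triv :: "('o,'a) smc \<Rightarrow> 'g list \<Rightarrow> ('o,'a) smcf" where
  "triv D \<equiv> act_triv SMCs D"

context sym_mon_cat begin

lemma triv_apply [simp]:
  "A \<in> Obj D \<Longrightarrow> fobj (triv D []) A = A" "f \<in> Arr D \<Longrightarrow> farr (triv D []) f = f"
  by (simp_all add: act_triv_def SMCs_def smcf_id_def smcf_restrict_def)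

lemma arr_inv_Idn [simp]: "A \<in> Obj D \<Longrightarrow> arr_inv D (\<i> A) = \<i> A"
  by (rule arr_inv_eqI) simp_all

lemma is_smc_functor_id: "is_smc_functor D D (smcf_id D)"
  by (simp add: is_smc_functor_def smcf_id_def smcf_restrict_def)

lemma triv_action: "smc_action D gtriv (triv D)"
  by unfold_locales (simp_all add: is_smc_functor_id, simp add: act_triv_def SMCs_def is_smc_functor_id)

lemma fold_triv [simp]:
  "A \<in> Obj D \<Longrightarrow> foldO D gtriv (triv D) A = A" "f \<in> Arr D \<Longrightarrow> foldA D gtriv (triv D) f = f"
  by (simp_all add: foldO_def foldA_def)

lemma pimap_triv [simp]:
  assumes "A \<in> Obj D" "B \<in> Obj D"
  shows "pimap D gtriv (triv D) A B = \<i> (A \<diamondop> B)" "arr_inv D (pimap D gtriv (triv D) A B) = \<i> (A \<diamondop> B)"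
proof -
  show 1: "pimap D gtriv (triv D) A B = \<i> (A \<diamondop> B)"
    unfolding pimap_def using assms by (simp add: front_def)
  show "arr_inv D (pimap D gtriv (triv D) A B) = \<i> (A \<diamondop> B)"
    unfolding 1 using assms by simp
qed

lemma tau_triv:
  assumes "A \<in> Obj D" shows "arr_inv D (tau D gtriv (triv D) A []) = \<i> A" (is "arr_inv D ?t = _")
proof -
  have "?t = \<i> A" unfolding tau_def using assms by (simp add: front_def)
  then show ?thesis using assms by simp
qed

lemma is_multi_env_triv: "is_multi_env D gtriv (triv D) (env_triv D)"
  by (auto simp: is_multi_env_def env_triv_def Homs_def env_tens_def tau_triv)

lemma fld_triv: "fld D gtriv (triv D) = smcf_id D"
  by (auto simp: fld_def smcf_id_def smcf_restrict_def restrict_def fun_eq_iff)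

text \<open>
  The only effect that can be discarded is the identity of the unit.
\<close>

lemma cpm_arrs_triv: "cpm_arrs D gtriv (triv D) (env_triv D) = Arr D"
proof (intro equalityI subsetI)
  fix f assume "f \<in> cpm_arrs D gtriv (triv D) (env_triv D)"
  then show "f \<in> Arr D"
    by induction (auto simp: env_triv_def split: if_splits)
next
  fix f assume "f \<in> Arr D"
  then show "f \<in> cpm_arrs D gtriv (triv D) (env_triv D)"
    using cpm_arrs.folded[of f D gtriv "triv D" "env_triv D"] by simp
qed

lemma pinned:
  "Dom D \<in> extensional (Arr D)" "Cod D \<in> extensional (Arr D)" "Idn D \<in> extensional (Obj D)"
  "\<not> (f \<in> Arr D \<and> g \<in> Arr D \<and> Cod D f = Dom D g) \<Longrightarrow> Cmp D g f = undefined"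
  "\<not> (A \<in> Obj D \<and> B \<in> Obj D) \<Longrightarrow> TensO D A B = undefined"
  "\<not> (A \<in> Obj D \<and> B \<in> Obj D) \<Longrightarrow> Sym D A B = undefined"
  "\<not> (f \<in> Arr D \<and> g \<in> Arr D) \<Longrightarrow> TensA D f g = undefined"
  using smc_D[unfolded is_smc_def smc_pinned_def, THEN conjunct1] by auto

lemma cpm_triv: "cpm D gtriv (triv D) (env_triv D) = D"
proof -
  have u: "unfoldO D gtriv (triv D) A = A" if "A \<in> Obj D" for A
    using that the_inv_into_f_f[of "foldO D gtriv (triv D)" "Obj D" A]
    by (simp add: unfoldO_def inj_on_def)
  have ob: "foldO D gtriv (triv D) ` Obj D = Obj D" by force
  show ?thesis
    unfolding cpm_def Let_def cpm_arrs_triv ob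
    by (rule smc.equality) (auto simp: u pinned extensional_restrict fun_eq_iff)
qed

end

lemma gfst_gtriv [simp]: "gfst gtriv w = []" and gsnd_gtriv [simp]: "gsnd gtriv w = w"
  by (simp_all add: gfst_def gsnd_def)

lemma triv_Nil: "triv D [] = smcf_id D"
  by (simp add: act_triv_def SMCs_def)

lemma act_prod_triv:
  assumes G: "smc_action D G Psi" and extn: "Psi \<in> extensional (carrier G)"
  shows "act_prod SMCs D G Psi gtriv (triv D) = Psi" "act_prod SMCs D gtriv (triv D) G Psi = Psi"
proof -
  interpret smc_action D G Psi by fact
  have "smcf_comp D (Psi w) (smcf_id D) = Psi w \<and> smcf_comp D (smcf_id D) (Psi w) = Psi w"
    if w: "w \<in> carrier G" for w
  proof -
    have "fobj (Psi w) \<in> extensional (Obj D)" "farr (Psi w) \<in> extensional (Arr D)"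
      "\<forall>A\<in>Obj D. fobj (Psi w) A \<in> Obj D" "\<forall>f\<in>Arr D. farr (Psi w) f \<in> Arr D"
      using act_functor[OF w] by (auto simp: is_smc_functor_def PiE_iff)
    then show ?thesis
      by (auto simp: smcf_comp_def smcf_id_def smcf_restrict_def restrict_def extensional_def fun_eq_iff
        intro!: smcf.equality)
  qed
  moreover have "gfst G w = w" "gsnd G w = []" if "w \<in> carrier G" for w
    using that gfst_append[of G w "[]"] gsnd_append[of G w "[]"] by simp_all
  moreover have "ccomp SMCs D D D F' F = smcf_comp D F' F" for F F' by (simp add: SMCs_def)
  ultimately show "act_prod SMCs D G Psi gtriv (triv D) = Psi" "act_prod SMCs D gtriv (triv D) G Psi = Psi"
    using extn fab by (auto simp: act_prod_def gprod_gtriv fun_eq_iff extensional_def triv_Nil)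
qed

context smc_action begin

lemma triv_right: "two_actions D G gtriv Psi (triv D)"
proof -
  interpret T: smc_action D gtriv "triv D" by (rule triv_action)
  show ?thesis by unfold_locales simp_all
qed

lemma triv_left: "two_actions D gtriv G (triv D) Psi"
  using triv_right by (rule two_actions.swap)

text \<open>
  The trivial structure contributes only the identity of the unit, which \<open>Xi\<close> contains
  already.
\<close>

lemma env_prod_triv_right:
  assumes env: "is_multi_env D G Psi Xi" and extn: "Psi \<in> extensional (carrier G)"
  shows "env_prod D G Psi Xi gtriv (triv D) (env_triv D) = Xi"
proof -
  interpret T: two_actions D G gtriv Psi "triv D" by (rule triv_right)
  note eqs = gprod_gtriv(1)[OF fab] act_prod_triv(1)[OF smc_action_axioms extn]
  have Obj: "A \<in> Obj D" "\<xi> \<in> Homs D (fO A) \<I>" if "\<xi> \<in> Xi A" for A \<xi>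
    using env that unfolding is_multi_env_def by blast+
  have lft: "T.lft A \<xi> = \<xi>" if "\<xi> \<in> Xi A" for A \<xi>
  proof -
    have "T.reorder_GH A = \<i> (fO A)"
      unfolding T.reorder_GH_def eqs using Obj[OF that] by (simp add: foldO_def)
    then show ?thesis unfolding T.lft_def using Obj[OF that] by (simp add: Homs_def)
  qed
  show ?thesis
  proof (intro ext equalityI subsetI)
    show "\<xi> \<in> Xi A" if "\<xi> \<in> T.envp Xi (env_triv D) A" for A \<xi>
      using that
    proof (induction rule: T.envp_induct)
      case (right A \<xi>)
      then have "A = \<I>" "\<xi> = \<i> \<I>" by (auto simp: env_triv_def split: if_splits)
      then show ?case using env by (simp add: is_multi_env_def)
    next
      case (tens A B \<xi> \<zeta>)
      then show ?case unfolding eqs using env unfolding is_multi_env_def by blast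
    qed (simp add: lft)
    show "\<xi> \<in> T.envp Xi (env_triv D) A" if "\<xi> \<in> Xi A" for A \<xi>
      using T.envp_left[of A \<xi> Xi] Obj[OF that] that by (simp add: lft)
  qed
qed

lemma env_prod_triv_left:
  assumes env: "is_multi_env D G Psi Xi" and extn: "Psi \<in> extensional (carrier G)"
  shows "env_prod D gtriv (triv D) (env_triv D) G Psi Xi = Xi"
proof -
  interpret T: two_actions D gtriv G "triv D" Psi by (rule triv_left)
  note eqs = gprod_gtriv(2)[OF fab] act_prod_triv(2)[OF smc_action_axioms extn]
  have Obj: "A \<in> Obj D" "\<xi> \<in> Homs D (fO A) \<I>" if "\<xi> \<in> Xi A" for A \<xi>
    using env that unfolding is_multi_env_def by blast+
  show ?thesis
  proof (intro ext equalityI subsetI)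
    show "\<xi> \<in> Xi A" if "\<xi> \<in> T.envp (env_triv D) Xi A" for A \<xi>
      using that
    proof (induction rule: T.envp_induct)
      case (left A \<xi>)
      then have A: "A = \<I>" "\<xi> = \<i> \<I>" by (auto simp: env_triv_def split: if_splits)
      have "T.reorder_GH A = \<i> (fO A)"
        unfolding T.reorder_GH_def eqs using left by (simp add: foldO_def)
      then show ?case unfolding T.lft_def using env A by (simp add: is_multi_env_def)
    next
      case (right A \<xi>)
      then show ?case using Obj by (simp add: Homs_def)
    next
      case (tens A B \<xi> \<zeta>)
      then show ?case unfolding eqs using env unfolding is_multi_env_def by blast
    qed
    show "\<xi> \<in> T.envp (env_triv D) Xi A" if "\<xi> \<in> Xi A" for A \<xi>
      using T.envp_right[of A \<xi> Xi] Obj[OF that] that by (simp add: Homs_def)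
  qed
qed

end

section \<open>Iterating the CPM construction\<close>

lemma fld_simps [simp]:
  "A \<in> Obj D \<Longrightarrow> fobj (fld D G Psi) A = foldO D G Psi A"
  "f \<in> Arr D \<Longrightarrow> farr (fld D G Psi) f = foldA D G Psi f"
  by (simp_all add: fld_def smcf_restrict_def)

lemma Obj_cpm: "Obj (cpm D G Psi Xi) = foldO D G Psi ` Obj D"
  and Arr_cpm: "Arr (cpm D G Psi Xi) = cpm_arrs D G Psi Xi"
  by (simp_all add: cpm_def Let_def)

text \<open>
  The generators of the CPM category that discard the first component of a tensor product.
\<close>

definition disc where
  "disc D G Psi A B \<xi> = Cmp D (TensA D \<xi> (Idn D (foldO D G Psi B))) (arr_inv D (pimap D G Psi A B))"

context smc_action begin

lemma disc_typing [simp]: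
  assumes "\<xi> \<in> Homs D (fO A) \<I>" "A \<in> Obj D" "B \<in> Obj D"
  shows "disc D G Psi A B \<xi> \<in> Arr D" "Dom D (disc D G Psi A B \<xi>) = fO (A \<diamondop> B)"
    "Cod D (disc D G Psi A B \<xi>) = fO B"
  using assms by (simp_all add: disc_def Homs_def)

lemma cpm_arrs_sub:
  assumes "\<And>A. A \<in> Obj D \<Longrightarrow> Xi A \<subseteq> Homs D (fO A) \<I>"
  shows "cpm_arrs D G Psi Xi \<subseteq> Arr D"
proof
  fix f assume "f \<in> cpm_arrs D G Psi Xi"
  then show "f \<in> Arr D"
  proof induction
    case (discard A B \<xi>)
    then show ?case using disc_typing(1)[of \<xi> A B] assms by (auto simp: disc_def)
  qed auto
qed

text \<open>
  Both composites separate the factors of the three objects.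
\<close>

lemma arr_inv_pimap_assoc:
  assumes ABC: "A \<in> Obj D" "B \<in> Obj D" "C \<in> Obj D"
  shows "(\<i> (fO A) \<star> arr_inv D (pimap D G Psi B C)) \<bullet> arr_inv D (pimap D G Psi A (B \<diamondop> C))
    = (arr_inv D (pimap D G Psi A B) \<star> \<i> (fO C)) \<bullet> arr_inv D (pimap D G Psi (A \<diamondop> B) C)"
proof -
  \<comment> \<open>a label for each of the three objects\<close>
  define X where "X = (\<lambda>n::nat. if n = 0 then A else if n = 1 then B else C)"
  let ?a = "[0::nat]" and ?b = "[1::nat]" and ?c = "[2::nat]"
  have eq: "A = tens X ?a" "B = tens X ?b" "C = tens X ?c" "A \<diamondop> B = tens X (?a @ ?b)" "B \<diamondop> C = tens X (?b @ ?c)"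
    using ABC by (simp_all add: X_def)
  have X [simp]: "X n \<in> Obj D" for n using ABC by (simp add: X_def)
  have o [simp]: "\<forall>p\<in>set (prd xs). lab X p \<in> Obj D" for xs by auto
  let ?t = "tperm D (lab X)" and ?P = "prd ?a @ prd ?b @ prd ?c"
  have r: "reord (prd (?a @ ?b @ ?c)) (prd ?a @ prd (?b @ ?c))" "reord (prd ?a @ prd (?b @ ?c)) ?P"
    "reord (prd (?a @ ?b @ ?c)) (prd (?a @ ?b) @ prd ?c)" "reord (prd (?a @ ?b) @ prd ?c) ?P"
    "reord (prd (?b @ ?c)) (prd ?b @ prd ?c)" "reord (prd (?a @ ?b)) (prd ?a @ prd ?b)"
    "reord (prd ?a) (prd ?a)" "reord (prd ?c) (prd ?c)"
    by (auto simp: reord_def distinct_product)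
  have d: "distinct (?b @ ?c)" "distinct (?a @ ?b @ ?c)" "distinct (?a @ ?b)" "distinct ((?a @ ?b) @ ?c)"
    by auto
  have p: "arr_inv D (pimap D G Psi B C) = ?t (prd (?b @ ?c)) (prd ?b @ prd ?c)"
    "arr_inv D (pimap D G Psi A (B \<diamondop> C)) = ?t (prd (?a @ ?b @ ?c)) (prd ?a @ prd (?b @ ?c))"
    "arr_inv D (pimap D G Psi A B) = ?t (prd (?a @ ?b)) (prd ?a @ prd ?b)"
    "arr_inv D (pimap D G Psi (A \<diamondop> B) C) = ?t (prd ((?a @ ?b) @ ?c)) (prd (?a @ ?b) @ prd ?c)"
    unfolding eq(4,5) unfolding eq(1-3) by (rule arr_inv_pimap_tens; simp)+
  have i: "\<i> (fO A) = ?t (prd ?a) (prd ?a)" "\<i> (fO C) = ?t (prd ?c) (prd ?c)"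
    unfolding tperm_refl[OF o] eq(1,3) by (subst foldO_tens; simp)+
  have "(\<i> (fO A) \<star> arr_inv D (pimap D G Psi B C)) \<bullet> arr_inv D (pimap D G Psi A (B \<diamondop> C))
    = ?t (prd ?a @ prd (?b @ ?c)) ?P \<bullet> ?t (prd (?a @ ?b @ ?c)) (prd ?a @ prd (?b @ ?c))"
    unfolding i p by (subst tperm_append[OF r(7,5)]) auto
  also have "\<dots> = ?t (prd (?a @ ?b @ ?c)) ?P"
    by (rule tperm_Cmp[OF r(1,2) o])
  also have "\<dots> = ?t (prd (?a @ ?b) @ prd ?c) ((prd ?a @ prd ?b) @ prd ?c)
      \<bullet> ?t (prd ((?a @ ?b) @ ?c)) (prd (?a @ ?b) @ prd ?c)"
    unfolding append_assoc by (rule tperm_Cmp[OF r(3,4) o, symmetric])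
  also have "\<dots> = (arr_inv D (pimap D G Psi A B) \<star> \<i> (fO C)) \<bullet> arr_inv D (pimap D G Psi (A \<diamondop> B) C)"
    unfolding i p by (subst tperm_append[OF r(6,8)]) auto
  finally show ?thesis .
qed

text \<open>
  By associativity of \<open>\<pi>\<close>, discarding two components at once is discarding one
  after the other.
\<close>

lemma disc_env_tens:
  assumes a: "\<xi> \<in> Homs D (fO A) \<I>" and b: "\<zeta> \<in> Homs D (fO B) \<I>"
    and ABC: "A \<in> Obj D" "B \<in> Obj D" "C \<in> Obj D"
  shows "disc D G Psi (A \<diamondop> B) C (env_tens D G Psi A B \<xi> \<zeta>)
    = disc D G Psi B C \<zeta> \<bullet> disc D G Psi A (B \<diamondop> C) \<xi>"
proof -
  let ?p = "\<lambda>A B. arr_inv D (pimap D G Psi A B)"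
  have ab: "\<xi> \<in> Arr D" "Dom D \<xi> = fO A" "Cod D \<xi> = \<I>" "\<zeta> \<in> Arr D" "Dom D \<zeta> = fO B" "Cod D \<zeta> = \<I>"
    using a b by (auto simp: Homs_def)
  have "disc D G Psi B C \<zeta> \<bullet> disc D G Psi A (B \<diamondop> C) \<xi>
    = (\<zeta> \<star> \<i> (fO C)) \<bullet> (?p B C \<bullet> (\<xi> \<star> \<i> (fO (B \<diamondop> C)))) \<bullet> ?p A (B \<diamondop> C)"
    using ab ABC by (simp add: disc_def)
  also have "?p B C \<bullet> (\<xi> \<star> \<i> (fO (B \<diamondop> C))) = (\<xi> \<star> \<i> (fO B \<diamondop> fO C)) \<bullet> (\<i> (fO A) \<star> ?p B C)"
    using slide[of \<xi> "fO A" \<I> "?p B C" "fO (B \<diamondop> C)" "fO B \<diamondop> fO C"] ab ABC by simp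
  also have "(\<zeta> \<star> \<i> (fO C)) \<bullet> ((\<xi> \<star> \<i> (fO B \<diamondop> fO C)) \<bullet> (\<i> (fO A) \<star> ?p B C)) \<bullet> ?p A (B \<diamondop> C)
    = ((\<zeta> \<star> \<i> (fO C)) \<bullet> (\<xi> \<star> \<i> (fO B \<diamondop> fO C))) \<bullet> (\<i> (fO A) \<star> ?p B C) \<bullet> ?p A (B \<diamondop> C)"
    using ab ABC by simp
  also have "(\<zeta> \<star> \<i> (fO C)) \<bullet> (\<xi> \<star> \<i> (fO B \<diamondop> fO C)) = \<xi> \<star> \<zeta> \<star> \<i> (fO C)"
    using interchange[of \<xi> "\<i> \<I>" "\<i> (fO B \<diamondop> fO C)" "\<zeta> \<star> \<i> (fO C)"] ab ABC by simp
  also have "(\<i> (fO A) \<star> ?p B C) \<bullet> ?p A (B \<diamondop> C) = (?p A B \<star> \<i> (fO C)) \<bullet> ?p (A \<diamondop> B) C"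
    by (rule arr_inv_pimap_assoc[OF ABC])
  also have "(\<xi> \<star> \<zeta> \<star> \<i> (fO C)) \<bullet> (?p A B \<star> \<i> (fO C)) \<bullet> ?p (A \<diamondop> B) C
    = disc D G Psi (A \<diamondop> B) C (env_tens D G Psi A B \<xi> \<zeta>)"
    unfolding disc_def env_tens_def using ab ABC
    by (simp add: whisker_right TensO_unit)
  finally show ?thesis ..
qed

end

lemma (in equivariant_functor) farr_disc:
  assumes "\<xi> \<in> Homs C (AC.fO A) (TUnit C)" "A \<in> Obj C" "B \<in> Obj C"
  shows "farr F (disc C G Psi A B \<xi>) = disc D G Psi' (fobj F A) (fobj F B) (farr F \<xi>)"
  using assms by (auto simp: disc_def Homs_def farr_pimap fobj_foldO)

context two_actions begin

lemma pimap_GH_eq: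
  assumes AB: "A \<in> Obj D" "B \<in> Obj D"
  shows "pimap D (gprod G H) Pact A B = Cmp D (G.fA (pimap D H Psi' A B)) (pimap D G Psi (H.fO A) (H.fO B))"
proof -
  let ?p = "G.fA (pimap D H Psi' A B)" and ?q = "pimap D G Psi (H.fO A) (H.fO B)"
    and ?r = "pimap D (gprod G H) Pact A B"
  let ?p' = "G.fA (arr_inv D (pimap D H Psi' A B))" and ?q' = "arr_inv D ?q"
  have pp: "Cmp D ?p ?p' = Idn D (GH.fO (TensO D A B))"
    using AB by (simp add: foldO_GH flip: G.foldA_Cmp)
  have qq: "Cmp D ?q (Cmp D ?q' ?p') = ?p'"
    using AB by (simp add: foldO_GH flip: G.Cmp_assoc)
  have "Cmp D ?p ?q = Cmp D (Cmp D ?p ?q) (Cmp D (arr_inv D ?r) ?r)"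
    using AB by (simp add: foldO_GH)
  also have "\<dots> = Cmp D (Cmp D ?p (Cmp D ?q (Cmp D ?q' ?p'))) ?r"
    unfolding arr_inv_pimap_GH[OF AB] using AB by (simp add: foldO_GH)
  also have "\<dots> = ?r" unfolding qq pp using AB by simp
  finally show ?thesis ..
qed

lemma disc_right:
  assumes "\<xi> \<in> Homs D (H.fO A) (TUnit D)" "A \<in> Obj D" "B \<in> Obj D"
  shows "G.fA (disc D H Psi' A B \<xi>) = disc D (gprod G H) Pact A B (G.fA \<xi>)"
  using assms unfolding disc_def arr_inv_pimap_GH[OF assms(2,3)]
  by (simp add: Homs_def G.foldA_TensA foldO_GH)

text \<open>
  The counterpart of \<open>disc_right\<close> for effects of \<open>G\<close>, where the factors
  are to be reordered on both sides because folding over \<open>H\<close> makes it the outer index.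
\<close>

lemma reorder_disc_left:
  assumes \<xi>: "\<xi> \<in> Homs D (G.fO A) (TUnit D)" and AB: "A \<in> Obj D" "B \<in> Obj D"
  shows "Cmp D (reorder_GH B) (disc D (gprod G H) Pact A B (lft A \<xi>))
    = Cmp D (H.fA (disc D G Psi A B \<xi>)) (reorder_GH (TensO D A B))"
proof -
  let ?p = "arr_inv D (pimap D G Psi A B)" and ?q = "arr_inv D (pimap D H Psi' (G.fO A) (G.fO B))"
    and ?r = "arr_inv D (pimap D (gprod G H) Pact A B)"
  let ?i = "Idn D (H.fO (G.fO B))"
  have x: "\<xi> \<in> Arr D" "Dom D \<xi> = G.fO A" "Cod D \<xi> = TUnit D" using \<xi> by (auto simp: Homs_def)
  have "Cmp D (reorder_GH B) (TensA D (lft A \<xi>) (Idn D (GH.fO B))) = TensA D (lft A \<xi>) (reorder_GH B)"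
    using G.interchange[of "lft A \<xi>" "Idn D (TUnit D)" "Idn D (GH.fO B)" "reorder_GH B"] x AB
    by (simp add: lft_def)
  also have "\<dots> = Cmp D (TensA D (H.fA \<xi>) ?i) (TensA D (reorder_GH A) (reorder_GH B))"
    using x AB by (simp add: lft_def G.interchange)
  finally have 1: "Cmp D (reorder_GH B) (TensA D (lft A \<xi>) (Idn D (GH.fO B)))
    = Cmp D (TensA D (H.fA \<xi>) ?i) (TensA D (reorder_GH A) (reorder_GH B))" .
  have l: "lft A \<xi> \<in> Arr D" "Dom D (lft A \<xi>) = GH.fO A" "Cod D (lft A \<xi>) = TUnit D"
    using x AB by (simp_all add: lft_def)
  have "Cmp D (reorder_GH B) (disc D (gprod G H) Pact A B (lft A \<xi>))
    = Cmp D (Cmp D (reorder_GH B) (TensA D (lft A \<xi>) (Idn D (GH.fO B)))) ?r"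
    unfolding disc_def using l AB by simp
  also have "\<dots> = Cmp D (TensA D (H.fA \<xi>) ?i) (Cmp D (TensA D (reorder_GH A) (reorder_GH B)) ?r)"
    unfolding 1 using x AB by simp
  also have "\<dots> = Cmp D (H.fA (disc D G Psi A B \<xi>)) (reorder_GH (TensO D A B))"
    unfolding arr_inv_pimap_reorder[OF AB, symmetric] disc_def using x AB
    by (simp add: H.foldA_TensA foldO_GH)
  finally show ?thesis .
qed

text \<open>
  Splitting the words that label the factors shows \<open>reorder_GH\<close> as an exchange of two
  indices, which is how iterated tensor products in the CPM category produce it.
\<close>

lemma reorder_GH_pairs:
  assumes A: "A \<in> Obj D"
  shows "reorder_GH A = tperm D (G.lab (\<lambda>h. fobj (Psi' h) A)) (List.product (elems G) (elems H))
    (map prod.swap (List.product (elems H) (elems G)))"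
proof -
  let ?j = "\<lambda>(g, h). g @ h" and ?w = "\<lambda>w. fobj (Pact w) A"
  have "concat (map (\<lambda>\<gamma>'. map (\<lambda>\<gamma>. \<gamma> @ \<gamma>') (elems G)) (elems H))
    = map ?j (map prod.swap (List.product (elems H) (elems G)))"
    by (simp add: product_concat_map map_concat comp_def)
  then have "reorder_GH A = tperm D ?w (map ?j (List.product (elems G) (elems H)))
    (map ?j (map prod.swap (List.product (elems H) (elems G))))"
    unfolding reorder_GH_def elems_gprod[OF G.fab H.fab] by simp
  also have "\<dots> = tperm D (G.lab (\<lambda>h. fobj (Psi' h) A)) (List.product (elems G) (elems H))
    (map prod.swap (List.product (elems H) (elems G)))"
    by (rule G.tperm_relabel)
      (use A inj_append[OF G.fab] in \<open>auto simp: reord_def distinct_map distinct_product\<close>)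
  finally show ?thesis .
qed

end

text \<open>
  The CPM construction for \<open>G\<close> has been carried out, giving the category
  \<open>E\<close>. The action of \<open>H\<close> restricts to \<open>E\<close>, and its effects
  are turned into effects in \<open>E\<close> by folding over \<open>G\<close>.
\<close>

locale cpm_step = two_actions D G H Psi Psi'
  for D :: "('o,'a) smc" and G H :: "'g::linorder list monoid" and Psi Psi' +
  fixes Xi :: "'o \<Rightarrow> 'a set" and Xi' :: "'o \<Rightarrow> 'a set"
  assumes smc_cpm: "is_smc (cpm D G Psi Xi)"
    and fld_functor: "is_smc_functor D (cpm D G Psi Xi) (fld D G Psi)"
    and restrict_functor: "\<eta> \<in> carrier H \<Longrightarrow>
      is_smc_functor (cpm D G Psi Xi) (cpm D G Psi Xi) (smcf_restrict (cpm D G Psi Xi) (Psi' \<eta>))"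
    and inj_G: "inj_on (foldO D G Psi) (Obj D)" and inj_H: "inj_on (foldO D H Psi') (Obj D)"
    and Xi_Homs: "A \<in> Obj D \<Longrightarrow> Xi A \<subseteq> Homs D (foldO D G Psi A) (TUnit D)"
    and Xi'_Homs: "A \<in> Obj D \<Longrightarrow> Xi' A \<subseteq> Homs D (foldO D H Psi' A) (TUnit D)"
begin

abbreviation E where "E \<equiv> cpm D G Psi Xi"
abbreviation F where "F \<equiv> fld D G Psi"
definition PsiE where "PsiE = (\<lambda>\<eta>\<in>carrier H. smcf_restrict E (Psi' \<eta>))"
abbreviation XiE where "XiE \<equiv> env_image D F Xi'"

lemma PsiE_apply [simp]: "\<eta> \<in> carrier H \<Longrightarrow> PsiE \<eta> = smcf_restrict E (Psi' \<eta>)"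
  by (simp add: PsiE_def)

lemmas Obj_E = Obj_cpm[of D G Psi Xi] and Arr_E = Arr_cpm[of D G Psi Xi]

lemma Arr_E_sub: "Arr E \<subseteq> Arr D"
  unfolding Arr_E using Xi_Homs by (rule G.cpm_arrs_sub)

lemma E_simps:
  "f \<in> Arr E \<Longrightarrow> Dom E f = Dom D f" "f \<in> Arr E \<Longrightarrow> Cod E f = Cod D f"
  "X \<in> Obj E \<Longrightarrow> Idn E X = Idn D X"
  "f \<in> Arr E \<Longrightarrow> g \<in> Arr E \<Longrightarrow> Cod D f = Dom D g \<Longrightarrow> Cmp E g f = Cmp D g f"
  by (simp_all add: cpm_def Let_def)

lemma TUnit_E: "TUnit E = TUnit D"
  by (simp add: cpm_def Let_def)

lemma unfold_G: "A \<in> Obj D \<Longrightarrow> unfoldO D G Psi (G.fO A) = A"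
  unfolding unfoldO_def by (rule the_inv_into_f_f[OF inj_G])

lemma TensA_E:
  assumes "f \<in> Arr E" "Dom D f = G.fO A" "Cod D f = G.fO B" "g \<in> Arr E" "Dom D g = G.fO A'" "Cod D g = G.fO B'"
    and "A \<in> Obj D" "B \<in> Obj D" "A' \<in> Obj D" "B' \<in> Obj D"
  shows "TensA E f g = Cmp D (pimap D G Psi B B') (Cmp D (TensA D f g) (arr_inv D (pimap D G Psi A A')))"
proof -
  have "TensA E f g = Cmp D (Cmp D (pimap D G Psi B B') (TensA D f g)) (arr_inv D (pimap D G Psi A A'))"
    using assms(1,4) by (simp add: Arr_E) (simp add: cpm_def Let_def assms unfold_G)
  then show ?thesis using assms Arr_E_sub by (simp add: subset_iff)
qed

sublocale E: smc_action E H PsiE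
proof -
  interpret E: sym_mon_cat E by unfold_locales (rule smc_cpm)
  have closed: "fobj (Psi' \<eta>) A \<in> Obj E" "farr (Psi' \<eta>) f \<in> Arr E"
    if "\<eta> \<in> carrier H" "A \<in> Obj E" "f \<in> Arr E" for \<eta> A f
    using restrict_functor[OF that(1)] that(2,3)
    by (auto simp: is_smc_functor_def smcf_restrict_def PiE_iff)
  have ex: "Idn E A \<in> Arr E" if "A \<in> Obj E" for A using that by simp
  have Obj_sub: "A \<in> Obj D" if "A \<in> Obj E" for A using that by (auto simp: Obj_E)
  show "smc_action E H PsiE"
  proof unfold_locales
    show "is_smc_functor E E (PsiE \<eta>)" if "\<eta> \<in> carrier H" for \<eta>
      using that restrict_functor by simp
    show "fobj (PsiE \<gamma>) (fobj (PsiE \<delta>) A) = fobj (PsiE (\<gamma> \<otimes>\<^bsub>H\<^esub> \<delta>)) A"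
      if "\<gamma> \<in> carrier H" "\<delta> \<in> carrier H" "A \<in> Obj E" for \<gamma> \<delta> A
      using that closed(1)[OF that(2,3) ex[OF that(3)]] Obj_sub
      by (simp add: smcf_restrict_def H.act_fobj)
    show "farr (PsiE \<gamma>) (farr (PsiE \<delta>) f) = farr (PsiE (\<gamma> \<otimes>\<^bsub>H\<^esub> \<delta>)) f"
      if "\<gamma> \<in> carrier H" "\<delta> \<in> carrier H" "f \<in> Arr E" for \<gamma> \<delta> f
      using that closed(2)[OF that(2) _ that(3), of "Dom E f"] Arr_E_sub
      by (simp add: smcf_restrict_def H.act_farr subset_iff)
  qed simp
qed

sublocale FH: equivariant_functor D E F H Psi' PsiE
proof unfold_locales
  show "is_smc_functor D E F" by (rule fld_functor)
  fix \<eta> assume \<eta>: "\<eta> \<in> carrier H"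
  show "fobj F (fobj (Psi' \<eta>) A) = fobj (PsiE \<eta>) (fobj F A)" if "A \<in> Obj D" for A
  proof -
    have "fobj (Psi' \<eta>) (G.fO A) = G.fO (fobj (Psi' \<eta>) A)"
      unfolding foldO_def using that \<eta>
      by (subst smc_functor.fobj_tens[OF H.act])
        (auto simp: comm_fobj intro!: arg_cong[where f = "tensO_list D"])
    then show ?thesis using that \<eta> by (simp add: smcf_restrict_def Obj_E)
  qed
  show "farr F (farr (Psi' \<eta>) f) = farr (PsiE \<eta>) (farr F f)" if "f \<in> Arr D" for f
  proof -
    have "farr (Psi' \<eta>) (G.fA f) = G.fA (farr (Psi' \<eta>) f)"
      unfolding foldA_def using that \<eta>
      by (subst smc_functor.farr_tensA_list[OF H.act])
        (auto simp: comm_farr intro!: arg_cong[where f = "tensA_list D"])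
    moreover have "G.fA f \<in> Arr E" using that cpm_arrs.folded by (auto simp: Arr_E)
    ultimately show ?thesis using that \<eta> by (simp add: smcf_restrict_def)
  qed
qed

lemma comm_foldO: "\<eta> \<in> carrier H \<Longrightarrow> A \<in> Obj D \<Longrightarrow> fobj (Psi' \<eta>) (G.fO A) = G.fO (fobj (Psi' \<eta>) A)"
  using FH.equiv_fobj[of \<eta> A] by (simp add: smcf_restrict_def Obj_E)

lemma Psi'_closed:
  assumes \<eta>: "\<eta> \<in> carrier H" and f: "f \<in> Arr E"
  shows "farr (PsiE \<eta>) f = farr (Psi' \<eta>) f" "farr (Psi' \<eta>) f \<in> Arr E"
proof -
  show 1: "farr (PsiE \<eta>) f = farr (Psi' \<eta>) f" using assms by (simp add: smcf_restrict_def)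
  show "farr (Psi' \<eta>) f \<in> Arr E" unfolding 1[symmetric] using E.act_simps(2) assms by blast
qed

text \<open>
  For \<open>hs = elems H\<close> this is the inverse of \<open>reorder_GH\<close>; the recursion
  over arbitrary \<open>hs\<close> is the one that builds tensor products in \<open>E\<close>.
\<close>

abbreviation unorder where
  "unorder A hs \<equiv> tperm D (G.lab A) (map prod.swap (List.product hs (elems G))) (G.prd hs)"

text \<open>
  Each binary tensor product in \<open>E\<close> is one in \<open>D\<close> conjugated by
  \<open>\<pi>\<close>. For products of several morphisms these conjugations combine to the exchange
  of the two indices of the factors.
\<close>

lemma tensA_list_E:
  assumes "distinct hs"
    and "\<forall>h\<in>set hs. f h \<in> Arr E \<and> Dom D (f h) = G.fO (A h) \<and> Cod D (f h) = G.fO (B h)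
      \<and> A h \<in> Obj D \<and> B h \<in> Obj D"
  shows "tensA_list E (map f hs) \<in> Arr E"
    "Dom D (tensA_list E (map f hs)) = G.fO (G.tens A hs)"
    "Cod D (tensA_list E (map f hs)) = G.fO (G.tens B hs)"
    and "Cmp D (tensA_list E (map f hs)) (unorder A hs) = Cmp D (unorder B hs) (tensA_list D (map f hs))"
proof -
  have typing: "tensA_list E (map f hs) \<in> Arr E \<and>
    Dom D (tensA_list E (map f hs)) = G.fO (G.tens A hs) \<and>
    Cod D (tensA_list E (map f hs)) = G.fO (G.tens B hs)"
    if f: "\<forall>h\<in>set hs. f h \<in> Arr E \<and> Dom D (f h) = G.fO (A h) \<and> Cod D (f h) = G.fO (B h)
      \<and> A h \<in> Obj D \<and> B h \<in> Obj D" for hs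
  proof -
    have t: "tensO_list E (map (\<lambda>h. fobj F (C h)) hs) = G.fO (G.tens C hs)" if "\<forall>h\<in>set hs. C h \<in> Obj D" for C
      using that by (simp flip: FH.fobj_tens)
    have arr: "tensA_list E (map f hs) \<in> Arr E" using f by simp
    have DC: "Dom E (tensA_list E (map f hs)) = tensO_list E (map (Dom E) (map f hs))"
      "Cod E (tensA_list E (map f hs)) = tensO_list E (map (Cod E) (map f hs))"
      using f by (intro E.tensA_list_typing; auto)+
    have "map (Dom E) (map f hs) = map (\<lambda>h. fobj F (A h)) hs" "map (Cod E) (map f hs) = map (\<lambda>h. fobj F (B h)) hs"
      using f by (simp_all add: E_simps)
    note DC = DC[unfolded this]
    have "Dom E (tensA_list E (map f hs)) = G.fO (G.tens A hs)" "Cod E (tensA_list E (map f hs)) = G.fO (G.tens B hs)"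
      unfolding DC using f by (intro t; auto)+
    then show ?thesis using arr E_simps(1,2)[OF arr] by simp
  qed
  show "tensA_list E (map f hs) \<in> Arr E" "Dom D (tensA_list E (map f hs)) = G.fO (G.tens A hs)"
    "Cod D (tensA_list E (map f hs)) = G.fO (G.tens B hs)"
    using typing[OF assms(2)] by auto
  show "Cmp D (tensA_list E (map f hs)) (unorder A hs) = Cmp D (unorder B hs) (tensA_list D (map f hs))"
    using assms
  proof (induction hs)
    case Nil
    show ?case using FH.fobj_Obj[of "TUnit D"] by (simp add: E_simps TUnit_E)
  next
    case (Cons h hs)
    have d: "distinct hs" "h \<notin> set hs" "distinct ([h] @ hs)" using Cons.prems by auto
    have f: "f h \<in> Arr E" "Dom D (f h) = G.fO (A h)" "Cod D (f h) = G.fO (B h)" "A h \<in> Obj D" "B h \<in> Obj D"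
      using Cons.prems by auto
    have fs: "\<forall>h\<in>set hs. f h \<in> Arr E \<and> Dom D (f h) = G.fO (A h) \<and> Cod D (f h) = G.fO (B h)
      \<and> A h \<in> Obj D \<and> B h \<in> Obj D" using Cons.prems by auto
    let ?r = "tensA_list E (map f hs)" and ?m = "tensA_list D (map f hs)"
    note r = typing[OF fs]
    note IH = Cons.IH[OF d(1) fs]
    have AB: "\<forall>h\<in>set hs. A h \<in> Obj D" "\<forall>h\<in>set hs. B h \<in> Obj D" using fs by auto
    have r2: "reord (map prod.swap (List.product ks (elems G))) (G.prd ks)" if "distinct ks" for ks :: "'b list"
      using that by (auto simp: reord_def distinct_map distinct_product)
    \<comment> \<open>exchanging the indices for \<open>h # hs\<close> is doing so for \<open>hs\<close>, followed by \<open>\<pi>\<close>\<close>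
    have un: "unorder C (h # hs) = Cmp D (pimap D G Psi (C h) (G.tens C hs)) (TensA D (Idn D (G.fO (C h))) (unorder C hs))"
      "unorder C hs \<in> Arr D" "Cod D (unorder C hs) = G.fO (G.tens C hs)"
      if C: "C h \<in> Obj D" "\<forall>h\<in>set hs. C h \<in> Obj D" for C
    proof -
      have Ch: "\<forall>x\<in>set [h]. C x \<in> Obj D" "\<forall>x\<in>set ([h] @ hs). C x \<in> Obj D" using C by auto
      have oh: "\<forall>p\<in>set (G.prd [h]). G.lab C p \<in> Obj D"
        "\<forall>p\<in>set (map prod.swap (List.product hs (elems G))). G.lab C p \<in> Obj D"
        using C by auto
      have one: "G.prd [h] = map (\<lambda>g. (g, h)) (elems G)" by (simp add: product_concat_map)
      have rh: "reord (G.prd [h]) (G.prd [h])" by (simp add: reord_def distinct_product)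
      show t: "unorder C hs \<in> Arr D" "Cod D (unorder C hs) = G.fO (G.tens C hs)"
        using G.tperm_typing[OF r2[OF d(1)] oh(2)] G.foldO_tens[OF C(2)] by simp_all
      have "Idn D (G.fO (C h)) = tperm D (G.lab C) (G.prd [h]) (G.prd [h])"
        using G.foldO_tens[OF Ch(1)] C oh(1) by simp
      then have "TensA D (Idn D (G.fO (C h))) (unorder C hs)
        = tperm D (G.lab C) (G.prd [h] @ map prod.swap (List.product hs (elems G))) (G.prd [h] @ G.prd hs)"
        by (simp only:) (rule G.tperm_append[symmetric, OF rh r2[OF d(1)] _ oh], use d in auto)
      moreover have "pimap D G Psi (C h) (G.tens C hs) = tperm D (G.lab C) (G.prd [h] @ G.prd hs) (G.prd ([h] @ hs))"
        using G.pimap_tens[OF d(3) Ch(2)] C by simp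
      moreover have "reord (G.prd [h] @ map prod.swap (List.product hs (elems G))) (G.prd [h] @ G.prd hs)"
        "reord (G.prd [h] @ G.prd hs) (G.prd ([h] @ hs))"
        using d by (auto simp: reord_def distinct_map distinct_product)
      moreover have "\<forall>p\<in>set (G.prd [h] @ map prod.swap (List.product hs (elems G))). G.lab C p \<in> Obj D"
        using oh by auto
      moreover have "map prod.swap (List.product (h # hs) (elems G)) = G.prd [h] @ map prod.swap (List.product hs (elems G))"
        by (simp add: one)
      ultimately show "unorder C (h # hs)
        = Cmp D (pimap D G Psi (C h) (G.tens C hs)) (TensA D (Idn D (G.fO (C h))) (unorder C hs))"
        by (simp only: G.tperm_Cmp append_Cons append_Nil)
    qed
    note unA = un[of A, OF f(4) AB(1)] and unB = un[of B, OF f(5) AB(2)]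
    let ?pA = "pimap D G Psi (A h) (G.tens A hs)" and ?pB = "pimap D G Psi (B h) (G.tens B hs)"
    have tAB: "G.tens A hs \<in> Obj D" "G.tens B hs \<in> Obj D" using AB by simp_all
    have rD: "?r \<in> Arr D" "f h \<in> Arr D" using r f Arr_E_sub by auto
    have "\<forall>h\<in>set hs. f h \<in> Arr D" using fs Arr_E_sub by blast
    then have mD: "?m \<in> Arr D" by simp
    have dB: "Dom D (unorder B hs) = Cod D ?m"
    proof -
      have "\<forall>p\<in>set (map prod.swap (List.product hs (elems G))). G.lab B p \<in> Obj D" using AB by auto
      then have "Dom D (unorder B hs) = G.tens (G.lab B) (map prod.swap (List.product hs (elems G)))"
        using G.tperm_typing[OF r2[OF d(1)]] by simp
      also have "\<dots> = G.tens (\<lambda>h. G.fO (B h)) hs"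
      proof -
        have "map prod.swap (List.product hs (elems G)) = concat (map (\<lambda>h. map (\<lambda>g. (g, h)) (elems G)) hs)"
          by (simp add: product_concat_map map_concat comp_def)
        then show ?thesis
          using AB by (simp add: G.tens_concat) (simp add: foldO_def comp_def)
      qed
      also have "\<dots> = Cod D ?m" using fs Arr_E_sub
        by (subst G.tensA_list_typing) (auto intro!: arg_cong[where f = "tensO_list D"])
      finally show ?thesis .
    qed
    have "Cmp D (tensA_list E (map f (h # hs))) (unorder A (h # hs))
      = Cmp D (Cmp D ?pB (Cmp D (TensA D (f h) ?r) (arr_inv D ?pA)))
        (Cmp D ?pA (TensA D (Idn D (G.fO (A h))) (unorder A hs)))"
      unfolding unA(1) using TensA_E[of "f h" "A h" "B h" ?r "G.tens A hs" "G.tens B hs"] f r tAB by simp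
    also have "\<dots> = Cmp D ?pB (Cmp D (Cmp D (TensA D (f h) ?r) (Cmp D (arr_inv D ?pA) ?pA))
        (TensA D (Idn D (G.fO (A h))) (unorder A hs)))"
      using rD r f tAB unA by (simp del: G.pimap_inverse)
    also have "\<dots> = Cmp D ?pB (TensA D (f h) (Cmp D ?r (unorder A hs)))"
      using rD r f tAB unA by (simp add: G.interchange)
    also have "\<dots> = Cmp D (Cmp D ?pB (TensA D (Idn D (G.fO (B h))) (unorder B hs))) (TensA D (f h) ?m)"
      unfolding IH using rD mD dB f tAB unB by (simp add: G.interchange)
    finally show ?case unfolding unB(1) by simp
  qed
qed

lemma reorder_inverse:
  assumes A: "A \<in> Obj D"
  shows "Cmp D (unorder (\<lambda>h. fobj (Psi' h) A) (elems H)) (reorder_GH A) = Idn D (GH.fO A)"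
    "Cmp D (reorder_GH A) (unorder (\<lambda>h. fobj (Psi' h) A) (elems H)) = Idn D (H.fO (G.fO A))"
    "unorder (\<lambda>h. fobj (Psi' h) A) (elems H) \<in> Arr D"
    "Dom D (unorder (\<lambda>h. fobj (Psi' h) A) (elems H)) = H.fO (G.fO A)"
    "Cod D (unorder (\<lambda>h. fobj (Psi' h) A) (elems H)) = GH.fO A"
proof -
  let ?gh = "List.product (elems G) (elems H)" and ?hg = "map prod.swap (List.product (elems H) (elems G))"
  let ?L = "G.lab (\<lambda>h. fobj (Psi' h) A)"
  have r: "reord ?gh ?hg" "reord ?hg ?gh" by (auto simp: reord_def distinct_map distinct_product)
  have o: "\<forall>p\<in>set ?gh. ?L p \<in> Obj D" "\<forall>p\<in>set ?hg. ?L p \<in> Obj D" using A by auto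
  note t = G.tperm_typing[OF r(1) o(1)] G.tperm_typing[OF r(2) o(2)]
  have dom: "G.tens ?L ?gh = GH.fO A" "G.tens ?L ?hg = H.fO (G.fO A)"
    using reorder_GH_typing[OF A] t(2,3) unfolding reorder_GH_pairs[OF A] by simp_all
  show "Cmp D (unorder (\<lambda>h. fobj (Psi' h) A) (elems H)) (reorder_GH A) = Idn D (GH.fO A)"
    "Cmp D (reorder_GH A) (unorder (\<lambda>h. fobj (Psi' h) A) (elems H)) = Idn D (H.fO (G.fO A))"
    "unorder (\<lambda>h. fobj (Psi' h) A) (elems H) \<in> Arr D"
    "Dom D (unorder (\<lambda>h. fobj (Psi' h) A) (elems H)) = H.fO (G.fO A)"
    "Cod D (unorder (\<lambda>h. fobj (Psi' h) A) (elems H)) = GH.fO A"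
    unfolding reorder_GH_pairs[OF A] using G.tperm_Cmp[OF r o(1)] G.tperm_Cmp[OF r(2,1) o(2)] t o dom
    by simp_all
qed

text \<open>
  Folding in \<open>E\<close> is a tensor product in \<open>E\<close> over the elements of
  \<open>H\<close>, so \<open>tensA_list_E\<close> applies.
\<close>

lemma foldA_E:
  assumes f: "f \<in> Arr E" "Dom D f = G.fO A" "Cod D f = G.fO B" and AB: "A \<in> Obj D" "B \<in> Obj D"
  shows "E.fA f \<in> Arr E" "Dom D (E.fA f) = GH.fO A" "Cod D (E.fA f) = GH.fO B"
    and "Cmp D (reorder_GH B) (E.fA f) = Cmp D (H.fA f) (reorder_GH A)"
proof -
  let ?f = "\<lambda>h. farr (Psi' h) f" and ?A = "\<lambda>h. fobj (Psi' h) A" and ?B = "\<lambda>h. fobj (Psi' h) B"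
  have E: "E.fA f = tensA_list E (map ?f (elems H))"
    unfolding foldA_def using f(1)
    by (intro arg_cong[where f = "tensA_list E"] map_cong) (simp_all add: smcf_restrict_def)
  have fD: "f \<in> Arr D" using f Arr_E_sub by auto
  have prems: "\<forall>h\<in>set (elems H). ?f h \<in> Arr E \<and> Dom D (?f h) = G.fO (?A h) \<and> Cod D (?f h) = G.fO (?B h)
      \<and> ?A h \<in> Obj D \<and> ?B h \<in> Obj D"
    using f fD AB by (auto simp: Psi'_closed comm_foldO)
  have o: "G.fO (G.tens ?A (elems H)) = GH.fO A" "G.fO (G.tens ?B (elems H)) = GH.fO B"
    using AB by (simp_all add: foldO_GH foldO_def[of D H])
  note t = tensA_list_E[OF _ prems, unfolded o]
  show ty: "E.fA f \<in> Arr E" "Dom D (E.fA f) = GH.fO A" "Cod D (E.fA f) = GH.fO B"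
    unfolding E using t by simp_all
  then have eD: "E.fA f \<in> Arr D" using Arr_E_sub by auto
  note uA = reorder_inverse[OF AB(1)] and uB = reorder_inverse[OF AB(2)]
  have "Cmp D (reorder_GH B) (E.fA f)
    = Cmp D (reorder_GH B) (Cmp D (Cmp D (E.fA f) (unorder ?A (elems H))) (reorder_GH A))"
    using uA eD ty AB by simp
  also have "Cmp D (E.fA f) (unorder ?A (elems H)) = Cmp D (unorder ?B (elems H)) (H.fA f)"
    using t(4) unfolding E by (simp add: foldA_def[of D H])
  also have "Cmp D (reorder_GH B) (Cmp D (Cmp D (unorder ?B (elems H)) (H.fA f)) (reorder_GH A))
    = Cmp D (Cmp D (reorder_GH B) (unorder ?B (elems H))) (Cmp D (H.fA f) (reorder_GH A))"
    using uB(3-5) fD f AB by simp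
  also have "\<dots> = Cmp D (H.fA f) (reorder_GH A)"
    unfolding uB(2) using fD f AB by simp
  finally show "Cmp D (reorder_GH B) (E.fA f) = Cmp D (H.fA f) (reorder_GH A)" .
qed

lemma disc_in_E: "A \<in> Obj D \<Longrightarrow> B \<in> Obj D \<Longrightarrow> \<xi> \<in> Xi A \<Longrightarrow> disc D G Psi A B \<xi> \<in> Arr E"
  unfolding Arr_E disc_def by (rule cpm_arrs.discard)

text \<open>
  Conjugation by the reordering turns folding in \<open>E\<close> into folding in \<open>D\<close>
  (\<open>foldA_E\<close>), and discarding a folded effect into discarding its lift
  (\<open>reorder_disc_left\<close>).
\<close>

lemma disc_left:
  assumes AB: "A \<in> Obj D" "B \<in> Obj D" and \<xi>: "\<xi> \<in> Xi A"
  shows "E.fA (disc D G Psi A B \<xi>) = disc D (gprod G H) Pact A B (lft A \<xi>)"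
proof -
  let ?d = "disc D G Psi A B \<xi>" and ?u = "unorder (\<lambda>h. fobj (Psi' h) B) (elems H)"
    and ?e = "disc D (gprod G H) Pact A B (lft A \<xi>)"
  have \<xi>H: "\<xi> \<in> Homs D (G.fO A) (TUnit D)" using Xi_Homs AB \<xi> by blast
  note d = G.disc_typing[OF \<xi>H AB] and e = GH.disc_typing[OF lft_Homs[OF \<xi>H AB(1)] AB]
  note fE = foldA_E[OF disc_in_E[OF AB \<xi>] d(2,3) G.TensO_Obj[OF AB] AB(2)]
  have f: "E.fA ?d \<in> Arr D" using fE(1) Arr_E_sub by auto
  note u = reorder_inverse[OF AB(2)]
  have "E.fA ?d = Cmp D ?u (Cmp D (reorder_GH B) (E.fA ?d))"
    using u f fE(3) AB by (simp flip: G.Cmp_assoc)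
  also have "\<dots> = Cmp D ?u (Cmp D (reorder_GH B) ?e)"
    unfolding fE(4) reorder_disc_left[OF \<xi>H AB] ..
  also have "\<dots> = ?e"
    using u e AB by (simp flip: G.Cmp_assoc)
  finally show ?thesis .
qed

lemma XiE_Homs: "X \<in> Obj E \<Longrightarrow> XiE X \<subseteq> Homs E (E.fO X) (TUnit E)"
proof
  fix \<xi> assume "\<xi> \<in> XiE X"
  then obtain A \<xi>0 where A: "A \<in> Obj D" "fobj F A = X" "\<xi>0 \<in> Xi' A" "farr F \<xi>0 = \<xi>"
    by (rule env_imageE)
  have "\<xi>0 \<in> Homs D (H.fO A) (TUnit D)" using Xi'_Homs A by blast
  from FH.farr_Homs[OF this A(1)] show "\<xi> \<in> Homs E (E.fO X) (TUnit E)" unfolding A .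
qed

abbreviation LHS where "LHS \<equiv> cpm_arrs E H PsiE XiE"
abbreviation RHS where "RHS \<equiv> cpm_arrs D (gprod G H) Pact (envp Xi Xi')"

lemma LHS_sub: "LHS \<subseteq> Arr E"
  using XiE_Homs by (rule E.cpm_arrs_sub)

lemma disc_right_E:
  assumes AB: "A \<in> Obj D" "B \<in> Obj D" and \<xi>: "\<xi> \<in> Xi' A"
  shows "disc E H PsiE (fobj F A) (fobj F B) (farr F \<xi>) = disc D (gprod G H) Pact A B (G.fA \<xi>)"
proof -
  have \<xi>H: "\<xi> \<in> Homs D (H.fO A) (TUnit D)" using Xi'_Homs AB \<xi> by blast
  show ?thesis
    unfolding FH.farr_disc[OF \<xi>H AB, symmetric] disc_right[OF \<xi>H AB, symmetric]
    by (rule fld_simps) (rule H.disc_typing(1)[OF \<xi>H AB])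
qed

lemma foldA_E_G: "f \<in> Arr D \<Longrightarrow> E.fA (G.fA f) = GH.fA f"
  using FH.farr_foldA[of f] by (simp add: foldA_GH)

lemma foldO_E_G: "A \<in> Obj D \<Longrightarrow> E.fO (G.fO A) = GH.fO A"
  using FH.fobj_foldO[of A] by (simp add: foldO_GH)

lemma foldA_E_mem: "f \<in> cpm_arrs D G Psi Xi \<Longrightarrow> E.fA f \<in> RHS"
proof (induction rule: cpm_arrs.induct)
  case (folded f)
  then show ?case unfolding foldA_E_G[OF folded] by (rule cpm_arrs.folded)
next
  case (discard A B \<xi>)
  then show ?case
    unfolding disc_def[symmetric] disc_left[OF discard]
    unfolding disc_def by (intro cpm_arrs.discard envp_left)
next
  case (composite f g)
  have fg: "f \<in> Arr E" "g \<in> Arr E" using composite by (auto simp: Arr_E)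
  have dc: "Cod E f = Dom E g" using composite fg by (simp add: E_simps)
  have efg: "E.fA f \<in> Arr E" "E.fA g \<in> Arr E" "Cod D (E.fA f) = Dom D (E.fA g)"
    using fg dc E.foldA_typing[OF fg(1)] E.foldA_typing[OF fg(2)] by (simp_all add: E_simps(1,2)[symmetric])
  have "E.fA (Cmp D g f) = Cmp D (E.fA g) (E.fA f)"
    using fg dc efg composite by (simp add: E_simps(4)[symmetric])
  then show ?case using composite efg by (auto intro: cpm_arrs.composite)
qed

text \<open>
  Only the generating effects of \<open>envp Xi Xi'\<close> give generators of the iterated
  construction; tensor products of effects give composites of them.
\<close>

lemma disc_mem:
  assumes "\<zeta> \<in> envp Xi Xi' A" "B \<in> Obj D"
  shows "disc D (gprod G H) Pact A B \<zeta> \<in> LHS"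
  using assms
proof (induction arbitrary: B rule: envp_induct)
  case (left A \<xi>)
  then show ?case
    unfolding disc_left[OF left(1,3,2), symmetric] by (intro cpm_arrs.folded disc_in_E)
next
  case (right A \<xi>)
  show ?case
    unfolding disc_right_E[OF right(1,3,2), symmetric]
    unfolding disc_def by (rule cpm_arrs.discard) (use right in \<open>auto simp del: fld_simps intro!: env_imageI\<close>)
next
  case (tens A C \<xi> \<zeta>)
  have xz: "\<xi> \<in> Homs D (GH.fO A) (TUnit D)" "\<zeta> \<in> Homs D (GH.fO C) (TUnit D)"
    using envp_Homs(2)[OF tens.hyps(3)] envp_Homs(2)[OF tens.hyps(4)] Xi_Homs Xi'_Homs by blast+
  let ?f = "disc D (gprod G H) Pact A (TensO D C B) \<xi>" and ?g = "disc D (gprod G H) Pact C B \<zeta>"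
  have CB: "TensO D C B \<in> Obj D" using tens by simp
  have mem: "?f \<in> LHS" "?g \<in> LHS" using tens.IH CB tens.prems by blast+
  then have E: "?f \<in> Arr E" "?g \<in> Arr E" using LHS_sub by auto
  have c: "Cod D ?f = Dom D ?g"
    using GH.disc_typing[OF xz(1) tens.hyps(1) CB] GH.disc_typing[OF xz(2) tens.hyps(2) tens.prems] by simp
  have "Cmp E ?g ?f \<in> LHS" using mem E c by (intro cpm_arrs.composite) (simp_all add: E_simps)
  then show ?case
    using E c GH.disc_env_tens[OF xz tens.hyps(1,2) tens.prems] by (simp add: E_simps)
qed

lemma LHS_eq_RHS: "LHS = RHS"
proof (intro equalityI subsetI)
  fix f assume "f \<in> LHS"
  then show "f \<in> RHS"
  proof (induction rule: cpm_arrs.induct)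
    case (folded f)
    then show ?case unfolding Arr_E by (rule foldA_E_mem)
  next
    case (discard X Y \<xi>)
    from discard(3) obtain A \<xi>0 where A: "A \<in> Obj D" "fobj F A = X" "\<xi>0 \<in> Xi' A" "farr F \<xi>0 = \<xi>"
      by (rule env_imageE)
    from discard(2) obtain B where B: "B \<in> Obj D" "fobj F B = Y" by (auto simp: Obj_E)
    show ?case
      unfolding disc_def[symmetric] A(2,4)[symmetric] B(2)[symmetric] disc_right_E[OF A(1) B(1) A(3)]
      unfolding disc_def by (rule cpm_arrs.discard[OF A(1) B(1)]) (rule envp_right[OF A(1), where Xi' = Xi', OF A(3)])
  next
    case (composite f g)
    then have "f \<in> Arr E" "g \<in> Arr E" using LHS_sub by auto
    then show ?case using composite by (auto simp: E_simps intro: cpm_arrs.composite)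
  qed
next
  fix f assume "f \<in> RHS"
  then show "f \<in> LHS"
  proof (induction rule: cpm_arrs.induct)
    case (folded f)
    then show ?case
      unfolding foldA_E_G[OF folded, symmetric]
      by (intro cpm_arrs.folded) (simp add: Arr_E cpm_arrs.folded)
  next
    case (discard A B \<xi>)
    then show ?case unfolding disc_def[symmetric] by (intro disc_mem)
  next
    case (composite f g)
    then have "f \<in> Arr E" "g \<in> Arr E" using LHS_sub by auto
    moreover from this have "Cmp E g f \<in> LHS"
      using composite by (intro cpm_arrs.composite) (simp_all add: E_simps)
    ultimately show ?case using composite by (simp add: E_simps)
  qed
qed

lemmas inj_GH = inj_foldO_GH[OF inj_G inj_H]

lemma inj_E: "inj_on E.fO (Obj E)"
proof (rule inj_onI)
  fix X Y assume XY: "X \<in> Obj E" "Y \<in> Obj E" "E.fO X = E.fO Y"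
  then obtain A B where AB: "A \<in> Obj D" "X = G.fO A" "B \<in> Obj D" "Y = G.fO B" by (auto simp: Obj_E)
  then show "X = Y" using XY inj_onD[OF inj_GH, of A B] by (simp add: foldO_E_G)
qed

lemma unfold_E: "A \<in> Obj D \<Longrightarrow> unfoldO E H PsiE (GH.fO A) = G.fO A"
  unfolding unfoldO_def using the_inv_into_f_f[OF inj_E, of "G.fO A"]
  by (simp add: Obj_E foldO_E_G)

lemma unfold_GH: "A \<in> Obj D \<Longrightarrow> unfoldO D (gprod G H) Pact (GH.fO A) = A"
  unfolding unfoldO_def by (rule the_inv_into_f_f[OF inj_GH])

lemma Obj_EE: "E.fO ` Obj E = GH.fO ` Obj D"
  by (auto simp: Obj_E foldO_E_G image_image)

lemma RHS_typing:
  assumes "f \<in> RHS"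
  obtains A B where "A \<in> Obj D" "B \<in> Obj D" "Dom D f = GH.fO A" "Cod D f = GH.fO B"
proof -
  from assms have "\<exists>A B. A \<in> Obj D \<and> B \<in> Obj D \<and> Dom D f = GH.fO A \<and> Cod D f = GH.fO B"
  proof (induction rule: cpm_arrs.induct)
    case (folded f)
    then show ?case by (intro exI[of _ "Dom D f"] exI[of _ "Cod D f"]) simp
  next
    case (discard A B \<xi>)
    then have "\<xi> \<in> Homs D (GH.fO A) (TUnit D)" using envp_Homs(2)[of \<xi> Xi Xi'] Xi_Homs Xi'_Homs by blast
    from GH.disc_typing[OF this discard(1,2)] show ?case
      using discard unfolding disc_def[symmetric]
      by (intro exI[of _ "TensO D A B"] exI[of _ B]) simp
  next
    case (composite f g)
    then have "f \<in> Arr D" "g \<in> Arr D" using LHS_sub Arr_E_sub LHS_eq_RHS by blast+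
    then show ?case using composite by auto
  qed
  then show ?thesis using that by blast
qed

text \<open>
  Objects agree by \<open>foldO_E_G\<close> and morphisms by \<open>LHS_eq_RHS\<close>. The tensor
  products agree, because \<open>\<pi>\<close> for the product action is composed of
  \<open>\<pi>\<close> for \<open>G\<close>, which \<open>E\<close> uses, and of
  \<open>\<pi>\<close> for \<open>H\<close> folded over \<open>G\<close>, which is
  \<open>\<pi>\<close> in \<open>E\<close>.
\<close>

theorem cpm_cpm: "cpm E H PsiE XiE = cpm D (gprod G H) Pact (envp Xi Xi')"
proof -
  let ?Ob = "GH.fO ` Obj D"
  have arrs: "f \<in> RHS \<Longrightarrow> f \<in> Arr E" for f using LHS_sub LHS_eq_RHS by blast
  have obs: "X \<in> ?Ob \<Longrightarrow> X \<in> Obj E" for X unfolding Obj_EE[symmetric] by auto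
  have tensO: "E.fO (TensO E (unfoldO E H PsiE X) (unfoldO E H PsiE Y))
    = GH.fO (TensO D (unfoldO D (gprod G H) Pact X) (unfoldO D (gprod G H) Pact Y))"
    if XY: "X \<in> ?Ob" "Y \<in> ?Ob" for X Y
  proof -
    obtain A B where AB: "A \<in> Obj D" "X = GH.fO A" "B \<in> Obj D" "Y = GH.fO B" using XY by auto
    have "TensO E (G.fO A) (G.fO B) = G.fO (TensO D A B)" using FH.fobj_TensO[of A B] AB by simp
    then show ?thesis using AB by (simp add: unfold_E unfold_GH foldO_E_G)
  qed
  have sym: "E.fA (Sym E (unfoldO E H PsiE X) (unfoldO E H PsiE Y))
    = GH.fA (Sym D (unfoldO D (gprod G H) Pact X) (unfoldO D (gprod G H) Pact Y))"
    if XY: "X \<in> ?Ob" "Y \<in> ?Ob" for X Y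
  proof -
    obtain A B where AB: "A \<in> Obj D" "X = GH.fO A" "B \<in> Obj D" "Y = GH.fO B" using XY by auto
    have "Sym E (G.fO A) (G.fO B) = G.fA (Sym D A B)" using FH.farr_Sym[of A B] AB by simp
    then show ?thesis using AB by (simp add: unfold_E unfold_GH foldA_E_G)
  qed
  have tensA: "Cmp E (Cmp E (pimap E H PsiE (unfoldO E H PsiE (Cod D f)) (unfoldO E H PsiE (Cod D g))) (TensA E f g))
      (arr_inv E (pimap E H PsiE (unfoldO E H PsiE (Dom D f)) (unfoldO E H PsiE (Dom D g))))
    = Cmp D (Cmp D (pimap D (gprod G H) Pact (unfoldO D (gprod G H) Pact (Cod D f)) (unfoldO D (gprod G H) Pact (Cod D g))) (TensA D f g))
      (arr_inv D (pimap D (gprod G H) Pact (unfoldO D (gprod G H) Pact (Dom D f)) (unfoldO D (gprod G H) Pact (Dom D g))))"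
    if fg: "f \<in> RHS" "g \<in> RHS" for f g
  proof -
    obtain A B where f: "A \<in> Obj D" "B \<in> Obj D" "Dom D f = GH.fO A" "Cod D f = GH.fO B"
      using fg(1) by (rule RHS_typing)
    obtain A' B' where g: "A' \<in> Obj D" "B' \<in> Obj D" "Dom D g = GH.fO A'" "Cod D g = GH.fO B'"
      using fg(2) by (rule RHS_typing)
    have fgE: "f \<in> Arr E" "g \<in> Arr E" using fg arrs by auto
    have fgD: "f \<in> Arr D" "g \<in> Arr D" using fgE Arr_E_sub by auto
    have u: "unfoldO E H PsiE (Cod D f) = fobj F B" "unfoldO E H PsiE (Cod D g) = fobj F B'"
      "unfoldO E H PsiE (Dom D f) = fobj F A" "unfoldO E H PsiE (Dom D g) = fobj F A'"
      using f g fgE by (simp_all add: E_simps unfold_E)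
    have v: "unfoldO D (gprod G H) Pact (Cod D f) = B" "unfoldO D (gprod G H) Pact (Cod D g) = B'"
      "unfoldO D (gprod G H) Pact (Dom D f) = A" "unfoldO D (gprod G H) Pact (Dom D g) = A'"
      using f g by (simp_all add: unfold_GH)
    let ?p = "pimap D H Psi' B B'" and ?p' = "arr_inv D (pimap D H Psi' A A')"
    let ?q = "pimap D G Psi (H.fO B) (H.fO B')" and ?q' = "arr_inv D (pimap D G Psi (H.fO A) (H.fO A'))"
    have p: "pimap E H PsiE (fobj F B) (fobj F B') = G.fA ?p"
      "arr_inv E (pimap E H PsiE (fobj F A) (fobj F A')) = G.fA ?p'"
      using f g FH.farr_pimap[of B B'] FH.farr_pimap[of A A'] by simp_all
    have pE: "G.fA ?p \<in> Arr E" "G.fA ?p' \<in> Arr E"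
      using f g by (simp_all add: Arr_E cpm_arrs.folded)
    have t: "TensA E f g = Cmp D ?q (Cmp D (TensA D f g) ?q')"
      using f g fgE by (intro TensA_E) (simp_all add: foldO_GH)
    have tE: "TensA E f g \<in> Arr E" using fgE by simp
    have td: "Dom D (TensA E f g) = G.fO (TensO D (H.fO A) (H.fO A'))"
      "Cod D (TensA E f g) = G.fO (TensO D (H.fO B) (H.fO B'))"
      unfolding t using f g fgD by (simp_all add: foldO_GH)
    have c1: "Cmp E (G.fA ?p) (TensA E f g) = Cmp D (G.fA ?p) (TensA E f g)"
      using pE tE td f g by (intro E_simps(4)) simp_all
    have c1E: "Cmp D (G.fA ?p) (TensA E f g) \<in> Arr E"
      unfolding c1[symmetric] using pE tE td f g by (intro E.Cmp_simps) (simp_all add: E_simps)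
    have "Cmp E (Cmp E (G.fA ?p) (TensA E f g)) (G.fA ?p') = Cmp D (Cmp D (G.fA ?p) (TensA E f g)) (G.fA ?p')"
      unfolding c1 using pE c1E tE td f g Arr_E_sub by (intro E_simps(4)) (auto simp: subset_iff)
    also have "\<dots> = Cmp D (Cmp D (pimap D (gprod G H) Pact B B') (TensA D f g)) (arr_inv D (pimap D (gprod G H) Pact A A'))"
      unfolding t pimap_GH_eq[OF f(2) g(2)] arr_inv_pimap_GH[OF f(1) g(1)]
      using f g fgD by (simp add: foldO_GH)
    finally show ?thesis unfolding u v p .
  qed
  show ?thesis
    unfolding cpm_def[of E H] cpm_def[of D "gprod G H"] Let_def LHS_eq_RHS Obj_EE
    by (rule smc.equality)
      (auto simp: restrict_def fun_eq_iff arrs obs E_simps tensO sym tensA foldO_E_G TUnit_E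
        E.foldO_unit[unfolded TUnit_E])
qed

end

section \<open>Categories and functors\<close>

lemma catD:
  assumes "is_category K"
  shows cat_cid: "A \<in> cob K \<Longrightarrow> cid K A \<in> chom K A A"
    and cat_ccomp: "\<lbrakk>A \<in> cob K; B \<in> cob K; C \<in> cob K; f \<in> chom K A B; g \<in> chom K B C\<rbrakk> \<Longrightarrow>
      ccomp K A B C g f \<in> chom K A C"
    and cat_right: "\<lbrakk>A \<in> cob K; B \<in> cob K; f \<in> chom K A B\<rbrakk> \<Longrightarrow> ccomp K A A B f (cid K A) = f"
    and cat_left: "\<lbrakk>A \<in> cob K; B \<in> cob K; f \<in> chom K A B\<rbrakk> \<Longrightarrow> ccomp K A B B (cid K B) f = f"
    and cat_assoc: "\<lbrakk>A \<in> cob K; B \<in> cob K; C \<in> cob K; E \<in> cob K;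
      f \<in> chom K A B; g \<in> chom K B C; h \<in> chom K C E\<rbrakk> \<Longrightarrow>
      ccomp K A C E h (ccomp K A B C g f) = ccomp K A B E (ccomp K B C E h g) f"
  using assms unfolding is_category_def by simp_all

lemma functorD:
  assumes "is_functor K L F"
  shows functor_source: "is_category K" and functor_target: "is_category L"
    and functor_omap: "A \<in> cob K \<Longrightarrow> omap F A \<in> cob L"
    and functor_mmap: "\<lbrakk>A \<in> cob K; B \<in> cob K; f \<in> chom K A B\<rbrakk> \<Longrightarrow>
      mmap F A B f \<in> chom L (omap F A) (omap F B)"
    and functor_cid: "A \<in> cob K \<Longrightarrow> mmap F A A (cid K A) = cid L (omap F A)"
    and functor_ccomp: "\<lbrakk>A \<in> cob K; B \<in> cob K; C \<in> cob K; f \<in> chom K A B; g \<in> chom K B C\<rbrakk> \<Longrightarrow>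
      mmap F A C (ccomp K A B C g f) =
        ccomp L (omap F A) (omap F B) (omap F C) (mmap F B C g) (mmap F A B f)"
  using assms unfolding is_functor_def by simp_all

lemma group_aut_group:
  assumes K: "is_category K" and A: "A \<in> cob K" shows "group (aut_group K A)"
proof (rule groupI)
  fix f g assume "f \<in> carrier (aut_group K A)" "g \<in> carrier (aut_group K A)"
  then obtain f' g' where f: "f \<in> chom K A A" "f' \<in> chom K A A" "ccomp K A A A f' f = cid K A" "ccomp K A A A f f' = cid K A"
    and g: "g \<in> chom K A A" "g' \<in> chom K A A" "ccomp K A A A g' g = cid K A" "ccomp K A A A g g' = cid K A"
    by (auto simp: aut_group_def)
  have fg: "ccomp K A A A f g \<in> chom K A A" "ccomp K A A A g' f' \<in> chom K A A"
    using cat_ccomp[OF K A A A] f g by auto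
  have "ccomp K A A A (ccomp K A A A g' f') (ccomp K A A A f g)
    = ccomp K A A A g' (ccomp K A A A (ccomp K A A A f' f) g)"
    using cat_assoc[OF K A A A A] fg f g by metis
  then have 1: "ccomp K A A A (ccomp K A A A g' f') (ccomp K A A A f g) = cid K A"
    using f g cat_left[OF K A A] by simp
  have "ccomp K A A A (ccomp K A A A f g) (ccomp K A A A g' f')
    = ccomp K A A A f (ccomp K A A A (ccomp K A A A g g') f')"
    using cat_assoc[OF K A A A A] fg f g by metis
  then have "ccomp K A A A (ccomp K A A A f g) (ccomp K A A A g' f') = cid K A"
    using f g cat_left[OF K A A] by simp
  then show "f \<otimes>\<^bsub>aut_group K A\<^esub> g \<in> carrier (aut_group K A)"
    using 1 fg by (auto simp: aut_group_def)
next
  fix f assume f: "f \<in> carrier (aut_group K A)"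
  then show "\<exists>g\<in>carrier (aut_group K A). g \<otimes>\<^bsub>aut_group K A\<^esub> f = \<one>\<^bsub>aut_group K A\<^esub>"
    by (auto simp: aut_group_def)
  show "\<one>\<^bsub>aut_group K A\<^esub> \<otimes>\<^bsub>aut_group K A\<^esub> f = f"
    using f cat_left[OF K A A] by (auto simp: aut_group_def)
next
  show "\<one>\<^bsub>aut_group K A\<^esub> \<in> carrier (aut_group K A)"
    using cat_cid[OF K A] cat_left[OF K A A, of "cid K A"] by (auto simp: aut_group_def)
next
  fix f g h
  assume "f \<in> carrier (aut_group K A)" "g \<in> carrier (aut_group K A)" "h \<in> carrier (aut_group K A)"
  then show "f \<otimes>\<^bsub>aut_group K A\<^esub> g \<otimes>\<^bsub>aut_group K A\<^esub> h = f \<otimes>\<^bsub>aut_group K A\<^esub> (g \<otimes>\<^bsub>aut_group K A\<^esub> h)"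
    using cat_assoc[OF K A A A A] by (auto simp: aut_group_def)
qed

section \<open>The category of symmetric monoidal categories\<close>

lemma SMCs_simps [simp]:
  "cob SMCs = {C. is_smc C}" "chom SMCs C D = {F. is_smc_functor C D F}"
  "cid SMCs = smcf_id" "ccomp SMCs C D E = smcf_comp C"
  by (simp_all add: SMCs_def fun_eq_iff)

lemma smcf_comp_simps [simp]:
  "A \<in> Obj C \<Longrightarrow> fobj (smcf_comp C G F) A = fobj G (fobj F A)"
  "f \<in> Arr C \<Longrightarrow> farr (smcf_comp C G F) f = farr G (farr F f)"
  by (simp_all add: smcf_comp_def smcf_restrict_def)

lemma smcf_id_simps [simp]:
  "A \<in> Obj C \<Longrightarrow> fobj (smcf_id C) A = A" "f \<in> Arr C \<Longrightarrow> farr (smcf_id C) f = f"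
  by (simp_all add: smcf_id_def smcf_restrict_def)

lemma smcf_restrict_functor: "is_smc_functor C D F \<Longrightarrow> smcf_restrict C F = F"
  by (auto simp: is_smc_functor_def smcf_restrict_def PiE_iff extensional_restrict intro!: smcf.equality)

lemma smcf_restrict_cong:
  "\<lbrakk>\<And>A. A \<in> Obj C \<Longrightarrow> fobj F A = fobj G A; \<And>f. f \<in> Arr C \<Longrightarrow> farr F f = farr G f\<rbrakk> \<Longrightarrow>
    smcf_restrict C F = smcf_restrict C G"
  by (auto simp: smcf_restrict_def restrict_def fun_eq_iff)

lemma smcf_comp_ids [simp]:
  assumes "is_smc_functor C D F"
  shows "smcf_comp C F (smcf_id C) = F" "smcf_comp C (smcf_id D) F = F"
proof -
  have C: "A \<in> Obj C \<Longrightarrow> fobj F A \<in> Obj D" "f \<in> Arr C \<Longrightarrow> farr F f \<in> Arr D" for A f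
    using assms by (auto simp: is_smc_functor_def PiE_iff)
  have "smcf_comp C F (smcf_id C) = smcf_restrict C F"
    unfolding smcf_comp_def by (rule smcf_restrict_cong) simp_all
  then show "smcf_comp C F (smcf_id C) = F" using smcf_restrict_functor[OF assms] by simp
  have "smcf_comp C (smcf_id D) F = smcf_restrict C F"
    unfolding smcf_comp_def by (rule smcf_restrict_cong) (simp_all add: C)
  then show "smcf_comp C (smcf_id D) F = F" using smcf_restrict_functor[OF assms] by simp
qed

lemma smcf_comp_assoc:
  assumes "is_smc_functor C D F"
  shows "smcf_comp C H (smcf_comp C G F) = smcf_comp C (smcf_comp D H G) F"
proof -
  have C: "A \<in> Obj C \<Longrightarrow> fobj F A \<in> Obj D" "f \<in> Arr C \<Longrightarrow> farr F f \<in> Arr D" for A f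
    using assms by (auto simp: is_smc_functor_def PiE_iff)
  show ?thesis
    unfolding smcf_comp_def[of C] by (rule smcf_restrict_cong) (simp_all add: C smcf_comp_def[of D] smcf_restrict_def)
qed

lemma is_smc_functor_comp:
  "is_smc C \<Longrightarrow> is_smc_functor C D F \<Longrightarrow> is_smc_functor D E G \<Longrightarrow> is_smc_functor C E (smcf_comp C G F)"
  by (intro sym_mon_cat.is_smc_functor_comp sym_mon_cat.intro)

lemma is_category_SMCs: "is_category SMCs"
  unfolding is_category_def
  by (auto simp: sym_mon_cat.is_smc_functor_id[OF sym_mon_cat.intro] is_smc_functor_comp smcf_comp_assoc)

section \<open>SMC-universes\<close>

locale universe =
  fixes \<Theta> :: "('u,'v,'o,'a) smcu"
  assumes is_universe: "is_smc_universe \<Theta>"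
begin

abbreviation K where "K \<equiv> ucat \<Theta>"
abbreviation ob where "ob \<equiv> omap (und \<Theta>)"
abbreviation ar where "ar \<equiv> mmap (und \<Theta>)"

lemma und_functor: "is_functor K SMCs (und \<Theta>)"
  using is_universe by (simp add: is_smc_universe_def)

lemma cat: "is_category K" by (rule functor_source[OF und_functor])

lemma ob_smc [simp]: "C \<in> cob K \<Longrightarrow> is_smc (ob C)"
  using functor_omap[OF und_functor] by simp

lemma ar_functor: "\<lbrakk>C \<in> cob K; C' \<in> cob K; f \<in> chom K C C'\<rbrakk> \<Longrightarrow> is_smc_functor (ob C) (ob C') (ar C C' f)"
  using functor_mmap[OF und_functor] by simp

lemma ar_cid [simp]: "C \<in> cob K \<Longrightarrow> ar C C (cid K C) = smcf_id (ob C)"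
  using functor_cid[OF und_functor] by simp

lemma ar_ccomp: "\<lbrakk>A \<in> cob K; B \<in> cob K; C \<in> cob K; f \<in> chom K A B; g \<in> chom K B C\<rbrakk> \<Longrightarrow>
    ar A C (ccomp K A B C g f) = smcf_comp (ob A) (ar B C g) (ar A B f)"
  using functor_ccomp[OF und_functor] by simp

lemma actionD:
  assumes "is_action K C G Phi"
  shows action_hom: "Phi \<in> hom G (aut_group K C)"
    and action_chom: "\<gamma> \<in> carrier G \<Longrightarrow> Phi \<gamma> \<in> chom K C C"
    and action_mult: "\<lbrakk>\<gamma> \<in> carrier G; \<delta> \<in> carrier G\<rbrakk> \<Longrightarrow> Phi (\<gamma> \<otimes>\<^bsub>G\<^esub> \<delta>) = ccomp K C C C (Phi \<gamma>) (Phi \<delta>)"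
    and action_ext: "Phi \<in> extensional (carrier G)"
  using assms by (auto simp: is_action_def hom_def aut_group_def Pi_iff)

lemma smc_action:
  assumes C: "C \<in> cob K" and G: "fab_group G" and Phi: "is_action K C G Phi"
  shows "smc_action (ob C) G (und_act \<Theta> C G Phi)"
proof -
  interpret D: sym_mon_cat "ob C" by unfold_locales (use C in simp)
  interpret G: comm_group G using G by (simp add: fab_group_def)
  note a = actionD[OF Phi]
  have "ar C C (Phi (\<gamma> \<otimes>\<^bsub>G\<^esub> \<delta>)) = smcf_comp (ob C) (ar C C (Phi \<gamma>)) (ar C C (Phi \<delta>))"
    if "\<gamma> \<in> carrier G" "\<delta> \<in> carrier G" for \<gamma> \<delta>
    using a that ar_ccomp[OF C C C] by simp
  then show ?thesis
    by unfold_locales (use a C G ar_functor[OF C C] in \<open>simp_all add: und_act_def\<close>)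
qed

lemma und_act_ext: "und_act \<Theta> C G Phi \<in> extensional (carrier G)"
  by (simp add: und_act_def)

end

lemma uimage_simps:
  "cob (uimage \<Theta>) = omap (und \<Theta>) ` cob (ucat \<Theta>)"
  "chom (uimage \<Theta>) X Y = {mmap (und \<Theta>) A B f | A B f. A \<in> cob (ucat \<Theta>) \<and> B \<in> cob (ucat \<Theta>)
     \<and> f \<in> chom (ucat \<Theta>) A B \<and> omap (und \<Theta>) A = X \<and> omap (und \<Theta>) B = Y}"
  "cid (uimage \<Theta>) = smcf_id" "ccomp (uimage \<Theta>) A B C = smcf_comp A"
  by (simp_all add: uimage_def image_cat_def)

section \<open>The PreCPM universe\<close>

lemma precpm_simps [simp]:
  "cob (ucat (precpm \<Theta>)) = precpm_obs \<Theta>" "chom (ucat (precpm \<Theta>)) = precpm_homs \<Theta>"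
  "cid (ucat (precpm \<Theta>)) X = cid (ucat \<Theta>) (pobj X)"
  "ccomp (ucat (precpm \<Theta>)) X Y Z = ccomp (ucat \<Theta>) (pobj X) (pobj Y) (pobj Z)"
  "omap (und (precpm \<Theta>)) X = omap (und \<Theta>) (pobj X)"
  "mmap (und (precpm \<Theta>)) X Y = mmap (und \<Theta>) (pobj X) (pobj Y)"
  by (simp_all add: precpm_def)

lemma precpm_obs_Pre [simp]:
  "Pre C G Phi Xi \<in> precpm_obs \<Theta> \<longleftrightarrow> C \<in> cob (ucat \<Theta>) \<and> fab_group G \<and> is_action (ucat \<Theta>) C G Phi \<and>
     is_multi_env (omap (und \<Theta>) C) G (und_act \<Theta> C G Phi) Xi \<and> cpm_in \<Theta> C G Phi Xi \<and> fold_inj \<Theta> C G Phi"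
  by (simp add: precpm_obs_def)

lemma precpm_obsE:
  assumes "X \<in> precpm_obs \<Theta>"
  obtains C G Phi Xi where "X = Pre C G Phi Xi" "Pre C G Phi Xi \<in> precpm_obs \<Theta>"
  using assms by (auto simp: precpm_obs_def)

lemma precpm_homs_Pre [simp]:
  "F \<in> precpm_homs \<Theta> (Pre C G Phi Xi) (Pre C' G' Phi' Xi') \<longleftrightarrow> G' = G \<and> F \<in> chom (ucat \<Theta>) C C' \<and>
    (\<forall>\<gamma>\<in>carrier G. ccomp (ucat \<Theta>) C C C' F (Phi \<gamma>) = ccomp (ucat \<Theta>) C C' C' (Phi' \<gamma>) F) \<and>
    (\<forall>A\<in>Obj (omap (und \<Theta>) C). \<forall>\<xi>\<in>Xi A.
       farr (mmap (und \<Theta>) C C' F) \<xi> \<in> Xi' (fobj (mmap (und \<Theta>) C C' F) A))"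
  unfolding precpm_homs_def by (auto simp: image_subset_iff)

lemma precpm_und_act [simp]: "und_act (precpm \<Theta>) X = und_act \<Theta> (pobj X)"
  by (simp add: und_act_def fun_eq_iff)

lemma precpm_fold_inj [simp]: "fold_inj (precpm \<Theta>) X = fold_inj \<Theta> (pobj X)"
  by (simp add: fold_inj_def fun_eq_iff)

locale univ = universe \<Theta> for \<Theta> :: "('b,'v,'o,'a,'g::linorder) univ"
begin

lemma homs_chom: "F \<in> precpm_homs \<Theta> X Y \<Longrightarrow> F \<in> chom K (pobj X) (pobj Y)"
  by (auto simp: precpm_homs_def)

lemma obs_cob: "X \<in> precpm_obs \<Theta> \<Longrightarrow> pobj X \<in> cob K"
  by (auto elim: precpm_obsE)

lemma precpm_category: "is_category (ucat (precpm \<Theta>))"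
proof -
  have comp: "ccomp K C1 C2 C3 g f \<in> precpm_homs \<Theta> (Pre C1 G Phi1 Xi1) (Pre C3 G Phi3 Xi3)"
    if X1: "Pre C1 G Phi1 Xi1 \<in> precpm_obs \<Theta>" and X2: "Pre C2 G Phi2 Xi2 \<in> precpm_obs \<Theta>"
      and X3: "Pre C3 G Phi3 Xi3 \<in> precpm_obs \<Theta>"
      and f: "f \<in> precpm_homs \<Theta> (Pre C1 G Phi1 Xi1) (Pre C2 G Phi2 Xi2)"
      and g: "g \<in> precpm_homs \<Theta> (Pre C2 G Phi2 Xi2) (Pre C3 G Phi3 Xi3)"
    for C1 C2 C3 G Phi1 Phi2 Phi3 Xi1 Xi2 Xi3 f g
  proof -
    have C: "C1 \<in> cob K" "C2 \<in> cob K" "C3 \<in> cob K" using X1 X2 X3 by auto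
    have fg: "f \<in> chom K C1 C2" "g \<in> chom K C2 C3" using f g by auto
    have fg': "ccomp K C1 C2 C3 g f \<in> chom K C1 C3" using cat_ccomp[OF cat C fg] .
    have "ccomp K C1 C1 C3 (ccomp K C1 C2 C3 g f) (Phi1 \<gamma>) = ccomp K C1 C3 C3 (Phi3 \<gamma>) (ccomp K C1 C2 C3 g f)"
      if \<gamma>: "\<gamma> \<in> carrier G" for \<gamma>
    proof -
      have P: "Phi1 \<gamma> \<in> chom K C1 C1" "Phi2 \<gamma> \<in> chom K C2 C2" "Phi3 \<gamma> \<in> chom K C3 C3"
        using X1 X2 X3 \<gamma> by (auto intro: action_chom)
      have "ccomp K C1 C1 C3 (ccomp K C1 C2 C3 g f) (Phi1 \<gamma>) = ccomp K C1 C2 C3 g (ccomp K C1 C1 C2 f (Phi1 \<gamma>))"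
        using cat_assoc[OF cat C(1,1,2,3) P(1) fg] by simp
      also have "\<dots> = ccomp K C1 C2 C3 g (ccomp K C1 C2 C2 (Phi2 \<gamma>) f)" using f \<gamma> by simp
      also have "\<dots> = ccomp K C1 C2 C3 (ccomp K C2 C2 C3 g (Phi2 \<gamma>)) f"
        using cat_assoc[OF cat C(1,2,2,3) fg(1) P(2) fg(2)] by simp
      also have "\<dots> = ccomp K C1 C2 C3 (ccomp K C2 C3 C3 (Phi3 \<gamma>) g) f" using g \<gamma> by simp
      also have "\<dots> = ccomp K C1 C3 C3 (Phi3 \<gamma>) (ccomp K C1 C2 C3 g f)"
        using cat_assoc[OF cat C(1,2,3,3) fg P(3)] by simp
      finally show ?thesis .
    qed
    moreover have "farr (ar C1 C3 (ccomp K C1 C2 C3 g f)) \<xi> \<in> Xi3 (fobj (ar C1 C3 (ccomp K C1 C2 C3 g f)) A)"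
      if A: "A \<in> Obj (ob C1)" "\<xi> \<in> Xi1 A" for A \<xi>
    proof -
      have "\<xi> \<in> Arr (ob C1)" using X1 A by (auto simp: is_multi_env_def Homs_def)
      moreover have "fobj (ar C1 C2 f) A \<in> Obj (ob C2)"
        using ar_functor[OF C(1,2) fg(1)] A by (auto simp: is_smc_functor_def PiE_iff)
      ultimately show ?thesis using f g A by (simp add: ar_ccomp[OF C fg])
    qed
    ultimately show ?thesis using fg' by simp
  qed
  have id: "cid K C \<in> precpm_homs \<Theta> (Pre C G Phi Xi) (Pre C G Phi Xi)"
    if X: "Pre C G Phi Xi \<in> precpm_obs \<Theta>" for C G Phi Xi
    unfolding precpm_homs_Pre
  proof (intro conjI ballI)
    have C: "C \<in> cob K" using X by simp
    show "cid K C \<in> chom K C C" by (rule cat_cid[OF cat C])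
    fix \<gamma> assume "\<gamma> \<in> carrier G"
    then have "Phi \<gamma> \<in> chom K C C" using X by (intro action_chom) simp_all
    then show "ccomp K C C C (cid K C) (Phi \<gamma>) = ccomp K C C C (Phi \<gamma>) (cid K C)"
      using cat_left[OF cat C C] cat_right[OF cat C C] by metis
  next
    fix A \<xi> assume A: "A \<in> Obj (ob C)" "\<xi> \<in> Xi A"
    then have "\<xi> \<in> Arr (ob C)" using X by (auto simp: is_multi_env_def Homs_def)
    then show "farr (ar C C (cid K C)) \<xi> \<in> Xi (fobj (ar C C (cid K C)) A)" using A X by simp
  qed simp
  show ?thesis
    unfolding is_category_def precpm_simps
  proof (intro conjI ballI)
    fix X assume "X \<in> precpm_obs \<Theta>"
    then show "cid K (pobj X) \<in> precpm_homs \<Theta> X X"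
      by (rule precpm_obsE) (simp only: id uobj.sel)
  next
    fix X Y Z f g assume XYZ: "X \<in> precpm_obs \<Theta>" "Y \<in> precpm_obs \<Theta>" "Z \<in> precpm_obs \<Theta>"
      and fg: "f \<in> precpm_homs \<Theta> X Y" "g \<in> precpm_homs \<Theta> Y Z"
    obtain C1 G Phi1 Xi1 where X: "X = Pre C1 G Phi1 Xi1" using XYZ(1) by (rule precpm_obsE)
    obtain C2 G2 Phi2 Xi2 where Y: "Y = Pre C2 G2 Phi2 Xi2" using XYZ(2) by (rule precpm_obsE)
    obtain C3 G3 Phi3 Xi3 where Z: "Z = Pre C3 G3 Phi3 Xi3" using XYZ(3) by (rule precpm_obsE)
    have "G2 = G" "G3 = G" using fg unfolding X Y Z by auto
    then show "ccomp K (pobj X) (pobj Y) (pobj Z) g f \<in> precpm_homs \<Theta> X Z"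
      using comp[OF XYZ[unfolded X Y Z \<open>G2 = G\<close> \<open>G3 = G\<close>]] fg unfolding X Y Z by (simp only: uobj.sel)
  next
    fix X Y f assume "X \<in> precpm_obs \<Theta>" "Y \<in> precpm_obs \<Theta>" "f \<in> precpm_homs \<Theta> X Y"
    then show "ccomp K (pobj X) (pobj X) (pobj Y) f (cid K (pobj X)) = f"
      "ccomp K (pobj X) (pobj Y) (pobj Y) (cid K (pobj Y)) f = f"
      by (simp_all only: cat_right[OF cat obs_cob obs_cob homs_chom] cat_left[OF cat obs_cob obs_cob homs_chom])
  next
    fix X Y Z W f g h assume "X \<in> precpm_obs \<Theta>" "Y \<in> precpm_obs \<Theta>" "Z \<in> precpm_obs \<Theta>" "W \<in> precpm_obs \<Theta>"
      "f \<in> precpm_homs \<Theta> X Y" "g \<in> precpm_homs \<Theta> Y Z" "h \<in> precpm_homs \<Theta> Z W"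
    then show "ccomp K (pobj X) (pobj Z) (pobj W) h (ccomp K (pobj X) (pobj Y) (pobj Z) g f)
      = ccomp K (pobj X) (pobj Y) (pobj W) (ccomp K (pobj Y) (pobj Z) (pobj W) h g) f"
      by (intro cat_assoc[OF cat] obs_cob homs_chom)
  qed
qed

lemma precpm_functor: "is_functor (ucat (precpm \<Theta>)) SMCs (und (precpm \<Theta>))"
  unfolding is_functor_def
  using precpm_category is_category_SMCs homs_chom obs_cob ar_functor ar_ccomp by simp

lemma und_act_triv: "C \<in> cob K \<Longrightarrow> und_act \<Theta> C gtriv (act_triv K C) = triv (ob C)"
  by (auto simp: und_act_def act_triv_def fun_eq_iff)

text \<open>
  Values of the unit of the monad are objects, because the CPM construction for the trivial action
  returns the given category. Hence both universes have the same image in the category of symmetric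
  monoidal categories.
\<close>

lemma unit_obs:
  assumes C: "C \<in> cob K" shows "Pre C gtriv (act_triv K C) (env_triv (ob C)) \<in> precpm_obs \<Theta>"
proof -
  interpret D: sym_mon_cat "ob C" by unfold_locales (use C in simp)
  have "cid K C \<in> chom K C C" "ccomp K C C C (cid K C) (cid K C) = cid K C"
    using cat_cid[OF cat C] cat_left[OF cat C C] by auto
  then have "is_action K C gtriv (act_triv K C)"
    by (auto simp: is_action_def act_triv_def hom_def aut_group_def)
  moreover have "cpm_in \<Theta> C gtriv (act_triv K C) (env_triv (ob C))"
    using C cat_cid[OF cat C] by (auto simp: cpm_in_def Let_def und_act_triv D.cpm_triv D.fld_triv uimage_simps
      intro!: exI[of _ C] exI[of _ "cid K C"])
  moreover have "fold_inj \<Theta> C gtriv (act_triv K C)"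
    using C by (simp add: fold_inj_def und_act_triv inj_on_def)
  ultimately show ?thesis using C by (simp add: und_act_triv D.is_multi_env_triv)
qed

lemma unit_homs:
  assumes C: "C \<in> cob K" "C' \<in> cob K" and F: "F \<in> chom K C C'"
  shows "F \<in> precpm_homs \<Theta> (Pre C gtriv (act_triv K C) (env_triv (ob C))) (Pre C' gtriv (act_triv K C') (env_triv (ob C')))"
proof -
  interpret F: smc_functor "ob C" "ob C'" "ar C C' F"
    by unfold_locales (use C ar_functor[OF C F] in simp_all)
  show ?thesis
    using F cat_left[OF cat C F] cat_right[OF cat C F]
    by (auto simp: act_triv_def env_triv_def split: if_splits)
qed

lemma uimage_precpm: "uimage (precpm \<Theta>) = uimage \<Theta>"
proof -
  have "cob (uimage (precpm \<Theta>)) = cob (uimage \<Theta>)"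
  proof (intro equalityI subsetI)
    fix D assume "D \<in> cob (uimage \<Theta>)"
    then obtain C where "C \<in> cob K" "D = ob C" by (auto simp: uimage_simps)
    then show "D \<in> cob (uimage (precpm \<Theta>))"
      using unit_obs by (auto simp: uimage_simps simp del: precpm_obs_Pre intro!: image_eqI[where x = "Pre C gtriv (act_triv K C) (env_triv (ob C))"])
  qed (auto simp: uimage_simps obs_cob)
  moreover have "chom (uimage (precpm \<Theta>)) D E = chom (uimage \<Theta>) D E" for D E
  proof (intro equalityI subsetI)
    fix f assume "f \<in> chom (uimage \<Theta>) D E"
    then obtain C C' F where F: "C \<in> cob K" "C' \<in> cob K" "F \<in> chom K C C'" "ob C = D" "ob C' = E" "f = ar C C' F"
      by (auto simp: uimage_simps)
    let ?e = "\<lambda>C. Pre C gtriv (act_triv K C) (env_triv (ob C))"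
    have "?e C \<in> precpm_obs \<Theta>" "?e C' \<in> precpm_obs \<Theta>" "F \<in> precpm_homs \<Theta> (?e C) (?e C')"
      by (rule unit_obs[OF F(1)], rule unit_obs[OF F(2)], rule unit_homs[OF F(1-3)])
    then show "f \<in> chom (uimage (precpm \<Theta>)) D E"
      using F(4-6) unfolding uimage_simps precpm_simps mem_Collect_eq
      by (intro exI[of _ "?e C"] exI[of _ "?e C'"] exI[of _ F]) (simp del: precpm_obs_Pre precpm_homs_Pre)
  next
    fix f assume "f \<in> chom (uimage (precpm \<Theta>)) D E"
    then show "f \<in> chom (uimage \<Theta>) D E" using homs_chom obs_cob unfolding uimage_simps precpm_simps by blast
  qed
  ultimately show ?thesis by (intro cat.equality) (auto simp: fun_eq_iff uimage_simps(3,4))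
qed

lemma precpm_universe: "is_smc_universe (precpm \<Theta>)"
proof -
  have "inj_on (ar (pobj X) (pobj Y)) (precpm_homs \<Theta> X Y)" if "X \<in> precpm_obs \<Theta>" "Y \<in> precpm_obs \<Theta>" for X Y
  proof (rule inj_on_subset)
    show "inj_on (ar (pobj X) (pobj Y)) (chom K (pobj X) (pobj Y))"
      using is_universe obs_cob[OF that(1)] obs_cob[OF that(2)] unfolding is_smc_universe_def is_faithful_def by blast
  qed (use homs_chom in blast)
  then show ?thesis
    using is_universe precpm_functor by (simp add: is_smc_universe_def uimage_precpm is_faithful_def)
qed

lemma precpm_cpm_in: "cpm_in (precpm \<Theta>) X G Phi Xi \<longleftrightarrow> cpm_in \<Theta> (pobj X) G Phi Xi"
  by (simp add: cpm_in_def uimage_precpm)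

lemma precpm_forget:
  assumes "Pre X H Phi' Xi' \<in> precpm_obs (precpm \<Theta>)"
  shows "Pre (pobj X) H Phi' Xi' \<in> precpm_obs \<Theta>"
proof -
  have "X \<in> precpm_obs \<Theta>" using assms by simp
  then have "pobj X \<in> cob K" by (auto elim: precpm_obsE)
  moreover have "is_action (ucat (precpm \<Theta>)) X H Phi' \<Longrightarrow> is_action K (pobj X) H Phi'"
    using homs_chom by (auto simp: is_action_def hom_def aut_group_def Pi_iff) blast
  ultimately show ?thesis using assms by (simp add: precpm_cpm_in)
qed

end

section \<open>Morphisms of SMC-universes\<close>

text \<open>
  Morphisms of universes are pinned outside their source, so they are equal once they agree on it.
\<close>

definition umor_agree :: "('u,'v,'o,'a) smcu \<Rightarrow> ('u,'v,'o,'a) umor \<Rightarrow> ('u,'v,'o,'a) umor \<Rightarrow> bool" where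
  "umor_agree \<Theta> m m' \<longleftrightarrow>
     (\<forall>C\<in>cob (ucat \<Theta>). omap (ufun m) C = omap (ufun m') C \<and> unat m C = unat m' C) \<and>
     (\<forall>C\<in>cob (ucat \<Theta>). \<forall>C'\<in>cob (ucat \<Theta>). \<forall>f\<in>chom (ucat \<Theta>) C C'.
        mmap (ufun m) C C' f = mmap (ufun m') C C' f)"

text \<open>
  The conditions on a morphism of universes apart from its being pinned outside its source. Data
  given by formulas satisfy them as they stand, so that the restriction can be ignored until two
  morphisms are compared.
\<close>

definition umor_ok :: "('u,'v,'o,'a) smcu \<Rightarrow> ('u,'v,'o,'a) smcu \<Rightarrow> ('u,'v,'o,'a) umor \<Rightarrow> bool" where
  "umor_ok \<Theta> \<Theta>' m \<longleftrightarrow>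
     is_functor (ucat \<Theta>) (ucat \<Theta>') (ufun m) \<and>
     (\<forall>C\<in>cob (ucat \<Theta>).
        is_smc_functor (omap (und \<Theta>) C) (omap (und \<Theta>') (omap (ufun m) C)) (unat m C)) \<and>
     (\<forall>C\<in>cob (ucat \<Theta>). \<forall>C'\<in>cob (ucat \<Theta>). \<forall>f\<in>chom (ucat \<Theta>) C C'.
        smcf_comp (omap (und \<Theta>) C) (unat m C') (mmap (und \<Theta>) C C' f) =
        smcf_comp (omap (und \<Theta>) C)
          (mmap (und \<Theta>') (omap (ufun m) C) (omap (ufun m) C') (mmap (ufun m) C C' f)) (unat m C))"

lemma umor_restrict_simps [simp]:
  "C \<in> cob (ucat \<Theta>) \<Longrightarrow> omap (ufun (umor_restrict \<Theta> m)) C = omap (ufun m) C"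
  "C \<in> cob (ucat \<Theta>) \<Longrightarrow> unat (umor_restrict \<Theta> m) C = unat m C"
  "C \<in> cob (ucat \<Theta>) \<Longrightarrow> C' \<in> cob (ucat \<Theta>) \<Longrightarrow> f \<in> chom (ucat \<Theta>) C C' \<Longrightarrow>
    mmap (ufun (umor_restrict \<Theta> m)) C C' f = mmap (ufun m) C C' f"
  by (simp_all add: umor_restrict_def fctr_restrict_def)

lemma umor_agree_restrict: "umor_agree \<Theta> (umor_restrict \<Theta> m) m"
  by (simp add: umor_agree_def)

lemma umor_agree_sym: "umor_agree \<Theta> m m' \<Longrightarrow> umor_agree \<Theta> m' m"
  by (simp add: umor_agree_def)

lemma umor_agree_trans: "umor_agree \<Theta> m m' \<Longrightarrow> umor_agree \<Theta> m' m'' \<Longrightarrow> umor_agree \<Theta> m m''"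
  by (simp add: umor_agree_def)

lemma umor_restrict_cong:
  assumes "umor_agree \<Theta> m m'" shows "umor_restrict \<Theta> m = umor_restrict \<Theta> m'"
proof -
  have "restrict (omap (ufun m)) (cob (ucat \<Theta>)) = restrict (omap (ufun m')) (cob (ucat \<Theta>))"
    "restrict (unat m) (cob (ucat \<Theta>)) = restrict (unat m') (cob (ucat \<Theta>))"
    using assms by (auto simp: umor_agree_def restrict_def fun_eq_iff)
  moreover have "restrict (mmap (ufun m) C C') (chom (ucat \<Theta>) C C') = restrict (mmap (ufun m') C C') (chom (ucat \<Theta>) C C')"
    if "C \<in> cob (ucat \<Theta>)" "C' \<in> cob (ucat \<Theta>)" for C C'
    using assms that by (auto simp: umor_agree_def restrict_def fun_eq_iff)
  ultimately show ?thesis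
    by (simp add: umor_restrict_def fctr_restrict_def fun_eq_iff)
qed

lemma umor_restrict_idem [simp]: "umor_restrict \<Theta> (umor_restrict \<Theta> m) = umor_restrict \<Theta> m"
  by (rule umor_restrict_cong[OF umor_agree_restrict])

lemma umor_eqI:
  "umor_restrict \<Theta> m = m \<Longrightarrow> umor_restrict \<Theta> m' = m' \<Longrightarrow> umor_agree \<Theta> m m' \<Longrightarrow> m = m'"
  by (metis umor_restrict_cong)

lemma umor_ok_cong:
  assumes agree: "umor_agree \<Theta> m m'" and ok: "umor_ok \<Theta> \<Theta>' m" shows "umor_ok \<Theta> \<Theta>' m'"
proof -
  have F: "is_functor (ucat \<Theta>) (ucat \<Theta>') (ufun m)" using ok by (simp add: umor_ok_def)
  have o: "omap (ufun m') C = omap (ufun m) C" "unat m' C = unat m C" if "C \<in> cob (ucat \<Theta>)" for C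
    using agree that by (simp_all add: umor_agree_def)
  have h: "mmap (ufun m') C C' f = mmap (ufun m) C C' f"
    if "C \<in> cob (ucat \<Theta>)" "C' \<in> cob (ucat \<Theta>)" "f \<in> chom (ucat \<Theta>) C C'" for C C' f
    using agree that by (simp add: umor_agree_def)
  have "is_functor (ucat \<Theta>) (ucat \<Theta>') (ufun m')"
    using F cat_cid[OF functor_source[OF F]] cat_ccomp[OF functor_source[OF F]]
    unfolding is_functor_def by (simp add: o h)
  then show ?thesis using ok unfolding umor_ok_def by (simp add: o h)
qed

lemma umor_ok_restrict: "umor_ok \<Theta> \<Theta>' (umor_restrict \<Theta> m) \<longleftrightarrow> umor_ok \<Theta> \<Theta>' m"
  using umor_ok_cong umor_agree_restrict umor_agree_sym by blast

lemma is_functor_fctr_comp: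
  assumes F: "is_functor K L F" and G: "is_functor L M G" shows "is_functor K M (fctr_comp G F)"
  unfolding is_functor_def fctr_comp_def fctr.simps
  using functorD[OF F] functorD[OF G] by simp

lemma is_smcu_mor_iff:
  assumes "is_smc_universe \<Theta>" "is_smc_universe \<Theta>'"
  shows "is_smcu_mor \<Theta> \<Theta>' m \<longleftrightarrow> umor_restrict \<Theta> m = m \<and> umor_ok \<Theta> \<Theta>' m"
proof -
  have U: "is_functor (ucat \<Theta>) SMCs (und \<Theta>)" "is_functor (ucat \<Theta>') SMCs (und \<Theta>')"
    using assms by (simp_all add: is_smc_universe_def)
  show ?thesis
    unfolding is_smcu_mor_def umor_ok_def is_nat_trans_def
    using U is_functor_fctr_comp[OF _ U(2)] by (auto simp: fctr_comp_def)
qed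

lemma umor_comp_simps [simp]:
  "C \<in> cob (ucat \<Theta>) \<Longrightarrow> omap (ufun (umor_comp \<Theta> m' m)) C = omap (ufun m') (omap (ufun m) C)"
  "C \<in> cob (ucat \<Theta>) \<Longrightarrow> unat (umor_comp \<Theta> m' m) C
    = smcf_comp (omap (und \<Theta>) C) (unat m' (omap (ufun m) C)) (unat m C)"
  "C \<in> cob (ucat \<Theta>) \<Longrightarrow> C' \<in> cob (ucat \<Theta>) \<Longrightarrow> f \<in> chom (ucat \<Theta>) C C' \<Longrightarrow>
    mmap (ufun (umor_comp \<Theta> m' m)) C C' f
      = mmap (ufun m') (omap (ufun m) C) (omap (ufun m) C') (mmap (ufun m) C C' f)"
  by (simp_all add: umor_comp_def fctr_comp_def)

lemma umor_id_simps [simp]: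
  "C \<in> cob (ucat \<Theta>) \<Longrightarrow> omap (ufun (umor_id \<Theta>)) C = C"
  "C \<in> cob (ucat \<Theta>) \<Longrightarrow> unat (umor_id \<Theta>) C = smcf_id (omap (und \<Theta>) C)"
  "C \<in> cob (ucat \<Theta>) \<Longrightarrow> C' \<in> cob (ucat \<Theta>) \<Longrightarrow> f \<in> chom (ucat \<Theta>) C C' \<Longrightarrow>
    mmap (ufun (umor_id \<Theta>)) C C' f = f"
  by (simp_all add: umor_id_def fctr_id_def)

lemma umor_restrict_comp [simp]: "umor_restrict \<Theta> (umor_comp \<Theta> m' m) = umor_comp \<Theta> m' m"
  and umor_restrict_id [simp]: "umor_restrict \<Theta> (umor_id \<Theta>) = umor_id \<Theta>"
  by (simp_all add: umor_comp_def umor_id_def)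

lemma act_image_agree:
  assumes "umor_agree \<Theta> m m'" "C \<in> cob (ucat \<Theta>)" "\<And>\<gamma>. \<gamma> \<in> carrier G \<Longrightarrow> Phi \<gamma> \<in> chom (ucat \<Theta>) C C"
  shows "act_image m C G Phi = act_image m' C G Phi"
  using assms by (auto simp: act_image_def umor_agree_def fun_eq_iff)

lemma env_image_id:
  assumes "\<And>A. A \<notin> Obj D \<Longrightarrow> Xi A = {}" "\<And>A. Xi A \<subseteq> Arr D"
  shows "env_image D (smcf_id D) Xi = Xi"
proof (intro ext equalityI subsetI)
  fix B \<xi>
  show "\<xi> \<in> Xi B" if "\<xi> \<in> env_image D (smcf_id D) Xi B"
    using that by (rule env_imageE) (use assms in \<open>auto simp: subset_iff\<close>)
  show "\<xi> \<in> env_image D (smcf_id D) Xi B" if "\<xi> \<in> Xi B"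
  proof -
    have B: "B \<in> Obj D" "\<xi> \<in> Arr D" using assms that by auto
    then show ?thesis using env_imageI[of B D \<xi> Xi "smcf_id D"] that by simp
  qed
qed

lemma env_image_comp:
  assumes F: "is_smc_functor C D F" and Xi: "\<And>A. A \<in> Obj C \<Longrightarrow> Xi A \<subseteq> Arr C"
  shows "env_image C (smcf_comp C F' F) Xi = env_image D F' (env_image C F Xi)"
proof (intro ext equalityI subsetI)
  fix B \<xi>
  have FO: "fobj F A \<in> Obj D" if "A \<in> Obj C" for A
    using F that by (auto simp: is_smc_functor_def PiE_iff)
  show "\<xi> \<in> env_image D F' (env_image C F Xi) B" if "\<xi> \<in> env_image C (smcf_comp C F' F) Xi B"
  proof -
    from that obtain A \<xi>0 where A: "A \<in> Obj C" "fobj (smcf_comp C F' F) A = B" "\<xi>0 \<in> Xi A"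
      "farr (smcf_comp C F' F) \<xi>0 = \<xi>" by (rule env_imageE)
    then have "\<xi>0 \<in> Arr C" using Xi by blast
    with A have "fobj F' (fobj F A) = B" "farr F' (farr F \<xi>0) = \<xi>" by simp_all
    then show ?thesis
      using env_imageI[OF FO[OF A(1)], of "farr F \<xi>0" "env_image C F Xi" F'] env_imageI[of A C \<xi>0 Xi F] A by simp
  qed
  show "\<xi> \<in> env_image C (smcf_comp C F' F) Xi B" if "\<xi> \<in> env_image D F' (env_image C F Xi) B"
  proof -
    from that obtain A' \<xi>' where A': "fobj F' A' = B" "\<xi>' \<in> env_image C F Xi A'" "farr F' \<xi>' = \<xi>"
      by (rule env_imageE)
    from A'(2) obtain A \<xi>0 where A: "A \<in> Obj C" "fobj F A = A'" "\<xi>0 \<in> Xi A" "farr F \<xi>0 = \<xi>'"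
      by (rule env_imageE)
    then have "\<xi>0 \<in> Arr C" using Xi by blast
    then show ?thesis
      using env_imageI[of A C \<xi>0 Xi "smcf_comp C F' F"] A A' by simp
  qed
qed

context univ begin

lemma multi_env_basic:
  assumes "Pre C G Phi Xi \<in> precpm_obs \<Theta>"
  shows "A \<in> Obj (ob C) \<Longrightarrow> Xi A \<subseteq> Homs (ob C) (foldO (ob C) G (und_act \<Theta> C G Phi) A) (TUnit (ob C))"
    "A \<notin> Obj (ob C) \<Longrightarrow> Xi A = {}" "Xi A \<subseteq> Arr (ob C)"
proof -
  have env: "is_multi_env (ob C) G (und_act \<Theta> C G Phi) Xi" using assms by simp
  show "A \<in> Obj (ob C) \<Longrightarrow> Xi A \<subseteq> Homs (ob C) (foldO (ob C) G (und_act \<Theta> C G Phi) A) (TUnit (ob C))"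
    "A \<notin> Obj (ob C) \<Longrightarrow> Xi A = {}"
    using env unfolding is_multi_env_def by blast+
  then show "Xi A \<subseteq> Arr (ob C)" unfolding Homs_def by blast
qed

lemma Pre_action:
  assumes "Pre C G Phi Xi \<in> precpm_obs \<Theta>"
  shows "C \<in> cob K" "fab_group G" "is_action K C G Phi" "\<gamma> \<in> carrier G \<Longrightarrow> Phi \<gamma> \<in> chom K C C"
    "smc_action (ob C) G (und_act \<Theta> C G Phi)"
  using assms action_chom smc_action by auto

lemma umor_id_ok: "umor_ok \<Theta> \<Theta> (umor_id \<Theta>)"
proof -
  have id: "is_smc_functor (ob C) (ob C) (smcf_id (ob C))" if "C \<in> cob K" for C
    using that by (intro sym_mon_cat.is_smc_functor_id sym_mon_cat.intro) simp
  show ?thesis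
    unfolding umor_ok_def is_functor_def
    using cat cat_cid[OF cat] cat_ccomp[OF cat] id ar_functor
    by (simp add: smcf_comp_ids(1)[OF ar_functor] smcf_comp_ids(2)[OF ar_functor])
qed

end

locale umor = A: univ \<Theta> + B: univ \<Theta>' for \<Theta> \<Theta>' :: "('b,'v,'o,'a,'g::linorder) univ" +
  fixes m :: "('b,'v,'o,'a,'g) univ_mor"
  assumes ok: "umor_ok \<Theta> \<Theta>' m"
begin

abbreviation mo where "mo \<equiv> omap (ufun m)"
abbreviation mh where "mh \<equiv> mmap (ufun m)"

lemma ufun_functor: "is_functor A.K B.K (ufun m)"
  using ok by (simp add: umor_ok_def)

lemmas mo_cob [simp] = functor_omap[OF ufun_functor]
lemmas mh_chom = functor_mmap[OF ufun_functor]
lemmas mh_cid = functor_cid[OF ufun_functor]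
lemmas mh_ccomp = functor_ccomp[OF ufun_functor]

lemma unat_functor: "C \<in> cob A.K \<Longrightarrow> is_smc_functor (A.ob C) (B.ob (mo C)) (unat m C)"
  using ok by (simp add: umor_ok_def)

lemma unat_natural: "\<lbrakk>C \<in> cob A.K; C' \<in> cob A.K; f \<in> chom A.K C C'\<rbrakk> \<Longrightarrow>
    smcf_comp (A.ob C) (unat m C') (A.ar C C' f)
      = smcf_comp (A.ob C) (B.ar (mo C) (mo C') (mh C C' f)) (unat m C)"
  using ok by (simp add: umor_ok_def)

lemma unat_natural_apply:
  assumes "C \<in> cob A.K" "C' \<in> cob A.K" "f \<in> chom A.K C C'"
  shows "A \<in> Obj (A.ob C) \<Longrightarrow> fobj (unat m C') (fobj (A.ar C C' f) A) = fobj (B.ar (mo C) (mo C') (mh C C' f)) (fobj (unat m C) A)"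
    "g \<in> Arr (A.ob C) \<Longrightarrow> farr (unat m C') (farr (A.ar C C' f) g) = farr (B.ar (mo C) (mo C') (mh C C' f)) (farr (unat m C) g)"
proof -
  note n = unat_natural[OF assms]
  show "A \<in> Obj (A.ob C) \<Longrightarrow> fobj (unat m C') (fobj (A.ar C C' f) A) = fobj (B.ar (mo C) (mo C') (mh C C' f)) (fobj (unat m C) A)"
    using arg_cong[OF n, of "\<lambda>F. fobj F A"] by simp
  show "g \<in> Arr (A.ob C) \<Longrightarrow> farr (unat m C') (farr (A.ar C C' f) g) = farr (B.ar (mo C) (mo C') (mh C C' f)) (farr (unat m C) g)"
    using arg_cong[OF n, of "\<lambda>F. farr F g"] by simp
qed

lemma act_image_action:
  assumes C: "C \<in> cob A.K" and Phi: "is_action A.K C G Phi" and G: "fab_group G"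
  shows "is_action B.K (mo C) G (act_image m C G Phi)"
proof -
  interpret G: comm_group G using G by (simp add: fab_group_def)
  note a = A.actionD[OF Phi]
  have "mh C C (Phi \<gamma>) \<in> carrier (aut_group B.K (mo C))" if "\<gamma> \<in> carrier G" for \<gamma>
  proof -
    have "Phi \<gamma> \<in> carrier (aut_group A.K C)" using a(1) that by (auto simp: hom_def)
    then obtain g where f: "Phi \<gamma> \<in> chom A.K C C" and g: "g \<in> chom A.K C C"
      and inv: "ccomp A.K C C C g (Phi \<gamma>) = cid A.K C" "ccomp A.K C C C (Phi \<gamma>) g = cid A.K C"
      by (auto simp: aut_group_def)
    have "ccomp B.K (mo C) (mo C) (mo C) (mh C C g) (mh C C (Phi \<gamma>)) = cid B.K (mo C)"
      "ccomp B.K (mo C) (mo C) (mo C) (mh C C (Phi \<gamma>)) (mh C C g) = cid B.K (mo C)"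
      using mh_ccomp[OF C C C f g] mh_ccomp[OF C C C g f] inv mh_cid[OF C] by simp_all
    then show ?thesis using mh_chom[OF C C f] mh_chom[OF C C g] by (auto simp: aut_group_def)
  qed
  moreover have "mh C C (Phi (\<gamma> \<otimes>\<^bsub>G\<^esub> \<delta>)) = ccomp B.K (mo C) (mo C) (mo C) (mh C C (Phi \<gamma>)) (mh C C (Phi \<delta>))"
    if "\<gamma> \<in> carrier G" "\<delta> \<in> carrier G" for \<gamma> \<delta>
    using that a mh_ccomp[OF C C C] by simp
  ultimately show ?thesis
    by (auto simp: is_action_def hom_def act_image_def) (simp add: aut_group_def)
qed

lemma equivariant:
  assumes C: "C \<in> cob A.K" and Phi: "is_action A.K C G Phi" and G: "fab_group G"
  shows "equivariant_functor (A.ob C) (B.ob (mo C)) (unat m C) G (und_act \<Theta> C G Phi)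
    (und_act \<Theta>' (mo C) G (act_image m C G Phi))"
proof -
  interpret CA: smc_action "A.ob C" G "und_act \<Theta> C G Phi" by (rule A.smc_action[OF C G Phi])
  interpret CB: smc_action "B.ob (mo C)" G "und_act \<Theta>' (mo C) G (act_image m C G Phi)"
    by (rule B.smc_action[OF mo_cob[OF C] G act_image_action[OF C Phi G]])
  show ?thesis
    by unfold_locales
      (use unat_functor[OF C] unat_natural_apply[OF C C A.action_chom[OF Phi]] in
        \<open>simp_all add: und_act_def act_image_def\<close>)
qed

lemma precpm_image_obs:
  assumes X: "Pre C G Phi Xi \<in> precpm_obs \<Theta>" and pres: "preserves_cpm \<Theta> \<Theta>' m"
  shows "Pre (mo C) G (act_image m C G Phi) (env_image (A.ob C) (unat m C) Xi) \<in> precpm_obs \<Theta>'"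
proof -
  note P = A.Pre_action[OF X]
  interpret F: equivariant_functor "A.ob C" "B.ob (mo C)" "unat m C" G "und_act \<Theta> C G Phi"
    "und_act \<Theta>' (mo C) G (act_image m C G Phi)"
    by (rule equivariant[OF P(1,3,2)])
  have p: "env_image (A.ob C) (unat m C) Xi (TUnit (B.ob (mo C))) = {Idn (B.ob (mo C)) (TUnit (B.ob (mo C)))}"
    "fold_inj \<Theta>' (mo C) G (act_image m C G Phi)"
    "cpm_in \<Theta>' (mo C) G (act_image m C G Phi) (env_image (A.ob C) (unat m C) Xi)"
    using pres X unfolding preserves_cpm_def Let_def precpm_simps by blast+
  show ?thesis
    using p P act_image_action[OF P(1,3,2)] F.is_multi_env_image[OF _ p(1)] X by simp
qed

lemma precpm_image_homs:
  assumes X: "Pre C G Phi Xi \<in> precpm_obs \<Theta>" and Y: "Pre C' G Phi' Xi' \<in> precpm_obs \<Theta>"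
    and F: "F \<in> precpm_homs \<Theta> (Pre C G Phi Xi) (Pre C' G Phi' Xi')"
  shows "mh C C' F \<in> precpm_homs \<Theta>' (Pre (mo C) G (act_image m C G Phi) (env_image (A.ob C) (unat m C) Xi))
    (Pre (mo C') G (act_image m C' G Phi') (env_image (A.ob C') (unat m C') Xi'))"
  unfolding precpm_homs_Pre
proof (intro conjI ballI)
  note PX = A.Pre_action[OF X] and PY = A.Pre_action[OF Y]
  have F': "F \<in> chom A.K C C'" using F by simp
  show "mh C C' F \<in> chom B.K (mo C) (mo C')" by (rule mh_chom[OF PX(1) PY(1) F'])
  fix \<gamma> assume \<gamma>: "\<gamma> \<in> carrier G"
  have "ccomp A.K C C C' F (Phi \<gamma>) = ccomp A.K C C' C' (Phi' \<gamma>) F" using F \<gamma> by simp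
  then show "ccomp B.K (mo C) (mo C) (mo C') (mh C C' F) (act_image m C G Phi \<gamma>)
    = ccomp B.K (mo C) (mo C') (mo C') (act_image m C' G Phi' \<gamma>) (mh C C' F)"
    using mh_ccomp[OF PX(1,1) PY(1) PX(4)[OF \<gamma>] F'] mh_ccomp[OF PX(1) PY(1,1) F' PY(4)[OF \<gamma>]] \<gamma>
    by (simp add: act_image_def)
next
  note PX = A.Pre_action[OF X] and PY = A.Pre_action[OF Y]
  have F': "F \<in> chom A.K C C'" using F by simp
  fix B \<xi> assume "\<xi> \<in> env_image (A.ob C) (unat m C) Xi B"
  then obtain A \<xi>0 where A: "A \<in> Obj (A.ob C)" "fobj (unat m C) A = B" "\<xi>0 \<in> Xi A" "farr (unat m C) \<xi>0 = \<xi>"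
    by (rule env_imageE)
  have "\<xi>0 \<in> Arr (A.ob C)" using A.multi_env_basic(3)[OF X] A(3) by blast
  note n = unat_natural_apply(1)[OF PX(1) PY(1) F' A(1)] unat_natural_apply(2)[OF PX(1) PY(1) F' this]
  have "farr (A.ar C C' F) \<xi>0 \<in> Xi' (fobj (A.ar C C' F) A)" using F A by simp
  moreover have "fobj (A.ar C C' F) A \<in> Obj (A.ob C')"
    using A.ar_functor[OF PX(1) PY(1) F'] A(1) by (auto simp: is_smc_functor_def PiE_iff)
  ultimately show "farr (B.ar (mo C) (mo C') (mh C C' F)) \<xi>
    \<in> env_image (A.ob C') (unat m C') Xi' (fobj (B.ar (mo C) (mo C') (mh C C' F)) B)"
    unfolding A(2,4)[symmetric] n[symmetric] by (intro env_imageI)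
qed simp

end

section \<open>PreCPM on morphisms\<close>

text \<open>
  The formulas that define \<open>precpm_mor\<close>, valid before restriction to the source; in the
  same way \<open>mult_raw\<close>, \<open>unit_raw\<close> and \<open>cpm_raw\<close> below belong
  to the multiplication, the unit and \<open>CPM_mor\<close>.
\<close>

definition precpm_raw :: "('b,'v,'o,'a,'g::linorder) univ \<Rightarrow> ('b,'v,'o,'a,'g) univ_mor \<Rightarrow> ('b,'v,'o,'a,'g) univ_mor" where
  "precpm_raw \<Theta> m = \<lparr>ufun = \<lparr>omap = (\<lambda>X. Pre (omap (ufun m) (pobj X)) (pgrp X)
                              (act_image m (pobj X) (pgrp X) (pact X))
                              (env_image (omap (und \<Theta>) (pobj X)) (unat m (pobj X)) (penv X))),
                mmap = (\<lambda>X Y. mmap (ufun m) (pobj X) (pobj Y))\<rparr>,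
        unat = (\<lambda>X. unat m (pobj X))\<rparr>"

lemma precpm_raw_simps [simp]:
  "omap (ufun (precpm_raw \<Theta> m)) (Pre C G Phi Xi)
    = Pre (omap (ufun m) C) G (act_image m C G Phi) (env_image (omap (und \<Theta>) C) (unat m C) Xi)"
  "mmap (ufun (precpm_raw \<Theta> m)) X Y = mmap (ufun m) (pobj X) (pobj Y)"
  "unat (precpm_raw \<Theta> m) X = unat m (pobj X)"
  by (simp_all add: precpm_raw_def)

lemma precpm_mor_raw: "precpm_mor \<Theta> m = umor_restrict (precpm \<Theta>) (precpm_raw \<Theta> m)"
  by (simp add: precpm_mor_def precpm_raw_def)

context umor begin

lemma precpm_raw_ok:
  assumes pres: "preserves_cpm \<Theta> \<Theta>' m"
  shows "umor_ok (precpm \<Theta>) (precpm \<Theta>') (precpm_raw \<Theta> m)"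
  unfolding umor_ok_def is_functor_def precpm_simps precpm_raw_simps
proof (intro conjI ballI)
  show "is_category (ucat (precpm \<Theta>))" "is_category (ucat (precpm \<Theta>'))"
    by (rule A.precpm_category, rule B.precpm_category)
  fix X assume X: "X \<in> precpm_obs \<Theta>"
  then obtain C G Phi Xi where XC: "X = Pre C G Phi Xi" by (rule precpm_obsE)
  note PX = A.Pre_action[OF X[unfolded XC]]
  show "omap (ufun (precpm_raw \<Theta> m)) X \<in> precpm_obs \<Theta>'"
    unfolding XC precpm_raw_simps by (rule precpm_image_obs[OF X[unfolded XC] pres])
  show "mh (pobj X) (pobj X) (cid A.K (pobj X)) = cid B.K (pobj (omap (ufun (precpm_raw \<Theta> m)) X))"
    unfolding XC using mh_cid[OF PX(1)] by simp
  show "is_smc_functor (A.ob (pobj X)) (B.ob (pobj (omap (ufun (precpm_raw \<Theta> m)) X))) (unat m (pobj X))"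
    unfolding XC using unat_functor[OF PX(1)] by simp
  fix Y F assume Y: "Y \<in> precpm_obs \<Theta>" and F: "F \<in> precpm_homs \<Theta> X Y"
  obtain C' G' Phi' Xi' where YC: "Y = Pre C' G' Phi' Xi'" using Y by (rule precpm_obsE)
  have G: "G' = G" using F unfolding XC YC by simp
  note PY = A.Pre_action[OF Y[unfolded YC]]
  show "mh (pobj X) (pobj Y) F \<in> precpm_homs \<Theta>' (omap (ufun (precpm_raw \<Theta> m)) X) (omap (ufun (precpm_raw \<Theta> m)) Y)"
    using precpm_image_homs[OF X[unfolded XC] Y[unfolded YC G] F[unfolded XC YC G]]
    unfolding XC YC G precpm_raw_simps uobj.sel .
  show "smcf_comp (A.ob (pobj X)) (unat m (pobj Y)) (A.ar (pobj X) (pobj Y) F)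
    = smcf_comp (A.ob (pobj X)) (B.ar (pobj (omap (ufun (precpm_raw \<Theta> m)) X)) (pobj (omap (ufun (precpm_raw \<Theta> m)) Y))
        (mh (pobj X) (pobj Y) F)) (unat m (pobj X))"
    using unat_natural[OF PX(1) PY(1) A.homs_chom[OF F, unfolded XC YC uobj.sel]] unfolding XC YC by simp
  fix Z H assume Z: "Z \<in> precpm_obs \<Theta>" and H: "H \<in> precpm_homs \<Theta> Y Z"
  obtain C'' G'' Phi'' Xi'' where ZC: "Z = Pre C'' G'' Phi'' Xi''" using Z by (rule precpm_obsE)
  note PZ = A.Pre_action[OF Z[unfolded ZC]]
  show "mh (pobj X) (pobj Z) (ccomp A.K (pobj X) (pobj Y) (pobj Z) H F)
    = ccomp B.K (pobj (omap (ufun (precpm_raw \<Theta> m)) X)) (pobj (omap (ufun (precpm_raw \<Theta> m)) Y))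
        (pobj (omap (ufun (precpm_raw \<Theta> m)) Z)) (mh (pobj Y) (pobj Z) H) (mh (pobj X) (pobj Y) F)"
    using mh_ccomp[OF PX(1) PY(1) PZ(1) A.homs_chom[OF F, unfolded XC YC uobj.sel] A.homs_chom[OF H, unfolded YC ZC uobj.sel]]
    unfolding XC YC ZC by simp
qed

end

section \<open>Preservation of CPM categories\<close>

lemma univI: "is_smc_universe \<Theta> \<Longrightarrow> univ \<Theta>"
  by (intro univ.intro universe.intro)

lemma umorI: "is_smc_universe \<Theta> \<Longrightarrow> is_smc_universe \<Theta>' \<Longrightarrow> umor_ok \<Theta> \<Theta>' m \<Longrightarrow> umor \<Theta> \<Theta>' m"
  by (intro umor.intro umor_axioms.intro univI)

lemma preserves_cpm_cong:
  assumes U: "is_smc_universe \<Theta>" and agree: "umor_agree \<Theta> m m'" and pres: "preserves_cpm \<Theta> \<Theta>' m"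
  shows "preserves_cpm \<Theta> \<Theta>' m'"
  unfolding preserves_cpm_def
proof (intro allI impI)
  interpret univ \<Theta> by (rule univI[OF U])
  fix C G Phi Xi assume "Pre C G Phi Xi \<in> cob (ucat (precpm \<Theta>))"
  then have X: "Pre C G Phi Xi \<in> precpm_obs \<Theta>" by simp
  note P = Pre_action[OF X]
  have "act_image m C G Phi = act_image m' C G Phi" by (rule act_image_agree[OF agree P(1,4)])
  moreover have "omap (ufun m) C = omap (ufun m') C" "unat m C = unat m' C"
    using agree P(1) by (simp_all add: umor_agree_def)
  ultimately show "let C' = omap (ufun m') C; D' = omap (und \<Theta>') C'; Phi' = act_image m' C G Phi;
             Xi' = env_image (omap (und \<Theta>) C) (unat m' C) Xi in
         Xi' (TUnit D') = {Idn D' (TUnit D')} \<and> fold_inj \<Theta>' C' G Phi' \<and> cpm_in \<Theta>' C' G Phi' Xi'"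
    using pres X unfolding preserves_cpm_def precpm_simps by (metis (no_types, lifting))
qed

text \<open>
  All conditions of \<open>preserves_cpm\<close> depend only on the underlying category, action and
  effects, and on the image of the universe.
\<close>

lemma preserves_cpm_same_und:
  assumes U: "is_smc_universe \<Theta>" and img: "uimage \<Theta>' = uimage \<Theta>"
    and ob: "\<And>C. C \<in> cob (ucat \<Theta>) \<Longrightarrow> omap (und \<Theta>') (omap (ufun m) C) = omap (und \<Theta>) C"
    and id: "\<And>C. C \<in> cob (ucat \<Theta>) \<Longrightarrow> unat m C = smcf_id (omap (und \<Theta>) C)"
    and ar: "\<And>C f. C \<in> cob (ucat \<Theta>) \<Longrightarrow> f \<in> chom (ucat \<Theta>) C C \<Longrightarrow>
      mmap (und \<Theta>') (omap (ufun m) C) (omap (ufun m) C) (mmap (ufun m) C C f) = mmap (und \<Theta>) C C f"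
  shows "preserves_cpm \<Theta> \<Theta>' m"
  unfolding preserves_cpm_def Let_def
proof (intro allI impI)
  interpret univ \<Theta> by (rule univI[OF U])
  fix C G Phi Xi assume "Pre C G Phi Xi \<in> cob (ucat (precpm \<Theta>))"
  then have X: "Pre C G Phi Xi \<in> precpm_obs \<Theta>" by simp
  note P = Pre_action[OF X]
  have act: "und_act \<Theta>' (omap (ufun m) C) G (act_image m C G Phi) = und_act \<Theta> C G Phi"
    using P ar[OF P(1)] by (auto simp: und_act_def act_image_def fun_eq_iff)
  have env: "env_image (omap (und \<Theta>) C) (unat m C) Xi = Xi"
    unfolding id[OF P(1)] by (rule env_image_id) (use multi_env_basic[OF X] in auto)
  have "Xi (TUnit (omap (und \<Theta>) C)) = {Idn (omap (und \<Theta>) C) (TUnit (omap (und \<Theta>) C))}"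
    "fold_inj \<Theta> C G Phi" "cpm_in \<Theta> C G Phi Xi"
    using X by (auto simp: is_multi_env_def)
  then show "env_image (omap (und \<Theta>) C) (unat m C) Xi (TUnit (omap (und \<Theta>') (omap (ufun m) C)))
      = {Idn (omap (und \<Theta>') (omap (ufun m) C)) (TUnit (omap (und \<Theta>') (omap (ufun m) C)))} \<and>
    fold_inj \<Theta>' (omap (ufun m) C) G (act_image m C G Phi) \<and>
    cpm_in \<Theta>' (omap (ufun m) C) G (act_image m C G Phi) (env_image (omap (und \<Theta>) C) (unat m C) Xi)"
    unfolding env by (simp add: fold_inj_def cpm_in_def act ob[OF P(1)] img)
qed

text \<open>
  An object of the iterated PreCPM universe remains one of the PreCPM universe when the inner action
  is forgotten, and the conditions do not see the inner action.
\<close>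

lemma (in umor) preserves_cpm_precpm_raw:
  assumes pres: "preserves_cpm \<Theta> \<Theta>' m"
  shows "preserves_cpm (precpm \<Theta>) (precpm \<Theta>') (precpm_raw \<Theta> m)"
  unfolding preserves_cpm_def Let_def
proof (intro allI impI)
  fix X H Phi Xi assume "Pre X H Phi Xi \<in> cob (ucat (precpm (precpm \<Theta>)))"
  then have 2: "Pre X H Phi Xi \<in> precpm_obs (precpm \<Theta>)" by simp
  then have "X \<in> precpm_obs \<Theta>" by simp
  then obtain C G Phi0 Xi0 where XC: "X = Pre C G Phi0 Xi0" by (rule precpm_obsE)
  have "Pre C H Phi Xi \<in> precpm_obs \<Theta>" using A.precpm_forget[OF 2] unfolding XC by simp
  then have p: "env_image (A.ob C) (unat m C) Xi (TUnit (B.ob (mo C))) = {Idn (B.ob (mo C)) (TUnit (B.ob (mo C)))}"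
    "fold_inj \<Theta>' (mo C) H (act_image m C H Phi)"
    "cpm_in \<Theta>' (mo C) H (act_image m C H Phi) (env_image (A.ob C) (unat m C) Xi)"
    using pres unfolding preserves_cpm_def Let_def precpm_simps by blast+
  have act: "act_image (precpm_raw \<Theta> m) X H Phi = act_image m C H Phi"
    by (simp add: act_image_def XC fun_eq_iff)
  show "env_image (omap (und (precpm \<Theta>)) X) (unat (precpm_raw \<Theta> m) X) Xi
      (TUnit (omap (und (precpm \<Theta>')) (omap (ufun (precpm_raw \<Theta> m)) X)))
    = {Idn (omap (und (precpm \<Theta>')) (omap (ufun (precpm_raw \<Theta> m)) X))
      (TUnit (omap (und (precpm \<Theta>')) (omap (ufun (precpm_raw \<Theta> m)) X)))} \<and>
    fold_inj (precpm \<Theta>') (omap (ufun (precpm_raw \<Theta> m)) X) H (act_image (precpm_raw \<Theta> m) X H Phi) \<and>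
    cpm_in (precpm \<Theta>') (omap (ufun (precpm_raw \<Theta> m)) X) H (act_image (precpm_raw \<Theta> m) X H Phi)
      (env_image (omap (und (precpm \<Theta>)) X) (unat (precpm_raw \<Theta> m) X) Xi)"
    unfolding act using p by (simp add: XC B.precpm_cpm_in)
qed

section \<open>The category of SMC-universes\<close>

lemma umor_ok_comp:
  fixes \<Theta> :: "('b,'v,'o,'a,'g::linorder) univ"
  assumes A: "is_smc_universe \<Theta>" and B: "is_smc_universe \<Theta>'" and C: "is_smc_universe \<Theta>''"
    and m: "umor_ok \<Theta> \<Theta>' m" and m': "umor_ok \<Theta>' \<Theta>'' m'"
  shows "umor_ok \<Theta> \<Theta>'' (umor_comp \<Theta> m' m)"
proof -
  interpret M: umor \<Theta> \<Theta>' m by (rule umorI[OF A B m])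
  interpret M': umor \<Theta>' \<Theta>'' m' by (rule umorI[OF B C m'])
  have F: "is_functor M.A.K M'.B.K (ufun (umor_comp \<Theta> m' m))"
  proof -
    have "is_functor M.A.K M'.B.K (fctr_comp (ufun m') (ufun m))"
      by (rule is_functor_fctr_comp[OF M.ufun_functor M'.ufun_functor])
    then show ?thesis
      using cat_cid[OF M.A.cat] cat_ccomp[OF M.A.cat] unfolding is_functor_def by (simp add: fctr_comp_def)
  qed
  have n: "is_smc_functor (M.A.ob X) (M'.B.ob (M'.mo (M.mo X))) (smcf_comp (M.A.ob X) (unat m' (M.mo X)) (unat m X))"
    if X: "X \<in> cob M.A.K" for X
    by (rule is_smc_functor_comp[OF M.A.ob_smc[OF X] M.unat_functor[OF X] M'.unat_functor[OF M.mo_cob[OF X]]])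
  have nat: "smcf_comp (M.A.ob X) (smcf_comp (M.A.ob Y) (unat m' (M.mo Y)) (unat m Y)) (M.A.ar X Y f)
    = smcf_comp (M.A.ob X) (M'.B.ar (M'.mo (M.mo X)) (M'.mo (M.mo Y)) (M'.mh (M.mo X) (M.mo Y) (M.mh X Y f)))
        (smcf_comp (M.A.ob X) (unat m' (M.mo X)) (unat m X))"
    if X: "X \<in> cob M.A.K" and Y: "Y \<in> cob M.A.K" and f: "f \<in> chom M.A.K X Y" for X Y f
  proof -
    let ?f' = "M.mh X Y f" and ?f'' = "M'.mh (M.mo X) (M.mo Y) (M.mh X Y f)"
    note mX = M.mo_cob[OF X] and mY = M.mo_cob[OF Y] and mf = M.mh_chom[OF X Y f]
    have "smcf_comp (M.A.ob X) (smcf_comp (M.A.ob Y) (unat m' (M.mo Y)) (unat m Y)) (M.A.ar X Y f)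
      = smcf_comp (M.A.ob X) (unat m' (M.mo Y)) (smcf_comp (M.A.ob X) (unat m Y) (M.A.ar X Y f))"
      by (rule smcf_comp_assoc[OF M.A.ar_functor[OF X Y f], symmetric])
    also have "\<dots> = smcf_comp (M.A.ob X) (unat m' (M.mo Y))
        (smcf_comp (M.A.ob X) (M.B.ar (M.mo X) (M.mo Y) ?f') (unat m X))"
      unfolding M.unat_natural[OF X Y f] ..
    also have "\<dots> = smcf_comp (M.A.ob X) (smcf_comp (M.B.ob (M.mo X)) (unat m' (M.mo Y)) (M.B.ar (M.mo X) (M.mo Y) ?f')) (unat m X)"
      by (rule smcf_comp_assoc[OF M.unat_functor[OF X]])
    also have "\<dots> = smcf_comp (M.A.ob X)
        (smcf_comp (M.B.ob (M.mo X)) (M'.B.ar (M'.mo (M.mo X)) (M'.mo (M.mo Y)) ?f'') (unat m' (M.mo X))) (unat m X)"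
      unfolding M'.unat_natural[OF mX mY mf] ..
    also have "\<dots> = smcf_comp (M.A.ob X) (M'.B.ar (M'.mo (M.mo X)) (M'.mo (M.mo Y)) ?f'')
        (smcf_comp (M.A.ob X) (unat m' (M.mo X)) (unat m X))"
      by (rule smcf_comp_assoc[OF M.unat_functor[OF X], symmetric])
    finally show ?thesis .
  qed
  show ?thesis unfolding umor_ok_def using F n nat by simp
qed

lemma preserves_cpm_comp:
  assumes A: "is_smc_universe \<Theta>" and B: "is_smc_universe \<Theta>'"
    and m: "umor_ok \<Theta> \<Theta>' m" and pm: "preserves_cpm \<Theta> \<Theta>' m" and pm': "preserves_cpm \<Theta>' \<Theta>'' m'"
  shows "preserves_cpm \<Theta> \<Theta>'' (umor_comp \<Theta> m' m)"
  unfolding preserves_cpm_def Let_def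
proof (intro allI impI)
  interpret M: umor \<Theta> \<Theta>' m by (rule umorI[OF A B m])
  fix C G Phi Xi assume "Pre C G Phi Xi \<in> cob (ucat (precpm \<Theta>))"
  then have X: "Pre C G Phi Xi \<in> precpm_obs \<Theta>" by simp
  note P = M.A.Pre_action[OF X]
  have act: "act_image (umor_comp \<Theta> m' m) C G Phi = act_image m' (M.mo C) G (act_image m C G Phi)"
    using P by (auto simp: act_image_def fun_eq_iff)
  have env: "env_image (M.A.ob C) (unat (umor_comp \<Theta> m' m) C) Xi
    = env_image (M.B.ob (M.mo C)) (unat m' (M.mo C)) (env_image (M.A.ob C) (unat m C) Xi)"
    using P M.A.multi_env_basic(3)[OF X] by (simp add: env_image_comp[OF M.unat_functor])
  from M.precpm_image_obs[OF X pm] pm'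
  show "env_image (M.A.ob C) (unat (umor_comp \<Theta> m' m) C) Xi (TUnit (omap (und \<Theta>'') (omap (ufun (umor_comp \<Theta> m' m)) C)))
      = {Idn (omap (und \<Theta>'') (omap (ufun (umor_comp \<Theta> m' m)) C)) (TUnit (omap (und \<Theta>'') (omap (ufun (umor_comp \<Theta> m' m)) C)))} \<and>
    fold_inj \<Theta>'' (omap (ufun (umor_comp \<Theta> m' m)) C) G (act_image (umor_comp \<Theta> m' m) C G Phi) \<and>
    cpm_in \<Theta>'' (omap (ufun (umor_comp \<Theta> m' m)) C) G (act_image (umor_comp \<Theta> m' m) C G Phi)
      (env_image (M.A.ob C) (unat (umor_comp \<Theta> m' m) C) Xi)"
    unfolding act env umor_comp_simps(1)[OF P(1)] preserves_cpm_def Let_def precpm_simps by blast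
qed

lemma preserves_cpm_id: "is_smc_universe \<Theta> \<Longrightarrow> preserves_cpm \<Theta> \<Theta> (umor_id \<Theta>)"
  by (rule preserves_cpm_same_und) simp_all

lemma SMCUnivs_cpm_simps [simp]:
  "cob SMCUnivs_cpm = {\<Theta>. is_smc_universe \<Theta>}"
  "cid SMCUnivs_cpm = umor_id" "ccomp SMCUnivs_cpm \<Theta> \<Theta>' \<Theta>'' = umor_comp \<Theta>"
  by (simp_all add: SMCUnivs_cpm_def SMCUnivs_def fun_eq_iff)

lemma SMCUnivs_cpm_chom:
  "is_smc_universe \<Theta> \<Longrightarrow> is_smc_universe \<Theta>' \<Longrightarrow>
    m \<in> chom SMCUnivs_cpm \<Theta> \<Theta>' \<longleftrightarrow> umor_restrict \<Theta> m = m \<and> umor_ok \<Theta> \<Theta>' m \<and> preserves_cpm \<Theta> \<Theta>' m"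
  by (auto simp: SMCUnivs_cpm_def SMCUnivs_def is_smcu_mor_iff)

lemma umor_comp_agree:
  fixes \<Theta> :: "('b,'v,'o,'a,'g::linorder) univ"
  assumes "is_smc_universe \<Theta>" "is_smc_universe \<Theta>'" "umor_ok \<Theta> \<Theta>' m"
    and "umor_agree \<Theta>' m1' m2'" "umor_agree \<Theta> m m2"
  shows "umor_comp \<Theta> m1' m = umor_comp \<Theta> m2' m2"
proof -
  interpret M: umor \<Theta> \<Theta>' m by (rule umorI[OF assms(1-3)])
  have "umor_agree \<Theta> (umor_comp \<Theta> m1' m) (umor_comp \<Theta> m2' m2)"
    unfolding umor_agree_def
  proof (intro conjI ballI)
    fix C assume C: "C \<in> cob M.A.K"
    have 1: "M.mo C = omap (ufun m2) C" "unat m C = unat m2 C"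
      using assms(5) C by (simp_all add: umor_agree_def)
    have 2: "omap (ufun m1') (M.mo C) = omap (ufun m2') (M.mo C)" "unat m1' (M.mo C) = unat m2' (M.mo C)"
      using assms(4) M.mo_cob[OF C] by (simp_all add: umor_agree_def)
    show "omap (ufun (umor_comp \<Theta> m1' m)) C = omap (ufun (umor_comp \<Theta> m2' m2)) C"
      "unat (umor_comp \<Theta> m1' m) C = unat (umor_comp \<Theta> m2' m2) C"
      unfolding umor_comp_simps(1,2)[OF C] 2 by (simp_all only: 1)
    fix C' f assume C': "C' \<in> cob M.A.K" and f: "f \<in> chom M.A.K C C'"
    have 3: "M.mo C' = omap (ufun m2) C'" "M.mh C C' f = mmap (ufun m2) C C' f"
      using assms(5) C C' f by (simp_all add: umor_agree_def)
    have 4: "mmap (ufun m1') (M.mo C) (M.mo C') (M.mh C C' f) = mmap (ufun m2') (M.mo C) (M.mo C') (M.mh C C' f)"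
      using assms(4) M.mo_cob[OF C] M.mo_cob[OF C'] M.mh_chom[OF C C' f] by (simp add: umor_agree_def)
    show "mmap (ufun (umor_comp \<Theta> m1' m)) C C' f = mmap (ufun (umor_comp \<Theta> m2' m2)) C C' f"
      unfolding umor_comp_simps(3)[OF C C' f] 4 by (simp only: 1 3)
  qed
  then show ?thesis by (rule umor_eqI[OF umor_restrict_comp umor_restrict_comp])
qed

lemma umor_comp_assoc:
  fixes \<Theta> :: "('b,'v,'o,'a,'g::linorder) univ"
  assumes A: "is_smc_universe \<Theta>" and B: "is_smc_universe \<Theta>'" and m: "umor_ok \<Theta> \<Theta>' m"
  shows "umor_comp \<Theta> m'' (umor_comp \<Theta> m' m) = umor_comp \<Theta> (umor_comp \<Theta>' m'' m') m"
proof -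
  interpret M: umor \<Theta> \<Theta>' m by (rule umorI[OF A B m])
  have "umor_agree \<Theta> (umor_comp \<Theta> m'' (umor_comp \<Theta> m' m)) (umor_comp \<Theta> (umor_comp \<Theta>' m'' m') m)"
    using M.mo_cob M.mh_chom smcf_comp_assoc[OF M.unat_functor] unfolding umor_agree_def by simp
  then show ?thesis by (rule umor_eqI[OF umor_restrict_comp umor_restrict_comp])
qed

lemma umor_comp_id:
  fixes \<Theta> :: "('b,'v,'o,'a,'g::linorder) univ"
  assumes A: "is_smc_universe \<Theta>" and B: "is_smc_universe \<Theta>'" and m: "umor_ok \<Theta> \<Theta>' m" "umor_restrict \<Theta> m = m"
  shows "umor_comp \<Theta> m (umor_id \<Theta>) = m" "umor_comp \<Theta> (umor_id \<Theta>') m = m"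
proof -
  interpret M: umor \<Theta> \<Theta>' m by (rule umorI[OF A B m(1)])
  have "umor_agree \<Theta> (umor_comp \<Theta> m (umor_id \<Theta>)) m" "umor_agree \<Theta> (umor_comp \<Theta> (umor_id \<Theta>') m) m"
    using M.mo_cob M.mh_chom unfolding umor_agree_def
    by (simp_all add: smcf_comp_ids(1)[OF M.unat_functor] smcf_comp_ids(2)[OF M.unat_functor])
  from umor_eqI[OF umor_restrict_comp m(2) this(1)] umor_eqI[OF umor_restrict_comp m(2) this(2)]
  show "umor_comp \<Theta> m (umor_id \<Theta>) = m" "umor_comp \<Theta> (umor_id \<Theta>') m = m" .
qed

lemma is_category_SMCUnivs_cpm:
  "is_category (SMCUnivs_cpm :: (('b,'v,'o,'a,'g::linorder) univ, ('b,'v,'o,'a,'g) univ_mor) cat)"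
  unfolding is_category_def SMCUnivs_cpm_simps mem_Collect_eq
proof (intro conjI ballI; (unfold mem_Collect_eq)?)
  fix \<Theta> :: "('b,'v,'o,'a,'g) univ" assume A: "is_smc_universe \<Theta>"
  then show "umor_id \<Theta> \<in> chom SMCUnivs_cpm \<Theta> \<Theta>"
    using preserves_cpm_id[OF A] univ.umor_id_ok[OF univI[OF A]] by (simp add: SMCUnivs_cpm_chom)
  fix \<Theta>' :: "('b,'v,'o,'a,'g) univ" assume B: "is_smc_universe \<Theta>'"
  fix \<Theta>'' :: "('b,'v,'o,'a,'g) univ" assume C: "is_smc_universe \<Theta>''"
  fix m m' assume "m \<in> chom SMCUnivs_cpm \<Theta> \<Theta>'" "m' \<in> chom SMCUnivs_cpm \<Theta>' \<Theta>''"
  then show "umor_comp \<Theta> m' m \<in> chom SMCUnivs_cpm \<Theta> \<Theta>''"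
    using umor_ok_comp[OF A B C] preserves_cpm_comp[OF A B] A B C by (simp add: SMCUnivs_cpm_chom)
next
  fix \<Theta> \<Theta>' :: "('b,'v,'o,'a,'g) univ" and m
  assume "is_smc_universe \<Theta>" "is_smc_universe \<Theta>'" "m \<in> chom SMCUnivs_cpm \<Theta> \<Theta>'"
  then show "umor_comp \<Theta> m (umor_id \<Theta>) = m" "umor_comp \<Theta> (umor_id \<Theta>') m = m"
    using umor_comp_id by (auto simp: SMCUnivs_cpm_chom)
next
  fix \<Theta> \<Theta>' \<Theta>'' \<Theta>''' :: "('b,'v,'o,'a,'g) univ" and m m' m''
  assume "is_smc_universe \<Theta>" "is_smc_universe \<Theta>'" "m \<in> chom SMCUnivs_cpm \<Theta> \<Theta>'"
  then show "umor_comp \<Theta> m'' (umor_comp \<Theta> m' m) = umor_comp \<Theta> (umor_comp \<Theta>' m'' m') m"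
    by (intro umor_comp_assoc) (auto simp: SMCUnivs_cpm_chom)
qed

lemma precpm_mor_chom:
  assumes A: "is_smc_universe \<Theta>" and B: "is_smc_universe \<Theta>'" and m: "m \<in> chom SMCUnivs_cpm \<Theta> \<Theta>'"
  shows "precpm_mor \<Theta> m \<in> chom SMCUnivs_cpm (precpm \<Theta>) (precpm \<Theta>')"
proof -
  have m': "umor_ok \<Theta> \<Theta>' m" "preserves_cpm \<Theta> \<Theta>' m" using m A B by (auto simp: SMCUnivs_cpm_chom)
  interpret M: umor \<Theta> \<Theta>' m by (rule umorI[OF A B m'(1)])
  have "preserves_cpm (precpm \<Theta>) (precpm \<Theta>') (precpm_mor \<Theta> m)"
    unfolding precpm_mor_raw
    by (rule preserves_cpm_cong[OF M.A.precpm_universe umor_agree_sym[OF umor_agree_restrict]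
          M.preserves_cpm_precpm_raw[OF m'(2)]])
  then show ?thesis
    using M.precpm_raw_ok[OF m'(2)] M.A.precpm_universe M.B.precpm_universe
    by (simp add: SMCUnivs_cpm_chom precpm_mor_raw umor_ok_restrict)
qed

lemma precpm_mor_id:
  assumes A: "is_smc_universe \<Theta>" shows "precpm_mor \<Theta> (umor_id \<Theta>) = umor_id (precpm \<Theta>)"
proof -
  interpret univ \<Theta> by (rule univI[OF A])
  have X: "omap (ufun (precpm_raw \<Theta> (umor_id \<Theta>))) X = X" if "X \<in> precpm_obs \<Theta>" for X
  proof -
    from that obtain C G Phi Xi where XC: "X = Pre C G Phi Xi" by (rule precpm_obsE)
    note P = Pre_action[OF that[unfolded XC]]
    have "act_image (umor_id \<Theta>) C G Phi = Phi"
      using P action_ext[OF P(3)] by (auto simp: act_image_def fun_eq_iff extensional_def)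
    moreover have "env_image (ob C) (unat (umor_id \<Theta>) C) Xi = Xi"
      using P(1) env_image_id[of "ob C" Xi] multi_env_basic[OF that[unfolded XC]] by simp
    ultimately show ?thesis unfolding XC using P(1) by simp
  qed
  have "umor_agree (precpm \<Theta>) (precpm_raw \<Theta> (umor_id \<Theta>)) (umor_id (precpm \<Theta>))"
    unfolding umor_agree_def precpm_simps using X obs_cob homs_chom by simp
  then show ?thesis
    unfolding precpm_mor_raw by (rule trans[OF umor_restrict_cong umor_restrict_id])
qed

lemma precpm_mor_comp:
  assumes A: "is_smc_universe \<Theta>" and B: "is_smc_universe \<Theta>'"
    and m: "umor_ok \<Theta> \<Theta>' m" "preserves_cpm \<Theta> \<Theta>' m"
  shows "precpm_mor \<Theta> (umor_comp \<Theta> m' m) = umor_comp (precpm \<Theta>) (precpm_mor \<Theta>' m') (precpm_mor \<Theta> m)"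
proof -
  interpret M: umor \<Theta> \<Theta>' m by (rule umorI[OF A B m(1)])
  have X: "omap (ufun (precpm_raw \<Theta> (umor_comp \<Theta> m' m))) X
      = omap (ufun (precpm_raw \<Theta>' m')) (omap (ufun (precpm_raw \<Theta> m)) X)" if "X \<in> precpm_obs \<Theta>" for X
  proof -
    from that obtain C G Phi Xi where XC: "X = Pre C G Phi Xi" by (rule precpm_obsE)
    note X = that[unfolded XC]
    note P = M.A.Pre_action[OF X]
    have "act_image (umor_comp \<Theta> m' m) C G Phi = act_image m' (M.mo C) G (act_image m C G Phi)"
      using P by (auto simp: act_image_def fun_eq_iff)
    moreover have "env_image (M.A.ob C) (unat (umor_comp \<Theta> m' m) C) Xi
      = env_image (M.B.ob (M.mo C)) (unat m' (M.mo C)) (env_image (M.A.ob C) (unat m C) Xi)"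
      using P M.A.multi_env_basic(3)[OF X] by (simp add: env_image_comp[OF M.unat_functor])
    ultimately show ?thesis unfolding XC using P(1) by simp
  qed
  have pob: "pobj (omap (ufun (precpm_raw \<Theta> m)) X) = M.mo (pobj X)" for X
    by (simp add: precpm_raw_def)
  have "umor_agree (precpm \<Theta>) (precpm_raw \<Theta> (umor_comp \<Theta> m' m))
    (umor_comp (precpm \<Theta>) (precpm_raw \<Theta>' m') (precpm_raw \<Theta> m))"
    unfolding umor_agree_def precpm_simps using X M.A.obs_cob M.A.homs_chom by (simp add: pob)
  moreover have "umor_comp (precpm \<Theta>) (precpm_raw \<Theta>' m') (precpm_raw \<Theta> m)
    = umor_comp (precpm \<Theta>) (precpm_mor \<Theta>' m') (precpm_mor \<Theta> m)"
    unfolding precpm_mor_raw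
    by (rule umor_comp_agree[OF M.A.precpm_universe M.B.precpm_universe M.precpm_raw_ok[OF m(2)]
          umor_agree_sym[OF umor_agree_restrict] umor_agree_sym[OF umor_agree_restrict]])
  ultimately show ?thesis
    unfolding precpm_mor_raw[of \<Theta> "umor_comp \<Theta> m' m"]
    by (metis umor_restrict_cong umor_restrict_comp)
qed

lemma precpm_fctr_simps [simp]: "omap precpm_fctr \<Theta> = precpm \<Theta>" "mmap precpm_fctr \<Theta> \<Theta>' m = precpm_mor \<Theta> m"
  by (simp_all add: precpm_fctr_def)

theorem is_functor_precpm:
  "is_functor (SMCUnivs_cpm :: (('b,'v,'o,'a,'g::linorder) univ, ('b,'v,'o,'a,'g) univ_mor) cat) SMCUnivs_cpm precpm_fctr"
  unfolding is_functor_def SMCUnivs_cpm_simps precpm_fctr_simps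
proof (intro conjI ballI is_category_SMCUnivs_cpm; (unfold mem_Collect_eq)?)
  fix \<Theta> :: "('b,'v,'o,'a,'g) univ" assume A: "is_smc_universe \<Theta>"
  then show "is_smc_universe (precpm \<Theta>)" by (intro univ.precpm_universe univI)
  show "precpm_mor \<Theta> (umor_id \<Theta>) = umor_id (precpm \<Theta>)" by (rule precpm_mor_id[OF A])
  fix \<Theta>' :: "('b,'v,'o,'a,'g) univ" assume B: "is_smc_universe \<Theta>'"
  fix m assume m: "m \<in> chom SMCUnivs_cpm \<Theta> \<Theta>'"
  show "precpm_mor \<Theta> m \<in> chom SMCUnivs_cpm (precpm \<Theta>) (precpm \<Theta>')" by (rule precpm_mor_chom[OF A B m])
  fix m' show "precpm_mor \<Theta> (umor_comp \<Theta> m' m) = umor_comp (precpm \<Theta>) (precpm_mor \<Theta>' m') (precpm_mor \<Theta> m)"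
    using m A B by (intro precpm_mor_comp) (auto simp: SMCUnivs_cpm_chom)
qed

section \<open>Multiplication and unit of the monad\<close>

lemma env_prod_mono:
  assumes "\<And>A. Xi A \<subseteq> Zi A" "\<And>A. Xi' A \<subseteq> Zi' A"
  shows "env_prod D G Psi Xi H Psi' Xi' A \<subseteq> env_prod D G Psi Zi H Psi' Zi' A"
proof
  fix \<xi> assume "\<xi> \<in> env_prod D G Psi Xi H Psi' Xi' A"
  then have "env_prod_rel D G Psi Xi H Psi' Xi' A \<xi>" by (simp add: env_prod_def)
  then have "env_prod_rel D G Psi Zi H Psi' Zi' A \<xi>"
  proof induction
    case (left A \<xi>)
    then show ?case using assms(1) by (intro env_prod_rel.left) auto
  next
    case (right A \<xi>)
    then show ?case using assms(2) by (intro env_prod_rel.right) auto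
  next
    case (tens A B \<xi> \<zeta>)
    then show ?case by (intro env_prod_rel.tens)
  qed
  then show "\<xi> \<in> env_prod D G Psi Zi H Psi' Zi' A" by (simp add: env_prod_def)
qed

definition commuting where
  "commuting K C G Phi H Phi' \<longleftrightarrow>
     (\<forall>\<gamma>\<in>carrier G. \<forall>\<eta>\<in>carrier H. ccomp K C C C (Phi' \<eta>) (Phi \<gamma>) = ccomp K C C C (Phi \<gamma>) (Phi' \<eta>))"

context universe begin

lemma two_actions:
  assumes C: "C \<in> cob K" and G: "fab_group G" and H: "fab_group H"
    and Phi: "is_action K C G Phi" and Phi': "is_action K C H Phi'" and comm: "commuting K C G Phi H Phi'"
  shows "two_actions (ob C) G H (und_act \<Theta> C G Phi) (und_act \<Theta> C H Phi')"
proof -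
  interpret G: smc_action "ob C" G "und_act \<Theta> C G Phi" by (rule smc_action[OF C G Phi])
  interpret H: smc_action "ob C" H "und_act \<Theta> C H Phi'" by (rule smc_action[OF C H Phi'])
  have e: "smcf_comp (ob C) (ar C C (Phi' \<eta>)) (ar C C (Phi \<gamma>)) = smcf_comp (ob C) (ar C C (Phi \<gamma>)) (ar C C (Phi' \<eta>))"
    if "\<gamma> \<in> carrier G" "\<eta> \<in> carrier H" for \<gamma> \<eta>
    using comm that ar_ccomp[OF C C C action_chom[OF Phi] action_chom[OF Phi']]
      ar_ccomp[OF C C C action_chom[OF Phi'] action_chom[OF Phi]] unfolding commuting_def by metis
  have c: "fobj (ar C C (Phi' \<eta>)) (fobj (ar C C (Phi \<gamma>)) A) = fobj (ar C C (Phi \<gamma>)) (fobj (ar C C (Phi' \<eta>)) A)"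
    if "\<gamma> \<in> carrier G" "\<eta> \<in> carrier H" "A \<in> Obj (ob C)" for \<gamma> \<eta> A
    using arg_cong[OF e[OF that(1,2)], of "\<lambda>F. fobj F A"] that(3) by simp
  have c': "farr (ar C C (Phi' \<eta>)) (farr (ar C C (Phi \<gamma>)) f) = farr (ar C C (Phi \<gamma>)) (farr (ar C C (Phi' \<eta>)) f)"
    if "\<gamma> \<in> carrier G" "\<eta> \<in> carrier H" "f \<in> Arr (ob C)" for \<gamma> \<eta> f
    using arg_cong[OF e[OF that(1,2)], of "\<lambda>F. farr F f"] that(3) by simp
  show ?thesis
    by unfold_locales (simp_all add: und_act_def c c')
qed

lemma und_act_prod:
  assumes C: "C \<in> cob K" and G: "fab_group G" and Phi: "is_action K C G Phi" and Phi': "is_action K C H Phi'"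
  shows "und_act \<Theta> C (gprod G H) (act_prod K C G Phi H Phi')
    = act_prod SMCs (ob C) G (und_act \<Theta> C G Phi) H (und_act \<Theta> C H Phi')"
proof
  fix w show "und_act \<Theta> C (gprod G H) (act_prod K C G Phi H Phi') w
    = act_prod SMCs (ob C) G (und_act \<Theta> C G Phi) H (und_act \<Theta> C H Phi') w"
  proof (cases "w \<in> carrier (gprod G H)")
    case True
    then obtain \<gamma> \<eta> where w: "w = \<gamma> @ \<eta>" "\<gamma> \<in> carrier G" "\<eta> \<in> carrier H" by (rule gprod_memE)
    then show ?thesis
      using True G ar_ccomp[OF C C C action_chom[OF Phi' w(3)] action_chom[OF Phi w(2)]]
      by (simp add: und_act_def act_prod_def)
  qed (simp add: und_act_def act_prod_def)
qed

lemma act_prod_action: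
  assumes C: "C \<in> cob K" and G: "fab_group G" and H: "fab_group H"
    and Phi: "is_action K C G Phi" and Phi': "is_action K C H Phi'" and comm: "commuting K C G Phi H Phi'"
  shows "is_action K C (gprod G H) (act_prod K C G Phi H Phi')"
proof -
  interpret A: group "aut_group K C" by (rule group_aut_group[OF cat C])
  have mult: "ccomp K C C C f g = f \<otimes>\<^bsub>aut_group K C\<^esub> g" for f g by (simp add: aut_group_def)
  have Phi_hom: "Phi \<in> hom G (aut_group K C)" "Phi' \<in> hom H (aut_group K C)"
    using action_hom Phi Phi' by auto
  have val: "act_prod K C G Phi H Phi' (\<gamma> @ \<eta>) = Phi \<gamma> \<otimes>\<^bsub>aut_group K C\<^esub> Phi' \<eta>"
    if "\<gamma> \<in> carrier G" "\<eta> \<in> carrier H" for \<gamma> \<eta>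
    using that G by (simp add: act_prod_def mult)
  have mem: "Phi \<gamma> \<in> carrier (aut_group K C)" if "\<gamma> \<in> carrier G" for \<gamma>
    using Phi_hom(1) that by (auto simp: hom_def)
  have mem': "Phi' \<eta> \<in> carrier (aut_group K C)" if "\<eta> \<in> carrier H" for \<eta>
    using Phi_hom(2) that by (auto simp: hom_def)
  have "act_prod K C G Phi H Phi' \<in> hom (gprod G H) (aut_group K C)"
  proof (rule homI)
    fix w assume "w \<in> carrier (gprod G H)"
    then obtain \<gamma> \<eta> where w: "w = \<gamma> @ \<eta>" "\<gamma> \<in> carrier G" "\<eta> \<in> carrier H" by (rule gprod_memE)
    then show "act_prod K C G Phi H Phi' w \<in> carrier (aut_group K C)"
      using mem mem' by (simp add: val)
    fix w' assume "w' \<in> carrier (gprod G H)"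
    then obtain \<gamma>' \<eta>' where w': "w' = \<gamma>' @ \<eta>'" "\<gamma>' \<in> carrier G" "\<eta>' \<in> carrier H" by (rule gprod_memE)
    interpret G: comm_group G using G by (simp add: fab_group_def)
    interpret H: comm_group H using H by (simp add: fab_group_def)
    note m = mem[OF w(2)] mem'[OF w(3)] mem[OF w'(2)] mem'[OF w'(3)]
    have c: "Phi' \<eta> \<otimes>\<^bsub>aut_group K C\<^esub> Phi \<gamma>' = Phi \<gamma>' \<otimes>\<^bsub>aut_group K C\<^esub> Phi' \<eta>"
      using comm w(3) w'(2) unfolding commuting_def mult by blast
    have "act_prod K C G Phi H Phi' (w \<otimes>\<^bsub>gprod G H\<^esub> w')
      = (Phi \<gamma> \<otimes>\<^bsub>aut_group K C\<^esub> Phi \<gamma>') \<otimes>\<^bsub>aut_group K C\<^esub> (Phi' \<eta> \<otimes>\<^bsub>aut_group K C\<^esub> Phi' \<eta>')"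
      using w w' G hom_mult[OF Phi_hom(1) w(2) w'(2)] hom_mult[OF Phi_hom(2) w(3) w'(3)] by (simp add: val)
    also have "\<dots> = Phi \<gamma> \<otimes>\<^bsub>aut_group K C\<^esub> ((Phi \<gamma>' \<otimes>\<^bsub>aut_group K C\<^esub> Phi' \<eta>) \<otimes>\<^bsub>aut_group K C\<^esub> Phi' \<eta>')"
      using m by (simp add: A.m_assoc)
    also have "\<dots> = (Phi \<gamma> \<otimes>\<^bsub>aut_group K C\<^esub> Phi' \<eta>) \<otimes>\<^bsub>aut_group K C\<^esub> (Phi \<gamma>' \<otimes>\<^bsub>aut_group K C\<^esub> Phi' \<eta>')"
      unfolding c[symmetric] using m by (simp add: A.m_assoc)
    finally show "act_prod K C G Phi H Phi' (w \<otimes>\<^bsub>gprod G H\<^esub> w')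
      = act_prod K C G Phi H Phi' w \<otimes>\<^bsub>aut_group K C\<^esub> act_prod K C G Phi H Phi' w'"
      using w w' by (simp add: val)
  qed
  then show ?thesis by (simp add: is_action_def) (simp add: act_prod_def)
qed

lemma act_prod_assoc_K:
  assumes C: "C \<in> cob K" and G: "fab_group G" and H: "fab_group H" and J: "fab_group J"
    and P: "is_action K C G P" and Q: "is_action K C H Q" and R: "is_action K C J R"
  shows "act_prod K C (gprod G H) (act_prod K C G P H Q) J R = act_prod K C G P (gprod H J) (act_prod K C H Q J R)"
proof
  fix w
  show "act_prod K C (gprod G H) (act_prod K C G P H Q) J R w = act_prod K C G P (gprod H J) (act_prod K C H Q J R) w"
  proof (cases "w \<in> carrier (gprod G (gprod H J))")
    case True
    then obtain x y z where w: "w = x @ y @ z" "x \<in> carrier G" "y \<in> carrier H" "z \<in> carrier J"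
      by (auto elim!: gprod_memE)
    have w': "(x @ y) @ z \<in> carrier (gprod (gprod G H) J)" using w by (intro gprod_memI)
    have "gfst (gprod G H) ((x @ y) @ z) = x @ y" "gsnd (gprod G H) ((x @ y) @ z) = z"
      by (rule gfst_append gsnd_append; use w G H in simp)+
    then have "act_prod K C (gprod G H) (act_prod K C G P H Q) J R w = ccomp K C C C (ccomp K C C C (P x) (Q y)) (R z)"
      using w w' G H unfolding w(1) by (simp add: act_prod_def)
    moreover have "act_prod K C G P (gprod H J) (act_prod K C H Q J R) w = ccomp K C C C (P x) (ccomp K C C C (Q y) (R z))"
      using w True G H by (simp add: act_prod_def)
    ultimately show ?thesis
      using cat_assoc[OF cat C C C C action_chom[OF R w(4)] action_chom[OF Q w(3)] action_chom[OF P w(2)]] by simp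
  next
    case False
    then show ?thesis using G H J by (simp add: act_prod_def gprod_assoc)
  qed
qed

lemma act_prod_triv_K:
  assumes C: "C \<in> cob K" and G: "fab_group G" and P: "is_action K C G P"
  shows "act_prod K C G P gtriv (act_triv K C) = P" "act_prod K C gtriv (act_triv K C) G P = P"
proof -
  have "ccomp K C C C (P w) (cid K C) = P w" "ccomp K C C C (cid K C) (P w) = P w" if "w \<in> carrier G" for w
    using cat_right[OF cat C C action_chom[OF P that]] cat_left[OF cat C C action_chom[OF P that]] .
  moreover have "gfst G w = w" "gsnd G w = []" if "w \<in> carrier G" for w
    using that G gfst_append[of G w "[]"] gsnd_append[of G w "[]"] by simp_all
  ultimately show "act_prod K C G P gtriv (act_triv K C) = P" "act_prod K C gtriv (act_triv K C) G P = P"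
    using action_ext[OF P] G by (auto simp: act_prod_def act_triv_def gprod_gtriv fun_eq_iff extensional_def)
qed

lemma ar_equivariant:
  assumes C: "C \<in> cob K" "C' \<in> cob K" and G: "fab_group G"
    and P: "is_action K C G P" and Q: "is_action K C' G Q" and F: "F \<in> chom K C C'"
    and eq: "\<And>\<gamma>. \<gamma> \<in> carrier G \<Longrightarrow> ccomp K C C C' F (P \<gamma>) = ccomp K C C' C' (Q \<gamma>) F"
  shows "equivariant_functor (ob C) (ob C') (ar C C' F) G (und_act \<Theta> C G P) (und_act \<Theta> C' G Q)"
proof -
  interpret A: smc_action "ob C" G "und_act \<Theta> C G P" by (rule smc_action[OF C(1) G P])
  interpret B: smc_action "ob C'" G "und_act \<Theta> C' G Q" by (rule smc_action[OF C(2) G Q])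
  have e: "smcf_comp (ob C) (ar C C' F) (ar C C (P \<gamma>)) = smcf_comp (ob C) (ar C' C' (Q \<gamma>)) (ar C C' F)"
    if \<gamma>: "\<gamma> \<in> carrier G" for \<gamma>
    using eq[OF \<gamma>] ar_ccomp[OF C(1,1,2) action_chom[OF P \<gamma>] F] ar_ccomp[OF C(1,2,2) F action_chom[OF Q \<gamma>]] by simp
  have c: "fobj (ar C C' F) (fobj (ar C C (P \<gamma>)) A) = fobj (ar C' C' (Q \<gamma>)) (fobj (ar C C' F) A)"
    if "\<gamma> \<in> carrier G" "A \<in> Obj (ob C)" for \<gamma> A
    using arg_cong[OF e[OF that(1)], of "\<lambda>F. fobj F A"] that(2) by simp
  have c': "farr (ar C C' F) (farr (ar C C (P \<gamma>)) f) = farr (ar C' C' (Q \<gamma>)) (farr (ar C C' F) f)"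
    if "\<gamma> \<in> carrier G" "f \<in> Arr (ob C)" for \<gamma> f
    using arg_cong[OF e[OF that(1)], of "\<lambda>F. farr F f"] that(2) by simp
  show ?thesis
    by unfold_locales (simp_all add: und_act_def c c' ar_functor[OF C F])
qed

end

definition mult_raw :: "('b,'v,'o,'a,'g::linorder) univ \<Rightarrow> ('b,'v,'o,'a,'g) univ_mor" where
  "mult_raw \<Theta> =
       \<lparr>ufun = \<lparr>omap = (\<lambda>X. let Y = pobj X; C = pobj Y; D = omap (und \<Theta>) C; G = pgrp Y; H = pgrp X in
                   Pre C (gprod G H)
                     (act_prod (ucat \<Theta>) C G (pact Y) H (pact X))
                     (env_prod D G (und_act \<Theta> C G (pact Y)) (penv Y)
                               H (und_act \<Theta> C H (pact X)) (penv X))),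
                mmap = (\<lambda>X Y F. F)\<rparr>,
        unat = (\<lambda>X. smcf_id (omap (und \<Theta>) (pobj (pobj X))))\<rparr>"

lemma mult_raw_simps [simp]:
  "omap (ufun (mult_raw \<Theta>)) (Pre (Pre C G Phi Xi) H Phi' Xi') = Pre C (gprod G H)
    (act_prod (ucat \<Theta>) C G Phi H Phi')
    (env_prod (omap (und \<Theta>) C) G (und_act \<Theta> C G Phi) Xi H (und_act \<Theta> C H Phi') Xi')"
  "pobj (omap (ufun (mult_raw \<Theta>)) X) = pobj (pobj X)"
  "mmap (ufun (mult_raw \<Theta>)) X Y F = F"
  "unat (mult_raw \<Theta>) X = smcf_id (omap (und \<Theta>) (pobj (pobj X)))"
  by (simp_all add: mult_raw_def Let_def)

lemma precpm_mult_raw: "precpm_mult \<Theta> = umor_restrict (precpm (precpm \<Theta>)) (mult_raw \<Theta>)"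
  by (simp add: precpm_mult_def mult_raw_def)

definition unit_raw :: "('b,'v,'o,'a,'g::linorder) univ \<Rightarrow> ('b,'v,'o,'a,'g) univ_mor" where
  "unit_raw \<Theta> =
       \<lparr>ufun = \<lparr>omap = (\<lambda>C. Pre C gtriv (act_triv (ucat \<Theta>) C) (env_triv (omap (und \<Theta>) C))),
                mmap = (\<lambda>C C' F. F)\<rparr>,
        unat = (\<lambda>C. smcf_id (omap (und \<Theta>) C))\<rparr>"

lemma unit_raw_simps [simp]:
  "omap (ufun (unit_raw \<Theta>)) C = Pre C gtriv (act_triv (ucat \<Theta>) C) (env_triv (omap (und \<Theta>) C))"
  "mmap (ufun (unit_raw \<Theta>)) X Y F = F" "unat (unit_raw \<Theta>) C = smcf_id (omap (und \<Theta>) C)"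
  by (simp_all add: unit_raw_def)

lemma precpm_unit_raw: "precpm_unit \<Theta> = umor_restrict \<Theta> (unit_raw \<Theta>)"
  by (simp add: precpm_unit_def unit_raw_def)

context univ begin

text \<open>
  Automorphisms in the PreCPM universe are equivariant, which means for the values of the outer
  action that they commute with the inner one.
\<close>

lemma iterated_obs:
  assumes W: "Pre (Pre C G Phi Xi) H Phi' Xi' \<in> precpm_obs (precpm \<Theta>)"
  shows "Pre C G Phi Xi \<in> precpm_obs \<Theta>" "Pre C H Phi' Xi' \<in> precpm_obs \<Theta>" "commuting K C G Phi H Phi'"
    "two_actions (ob C) G H (und_act \<Theta> C G Phi) (und_act \<Theta> C H Phi')"
proof -
  interpret T: univ "precpm \<Theta>" by (rule univI[OF precpm_universe])
  show X: "Pre C G Phi Xi \<in> precpm_obs \<Theta>" using W by simp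
  show Y: "Pre C H Phi' Xi' \<in> precpm_obs \<Theta>" using precpm_forget[OF W] by simp
  have "Phi' \<eta> \<in> precpm_homs \<Theta> (Pre C G Phi Xi) (Pre C G Phi Xi)" if "\<eta> \<in> carrier H" for \<eta>
    using T.Pre_action(4)[OF W that] by (simp del: precpm_homs_Pre)
  then show c: "commuting K C G Phi H Phi'" by (simp add: commuting_def)
  show "two_actions (ob C) G H (und_act \<Theta> C G Phi) (und_act \<Theta> C H Phi')"
    using Pre_action[OF X] Pre_action[OF Y] c by (intro two_actions)
qed

lemma iterated_obsE:
  assumes "W \<in> precpm_obs (precpm \<Theta>)"
  obtains C G Phi Xi H Phi' Xi' where "W = Pre (Pre C G Phi Xi) H Phi' Xi'"
    "Pre (Pre C G Phi Xi) H Phi' Xi' \<in> precpm_obs (precpm \<Theta>)"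
proof -
  from assms obtain X H Phi' Xi' where W: "W = Pre X H Phi' Xi'" "Pre X H Phi' Xi' \<in> precpm_obs (precpm \<Theta>)"
    by (rule precpm_obsE)
  then have "X \<in> precpm_obs \<Theta>" by simp
  then obtain C G Phi Xi where "X = Pre C G Phi Xi" by (rule precpm_obsE)
  with W that show ?thesis by blast
qed

text \<open>
  The two conditions that products of actions do not satisfy automatically are those required by
  \<open>closed_under_products\<close>.
\<close>

lemma mult_obs:
  assumes closed: "closed_under_products \<Theta>" and W: "Pre (Pre C G Phi Xi) H Phi' Xi' \<in> precpm_obs (precpm \<Theta>)"
  shows "omap (ufun (mult_raw \<Theta>)) (Pre (Pre C G Phi Xi) H Phi' Xi') \<in> precpm_obs \<Theta>"
proof -
  note it = iterated_obs[OF W]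
  note PX = Pre_action[OF it(1)] and PY = Pre_action[OF it(2)]
  interpret T: two_actions "ob C" G H "und_act \<Theta> C G Phi" "und_act \<Theta> C H Phi'" by (rule it(4))
  have cl: "T.envp Xi Xi' (TUnit (ob C)) = {Idn (ob C) (TUnit (ob C))}"
    "cpm_in \<Theta> C (gprod G H) (act_prod K C G Phi H Phi') (T.envp Xi Xi')"
    using closed W unfolding closed_under_products_def Let_def precpm_simps by blast+
  have u: "und_act \<Theta> C (gprod G H) (act_prod K C G Phi H Phi') = T.Pact"
    by (rule und_act_prod[OF PX(1-3) PY(3)])
  have "is_multi_env (ob C) (gprod G H) T.Pact (T.envp Xi Xi')"
    using it(1,2) cl(1) by (intro T.is_multi_env_envp) simp_all
  moreover have "fold_inj \<Theta> C (gprod G H) (act_prod K C G Phi H Phi')"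
    using it(1,2) T.inj_foldO_GH by (simp add: fold_inj_def u)
  ultimately show ?thesis
    using PX PY cl act_prod_action[OF PX(1,2) PY(2) PX(3) PY(3) it(3)] by (simp add: u)
qed

lemma mult_homs:
  assumes W: "Pre (Pre C G P Xi) H Q Xi' \<in> precpm_obs (precpm \<Theta>)"
    and W': "Pre (Pre C' G P' Zi) H Q' Zi' \<in> precpm_obs (precpm \<Theta>)"
    and F: "F \<in> precpm_homs (precpm \<Theta>) (Pre (Pre C G P Xi) H Q Xi') (Pre (Pre C' G P' Zi) H Q' Zi')"
  shows "F \<in> precpm_homs \<Theta> (omap (ufun (mult_raw \<Theta>)) (Pre (Pre C G P Xi) H Q Xi'))
    (omap (ufun (mult_raw \<Theta>)) (Pre (Pre C' G P' Zi) H Q' Zi'))"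
proof -
  note it = iterated_obs[OF W] and it' = iterated_obs[OF W']
  note PX = Pre_action[OF it(1)] and PY = Pre_action[OF it(2)] and PX' = Pre_action[OF it'(1)] and PY' = Pre_action[OF it'(2)]
  have F1: "F \<in> precpm_homs \<Theta> (Pre C G P Xi) (Pre C' G P' Zi)" using F by simp
  have Fc: "F \<in> chom K C C'" using F1 by simp
  have eqG: "ccomp K C C C' F (P \<gamma>) = ccomp K C C' C' (P' \<gamma>) F" if "\<gamma> \<in> carrier G" for \<gamma> using F1 that by simp
  have eqH: "ccomp K C C C' F (Q \<eta>) = ccomp K C C' C' (Q' \<eta>) F" if "\<eta> \<in> carrier H" for \<eta> using F that by simp
  interpret A: two_actions "ob C" G H "und_act \<Theta> C G P" "und_act \<Theta> C H Q" by (rule it(4))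
  interpret B: two_actions "ob C'" G H "und_act \<Theta> C' G P'" "und_act \<Theta> C' H Q'" by (rule it'(4))
  interpret FG: equivariant_functor "ob C" "ob C'" "ar C C' F" G "und_act \<Theta> C G P" "und_act \<Theta> C' G P'"
    by (rule ar_equivariant[OF PX(1) PX'(1) PX(2,3) PX'(3) Fc eqG])
  interpret FH: equivariant_functor "ob C" "ob C'" "ar C C' F" H "und_act \<Theta> C H Q" "und_act \<Theta> C' H Q'"
    by (rule ar_equivariant[OF PX(1) PX'(1) PY(2,3) PY'(3) Fc eqH])
  interpret E: equivariant_functor2 "ob C" "ob C'" "ar C C' F" G H "und_act \<Theta> C G P" "und_act \<Theta> C H Q"
    "und_act \<Theta> C' G P'" "und_act \<Theta> C' H Q'" by unfold_locales
  show ?thesis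
    unfolding mult_raw_simps precpm_homs_Pre
  proof (intro conjI ballI Fc)
    fix w assume "w \<in> carrier (gprod G H)"
    then obtain x y where w: "w = x @ y" "x \<in> carrier G" "y \<in> carrier H" by (rule gprod_memE)
    note Px = PX(4)[OF w(2)] and Qy = PY(4)[OF w(3)] and Px' = PX'(4)[OF w(2)] and Qy' = PY'(4)[OF w(3)]
    have v: "act_prod K C G P H Q w = ccomp K C C C (P x) (Q y)" "act_prod K C' G P' H Q' w = ccomp K C' C' C' (P' x) (Q' y)"
      using w PX(2) by (simp_all add: act_prod_def)
    have "ccomp K C C C' F (ccomp K C C C (P x) (Q y)) = ccomp K C C C' (ccomp K C C C' F (P x)) (Q y)"
      by (rule cat_assoc[OF cat PX(1) PX(1) PX(1) PX'(1) Qy Px Fc])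
    also have "\<dots> = ccomp K C C' C' (P' x) (ccomp K C C C' F (Q y))"
      unfolding eqG[OF w(2)] by (rule cat_assoc[OF cat PX(1) PX(1) PX'(1) PX'(1) Qy Fc Px', symmetric])
    also have "\<dots> = ccomp K C C' C' (ccomp K C' C' C' (P' x) (Q' y)) F"
      unfolding eqH[OF w(3)] by (rule cat_assoc[OF cat PX(1) PX'(1) PX'(1) PX'(1) Fc Qy' Px'])
    finally show "ccomp K C C C' F (act_prod K C G P H Q w) = ccomp K C C' C' (act_prod K C' G P' H Q' w) F"
      unfolding v .
  next
    fix A \<xi> assume A: "A \<in> Obj (ob C)" and \<xi>: "\<xi> \<in> A.envp Xi Xi' A"
    have "farr (ar C C' F) \<xi> \<in> env_image (ob C) (ar C C' F) (A.envp Xi Xi') (fobj (ar C C' F) A)"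
      by (intro env_imageI A \<xi>)
    also have "env_image (ob C) (ar C C' F) (A.envp Xi Xi')
      = B.envp (env_image (ob C) (ar C C' F) Xi) (env_image (ob C) (ar C C' F) Xi')"
      by (rule E.env_image_envp[OF multi_env_basic(1)[OF it(1)] multi_env_basic(1)[OF it(2)]])
    also have "\<dots> (fobj (ar C C' F) A) \<subseteq> B.envp Zi Zi' (fobj (ar C C' F) A)"
    proof (rule env_prod_mono)
      show "env_image (ob C) (ar C C' F) Xi A \<subseteq> Zi A" for A using F1 by (auto elim!: env_imageE)
      show "env_image (ob C) (ar C C' F) Xi' A \<subseteq> Zi' A" for A using F by (auto elim!: env_imageE)
    qed
    finally show "farr (ar C C' F) \<xi> \<in> B.envp Zi Zi' (fobj (ar C C' F) A)" .
  qed simp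
qed

lemma mult_raw_ok:
  assumes closed: "closed_under_products \<Theta>"
  shows "umor_ok (precpm (precpm \<Theta>)) (precpm \<Theta>) (mult_raw \<Theta>)"
proof -
  interpret T: univ "precpm \<Theta>" by (rule univI[OF precpm_universe])
  have hom: "F \<in> precpm_homs \<Theta> (omap (ufun (mult_raw \<Theta>)) W) (omap (ufun (mult_raw \<Theta>)) W')"
    if W: "W \<in> precpm_obs (precpm \<Theta>)" and W': "W' \<in> precpm_obs (precpm \<Theta>)" and F: "F \<in> precpm_homs (precpm \<Theta>) W W'" for W W' F
  proof -
    obtain C G P Xi H Q Xi' where 1: "W = Pre (Pre C G P Xi) H Q Xi'" using W by (rule iterated_obsE)
    obtain C' G' P' Zi H' Q' Zi' where 2: "W' = Pre (Pre C' G' P' Zi) H' Q' Zi'" using W' by (rule iterated_obsE)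
    have g: "G' = G" "H' = H" using F unfolding 1 2 by simp_all
    show ?thesis using mult_homs W W' F unfolding 1 2 g by blast
  qed
  have obs: "omap (ufun (mult_raw \<Theta>)) W \<in> precpm_obs \<Theta>" if W: "W \<in> precpm_obs (precpm \<Theta>)" for W
    using W by (rule iterated_obsE) (use mult_obs[OF closed] in blast)
  have cob: "pobj (pobj W) \<in> cob K" if "W \<in> precpm_obs (precpm \<Theta>)" for W
    using T.obs_cob[OF that] obs_cob by simp
  have chom: "F \<in> chom K (pobj (pobj W)) (pobj (pobj W'))" if "F \<in> precpm_homs (precpm \<Theta>) W W'" for W W' F
    using T.homs_chom[OF that] homs_chom by simp
  have id: "is_smc_functor (ob C) (ob C) (smcf_id (ob C))" if "C \<in> cob K" for C
    using that by (intro sym_mon_cat.is_smc_functor_id sym_mon_cat.intro) simp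
  show ?thesis
    unfolding umor_ok_def is_functor_def
    using T.precpm_category precpm_category hom obs cob chom id
    by (simp add: smcf_comp_ids(1)[OF ar_functor] smcf_comp_ids(2)[OF ar_functor])
qed

lemma unit_raw_ok: "umor_ok \<Theta> (precpm \<Theta>) (unit_raw \<Theta>)"
proof -
  have id: "is_smc_functor (ob C) (ob C) (smcf_id (ob C))" if "C \<in> cob K" for C
    using that by (intro sym_mon_cat.is_smc_functor_id sym_mon_cat.intro) simp
  show ?thesis
    unfolding umor_ok_def is_functor_def
    using cat precpm_category id unit_obs unit_homs
    by (simp add: smcf_comp_ids(1)[OF ar_functor] smcf_comp_ids(2)[OF ar_functor] del: precpm_obs_Pre precpm_homs_Pre)
qed

lemma mult_raw_preserves: "preserves_cpm (precpm (precpm \<Theta>)) (precpm \<Theta>) (mult_raw \<Theta>)"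
proof -
  interpret T: univ "precpm \<Theta>" by (rule univI[OF precpm_universe])
  show ?thesis
    by (rule preserves_cpm_same_und[OF T.precpm_universe]) (simp_all add: T.uimage_precpm)
qed

lemma unit_raw_preserves: "preserves_cpm \<Theta> (precpm \<Theta>) (unit_raw \<Theta>)"
  by (rule preserves_cpm_same_und[OF is_universe]) (simp_all add: uimage_precpm)

text \<open>
  An object of the threefold PreCPM universe carries three commuting actions. The innermost one may
  be forgotten, since the CPM categories in question belong to the product of the two outer ones.
\<close>

lemma closed_precpm:
  assumes closed: "closed_under_products \<Theta>" shows "closed_under_products (precpm \<Theta>)"
  unfolding closed_under_products_def Let_def
proof (intro allI impI)
  interpret T: univ "precpm \<Theta>" by (rule univI[OF precpm_universe])
  fix X H Q Xi' J R Xi''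
  assume "Pre (Pre X H Q Xi') J R Xi'' \<in> cob (ucat (precpm (precpm (precpm \<Theta>))))"
  then have W: "Pre (Pre X H Q Xi') J R Xi'' \<in> precpm_obs (precpm (precpm \<Theta>))" by simp
  have Z: "Pre X H Q Xi' \<in> precpm_obs (precpm \<Theta>)" and Z': "Pre X J R Xi'' \<in> precpm_obs (precpm \<Theta>)"
    using T.iterated_obs[OF W] by auto
  have "X \<in> precpm_obs \<Theta>" using Z by simp
  then obtain C G P Xi where X: "X = Pre C G P Xi" by (rule precpm_obsE)
  note it = iterated_obs[OF Z[unfolded X]] and it' = iterated_obs[OF Z'[unfolded X]]
  note PC = Pre_action[OF it(2)]
  have Y: "Pre C H Q Xi' \<in> precpm_obs \<Theta>" by (rule it(2))
  \<comment> \<open>the innermost action \<open>P\<close> is forgotten\<close>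
  have "Pre (Pre C H Q Xi') J R Xi'' \<in> precpm_obs (precpm \<Theta>)"
  proof -
    have R: "R j \<in> precpm_homs (precpm \<Theta>) (Pre X H Q Xi') (Pre X H Q Xi')" if "j \<in> carrier J" for j
      using univ.Pre_action(4)[OF univI[OF T.precpm_universe] W that] by simp
    have Rh: "R j \<in> precpm_homs \<Theta> (Pre C H Q Xi') (Pre C H Q Xi')" if "j \<in> carrier J" for j
      using R[OF that] homs_chom[of "R j" X X] by (simp add: X)
    have act: "is_action (ucat (precpm \<Theta>)) (Pre C H Q Xi') J R"
    proof -
      have a: "is_action K C J R" using Pre_action[OF it'(2)] by simp
      have G: "fab_group J" using it'(2) by simp
      interpret J: comm_group J using G by (simp add: fab_group_def)
      \<comment> \<open>\<open>R j\<close> is invertible as a morphism of the smaller object, since its inverse is a value of \<open>R\<close> as well\<close>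
      have "R j \<in> carrier (aut_group (ucat (precpm \<Theta>)) (Pre C H Q Xi'))" if j: "j \<in> carrier J" for j
      proof -
        have ji: "inv\<^bsub>J\<^esub> j \<in> carrier J" using j by simp
        have one: "R \<one>\<^bsub>J\<^esub> = cid K C"
        proof -
          interpret A: group "aut_group K C" by (rule group_aut_group[OF cat PC(1)])
          have "R \<one>\<^bsub>J\<^esub> = \<one>\<^bsub>aut_group K C\<^esub>"
            by (rule hom_one[OF action_hom[OF a] J.is_group A.is_group])
          then show ?thesis by (simp add: aut_group_def)
        qed
        have "ccomp K C C C (R (inv\<^bsub>J\<^esub> j)) (R j) = cid K C" "ccomp K C C C (R j) (R (inv\<^bsub>J\<^esub> j)) = cid K C"
          using action_mult[OF a ji j] action_mult[OF a j ji] j one by simp_all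
        then show ?thesis using Rh[OF j] Rh[OF ji] by (auto simp: aut_group_def simp del: precpm_homs_Pre)
      qed
      then show ?thesis
        using action_mult[OF a] action_ext[OF a] by (auto simp: is_action_def hom_def) (simp add: aut_group_def)
    qed
    show ?thesis using act Y it'(2) by (simp add: precpm_cpm_in)
  qed
  then have cl: "env_prod (ob C) H (und_act \<Theta> C H Q) Xi' J (und_act \<Theta> C J R) Xi'' (TUnit (ob C)) = {Idn (ob C) (TUnit (ob C))}"
    "cpm_in \<Theta> C (gprod H J) (act_prod K C H Q J R) (env_prod (ob C) H (und_act \<Theta> C H Q) Xi' J (und_act \<Theta> C J R) Xi'')"
    using closed unfolding closed_under_products_def Let_def precpm_simps by blast+
  have act: "act_prod (ucat (precpm \<Theta>)) X H Q J R = act_prod K C H Q J R"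
    by (simp add: act_prod_def X fun_eq_iff)
  show "env_prod (omap (und (precpm \<Theta>)) X) H (und_act (precpm \<Theta>) X H Q) Xi' J (und_act (precpm \<Theta>) X J R) Xi''
      (TUnit (omap (und (precpm \<Theta>)) X)) = {Idn (omap (und (precpm \<Theta>)) X) (TUnit (omap (und (precpm \<Theta>)) X))} \<and>
    cpm_in (precpm \<Theta>) X (gprod H J) (act_prod (ucat (precpm \<Theta>)) X H Q J R)
      (env_prod (omap (und (precpm \<Theta>)) X) H (und_act (precpm \<Theta>) X H Q) Xi' J (und_act (precpm \<Theta>) X J R) Xi'')"
    unfolding act using cl by (simp add: X precpm_cpm_in)
qed

end

section \<open>The monad laws\<close>

lemma precpm_raw_agree:
  assumes U: "is_smc_universe \<Theta>" and agree: "umor_agree \<Theta> m m'"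
  shows "umor_agree (precpm \<Theta>) (precpm_raw \<Theta> m) (precpm_raw \<Theta> m')"
proof -
  interpret univ \<Theta> by (rule univI[OF U])
  have X: "omap (ufun (precpm_raw \<Theta> m)) X = omap (ufun (precpm_raw \<Theta> m')) X" if X: "X \<in> precpm_obs \<Theta>" for X
  proof -
    obtain C G Phi Xi where XC: "X = Pre C G Phi Xi" using X by (rule precpm_obsE)
    note P = Pre_action[OF X[unfolded XC]]
    have "act_image m C G Phi = act_image m' C G Phi" by (rule act_image_agree[OF agree P(1,4)])
    then show ?thesis using agree P(1) unfolding XC by (simp add: umor_agree_def)
  qed
  show ?thesis
    using X agree obs_cob homs_chom unfolding umor_agree_def precpm_simps by simp
qed

lemma precpm_mor_agree:
  assumes "is_smc_universe \<Theta>" "umor_agree \<Theta> m m'"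
  shows "umor_agree (precpm \<Theta>) (precpm_mor \<Theta> m) (precpm_raw \<Theta> m')"
  unfolding precpm_mor_raw
  by (rule umor_agree_trans[OF umor_agree_restrict precpm_raw_agree[OF assms]])

text \<open>
  Composites of restricted morphisms can be compared through the formulas that define them.
\<close>

lemma umor_square:
  fixes \<Theta> :: "('b,'v,'o,'a,'g::linorder) univ"
  assumes A: "is_smc_universe \<Theta>" "is_smc_universe \<Theta>1" "is_smc_universe \<Theta>2"
    and m: "umor_ok \<Theta> \<Theta>1 m" "umor_agree \<Theta>1 n n0" "umor_agree \<Theta> m m0"
    and k: "umor_ok \<Theta> \<Theta>2 k" "umor_agree \<Theta>2 l l0" "umor_agree \<Theta> k k0"
    and eq: "umor_agree \<Theta> (umor_comp \<Theta> n0 m0) (umor_comp \<Theta> l0 k0)"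
  shows "umor_comp \<Theta> n m = umor_comp \<Theta> l k"
  using umor_comp_agree[OF A(1,2) m] umor_comp_agree[OF A(1,3) k] umor_eqI[OF umor_restrict_comp umor_restrict_comp eq]
  by simp

lemma is_category_full_subset: "is_category K \<Longrightarrow> S \<subseteq> cob K \<Longrightarrow> is_category (K\<lparr>cob := S\<rparr>)"
  unfolding is_category_def subset_iff by simp

lemma is_functor_full_subset:
  assumes F: "is_functor K K F" and S: "S \<subseteq> cob K" "\<And>A. A \<in> S \<Longrightarrow> omap F A \<in> S"
  shows "is_functor (K\<lparr>cob := S\<rparr>) (K\<lparr>cob := S\<rparr>) F"
  using F S is_category_full_subset[OF _ S(1)] unfolding is_functor_def subset_iff by simp

lemma SMCUnivs_prod_simps [simp]:
  "cob SMCUnivs_prod = {\<Theta>. is_smc_universe \<Theta> \<and> closed_under_products \<Theta>}"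
  "chom SMCUnivs_prod = chom SMCUnivs_cpm"
  "cid SMCUnivs_prod = umor_id" "ccomp SMCUnivs_prod \<Theta> \<Theta>' \<Theta>'' = umor_comp \<Theta>"
  by (simp_all add: SMCUnivs_prod_def SMCUnivs_def)

lemma is_functor_precpm_prod:
  "is_functor (SMCUnivs_prod :: (('b,'v,'o,'a,'g::linorder) univ, ('b,'v,'o,'a,'g) univ_mor) cat) SMCUnivs_prod precpm_fctr"
  unfolding SMCUnivs_prod_def
  by (rule is_functor_full_subset[OF is_functor_precpm])
    (auto simp: SMCUnivs_def intro: univ.precpm_universe[OF univI] univ.closed_precpm[OF univI])

lemma is_functor_fctr_id: "is_category K \<Longrightarrow> is_functor K K fctr_id"
  unfolding is_functor_def fctr_id_def using cat_cid cat_ccomp by fastforce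

context univ begin

lemma mult_ok:
  assumes closed: "closed_under_products \<Theta>"
  shows "umor_ok (precpm (precpm \<Theta>)) (precpm \<Theta>) (precpm_mult \<Theta>)"
    "precpm_mult \<Theta> \<in> chom SMCUnivs_cpm (precpm (precpm \<Theta>)) (precpm \<Theta>)"
proof -
  interpret T: univ "precpm \<Theta>" by (rule univI[OF precpm_universe])
  show ok: "umor_ok (precpm (precpm \<Theta>)) (precpm \<Theta>) (precpm_mult \<Theta>)"
    unfolding precpm_mult_raw umor_ok_restrict by (rule mult_raw_ok[OF closed])
  have "preserves_cpm (precpm (precpm \<Theta>)) (precpm \<Theta>) (precpm_mult \<Theta>)"
    unfolding precpm_mult_raw
    by (rule preserves_cpm_cong[OF T.precpm_universe umor_agree_sym[OF umor_agree_restrict] mult_raw_preserves])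
  then show "precpm_mult \<Theta> \<in> chom SMCUnivs_cpm (precpm (precpm \<Theta>)) (precpm \<Theta>)"
    using ok precpm_universe T.precpm_universe by (simp add: SMCUnivs_cpm_chom) (simp add: precpm_mult_raw)
qed

lemma unit_ok:
  "umor_ok \<Theta> (precpm \<Theta>) (precpm_unit \<Theta>)" "precpm_unit \<Theta> \<in> chom SMCUnivs_cpm \<Theta> (precpm \<Theta>)"
proof -
  show ok: "umor_ok \<Theta> (precpm \<Theta>) (precpm_unit \<Theta>)"
    unfolding precpm_unit_raw umor_ok_restrict by (rule unit_raw_ok)
  have "preserves_cpm \<Theta> (precpm \<Theta>) (precpm_unit \<Theta>)"
    unfolding precpm_unit_raw
    by (rule preserves_cpm_cong[OF is_universe umor_agree_sym[OF umor_agree_restrict] unit_raw_preserves])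
  then show "precpm_unit \<Theta> \<in> chom SMCUnivs_cpm \<Theta> (precpm \<Theta>)"
    using ok precpm_universe is_universe by (simp add: SMCUnivs_cpm_chom) (simp add: precpm_unit_raw)
qed

lemma mult_agree: "umor_agree (precpm (precpm \<Theta>)) (precpm_mult \<Theta>) (mult_raw \<Theta>)"
  unfolding precpm_mult_raw by (rule umor_agree_restrict)

lemma unit_agree: "umor_agree \<Theta> (precpm_unit \<Theta>) (unit_raw \<Theta>)"
  unfolding precpm_unit_raw by (rule umor_agree_restrict)

lemma act_image_trivial:
  assumes "is_action K' X G Phi" "\<And>\<gamma>. mmap (ufun m) C C (Phi \<gamma>) = Phi \<gamma>"
  shows "act_image m C G Phi = Phi"
  using assms by (auto simp: act_image_def is_action_def extensional_def fun_eq_iff)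

lemma env_image_Pre_id:
  assumes "Pre C G Phi Xi \<in> precpm_obs \<Theta>" shows "env_image (ob C) (smcf_id (ob C)) Xi = Xi"
  by (rule env_image_id) (use multi_env_basic[OF assms] in auto)

text \<open>
  The actions of the three groups are composed in either order, and the multi-environment structures
  are compared by \<open>envp_assoc\<close>.
\<close>

lemma mult_assoc_obs:
  assumes W: "W \<in> precpm_obs (precpm (precpm \<Theta>))"
  shows "omap (ufun (mult_raw \<Theta>)) (omap (ufun (precpm_raw (precpm (precpm \<Theta>)) (mult_raw \<Theta>))) W)
    = omap (ufun (mult_raw \<Theta>)) (omap (ufun (mult_raw (precpm \<Theta>))) W)"
proof -
  interpret T: univ "precpm \<Theta>" by (rule univI[OF precpm_universe])
  interpret TT: univ "precpm (precpm \<Theta>)" by (rule univI[OF T.precpm_universe])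
  obtain X H Q Xi' J R Xi'' where W1: "W = Pre (Pre X H Q Xi') J R Xi''"
    and W2: "Pre (Pre X H Q Xi') J R Xi'' \<in> precpm_obs (precpm (precpm \<Theta>))" using W by (rule T.iterated_obsE)
  note itT = T.iterated_obs[OF W2]
  have "X \<in> precpm_obs \<Theta>" using itT(1) by simp
  then obtain C G P Xi where X: "X = Pre C G P Xi" by (rule precpm_obsE)
  note Z = itT(1)[unfolded X] and Z' = itT(2)[unfolded X]
  note it = iterated_obs[OF Z] and it' = iterated_obs[OF Z']
  note PX = Pre_action[OF it(1)] and PY = Pre_action[OF it(2)] and PZ = Pre_action[OF it'(2)]
  have HJ: "two_actions (ob C) H J (und_act \<Theta> C H Q) (und_act \<Theta> C J R)" using itT(4) by (simp add: X)
  interpret three_actions "ob C" G H J "und_act \<Theta> C G P" "und_act \<Theta> C H Q" "und_act \<Theta> C J R"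
    by (intro three_actions.intro it(4) it'(4) HJ)
  have R: "act_image (mult_raw \<Theta>) (Pre X H Q Xi') J R = R" by (rule act_image_trivial[OF PZ(3)]) simp
  have Xi'': "env_image (ob C) (smcf_id (ob C)) Xi'' = Xi''" by (rule env_image_Pre_id[OF it'(2)])
  have QR: "act_prod (ucat (precpm \<Theta>)) X H Q J R = act_prod K C H Q J R"
    by (simp add: act_prod_def X fun_eq_iff)
  have "env_prod (ob C) (gprod G H) GH.Pact (GH.envp Xi Xi') J (und_act \<Theta> C J R) Xi''
    = env_prod (ob C) G (und_act \<Theta> C G P) Xi (gprod H J) HJ.Pact (HJ.envp Xi' Xi'')"
    by (rule envp_assoc[OF multi_env_basic(1)[OF it(1)] multi_env_basic(1)[OF it(2)] multi_env_basic(1)[OF it'(2)]])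
  then show ?thesis
    unfolding W1 by (simp add: R[unfolded X] Xi'' QR[unfolded X] X und_act_prod[OF PX(1,2,3) PY(3)] und_act_prod[OF PX(1) PY(2,3) PZ(3)]
        act_prod_assoc_K[OF PX(1,2) PY(2) PZ(2) PX(3) PY(3) PZ(3)] gprod_assoc PX(2) PY(2) PZ(2)
        del: precpm_obs_Pre)
qed

lemma mult_assoc:
  assumes closed: "closed_under_products \<Theta>"
  shows "umor_comp (precpm (precpm (precpm \<Theta>))) (precpm_mult \<Theta>) (precpm_mor (precpm (precpm \<Theta>)) (precpm_mult \<Theta>))
    = umor_comp (precpm (precpm (precpm \<Theta>))) (precpm_mult \<Theta>) (precpm_mult (precpm \<Theta>))"
proof -
  interpret T: univ "precpm \<Theta>" by (rule univI[OF precpm_universe])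
  interpret TT: univ "precpm (precpm \<Theta>)" by (rule univI[OF T.precpm_universe])
  interpret TTT: univ "precpm (precpm (precpm \<Theta>))" by (rule univI[OF TT.precpm_universe])
  have 1: "umor_ok (precpm (precpm (precpm \<Theta>))) (precpm (precpm \<Theta>)) (precpm_mor (precpm (precpm \<Theta>)) (precpm_mult \<Theta>))"
    using precpm_mor_chom[OF T.precpm_universe precpm_universe mult_ok(2)[OF closed]]
    by (simp add: SMCUnivs_cpm_chom TT.precpm_universe T.precpm_universe)
  have id: "is_smc_functor (ob C) (ob C) (smcf_id (ob C))" if "C \<in> cob K" for C
    using that by (intro sym_mon_cat.is_smc_functor_id sym_mon_cat.intro) simp
  have C: "pobj (pobj (pobj W)) \<in> cob K" if "W \<in> precpm_obs (precpm (precpm \<Theta>))" for W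
    using TT.obs_cob[OF that] T.obs_cob[of "pobj W"] obs_cob[of "pobj (pobj W)"] by simp
  have agree: "umor_agree (precpm (precpm (precpm \<Theta>)))
      (umor_comp (precpm (precpm (precpm \<Theta>))) (mult_raw \<Theta>) (precpm_raw (precpm (precpm \<Theta>)) (mult_raw \<Theta>)))
      (umor_comp (precpm (precpm (precpm \<Theta>))) (mult_raw \<Theta>) (mult_raw (precpm \<Theta>)))"
    unfolding umor_agree_def precpm_simps
    using mult_assoc_obs C by (simp add: precpm_raw_def)
  show ?thesis
    by (rule umor_square[OF TT.precpm_universe T.precpm_universe T.precpm_universe 1 mult_agree
        precpm_mor_agree[OF T.precpm_universe mult_agree] T.mult_ok(1)[OF closed_precpm[OF closed]] mult_agree T.mult_agree agree])
qed

lemma mult_unit_obs: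
  assumes X: "X \<in> precpm_obs \<Theta>"
  shows "omap (ufun (mult_raw \<Theta>)) (omap (ufun (precpm_raw \<Theta> (unit_raw \<Theta>))) X) = X"
    "omap (ufun (mult_raw \<Theta>)) (omap (ufun (unit_raw (precpm \<Theta>))) X) = X"
proof -
  obtain C G P Xi where XC: "X = Pre C G P Xi" and X2: "Pre C G P Xi \<in> precpm_obs \<Theta>" using X by (rule precpm_obsE)
  note PX = Pre_action[OF X2]
  interpret smc_action "ob C" G "und_act \<Theta> C G P" by (rule PX(5))
  have P: "act_image (unit_raw \<Theta>) C G P = P" by (rule act_image_trivial[OF PX(3)]) simp
  have Xi: "env_image (ob C) (smcf_id (ob C)) Xi = Xi" by (rule env_image_Pre_id[OF X2])
  have env: "is_multi_env (ob C) G (und_act \<Theta> C G P) Xi" using X2 by simp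
  have triv: "act_triv (ucat (precpm \<Theta>)) (Pre C G P Xi) = act_triv K C"
    by (simp add: act_triv_def fun_eq_iff)
  show "omap (ufun (mult_raw \<Theta>)) (omap (ufun (precpm_raw \<Theta> (unit_raw \<Theta>))) X) = X"
    "omap (ufun (mult_raw \<Theta>)) (omap (ufun (unit_raw (precpm \<Theta>))) X) = X"
    unfolding XC using PX(1,2)
    by (simp_all add: P Xi triv act_prod_triv_K[OF PX(1-3)] gprod_gtriv und_act_triv
        env_prod_triv_right[OF env und_act_ext] env_prod_triv_left[OF env und_act_ext])
qed

lemma mult_unit:
  assumes closed: "closed_under_products \<Theta>"
  shows "umor_comp (precpm \<Theta>) (precpm_mult \<Theta>) (precpm_mor \<Theta> (precpm_unit \<Theta>)) = umor_id (precpm \<Theta>)"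
    "umor_comp (precpm \<Theta>) (precpm_mult \<Theta>) (precpm_unit (precpm \<Theta>)) = umor_id (precpm \<Theta>)"
proof -
  interpret T: univ "precpm \<Theta>" by (rule univI[OF precpm_universe])
  have 1: "umor_ok (precpm \<Theta>) (precpm (precpm \<Theta>)) (precpm_mor \<Theta> (precpm_unit \<Theta>))"
    using precpm_mor_chom[OF is_universe precpm_universe unit_ok(2)]
    by (simp add: SMCUnivs_cpm_chom T.precpm_universe precpm_universe)
  have id: "is_smc_functor (ob C) (ob C) (smcf_id (ob C))" if "C \<in> cob K" for C
    using that by (intro sym_mon_cat.is_smc_functor_id sym_mon_cat.intro) simp
  have agree: "umor_agree (precpm \<Theta>) (umor_comp (precpm \<Theta>) (mult_raw \<Theta>) (precpm_raw \<Theta> (unit_raw \<Theta>))) (umor_id (precpm \<Theta>))"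
    "umor_agree (precpm \<Theta>) (umor_comp (precpm \<Theta>) (mult_raw \<Theta>) (unit_raw (precpm \<Theta>))) (umor_id (precpm \<Theta>))"
    unfolding umor_agree_def precpm_simps
    using mult_unit_obs obs_cob by (simp_all add: precpm_raw_def smcf_comp_ids(1)[OF id])
  show "umor_comp (precpm \<Theta>) (precpm_mult \<Theta>) (precpm_mor \<Theta> (precpm_unit \<Theta>)) = umor_id (precpm \<Theta>)"
    using umor_comp_agree[OF precpm_universe T.precpm_universe 1 mult_agree precpm_mor_agree[OF is_universe unit_agree]]
      umor_eqI[OF umor_restrict_comp umor_restrict_id agree(1)] by simp
  show "umor_comp (precpm \<Theta>) (precpm_mult \<Theta>) (precpm_unit (precpm \<Theta>)) = umor_id (precpm \<Theta>)"
    using umor_comp_agree[OF precpm_universe T.precpm_universe T.unit_ok(1) mult_agree T.unit_agree]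
      umor_eqI[OF umor_restrict_comp umor_restrict_id agree(2)] by simp
qed

end

context umor begin

text \<open>
  The functor part of a morphism preserves composites, hence products of actions, and its natural
  transformation is equivariant, hence preserves products of multi-environment structures.
\<close>

lemma mult_natural_obs:
  assumes W: "W \<in> precpm_obs (precpm \<Theta>)"
  shows "omap (ufun (mult_raw \<Theta>')) (omap (ufun (precpm_raw (precpm \<Theta>) (precpm_raw \<Theta> m))) W)
    = omap (ufun (precpm_raw \<Theta> m)) (omap (ufun (mult_raw \<Theta>)) W)"
proof -
  obtain C G P Xi H Q Xi' where W1: "W = Pre (Pre C G P Xi) H Q Xi'"
    and W2: "Pre (Pre C G P Xi) H Q Xi' \<in> precpm_obs (precpm \<Theta>)" using W by (rule A.iterated_obsE)
  note it = A.iterated_obs[OF W2]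
  note PX = A.Pre_action[OF it(1)] and PY = A.Pre_action[OF it(2)]
  let ?P = "act_image m C G P" and ?Q = "act_image m C H Q"
  have aP: "is_action B.K (mo C) G ?P" by (rule act_image_action[OF PX(1,3,2)])
  have aQ: "is_action B.K (mo C) H ?Q" by (rule act_image_action[OF PY(1,3,2)])
  have Q: "act_image (precpm_raw \<Theta> m) (Pre C G P Xi) H Q = ?Q" by (simp add: act_image_def fun_eq_iff)
  have c: "ccomp A.K C C C (Q \<eta>) (P \<gamma>) = ccomp A.K C C C (P \<gamma>) (Q \<eta>)"
    if "\<gamma> \<in> carrier G" "\<eta> \<in> carrier H" for \<gamma> \<eta> using it(3) that by (simp add: commuting_def)
  have comm: "commuting B.K (mo C) G ?P H ?Q"
    unfolding commuting_def
  proof (intro ballI)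
    fix \<gamma> \<eta> assume g: "\<gamma> \<in> carrier G" "\<eta> \<in> carrier H"
    show "ccomp B.K (mo C) (mo C) (mo C) (?Q \<eta>) (?P \<gamma>) = ccomp B.K (mo C) (mo C) (mo C) (?P \<gamma>) (?Q \<eta>)"
      using g mh_ccomp[OF PX(1,1,1) PX(4)[OF g(1)] PY(4)[OF g(2)]] mh_ccomp[OF PX(1,1,1) PY(4)[OF g(2)] PX(4)[OF g(1)]] c[OF g]
      by (simp add: act_image_def)
  qed
  have PQ: "act_prod B.K (mo C) G ?P H ?Q = act_image m C (gprod G H) (act_prod A.K C G P H Q)"
  proof
    fix w show "act_prod B.K (mo C) G ?P H ?Q w = act_image m C (gprod G H) (act_prod A.K C G P H Q) w"
    proof (cases "w \<in> carrier (gprod G H)")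
      case True
      then obtain x y where w: "w = x @ y" "x \<in> carrier G" "y \<in> carrier H" by (rule gprod_memE)
      then show ?thesis
        using True PX(2) mh_ccomp[OF PX(1,1,1) PY(4)[OF w(3)] PX(4)[OF w(2)]]
        by (simp add: act_prod_def act_image_def)
    qed (simp add: act_prod_def act_image_def)
  qed
  interpret FG: equivariant_functor "A.ob C" "B.ob (mo C)" "unat m C" G "und_act \<Theta> C G P" "und_act \<Theta>' (mo C) G ?P"
    by (rule equivariant[OF PX(1,3,2)])
  interpret FH: equivariant_functor "A.ob C" "B.ob (mo C)" "unat m C" H "und_act \<Theta> C H Q" "und_act \<Theta>' (mo C) H ?Q"
    by (rule equivariant[OF PY(1,3,2)])
  interpret S: two_actions "A.ob C" G H "und_act \<Theta> C G P" "und_act \<Theta> C H Q" by (rule it(4))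
  interpret S': two_actions "B.ob (mo C)" G H "und_act \<Theta>' (mo C) G ?P" "und_act \<Theta>' (mo C) H ?Q"
    by (rule B.two_actions[OF mo_cob[OF PX(1)] PX(2) PY(2) aP aQ comm])
  interpret E: equivariant_functor2 "A.ob C" "B.ob (mo C)" "unat m C" G H "und_act \<Theta> C G P" "und_act \<Theta> C H Q"
    "und_act \<Theta>' (mo C) G ?P" "und_act \<Theta>' (mo C) H ?Q" by unfold_locales
  have env: "env_image (A.ob C) (unat m C) (S.envp Xi Xi')
    = S'.envp (env_image (A.ob C) (unat m C) Xi) (env_image (A.ob C) (unat m C) Xi')"
    by (rule E.env_image_envp[OF A.multi_env_basic(1)[OF it(1)] A.multi_env_basic(1)[OF it(2)]])
  show ?thesis unfolding W1 by (simp add: Q PQ env)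
qed

lemma mult_natural:
  assumes pres: "preserves_cpm \<Theta> \<Theta>' m" and closed: "closed_under_products \<Theta>"
  shows "umor_comp (precpm (precpm \<Theta>)) (precpm_mult \<Theta>') (precpm_mor (precpm \<Theta>) (precpm_mor \<Theta> m))
    = umor_comp (precpm (precpm \<Theta>)) (precpm_mor \<Theta> m) (precpm_mult \<Theta>)"
proof -
  interpret TA: univ "precpm \<Theta>" by (rule univI[OF A.precpm_universe])
  interpret TB: univ "precpm \<Theta>'" by (rule univI[OF B.precpm_universe])
  interpret Tm: umor "precpm \<Theta>" "precpm \<Theta>'" "precpm_raw \<Theta> m"
    by (rule umorI[OF A.precpm_universe B.precpm_universe precpm_raw_ok[OF pres]])
  have raw: "umor_agree (precpm \<Theta>) (precpm_mor \<Theta> m) (precpm_raw \<Theta> m)"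
    unfolding precpm_mor_raw by (rule umor_agree_restrict)
  note raw2 = precpm_mor_agree[OF A.precpm_universe raw]
  have 1: "umor_ok (precpm (precpm \<Theta>)) (precpm (precpm \<Theta>')) (precpm_mor (precpm \<Theta>) (precpm_mor \<Theta> m))"
    by (rule umor_ok_cong[OF umor_agree_sym[OF raw2] Tm.precpm_raw_ok[OF preserves_cpm_precpm_raw[OF pres]]])
  have C: "pobj (pobj W) \<in> cob A.K" if "W \<in> precpm_obs (precpm \<Theta>)" for W
    using TA.obs_cob[OF that] A.obs_cob[of "pobj W"] by simp
  have agree: "umor_agree (precpm (precpm \<Theta>)) (umor_comp (precpm (precpm \<Theta>)) (mult_raw \<Theta>') (precpm_raw (precpm \<Theta>) (precpm_raw \<Theta> m)))
      (umor_comp (precpm (precpm \<Theta>)) (precpm_raw \<Theta> m) (mult_raw \<Theta>))"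
    unfolding umor_agree_def precpm_simps
    using mult_natural_obs C
    by (simp add: precpm_raw_def smcf_comp_ids(1)[OF unat_functor] smcf_comp_ids(2)[OF unat_functor])
  show ?thesis
    by (rule umor_square[OF TA.precpm_universe TB.precpm_universe A.precpm_universe 1 B.mult_agree raw2
        A.mult_ok(1)[OF closed] raw A.mult_agree agree])
qed

lemma unit_natural:
  assumes pres: "preserves_cpm \<Theta> \<Theta>' m"
  shows "umor_comp \<Theta> (precpm_unit \<Theta>') m = umor_comp \<Theta> (precpm_mor \<Theta> m) (precpm_unit \<Theta>)"
proof -
  have obs: "omap (ufun (unit_raw \<Theta>')) (mo C) = omap (ufun (precpm_raw \<Theta> m)) (omap (ufun (unit_raw \<Theta>)) C)"
    if C: "C \<in> cob A.K" for C
  proof -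
    have F: "fobj (unat m C) (TUnit (A.ob C)) = TUnit (B.ob (mo C))"
      "farr (unat m C) (Idn (A.ob C) (TUnit (A.ob C))) = Idn (B.ob (mo C)) (TUnit (B.ob (mo C)))"
      and I: "TUnit (A.ob C) \<in> Obj (A.ob C)"
      using unat_functor[OF C] A.ob_smc[OF C] by (auto simp: is_smc_functor_def is_smc_def)
    have "env_image (A.ob C) (unat m C) (env_triv (A.ob C)) = env_triv (B.ob (mo C))"
      using F I by (auto simp: env_image_def env_triv_def fun_eq_iff split: if_splits)
    moreover have "act_image m C (gtriv :: 'g list monoid) (act_triv A.K C) = act_triv B.K (mo C)"
      using mh_cid[OF C] by (auto simp: act_image_def act_triv_def fun_eq_iff)
    ultimately show ?thesis by simp
  qed
  have raw: "umor_agree (precpm \<Theta>) (precpm_mor \<Theta> m) (precpm_raw \<Theta> m)"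
    unfolding precpm_mor_raw by (rule umor_agree_restrict)
  have agree: "umor_agree \<Theta> (umor_comp \<Theta> (unit_raw \<Theta>') m) (umor_comp \<Theta> (precpm_raw \<Theta> m) (unit_raw \<Theta>))"
    unfolding umor_agree_def using obs
    by (simp add: precpm_raw_def smcf_comp_ids(1)[OF unat_functor] smcf_comp_ids(2)[OF unat_functor])
  have refl: "umor_agree \<Theta> m m" by (simp add: umor_agree_def)
  show ?thesis
    by (rule umor_square[OF A.is_universe B.is_universe A.precpm_universe ok B.unit_agree refl
        A.unit_ok(1) raw A.unit_agree agree])
qed

end

theorem is_monad_precpm:
  "is_monad (SMCUnivs_prod :: (('b,'v,'o,'a,'g::linorder) univ, ('b,'v,'o,'a,'g) univ_mor) cat)
     precpm_fctr precpm_mult precpm_unit"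
proof -
  let ?K = "SMCUnivs_prod :: (('b,'v,'o,'a,'g) univ, ('b,'v,'o,'a,'g) univ_mor) cat"
  have T: "is_functor ?K ?K precpm_fctr" by (rule is_functor_precpm_prod)
  have I: "is_functor ?K ?K fctr_id" by (rule is_functor_fctr_id[OF functor_source[OF T]])
  have comp: "omap (fctr_comp precpm_fctr precpm_fctr) \<Theta> = precpm (precpm \<Theta>)"
    "mmap (fctr_comp precpm_fctr precpm_fctr) \<Theta> \<Theta>' m = precpm_mor (precpm \<Theta>) (precpm_mor \<Theta> m)"
    for \<Theta> \<Theta>' :: "('b,'v,'o,'a,'g) univ" and m by (simp_all add: fctr_comp_def)
  have idf: "omap fctr_id \<Theta> = \<Theta>" "mmap fctr_id \<Theta> \<Theta>' m = m"
    for \<Theta> \<Theta>' :: "('b,'v,'o,'a,'g) univ" and m :: "('b,'v,'o,'a,'g) univ_mor" by (simp_all add: fctr_id_def)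
  have mu: "is_nat_trans ?K ?K (fctr_comp precpm_fctr precpm_fctr) precpm_fctr precpm_mult"
    unfolding is_nat_trans_def comp precpm_fctr_simps SMCUnivs_prod_simps
  proof (intro conjI ballI T is_functor_fctr_comp[OF T T]; (elim CollectE conjE)?)
    fix \<Theta> :: "('b,'v,'o,'a,'g) univ" assume A: "is_smc_universe \<Theta>" "closed_under_products \<Theta>"
    show "precpm_mult \<Theta> \<in> chom SMCUnivs_cpm (precpm (precpm \<Theta>)) (precpm \<Theta>)"
      by (rule univ.mult_ok(2)[OF univI[OF A(1)] A(2)])
    fix \<Theta>' :: "('b,'v,'o,'a,'g) univ" assume B: "is_smc_universe \<Theta>'"
    fix m assume "m \<in> chom SMCUnivs_cpm \<Theta> \<Theta>'"
    then have m: "umor_ok \<Theta> \<Theta>' m" "preserves_cpm \<Theta> \<Theta>' m" using A B by (auto simp: SMCUnivs_cpm_chom)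
    show "umor_comp (precpm (precpm \<Theta>)) (precpm_mult \<Theta>') (precpm_mor (precpm \<Theta>) (precpm_mor \<Theta> m))
      = umor_comp (precpm (precpm \<Theta>)) (precpm_mor \<Theta> m) (precpm_mult \<Theta>)"
      by (rule umor.mult_natural[OF umorI[OF A(1) B m(1)] m(2) A(2)])
  qed
  have eta: "is_nat_trans ?K ?K fctr_id precpm_fctr precpm_unit"
    unfolding is_nat_trans_def idf precpm_fctr_simps SMCUnivs_prod_simps
  proof (intro conjI ballI T I; (elim CollectE conjE)?)
    fix \<Theta> :: "('b,'v,'o,'a,'g) univ" assume A: "is_smc_universe \<Theta>" "closed_under_products \<Theta>"
    show "precpm_unit \<Theta> \<in> chom SMCUnivs_cpm \<Theta> (precpm \<Theta>)"
      by (rule univ.unit_ok(2)[OF univI[OF A(1)]])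
    fix \<Theta>' :: "('b,'v,'o,'a,'g) univ" assume B: "is_smc_universe \<Theta>'"
    fix m assume "m \<in> chom SMCUnivs_cpm \<Theta> \<Theta>'"
    then have m: "umor_ok \<Theta> \<Theta>' m" "preserves_cpm \<Theta> \<Theta>' m" using A B by (auto simp: SMCUnivs_cpm_chom)
    show "umor_comp \<Theta> (precpm_unit \<Theta>') m = umor_comp \<Theta> (precpm_mor \<Theta> m) (precpm_unit \<Theta>)"
      by (rule umor.unit_natural[OF umorI[OF A(1) B m(1)] m(2)])
  qed
  show ?thesis
    unfolding is_monad_def Let_def precpm_fctr_simps SMCUnivs_prod_simps
  proof (intro conjI ballI T mu eta; elim CollectE conjE)
    fix \<Theta> :: "('b,'v,'o,'a,'g) univ" assume A: "is_smc_universe \<Theta>" "closed_under_products \<Theta>"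
    interpret univ \<Theta> by (rule univI[OF A(1)])
    note mult_assoc[OF A(2)] mult_unit[OF A(2)]
    then show "umor_comp (precpm (precpm (precpm \<Theta>))) (precpm_mult \<Theta>) (precpm_mor (precpm (precpm \<Theta>)) (precpm_mult \<Theta>))
        = umor_comp (precpm (precpm (precpm \<Theta>))) (precpm_mult \<Theta>) (precpm_mult (precpm \<Theta>))"
      "umor_comp (precpm \<Theta>) (precpm_mult \<Theta>) (precpm_mor \<Theta> (precpm_unit \<Theta>)) = umor_id (precpm \<Theta>)"
      "umor_comp (precpm \<Theta>) (precpm_mult \<Theta>) (precpm_unit (precpm \<Theta>)) = umor_id (precpm \<Theta>)" by -
  qed
qed

section \<open>The CPM construction as an algebra\<close>

lemma incl_univ_simps [simp]:
  "cob (ucat (incl_univ L)) = Base ` cob L"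
  "chom (ucat (incl_univ L)) X Y = chom L (unBase X) (unBase Y)"
  "cid (ucat (incl_univ L)) X = cid L (unBase X)"
  "ccomp (ucat (incl_univ L)) X Y Z = ccomp L (unBase X) (unBase Y) (unBase Z)"
  "omap (und (incl_univ L)) X = unBase X" "mmap (und (incl_univ L)) X Y F = F"
  by (simp_all add: incl_univ_def)

lemma subcategoryD:
  assumes "is_subcategory L SMCs"
  shows "is_category L" "C \<in> cob L \<Longrightarrow> is_smc C" "C \<in> cob L \<Longrightarrow> cid L C = smcf_id C"
    "C \<in> cob L \<Longrightarrow> D \<in> cob L \<Longrightarrow> F \<in> chom L C D \<Longrightarrow> is_smc_functor C D F"
    "\<lbrakk>C \<in> cob L; D \<in> cob L; E \<in> cob L; F \<in> chom L C D; G \<in> chom L D E\<rbrakk> \<Longrightarrow> ccomp L C D E G F = smcf_comp C G F"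
  using assms unfolding is_subcategory_def by (auto simp: subset_iff)

lemma uimage_incl_univ:
  "cob (uimage (incl_univ L)) = cob L"
  "C \<in> cob L \<Longrightarrow> D \<in> cob L \<Longrightarrow> chom (uimage (incl_univ L)) C D = chom L C D"
  unfolding uimage_simps by (force simp: image_image)+

lemma incl_univ_universe:
  assumes L: "is_subcategory L SMCs" shows "is_smc_universe (incl_univ L)"
proof -
  note LD = subcategoryD[OF L]
  have cat: "is_category (ucat (incl_univ L))"
    using LD(1) unfolding is_category_def incl_univ_simps ball_simps uobj.sel by blast
  have "is_category (uimage (incl_univ L))"
    using cat_cid[OF LD(1)] cat_ccomp[OF LD(1)] cat_left[OF LD(1)] cat_right[OF LD(1)] cat_assoc[OF LD(1)] LD(3,5)
    unfolding is_category_def by (simp add: uimage_incl_univ) (simp add: uimage_simps)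
  moreover have "is_functor (ucat (incl_univ L)) SMCs (und (incl_univ L))"
    unfolding is_functor_def using cat is_category_SMCs LD(2-5) by auto
  ultimately show ?thesis
    using is_category_SMCs LD(2,4)
    by (auto simp: is_smc_universe_def is_faithful_def is_subcategory_def inj_on_def uimage_incl_univ)
      (simp_all add: uimage_simps)
qed

definition cpm_raw :: "(('o,'a) smc, ('o,'a) smcf, 'o, 'a, 'g::linorder) univ
    \<Rightarrow> (('o,'a) smc, ('o,'a) smcf, 'o, 'a, 'g) univ_mor" where
  "cpm_raw \<Theta> =
    \<lparr>ufun = \<lparr>omap = (\<lambda>X. Base (cpm_of \<Theta> X)), mmap = (\<lambda>X Y F. smcf_restrict (cpm_of \<Theta> X) F)\<rparr>,
     unat = (\<lambda>X. fld (omap (und \<Theta>) (pobj X)) (pgrp X) (und_act \<Theta> (pobj X) (pgrp X) (pact X)))\<rparr>"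

lemma cpm_raw_simps [simp]:
  "omap (ufun (cpm_raw \<Theta>)) X = Base (cpm_of \<Theta> X)"
  "mmap (ufun (cpm_raw \<Theta>)) X Y F = smcf_restrict (cpm_of \<Theta> X) F"
  "unat (cpm_raw \<Theta>) X = fld (omap (und \<Theta>) (pobj X)) (pgrp X) (und_act \<Theta> (pobj X) (pgrp X) (pact X))"
  by (simp_all add: cpm_raw_def)

lemma CPM_mor_raw: "CPM_mor L = umor_restrict (precpm (incl_univ L)) (cpm_raw (incl_univ L))"
  by (simp add: CPM_mor_def cpm_raw_def Let_def)

lemma smcf_restrict_simps [simp]:
  "A \<in> Obj C \<Longrightarrow> fobj (smcf_restrict C F) A = fobj F A"
  "f \<in> Arr C \<Longrightarrow> farr (smcf_restrict C F) f = farr F f"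
  by (simp_all add: smcf_restrict_def)

lemma cpm_of_Pre [simp]: "cpm_of \<Theta> (Pre C G Phi Xi) = cpm (omap (und \<Theta>) C) G (und_act \<Theta> C G Phi) Xi"
  by (simp add: cpm_of_def)

text \<open>
  The parameter \<open>\<Theta>\<close> fixes the type of the elements of groups, which does not
  occur in \<open>L\<close>.
\<close>

locale cpm_universe =
  fixes L :: "(('o,'a) smc, ('o,'a) smcf) cat" and \<Theta> :: "(('o,'a) smc, ('o,'a) smcf, 'o, 'a, 'g::linorder) univ"
  assumes sub: "is_subcategory L SMCs" and \<Theta>: "\<Theta> = incl_univ L"
    and restr: "closed_under_restriction L TYPE('g)"
begin

sublocale univ \<Theta>
  unfolding \<Theta> by (rule univI[OF incl_univ_universe[OF sub]])

lemma incl [simp]: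
  "C \<in> cob K \<longleftrightarrow> C \<in> Base ` cob L" "F \<in> chom K X Y \<longleftrightarrow> F \<in> chom L (ob X) (ob Y)" "ar X Y F = F"
  "cid K X = cid L (ob X)" "ccomp K X Y Z F F' = ccomp L (ob X) (ob Y) (ob Z) F F'" "ob (Base D) = D"
  by (simp_all add: \<Theta>)

lemmas LD = subcategoryD[OF sub]

lemma obs_L: "X \<in> precpm_obs \<Theta> \<Longrightarrow> ob (pobj X) \<in> cob L"
  using obs_cob[of X] by auto

lemma cpm_of_L:
  assumes X: "X \<in> precpm_obs \<Theta>"
  shows "cpm_of \<Theta> X \<in> cob L" "unat (cpm_raw \<Theta>) X \<in> chom L (ob (pobj X)) (cpm_of \<Theta> X)"
proof -
  obtain C G P Xi where XC: "X = Pre C G P Xi" and X2: "Pre C G P Xi \<in> precpm_obs \<Theta>" using X by (rule precpm_obsE)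
  have "cpm_in \<Theta> C G P Xi" "ob C \<in> cob L" using X2 obs_L[OF X2] by simp_all
  then show "cpm_of \<Theta> X \<in> cob L" "unat (cpm_raw \<Theta>) X \<in> chom L (ob (pobj X)) (cpm_of \<Theta> X)"
    unfolding XC by (auto simp: cpm_in_def Let_def uimage_incl_univ \<Theta>)
qed

lemma cpm_of_sub:
  assumes X: "X \<in> precpm_obs \<Theta>"
  shows "Obj (cpm_of \<Theta> X) \<subseteq> Obj (ob (pobj X))" "Arr (cpm_of \<Theta> X) \<subseteq> Arr (ob (pobj X))"
proof -
  obtain C G P Xi where XC: "X = Pre C G P Xi" and X2: "Pre C G P Xi \<in> precpm_obs \<Theta>" using X by (rule precpm_obsE)
  interpret smc_action "ob C" G "und_act \<Theta> C G P" by (rule Pre_action(5)[OF X2])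
  show "Obj (cpm_of \<Theta> X) \<subseteq> Obj (ob (pobj X))" unfolding XC by (auto simp: Obj_cpm)
  show "Arr (cpm_of \<Theta> X) \<subseteq> Arr (ob (pobj X))"
    unfolding XC using cpm_arrs_sub[OF multi_env_basic(1)[OF X2]] by (simp add: Arr_cpm)
qed

lemma restrict_L:
  assumes "X \<in> precpm_obs \<Theta>" "Y \<in> precpm_obs \<Theta>" "F \<in> precpm_homs \<Theta> X Y"
  shows "smcf_restrict (cpm_of \<Theta> X) F \<in> chom L (cpm_of \<Theta> X) (cpm_of \<Theta> Y)"
    "is_smc_functor (cpm_of \<Theta> X) (cpm_of \<Theta> Y) (smcf_restrict (cpm_of \<Theta> X) F)"
proof -
  show "smcf_restrict (cpm_of \<Theta> X) F \<in> chom L (cpm_of \<Theta> X) (cpm_of \<Theta> Y)"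
    using restr assms unfolding closed_under_restriction_def Let_def \<Theta> by simp
  then show "is_smc_functor (cpm_of \<Theta> X) (cpm_of \<Theta> Y) (smcf_restrict (cpm_of \<Theta> X) F)"
    by (intro LD(4) cpm_of_L assms(1,2))
qed

text \<open>
  Equivariant functors commute with folding.
\<close>

lemma fld_natural:
  assumes X: "X \<in> precpm_obs \<Theta>" and Y: "Y \<in> precpm_obs \<Theta>" and F: "F \<in> precpm_homs \<Theta> X Y"
  shows "smcf_comp (ob (pobj X)) (unat (cpm_raw \<Theta>) Y) F
    = smcf_comp (ob (pobj X)) (smcf_restrict (cpm_of \<Theta> X) F) (unat (cpm_raw \<Theta>) X)"
proof -
  obtain C G P Xi where XC: "X = Pre C G P Xi" and X2: "Pre C G P Xi \<in> precpm_obs \<Theta>" using X by (rule precpm_obsE)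
  obtain C' G' P' Xi' where YC: "Y = Pre C' G' P' Xi'" using Y by (rule precpm_obsE)
  have G: "G' = G" using F by (simp add: XC YC)
  have Y2: "Pre C' G P' Xi' \<in> precpm_obs \<Theta>" using Y unfolding YC G .
  note PX = Pre_action[OF X2] and PY = Pre_action[OF Y2]
  have F': "F \<in> chom K C C'" "\<And>\<gamma>. \<gamma> \<in> carrier G \<Longrightarrow> ccomp K C C C' F (P \<gamma>) = ccomp K C C' C' (P' \<gamma>) F"
    using F unfolding XC YC G precpm_homs_Pre by blast+
  interpret E: equivariant_functor "ob C" "ob C'" "ar C C' F" G "und_act \<Theta> C G P" "und_act \<Theta> C' G P'"
    by (rule ar_equivariant[OF PX(1) PY(1) PX(2,3) PY(3) F'])
  have FO: "A \<in> Obj (ob C) \<Longrightarrow> fobj F A \<in> Obj (ob C')" "f \<in> Arr (ob C) \<Longrightarrow> farr F f \<in> Arr (ob C')" for A f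
    using ar_functor[OF PX(1) PY(1) F'(1)] by (auto simp: is_smc_functor_def PiE_iff)
  show ?thesis
    unfolding smcf_comp_def XC YC G
  proof (rule smcf_restrict_cong)
    fix A assume A: "A \<in> Obj (ob (pobj (Pre C G P Xi)))"
    then have "foldO (ob C) G (und_act \<Theta> C G P) A \<in> Obj (cpm_of \<Theta> (Pre C G P Xi))" by (simp add: Obj_cpm)
    then show "fobj \<lparr>fobj = fobj (unat (cpm_raw \<Theta>) (Pre C' G P' Xi')) \<circ> fobj F, farr = farr (unat (cpm_raw \<Theta>) (Pre C' G P' Xi')) \<circ> farr F\<rparr> A
      = fobj \<lparr>fobj = fobj (smcf_restrict (cpm_of \<Theta> (Pre C G P Xi)) F) \<circ> fobj (unat (cpm_raw \<Theta>) (Pre C G P Xi)),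
        farr = farr (smcf_restrict (cpm_of \<Theta> (Pre C G P Xi)) F) \<circ> farr (unat (cpm_raw \<Theta>) (Pre C G P Xi))\<rparr> A"
      using A E.fobj_foldO[of A] FO by simp
  next
    fix f assume f: "f \<in> Arr (ob (pobj (Pre C G P Xi)))"
    then have "foldA (ob C) G (und_act \<Theta> C G P) f \<in> Arr (cpm_of \<Theta> (Pre C G P Xi))"
      by (simp add: Arr_cpm cpm_arrs.folded)
    then show "farr \<lparr>fobj = fobj (unat (cpm_raw \<Theta>) (Pre C' G P' Xi')) \<circ> fobj F, farr = farr (unat (cpm_raw \<Theta>) (Pre C' G P' Xi')) \<circ> farr F\<rparr> f
      = farr \<lparr>fobj = fobj (smcf_restrict (cpm_of \<Theta> (Pre C G P Xi)) F) \<circ> fobj (unat (cpm_raw \<Theta>) (Pre C G P Xi)),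
        farr = farr (smcf_restrict (cpm_of \<Theta> (Pre C G P Xi)) F) \<circ> farr (unat (cpm_raw \<Theta>) (Pre C G P Xi))\<rparr> f"
      using f E.farr_foldA[of f] FO by simp
  qed
qed

lemma cpm_raw_ok: "umor_ok (precpm \<Theta>) \<Theta> (cpm_raw \<Theta>)"
proof -
  have id: "smcf_restrict (cpm_of \<Theta> X) (cid L (ob (pobj X))) = cid L (cpm_of \<Theta> X)" if X: "X \<in> precpm_obs \<Theta>" for X
    unfolding LD(3)[OF obs_L[OF X]] LD(3)[OF cpm_of_L(1)[OF X]]
    using cpm_of_sub[OF X] unfolding smcf_id_def[of "cpm_of \<Theta> X"] by (intro smcf_restrict_cong) auto
  have comp: "smcf_restrict (cpm_of \<Theta> X) (ccomp L (ob (pobj X)) (ob (pobj Y)) (ob (pobj Z)) H F)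
      = ccomp L (cpm_of \<Theta> X) (cpm_of \<Theta> Y) (cpm_of \<Theta> Z) (smcf_restrict (cpm_of \<Theta> Y) H) (smcf_restrict (cpm_of \<Theta> X) F)"
    if XYZ: "X \<in> precpm_obs \<Theta>" "Y \<in> precpm_obs \<Theta>" "Z \<in> precpm_obs \<Theta>" and F: "F \<in> precpm_homs \<Theta> X Y" and H: "H \<in> precpm_homs \<Theta> Y Z"
    for X Y Z F H
  proof -
    have F': "F \<in> chom L (ob (pobj X)) (ob (pobj Y))" "H \<in> chom L (ob (pobj Y)) (ob (pobj Z))"
      using homs_chom[OF F] homs_chom[OF H] by simp_all
    have R: "A \<in> Obj (cpm_of \<Theta> X) \<Longrightarrow> fobj F A \<in> Obj (cpm_of \<Theta> Y)" "f \<in> Arr (cpm_of \<Theta> X) \<Longrightarrow> farr F f \<in> Arr (cpm_of \<Theta> Y)" for A f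
      using restrict_L(2)[OF XYZ(1,2) F] by (auto simp: is_smc_functor_def PiE_iff)
    show ?thesis
      unfolding LD(5)[OF XYZ(1,2,3)[THEN obs_L] F'] LD(5)[OF XYZ(1,2,3)[THEN cpm_of_L(1)] restrict_L(1)[OF XYZ(1,2) F] restrict_L(1)[OF XYZ(2,3) H]]
      unfolding smcf_comp_def[of "cpm_of \<Theta> X"] using cpm_of_sub[OF XYZ(1)] R by (intro smcf_restrict_cong) auto
  qed
  show ?thesis
    unfolding umor_ok_def is_functor_def precpm_simps cpm_raw_simps(1,2) incl
    using precpm_category cat id comp restrict_L(1) cpm_of_L fld_natural LD(4)[OF obs_L cpm_of_L(1) cpm_of_L(2)]
    by (simp del: cpm_raw_simps(3))
qed

lemma cpm_unit:
  "umor_comp \<Theta> (CPM_mor L) (precpm_unit \<Theta>) = umor_id \<Theta>"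
proof -
  have C: "is_smc (ob C)" "cpm (ob C) (gtriv :: 'g list monoid) (und_act \<Theta> C gtriv (act_triv K C)) (env_triv (ob C)) = ob C"
    "fld (ob C) (gtriv :: 'g list monoid) (und_act \<Theta> C gtriv (act_triv K C)) = smcf_id (ob C)" if "C \<in> cob K" for C
  proof -
    show s: "is_smc (ob C)" by (rule ob_smc[OF that])
    interpret sym_mon_cat "ob C" by (rule sym_mon_cat.intro[OF s])
    show "cpm (ob C) (gtriv :: 'g list monoid) (und_act \<Theta> C gtriv (act_triv K C)) (env_triv (ob C)) = ob C"
      "fld (ob C) (gtriv :: 'g list monoid) (und_act \<Theta> C gtriv (act_triv K C)) = smcf_id (ob C)"
      unfolding und_act_triv[OF that] by (rule cpm_triv, rule fld_triv)
  qed
  have id: "is_smc_functor (ob C) (ob C) (smcf_id (ob C))" if "C \<in> cob K" for C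
    using C(1)[OF that] by (intro sym_mon_cat.is_smc_functor_id sym_mon_cat.intro)
  have B: "Base (ob C) = C" if "C \<in> cob K" for C using that by auto
  have "umor_agree \<Theta> (umor_comp \<Theta> (cpm_raw \<Theta>) (unit_raw \<Theta>)) (umor_id \<Theta>)"
    unfolding umor_agree_def
    using C B smcf_restrict_functor[OF ar_functor] smcf_comp_ids(1)[OF id] by (simp del: incl(1,2,4,5))
  then show ?thesis
    using umor_comp_agree[OF is_universe precpm_universe unit_ok(1) _ unit_agree, of "CPM_mor L" "cpm_raw \<Theta>"]
      umor_eqI[OF umor_restrict_comp umor_restrict_id] umor_agree_restrict[of "precpm \<Theta>" "cpm_raw \<Theta>"]
    by (simp add: CPM_mor_raw \<Theta>[symmetric])
qed

text \<open>
  The equality \<open>cpm_cpm\<close> of categories, and the corresponding one for folding functors.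
\<close>

lemma cpm_mult_obs:
  assumes W: "W \<in> precpm_obs (precpm \<Theta>)"
  shows "cpm_of \<Theta> (omap (ufun (precpm_raw (precpm \<Theta>) (cpm_raw \<Theta>))) W) = cpm_of \<Theta> (omap (ufun (mult_raw \<Theta>)) W)"
    "smcf_comp (ob (pobj (pobj W))) (unat (cpm_raw \<Theta>) (omap (ufun (precpm_raw (precpm \<Theta>) (cpm_raw \<Theta>))) W)) (unat (cpm_raw \<Theta>) (pobj W))
      = smcf_comp (ob (pobj (pobj W))) (unat (cpm_raw \<Theta>) (omap (ufun (mult_raw \<Theta>)) W)) (smcf_id (ob (pobj (pobj W))))"
proof -
  obtain C G P Xi H Q Xi' where W1: "W = Pre (Pre C G P Xi) H Q Xi'"
    and W2: "Pre (Pre C G P Xi) H Q Xi' \<in> precpm_obs (precpm \<Theta>)" using W by (rule iterated_obsE)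
  interpret T: univ "precpm \<Theta>" by (rule univI[OF precpm_universe])
  note it = iterated_obs[OF W2]
  note PX = Pre_action[OF it(1)] and PY = Pre_action[OF it(2)]
  let ?D = "ob C" and ?P = "und_act \<Theta> C G P" and ?Q = "und_act \<Theta> C H Q"
  interpret two_actions ?D G H ?P ?Q by (rule it(4))
  interpret S: cpm_step ?D G H ?P ?Q Xi Xi'
  proof
    show "is_smc (cpm ?D G ?P Xi)" using LD(2)[OF cpm_of_L(1)[OF it(1)]] by simp
    show "is_smc_functor ?D (cpm ?D G ?P Xi) (fld ?D G ?P)"
      using LD(4)[OF obs_L[OF it(1)] cpm_of_L(1)[OF it(1)] cpm_of_L(2)[OF it(1)]] by simp
    show "is_smc_functor (cpm ?D G ?P Xi) (cpm ?D G ?P Xi) (smcf_restrict (cpm ?D G ?P Xi) (?Q \<eta>))"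
      if \<eta>: "\<eta> \<in> carrier H" for \<eta>
      using restrict_L(2)[OF it(1,1)] T.Pre_action(4)[OF W2 \<eta>] \<eta> by (simp add: und_act_def del: precpm_homs_Pre)
    show "inj_on (foldO ?D G ?P) (Obj ?D)" "inj_on (foldO ?D H ?Q) (Obj ?D)"
      using it(1,2) by (simp_all add: fold_inj_def)
    show "Xi A \<subseteq> Homs ?D (foldO ?D G ?P A) (TUnit ?D)" "Xi' A \<subseteq> Homs ?D (foldO ?D H ?Q A) (TUnit ?D)"
      if "A \<in> Obj ?D" for A using multi_env_basic(1)[OF it(1) that] multi_env_basic(1)[OF it(2) that] .
  qed
  have act: "und_act \<Theta> (Base S.E) H (act_image (cpm_raw \<Theta>) (Pre C G P Xi) H Q) = S.PsiE"
    unfolding S.PsiE_def by (simp add: und_act_def act_image_def fun_eq_iff)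
  have prod: "und_act \<Theta> C (gprod G H) (act_prod K C G P H Q) = Pact"
    by (rule und_act_prod[OF PX(1-3) PY(3)])
  show "cpm_of \<Theta> (omap (ufun (precpm_raw (precpm \<Theta>) (cpm_raw \<Theta>))) W) = cpm_of \<Theta> (omap (ufun (mult_raw \<Theta>)) W)"
    unfolding W1 using S.cpm_cpm act prod by simp
  have "smcf_comp ?D (fld S.E H S.PsiE) S.F = smcf_comp ?D (fld ?D (gprod G H) Pact) (smcf_id ?D)"
    unfolding smcf_comp_def
    by (rule smcf_restrict_cong)
      (simp_all add: S.foldO_E_G S.foldA_E_G Obj_cpm Arr_cpm cpm_arrs.folded)
  then show "smcf_comp (ob (pobj (pobj W))) (unat (cpm_raw \<Theta>) (omap (ufun (precpm_raw (precpm \<Theta>) (cpm_raw \<Theta>))) W)) (unat (cpm_raw \<Theta>) (pobj W))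
      = smcf_comp (ob (pobj (pobj W))) (unat (cpm_raw \<Theta>) (omap (ufun (mult_raw \<Theta>)) W)) (smcf_id (ob (pobj (pobj W))))"
    unfolding W1 using act prod by simp
qed

text \<open>
  A morphism is restricted first to the inner and then to the iterated CPM category, where the first
  restriction has no effect.
\<close>

lemma cpm_mult:
  assumes closed: "closed_under_products \<Theta>" and pres: "preserves_cpm (precpm \<Theta>) \<Theta> (CPM_mor L)"
  shows "umor_comp (precpm (precpm \<Theta>)) (CPM_mor L) (precpm_mor (precpm \<Theta>) (CPM_mor L))
    = umor_comp (precpm (precpm \<Theta>)) (CPM_mor L) (precpm_mult \<Theta>)"
proof -
  interpret T: univ "precpm \<Theta>" by (rule univI[OF precpm_universe])
  interpret cpm: umor "precpm \<Theta>" \<Theta> "cpm_raw \<Theta>" by (rule umorI[OF precpm_universe is_universe cpm_raw_ok])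
  have raw: "umor_agree (precpm \<Theta>) (CPM_mor L) (cpm_raw \<Theta>)"
    unfolding CPM_mor_raw \<Theta>[symmetric] by (rule umor_agree_restrict)
  have ok: "umor_ok (precpm (precpm \<Theta>)) (precpm \<Theta>) (precpm_raw (precpm \<Theta>) (cpm_raw \<Theta>))"
    by (rule cpm.precpm_raw_ok[OF preserves_cpm_cong[OF precpm_universe raw pres]])
  note raw2 = precpm_mor_agree[OF precpm_universe raw]
  have obs: "omap (ufun (precpm_raw (precpm \<Theta>) (cpm_raw \<Theta>))) W \<in> precpm_obs \<Theta>" if "W \<in> precpm_obs (precpm \<Theta>)" for W
  proof -
    have "is_functor (ucat (precpm (precpm \<Theta>))) (ucat (precpm \<Theta>)) (ufun (precpm_raw (precpm \<Theta>) (cpm_raw \<Theta>)))"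
      using ok unfolding umor_ok_def by blast
    from functor_omap[OF this] show ?thesis using that unfolding precpm_simps by blast
  qed
  have mor: "smcf_restrict (cpm_of \<Theta> (omap (ufun (precpm_raw (precpm \<Theta>) (cpm_raw \<Theta>))) W)) (smcf_restrict (cpm_of \<Theta> (pobj W)) F)
      = smcf_restrict (cpm_of \<Theta> (omap (ufun (mult_raw \<Theta>)) W)) F" if W: "W \<in> precpm_obs (precpm \<Theta>)" for W F
  proof -
    have "pobj (omap (ufun (precpm_raw (precpm \<Theta>) (cpm_raw \<Theta>))) W) = Base (cpm_of \<Theta> (pobj W))"
      by (simp add: precpm_raw_def)
    then have "Obj (cpm_of \<Theta> (omap (ufun (precpm_raw (precpm \<Theta>) (cpm_raw \<Theta>))) W)) \<subseteq> Obj (cpm_of \<Theta> (pobj W))"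
      "Arr (cpm_of \<Theta> (omap (ufun (precpm_raw (precpm \<Theta>) (cpm_raw \<Theta>))) W)) \<subseteq> Arr (cpm_of \<Theta> (pobj W))"
      using cpm_of_sub[OF obs[OF W]] by simp_all
    then show ?thesis
      unfolding cpm_mult_obs(1)[OF W, symmetric] by (intro smcf_restrict_cong) auto
  qed
  have agree: "umor_agree (precpm (precpm \<Theta>)) (umor_comp (precpm (precpm \<Theta>)) (cpm_raw \<Theta>) (precpm_raw (precpm \<Theta>) (cpm_raw \<Theta>)))
      (umor_comp (precpm (precpm \<Theta>)) (cpm_raw \<Theta>) (mult_raw \<Theta>))"
    unfolding umor_agree_def precpm_simps
    using cpm_mult_obs mor by (simp del: cpm_raw_simps(3))
  show ?thesis
    by (rule umor_square[OF T.precpm_universe precpm_universe precpm_universe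
        umor_ok_cong[OF umor_agree_sym[OF raw2] ok] raw raw2 mult_ok(1)[OF closed] raw mult_agree agree])
qed

end

theorem theorem12:
  fixes K :: "(('o,'a) smc, ('o,'a) smcf) cat"
  shows
   "is_functor
      (SMCUnivs_cpm :: (('b,'v,'o,'a,'g::linorder) univ, ('b,'v,'o,'a,'g) univ_mor) cat)
      SMCUnivs_cpm precpm_fctr
    \<and> is_monad
      (SMCUnivs_prod :: (('b,'v,'o,'a,'g) univ, ('b,'v,'o,'a,'g) univ_mor) cat)
      precpm_fctr precpm_mult precpm_unit
    \<and> (let \<Theta> = incl_univ K :: (('o,'a) smc, ('o,'a) smcf, 'o, 'a, 'g) univ in
        is_subcategory K SMCs
        \<longrightarrow> closed_under_products \<Theta>
        \<longrightarrow> closed_under_restriction K TYPE('g)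
        \<longrightarrow> preserves_cpm (precpm \<Theta>) \<Theta> (CPM_mor K)
        \<longrightarrow> is_EM_algebra SMCUnivs_prod precpm_fctr precpm_mult precpm_unit \<Theta> (CPM_mor K))"
  unfolding Let_def
proof (intro conjI impI is_functor_precpm is_monad_precpm)
  let ?\<Theta> = "incl_univ K :: (('o,'a) smc, ('o,'a) smcf, 'o, 'a, 'g) univ"
  assume sub: "is_subcategory K SMCs" and closed: "closed_under_products ?\<Theta>"
    and restr: "closed_under_restriction K TYPE('g)" and pres: "preserves_cpm (precpm ?\<Theta>) ?\<Theta> (CPM_mor K)"
  interpret E: cpm_universe K ?\<Theta> by (intro cpm_universe.intro sub refl restr)
  have "CPM_mor K \<in> chom SMCUnivs_cpm (precpm ?\<Theta>) ?\<Theta>"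
    using E.cpm_raw_ok E.precpm_universe E.is_universe pres
    by (simp add: SMCUnivs_cpm_chom) (simp add: CPM_mor_raw umor_ok_restrict)
  then show "is_EM_algebra SMCUnivs_prod precpm_fctr precpm_mult precpm_unit ?\<Theta> (CPM_mor K)"
    using is_monad_precpm closed E.is_universe E.cpm_unit E.cpm_mult[OF closed pres]
    by (simp add: is_EM_algebra_def)
qed

end
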